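(* Let $g\ge0$ be an even integer and let $x=r/p$ with coprime integers $r\in\mathbb{Z}$, $p\in\mathbb{Z}_{>0}$. (1) One has $$S_g^{\mathrm{odd}}(x)=(-1)^{g/2+1}2^{g+2}S_{E_{g+2}^{\mathrm{odd}}}(x)=\frac{i}{p^{g+1}}\sum_{\substack{1\le m,n<2p\\ m,n\text{ odd}}}\mathbf{e}\left(\frac{mnx}{2}\right)B_1\left(\frac{m}{2p}\right)\cot^{(g)}\left(\frac{\pi n}{2p}\right)$$ $$=\frac{(-1)^{g/2}2^{2g+1}}{g+1}\sum_{\substack{1\le m\le2p\\ m\text{ odd}}}\left(\widetilde B_{g+1}\left(\frac{mx}{2}\right)-\widetilde B_{g+1}\left(\frac{mx}{2}+\frac12\right)\right)B_1\left(\frac{m}{2p}\right).$$ (2) For any $\varepsilon>0$, uniformly for $\tau$ with $\varepsilon\le\arg(\tau)\le\pi-\varepsilon$, $$E_{-g}^{\mathrm{odd}}(x+\tau)=-\frac{(\pi i)^{g+1}}{(g+1)!}\,\frac{a_{E_{g+2}^{\mathrm{odd}},0}^{(x)}}{p^{g+2}}\,\frac1\tau+i\,\frac{\pi^{g+1}}{2^{g+2}g!}\,S_g^{\mathrm{odd}}(x)+O(\tau)\quad\text{as }\tau\to0,$$ where $$a_{E_{g+2}^{\mathrm{odd}},0}^{(x)}=\mathbf{1}_2(p)(-1)^{r+1}\frac{2^{g+2}-1}{4(g+2)}B_{g+2}.$$ (3) For any $\gamma=\begin{pmatrix}a&b\\c&d\end{pmatrix}\in\Gamma(2)$ with $cx+d\ne0$,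 $$(cx+d)^gS_g^{\mathrm{odd}}(\gamma x)-S_g^{\mathrm{odd}}(x)=(-1)^{g/2+1}2^{g+2}R_{E_{g+2}^{\mathrm{odd}},\gamma}(x)+(-1)^{g/2}2^{g+2}a_{E_{g+2}^{\mathrm{odd}},0}^{(x)}\frac{c}{p^{g+1}(cr+dp)},$$ where $$R_{E_{g+2}^{\mathrm{odd}},\gamma}(X)=\int_{i\infty}^{\gamma^{-1}(i\infty)}E_{g+2}^{\mathrm{odd}}(z)(X-z)^g\,dz\in\mathbb{C}[X].$$ In particular, for $g=0,2$ and $2x+1\neq0$, $$S_0^{\mathrm{odd}}\left(\frac{x}{2x+1}\right)-S_0^{\mathrm{odd}}(x)=\frac12+\frac{\mathbf{1}_2(p)(-1)^{r+1}}{2p(2r+p)},$$ $$(2x+1)^2S_2^{\mathrm{odd}}\left(\frac{x}{2x+1}\right)-S_2^{\mathrm{odd}}(x)=2x^2+2x+1+\frac{\mathbf{1}_2(p)(-1)^{r+1}}{p^3(2r+p)}.$$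
   Context: $\mathbf{e}(z)=e^{2\pi iz}$. $\mathbf{1}_2$ is the characteristic function of the odd integers. $B_j(\alpha)$ are the Bernoulli polynomials ($\sum_jB_j(\alpha)t^j/j!=te^{\alpha t}/(e^t-1)$), $B_j=B_j(0)$, and $\widetilde B_j(\alpha)=B_j(\alpha-\lfloor\alpha\rfloor)$. $\cot^{(g)}$ is the $g$-th derivative of $\cot$. For $x=r/p$ in lowest terms with $p>0$, $$S_g^{\mathrm{odd}}(x)=\frac1{p^{g+1}}\sum_{\substack{1\le n\le p-1\\ n\text{ odd}}}\frac{\cot^{(g)}(\pi n/2p)}{\sin(\pi nx)}.$$ For an even integer $k$ and $\tau$ in the upper half plane, $$E_k^{\mathrm{odd}}(\tau)=\sum_{n\ge1,\ n\text{ odd}}\sigma_{k-1}(n)e^{\pi in\tau},\qquad\sigma_{k-1}(n)=\sum_{0<d\mid n}d^{k-1}.$$ For $g\ge0$ even, $f=E_{g+2}^{\mathrm{odd}}$ is a modular form of weight $g+2$ for $\Gamma(2)$; writing $f=\sum_{n\ge1}a_n\mathbf{e}(n\tau/2)$, put, for $\mathrm{Re}(s)>g+2$, $$\widehat L_f(s;x)=-\left(\frac{2}{2\pi}\right)^s\mathbf{e}\left(-\frac s4\right)\Gamma(s)\sum_{n\ge1}\frac{a_n}{n^s}\mathbf{e}\left(\frac{nx}{2}\right),$$ which extends holomorphically to $\mathbb{C}\smallsetminus\{0,g+2\}$, and $S_f(x)=\widehat L_f(g+1;x)$. The constant $a_{f,0}^{(x)}$ is the constant term at $\tau\to i\infty$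 of $(p\tau+p')^{-(g+2)}f\left(\frac{r\tau+r'}{p\tau+p'}\right)$ for any $\begin{pmatrix} r & r' \\ p & p' \end{pmatrix}\in\mathrm{SL}_2(\mathbb{Z})$. The integral in (3) is taken along a path in the upper half plane between the cusps $i\infty$ and $\gamma^{-1}(i\infty)$, approaching each cusp vertically.
   Formalization: For g=0 and p odd, the first equality of (1) and the expansion (2) fail as printed (e.g. x=0, where S_f(0)=-i ln2/(4π) but the sum is 0); the right sides gain (4i/π)δ and δ respectively, δ=(-1)^{r+1}(ln 2)/4. All else is as printed. *)

theory Defs
  imports "HOL-Complex_Analysis.Complex_Analysis" "HOL-Library.Landau_Symbols"
begin

definition e2pi :: "complex \<Rightarrow> complex" where
  "e2pi z = exp (2 * of_real pi * \<i> * z)"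

definition upper_half_plane :: "complex set" where
  "upper_half_plane = {\<tau>. Im \<tau> > 0}"


section \<open>Bernoulli polynomials\<close>

text \<open>The generating function is a quotient of formal power series; numerator and
  denominator both have subdegree 1, so the quotient is the expected power series in \<open>t\<close>.\<close>

definition bernpoly :: "nat \<Rightarrow> real \<Rightarrow> real" where
  "bernpoly j \<alpha> = fact j * fps_nth ((fps_X * fps_exp \<alpha>) / (fps_exp 1 - 1)) j"

definition bernpoly_per :: "nat \<Rightarrow> real \<Rightarrow> real" where
  "bernpoly_per j \<alpha> = bernpoly j (frac \<alpha>)"


section \<open>The cotangent sum and the Eisenstein series\<close>

text \<open>\<open>quotient_of x\<close> is the pair \<open>(r, p)\<close> with \<open>x = r/p\<close> in lowest terms and \<open>p > 0\<close>.\<close>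

definition S_odd :: "nat \<Rightarrow> rat \<Rightarrow> real" where
  "S_odd g x = (let p = snd (quotient_of x) in
     1 / of_int p ^ (g + 1) *
     (\<Sum>n | 1 \<le> n \<and> n \<le> p - 1 \<and> odd n.
        (deriv ^^ g) cot (pi * of_int n / (2 * of_int p)) / sin (pi * of_int n * of_rat x)))"

definition divisor_sigma :: "int \<Rightarrow> nat \<Rightarrow> complex" where
  "divisor_sigma j n = (\<Sum>d | d dvd n. of_nat d powi j)"

definition E_odd :: "int \<Rightarrow> complex \<Rightarrow> complex" where
  "E_odd k \<tau> = (\<Sum>n. if odd n then divisor_sigma (k - 1) n * exp (of_real pi * \<i> * of_nat n * \<tau>) else 0)"


section \<open>Fourier coefficients, constant terms at cusps, the completed L-function\<close>

text \<open>Fourier coefficients with respect to \<open>\<tau> \<mapsto> \<tau> + 2\<close>, the translations in \<open>\<Gamma>(2)\<close>.\<close>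

definition fourier_coeff :: "(complex \<Rightarrow> complex) \<Rightarrow> nat \<Rightarrow> complex" where
  "fourier_coeff f = (THE a. \<forall>\<tau>\<in>upper_half_plane. (\<lambda>n. a n * e2pi (of_nat n * \<tau> / 2)) sums f \<tau>)"

definition slash :: "nat \<Rightarrow> int \<Rightarrow> int \<Rightarrow> int \<Rightarrow> int \<Rightarrow> (complex \<Rightarrow> complex) \<Rightarrow> complex \<Rightarrow> complex" where
  "slash k a b c d f \<tau> = (of_int c * \<tau> + of_int d) powi (- int k) *
     f ((of_int a * \<tau> + of_int b) / (of_int c * \<tau> + of_int d))"

text \<open>The common value of the constant term for all matrices in \<open>SL\<^sub>2(\<int>)\<close> with first column
  \<open>(r, p)\<close>, where \<open>x = r/p\<close> in lowest terms.\<close>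

definition cusp_const :: "nat \<Rightarrow> (complex \<Rightarrow> complex) \<Rightarrow> rat \<Rightarrow> complex" where
  "cusp_const k f x = (let (r, p) = quotient_of x in
     THE v. \<forall>r' p'. r * p' - r' * p = 1 \<longrightarrow> fourier_coeff (slash k r r' p p' f) 0 = v)"

text \<open>The holomorphic continuation to \<open>\<complex> - {0, k}\<close> of the Dirichlet series in the half plane
  \<open>Re s > k\<close>. Since \<open>\<complex> - {0, k}\<close> is connected, the chosen function is uniquely determined away
  from \<open>0\<close> and \<open>k\<close>.\<close>

definition completed_L :: "nat \<Rightarrow> (complex \<Rightarrow> complex) \<Rightarrow> rat \<Rightarrow> complex \<Rightarrow> complex" where
  "completed_L k f x = (SOME F. F holomorphic_on (UNIV - {0, of_nat k}) \<and>
     (\<forall>s. Re s > of_nat k \<longrightarrow>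
        F s = - (of_real (2 / (2 * pi)) powr s) * e2pi (- s / 4) * Gamma s *
          (\<Sum>n. fourier_coeff f (Suc n) / of_nat (Suc n) powr s * e2pi (of_nat (Suc n) * of_rat x / 2))))"

text \<open>\<open>S_L g f\<close> is \<open>S\<^sub>f\<close> for \<open>f\<close> of weight \<open>g + 2\<close>.\<close>

definition S_L :: "nat \<Rightarrow> (complex \<Rightarrow> complex) \<Rightarrow> rat \<Rightarrow> complex" where
  "S_L g f x = completed_L (g + 2) f x (of_nat (g + 1))"

text \<open>
  In weight 2 and at cusps with odd denominator the value \<open>S\<^sub>f(x)\<close> is not exactly proportional to the
  cotangent sum. For example \<open>f = E_odd 2\<close> at \<open>x = 0\<close> has Dirichlet series
  \<open>(1 - 2\<^bsup>-s\<^esup>)(1 - 2\<^bsup>1-s\<^esup>) \<zeta>(s) \<zeta>(s - 1)\<close>. At \<open>s = 1\<close> the zero of \<open>1 - 2\<^bsup>1-s\<^esup>\<close> meets the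
  pole of \<open>\<zeta>(s)\<close> and the value is \<open>- ln 2 / 4\<close>, whereas \<open>S_odd 0 0\<close> is an empty sum.
  The defect is this contribution; it is zero for \<open>g > 0\<close> and for even denominators.
\<close>

definition weight2_defect :: "nat \<Rightarrow> rat \<Rightarrow> real" where
  "weight2_defect g x = (let (r, p) = quotient_of x in
     if g = 0 \<and> odd p then (- 1) powi (r + 1) * ln 2 / 4 else 0)"


section \<open>Integrals between cusps\<close>

text \<open>A cusp is \<open>None\<close> (for \<open>i\<infinity>\<close>) or \<open>Some s\<close> with \<open>s\<close> rational.\<close>

fun above_cusp :: "complex \<Rightarrow> rat option \<Rightarrow> bool" where
  "above_cusp z None \<longleftrightarrow> Im z > 0"
| "above_cusp z (Some s) \<longleftrightarrow> Im z > 0 \<and> Re z = of_rat s"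

text \<open>\<open>I\<close> is the integral of \<open>h\<close> along the vertical line from \<open>z\<close> to the given cusp.\<close>

fun has_vertical_integral :: "(complex \<Rightarrow> complex) \<Rightarrow> complex \<Rightarrow> complex \<Rightarrow> rat option \<Rightarrow> bool" where
  "has_vertical_integral h I z None \<longleftrightarrow> ((\<lambda>t. h (z + \<i> * of_real t) * \<i>) has_integral I) {0..}"
| "has_vertical_integral h I z (Some s) \<longleftrightarrow> (h has_contour_integral I) (linepath z (of_rat s))"

text \<open>The path comes vertically from the cusp \<open>u\<close> to the starting point of \<open>\<delta>\<close>, follows \<open>\<delta>\<close>, and then
  runs vertically from the end point of \<open>\<delta>\<close> into the cusp \<open>v\<close>.\<close>

definition has_cusp_integral ::
  "(complex \<Rightarrow> complex) \<Rightarrow> complex \<Rightarrow> rat option \<Rightarrow> (real \<Rightarrow> complex) \<Rightarrow> rat option \<Rightarrow> bool" where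
  "has_cusp_integral h I u \<delta> v \<longleftrightarrow>
     (\<exists>I1 I2 I3. has_vertical_integral h I1 (pathstart \<delta>) u \<and> (h has_contour_integral I2) \<delta> \<and>
        has_vertical_integral h I3 (pathfinish \<delta>) v \<and> I = - I1 + I2 + I3)"

definition cusp_integral :: "(complex \<Rightarrow> complex) \<Rightarrow> rat option \<Rightarrow> rat option \<Rightarrow> complex" where
  "cusp_integral h u v = (THE I. \<forall>\<delta>. valid_path \<delta> \<and> path_image \<delta> \<subseteq> upper_half_plane \<and>
     above_cusp (pathstart \<delta>) u \<and> above_cusp (pathfinish \<delta>) v \<longrightarrow> has_cusp_integral h I u \<delta> v)"

text \<open>Elements of \<open>\<Gamma>(2)\<close> are given by their entries \<open>a b c d\<close>.\<close>

definition Gamma2 :: "int \<Rightarrow> int \<Rightarrow> int \<Rightarrow> int \<Rightarrow> bool" where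
  "Gamma2 a b c d \<longleftrightarrow> a * d - b * c = 1 \<and> odd a \<and> even b \<and> even c \<and> odd d"

definition moebius_infinity :: "int \<Rightarrow> int \<Rightarrow> int \<Rightarrow> int \<Rightarrow> rat option" where
  "moebius_infinity a b c d = (if c = 0 then None else Some (of_int a / of_int c))"

text \<open>The inverse of the matrix with entries \<open>a b c d\<close> has the entries \<open>d (-b) (-c) a\<close>.\<close>

definition period_R :: "nat \<Rightarrow> (complex \<Rightarrow> complex) \<Rightarrow> int \<Rightarrow> int \<Rightarrow> int \<Rightarrow> int \<Rightarrow> complex \<Rightarrow> complex" where
  "period_R g f a b c d X =
     cusp_integral (\<lambda>z. f z * (X - z) ^ g) None (moebius_infinity d (- b) (- c) a)"

end

theory Submission
  imports Defs "HOL-Real_Asymp.Real_Asymp"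
begin

text \<open>
  Write \<open>f = E\<^bsub>g+2\<^esub>\<close> for the Eisenstein series over the odd integers. All statements are read off from one
  function, the series \<open>E\<^bsub>-g\<^esub>\<close>: because of \<open>\<sigma>\<^bsub>g+1\<^esub>(n) = n\<^bsup>g+1\<^esup> \<sigma>\<^bsub>-g-1\<^esub>(n)\<close> its \<open>(g+1)\<close>-fold derivative is
  \<open>(\<pi>i)\<^bsup>g+1\<^esup> f\<close>, so it is an Eichler integral of \<open>f\<close>.

  Transformation behaviour. Summing over cofactors, \<open>E\<^bsub>-g\<^esub>(\<tau>)\<close> is a series of terms \<open>i / (2 d\<^bsup>g+1\<^esup> sin (\<pi> d \<tau>))\<close>
  over the odd \<open>d\<close>. Partial fractions turn it into a double series whose two orders of summation yield
  \<open>E\<^bsub>-g\<^esub>(-1/\<tau>)\<close> and a Fourier series in \<open>\<tau>\<close> (\<open>E_odd_inversion\<close>). Euclidean descent extends this to \<open>\<Gamma>(2)\<close>: \<open>E\<^bsub>-g\<^esub>\<close> is invariant in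
  weight \<open>-g\<close> up to \<open>i\<close> times a real polynomial of degree at most \<open>g\<close> (\<open>slash_rel_E_Gamma2\<close>), and at every cusp it
  is a Fourier series plus a multiple of \<open>\<tau>\<^bsup>g+1\<^esup>\<close> plus such a polynomial (\<open>E_odd_cusp_expansion\<close>). Bol's identity
  transports this to \<open>f\<close>, whose constant terms at the cusps come from the coefficients of \<open>\<tau>\<^bsup>g+1\<^esup>\<close>.

  Values at the cusps. In the coordinate of the cusp \<open>x\<close> the expansion reads: pole, constant, \<open>O(\<tau>)\<close>. Apart
  from the constant Fourier coefficient, which is felt only for \<open>g = 0\<close>, everything in the constant is
  imaginary. The imaginary part is a radial limit: grouping the series of cosecants by residues modulo \<open>2p\<close>
  and pairing \<open>b\<close> with \<open>2p - b\<close>, each group tends to the partial fraction series of \<open>cot\<^bsup>(g)\<^esup>\<close> divided by a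
  sine, and the groups add up to the cotangent sum (\<open>Im_E_odd_limit\<close>, \<open>E_odd_asymptotics\<close>).

  Reciprocity. Comparing the expansions of \<open>E\<^bsub>-g\<^esub>\<close> at \<open>x\<close> and at \<open>\<gamma>x\<close> gives the reciprocity law with the
  polynomial of the transformation law (\<open>cusp_constant_term_moebius\<close>). That polynomial is the period
  polynomial, since the Taylor sum of \<open>E\<^bsub>-g\<^esub>\<close> of order \<open>g\<close> is a primitive of \<open>f(z) (X - z)\<^sup>g\<close> up to a
  constant (\<open>period_R_eq\<close>). For \<open>x / (2x + 1)\<close> it is determined by its degree and a few values.

  \<open>L\<close>-value. The completed \<open>L\<close>-function is the Mellin transform of \<open>f\<close> on the vertical line above \<open>x\<close>, after
  removal of the singular part at \<open>x\<close>. At \<open>s = g + 1\<close> the Mellin integral is an Eichler integral, so that it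
  computes the constant term of \<open>E\<^bsub>-g\<^esub>\<close> at \<open>x\<close> (\<open>mellin_continuation_value\<close>).

  The finite formulas with Bernoulli polynomials express that \<open>B\<^sub>1\<close> and \<open>1/sin\<close>, and likewise \<open>B\<^bsub>g+1\<^esub>\<close> and
  \<open>cot\<^bsup>(g)\<^esup>\<close>, are finite Fourier transforms of each other (\<open>bernpoly_1_dft\<close>, \<open>bernpoly_per_difference\<close>).
\<close>

section \<open>Fourier series in the upper half plane\<close>

definition qser :: "(nat \<Rightarrow> complex) \<Rightarrow> complex \<Rightarrow> complex" where
  "qser c \<tau> = (\<Sum>n. c n * exp (of_real pi * \<i> * of_nat n * \<tau>))"

text \<open>Polynomial growth of the coefficients is preserved by termwise differentiation.\<close>

definition poly_bounded :: "(nat \<Rightarrow> complex) \<Rightarrow> bool" where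
  "poly_bounded c \<longleftrightarrow> (\<exists>C N. \<forall>n. norm (c n) \<le> C * (of_nat n + 1) ^ N)"

lemma poly_boundedE:
  assumes "poly_bounded c"
  obtains C N where "C \<ge> 0" "\<And>n. norm (c n) \<le> C * (of_nat n + 1) ^ N"
proof -
  obtain C N where *: "\<And>n. norm (c n) \<le> C * (of_nat n + 1) ^ N"
    using assms unfolding poly_bounded_def by blast
  have "0 \<le> norm (c 0)" by simp
  also have "\<dots> \<le> C" using *[of 0] by simp
  finally show ?thesis using that * by blast
qed

lemma poly_bounded_const_mult: "poly_bounded c \<Longrightarrow> poly_bounded (\<lambda>n. a * c n)"
proof (elim poly_boundedE)
  fix C :: real and N assume C: "C \<ge> 0" "\<And>n. norm (c n) \<le> C * (of_nat n + 1) ^ N"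
  have "norm (a * c n) \<le> (norm a * C) * (of_nat n + 1) ^ N" for n
    using mult_left_mono[OF C(2)[of n], of "norm a"] by (simp add: norm_mult mult_ac)
  thus ?thesis unfolding poly_bounded_def by blast
qed

lemma poly_bounded_nat_mult: "poly_bounded c \<Longrightarrow> poly_bounded (\<lambda>n. of_nat n * c n)"
proof (elim poly_boundedE)
  fix C :: real and N assume C: "C \<ge> 0" "\<And>n. norm (c n) \<le> C * (of_nat n + 1) ^ N"
  have "norm (of_nat n * c n) \<le> C * (of_nat n + 1) ^ Suc N" for n
  proof -
    have "norm (of_nat n * c n) = of_nat n * norm (c n)" by (simp add: norm_mult)
    also have "\<dots> \<le> (of_nat n + 1) * (C * (of_nat n + 1) ^ N)"
      using C by (intro mult_mono) auto
    finally show ?thesis by (simp add: mult_ac)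
  qed
  thus ?thesis unfolding poly_bounded_def by blast
qed

lemma poly_bounded_deriv: "poly_bounded c \<Longrightarrow> poly_bounded (\<lambda>n. (a * of_nat n) ^ m * c n)"
proof (induction m)
  case (Suc m)
  from poly_bounded_const_mult[OF poly_bounded_nat_mult[OF Suc.IH[OF Suc.prems]], of a]
  show ?case by (simp add: mult_ac)
qed simp

lemma exp_qpow: "exp (of_real pi * \<i> * of_nat n * \<tau>) = exp (of_real pi * \<i> * \<tau>) ^ n"
  by (simp add: exp_of_nat_mult [symmetric] mult_ac)

lemma norm_q: "norm (exp (of_real pi * \<i> * \<tau>)) = exp (- pi * Im \<tau>)"
  by (simp add: norm_exp_eq_Re)

lemma summable_poly_geometric:
  fixes x :: real assumes "0 \<le> x" "x < 1"
  shows "summable (\<lambda>n. (of_nat n + 1) ^ N * x ^ n)"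
  using assms
proof (induction N arbitrary: x)
  case 0
  thus ?case by (simp add: summable_geometric)
next
  case (Suc N)
  define y where "y = sqrt x"
  have y: "0 \<le> y" "y < 1" "x = y * y" using Suc.prems by (auto simp: y_def real_sqrt_lt_1_iff)
  have "(\<lambda>n. of_nat n * y ^ n + y ^ n) \<longlonglongrightarrow> 0 + 0"
    using y by (intro tendsto_add powser_times_n_limit_0 LIMSEQ_power_zero) auto
  hence "Bseq (\<lambda>n. of_nat n * y ^ n + y ^ n)"
    by (intro convergent_imp_Bseq convergentI)
  then obtain K where K: "\<And>n. norm (of_nat n * y ^ n + y ^ n) \<le> K"
    by (elim BseqE) auto
  show ?case
  proof (rule summable_comparison_test')
    show "summable (\<lambda>n. ((of_nat n + 1) ^ N * y ^ n) * K)"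
      by (rule summable_mult2[OF Suc.IH[OF y(1,2)]])
    fix n :: nat
    have "norm ((of_nat n + 1) ^ Suc N * x ^ n) = ((of_nat n + 1) ^ N * y ^ n) * norm (of_nat n * y ^ n + y ^ n)"
      using y by (simp add: power_mult_distrib algebra_simps abs_mult)
    also have "\<dots> \<le> ((of_nat n + 1) ^ N * y ^ n) * K"
      using y by (intro mult_left_mono K) auto
    finally show "norm ((of_nat n + 1) ^ Suc N * x ^ n) \<le> ((of_nat n + 1) ^ N * y ^ n) * K" .
  qed
qed

lemma
  assumes "poly_bounded c" "Im \<tau> > 0"
  shows qser_abs_summable: "summable (\<lambda>n. norm (c n * exp (of_real pi * \<i> * of_nat n * \<tau>)))"
    and qser_sums: "(\<lambda>n. c n * exp (of_real pi * \<i> * of_nat n * \<tau>)) sums qser c \<tau>"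
proof -
  obtain C N where C: "C \<ge> 0" "\<And>n. norm (c n) \<le> C * (of_nat n + 1) ^ N"
    using poly_boundedE[OF assms(1)] by blast
  show *: "summable (\<lambda>n. norm (c n * exp (of_real pi * \<i> * of_nat n * \<tau>)))"
  proof (rule summable_comparison_test')
    show "summable (\<lambda>n. C * ((of_nat n + 1) ^ N * exp (- pi * Im \<tau>) ^ n))"
      using assms(2) by (intro summable_mult summable_poly_geometric) auto
    show "norm (norm (c n * exp (of_real pi * \<i> * of_nat n * \<tau>))) \<le>
        C * ((of_nat n + 1) ^ N * exp (- pi * Im \<tau>) ^ n)" if "n \<ge> 0" for n
      unfolding exp_qpow norm_mult norm_power norm_q
      using mult_right_mono[OF C(2)[of n], of "exp (- pi * Im \<tau>) ^ n"] by (simp add: mult_ac)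
  qed
  show "(\<lambda>n. c n * exp (of_real pi * \<i> * of_nat n * \<tau>)) sums qser c \<tau>"
    unfolding qser_def by (rule summable_sums[OF summable_norm_cancel[OF *]])
qed

lemma qser_const_mult:
  assumes "poly_bounded c" "Im \<tau> > 0"
  shows "qser (\<lambda>n. a * c n) \<tau> = a * qser c \<tau>"
proof -
  have "(\<lambda>n. a * c n * exp (of_real pi * \<i> * of_nat n * \<tau>)) sums (a * qser c \<tau>)"
    using sums_mult[OF qser_sums[OF assms], of a] by (simp add: mult.assoc)
  thus ?thesis unfolding qser_def[of "\<lambda>n. a * c n"] by (rule sums_unique[symmetric])
qed

lemma DERIV_qser:
  assumes "poly_bounded c" "Im \<tau> > 0"
  shows "(qser c has_field_derivative qser (\<lambda>n. (of_real pi * \<i> * of_nat n) * c n) \<tau>) (at \<tau>)"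
proof -
  define q where "q = (\<lambda>\<tau>::complex. exp (of_real pi * \<i> * \<tau>))"
  have q: "norm (q \<tau>) < 1" "q \<tau> \<noteq> 0" using assms(2) unfolding q_def norm_q by auto
  define \<tau>' where "\<tau>' = \<i> * of_real (Im \<tau> / 2)"
  have S': "summable (\<lambda>n. c n * q \<tau>' ^ n)"
    using summable_norm_cancel[OF qser_abs_summable[OF assms(1), of \<tau>']] assms(2)
    unfolding exp_qpow q_def \<tau>'_def by simp
  have lt: "norm (q \<tau>) < norm (q \<tau>')"
    using assms(2) unfolding q_def norm_q \<tau>'_def by simp
  have D: "((\<lambda>x. \<Sum>n. c n * x ^ n) has_field_derivative (\<Sum>n. diffs c n * q \<tau> ^ n)) (at (q \<tau>))"
    by (rule termdiffs_strong[OF S' lt])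
  have S: "summable (\<lambda>n. diffs c n * q \<tau> ^ n)"
    by (rule termdiff_converges[OF lt]) (rule powser_inside[OF S'])
  have Dq: "(q has_field_derivative (of_real pi * \<i> * q \<tau>)) (at \<tau>)"
    unfolding q_def by (auto intro!: derivative_eq_intros)
  have "((\<lambda>x. \<Sum>n. c n * q x ^ n) has_field_derivative (\<Sum>n. diffs c n * q \<tau> ^ n) * (of_real pi * \<i> * q \<tau>)) (at \<tau>)"
    by (rule DERIV_chain2[OF D Dq])
  also have "(\<lambda>x. \<Sum>n. c n * q x ^ n) = qser c"
    by (rule ext) (simp add: qser_def exp_qpow q_def)
  also have "(\<Sum>n. diffs c n * q \<tau> ^ n) * (of_real pi * \<i> * q \<tau>) =
      qser (\<lambda>n. (of_real pi * \<i> * of_nat n) * c n) \<tau>"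
  proof -
    have pb: "poly_bounded (\<lambda>n. (of_real pi * \<i> * of_nat n) * c n)"
      using poly_bounded_deriv[OF assms(1), of "of_real pi * \<i>" 1] by simp
    have "(\<lambda>n. (of_real pi * \<i> * of_nat (Suc n)) * c (Suc n) * q \<tau> ^ Suc n) sums
        ((\<Sum>n. diffs c n * q \<tau> ^ n) * (of_real pi * \<i> * q \<tau>))"
      using sums_mult2[OF summable_sums[OF S], of "of_real pi * \<i> * q \<tau>"]
      by (simp add: diffs_def mult_ac)
    hence "(\<lambda>n. (of_real pi * \<i> * of_nat n) * c n * q \<tau> ^ n) sums
        ((\<Sum>n. diffs c n * q \<tau> ^ n) * (of_real pi * \<i> * q \<tau>))"
      by (subst (asm) sums_Suc_iff) simp
    thus ?thesis unfolding qser_def exp_qpow q_def by (rule sums_unique)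
  qed
  finally show ?thesis .
qed

lemma open_upper_half_plane: "open upper_half_plane"
  unfolding upper_half_plane_def by (rule open_halfspace_Im_gt)

lemma higher_deriv_qser:
  assumes "poly_bounded c" "Im \<tau> > 0"
  shows "(deriv ^^ m) (qser c) \<tau> = qser (\<lambda>n. (of_real pi * \<i> * of_nat n) ^ m * c n) \<tau>"
  using assms(2)
proof (induction m arbitrary: \<tau>)
  case (Suc m)
  have pb: "poly_bounded (\<lambda>n. (of_real pi * \<i> * of_nat n) ^ m * c n)"
    by (rule poly_bounded_deriv[OF assms(1)])
  have "((deriv ^^ m) (qser c) has_field_derivative
      qser (\<lambda>n. (of_real pi * \<i> * of_nat n) * ((of_real pi * \<i> * of_nat n) ^ m * c n)) \<tau>) (at \<tau>)"
    by (rule has_field_derivative_transform_within_open[OF DERIV_qser[OF pb Suc.prems] open_upper_half_plane])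
       (use Suc in \<open>auto simp: upper_half_plane_def\<close>)
  from DERIV_imp_deriv[OF this] show ?case by (simp add: mult_ac)
qed simp

lemma qser_holomorphic:
  assumes "poly_bounded c" shows "qser c holomorphic_on upper_half_plane"
  unfolding holomorphic_on_open[OF open_upper_half_plane]
  using DERIV_qser[OF assms] by (auto simp: upper_half_plane_def)

text \<open>A Fourier series approaches its constant term at the rate of \<open>q = e\<^sup>\<pi>\<^sup>i\<^sup>\<tau>\<close>, uniformly away from
  the real axis.\<close>

lemma qser_minus_const_bound:
  assumes "poly_bounded c" "\<delta> > 0"
  obtains M where "M \<ge> 0" "\<And>\<tau>. Im \<tau> \<ge> \<delta> \<Longrightarrow> norm (qser c \<tau> - c 0) \<le> M * exp (- pi * Im \<tau>)"
proof -
  define x where "x = exp (- pi * \<delta>)"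
  have x: "0 < x" "x < 1" using assms(2) unfolding x_def by auto
  obtain C N where C: "C \<ge> 0" "\<And>n. norm (c n) \<le> C * (of_nat n + 1) ^ N"
    using poly_boundedE[OF assms(1)] by blast
  have sum: "summable (\<lambda>n. norm (c (Suc n)) * x ^ n)"
  proof -
    have "summable (\<lambda>n. norm (c n * exp (of_real pi * \<i> * of_nat n * (\<i> * of_real \<delta>))))"
      by (rule qser_abs_summable[OF assms(1)]) (use assms in auto)
    hence "summable (\<lambda>n. norm (c n) * x ^ n)"
      unfolding exp_qpow norm_mult norm_power norm_q by (simp add: x_def)
    hence "summable (\<lambda>n. norm (c (Suc n)) * x ^ Suc n)" by (subst summable_Suc_iff)
    from summable_mult[OF this, of "1/x"] show ?thesis using x by (simp add: field_simps)
  qed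
  define M where "M = (\<Sum>n. norm (c (Suc n)) * x ^ n)"
  have "norm (qser c \<tau> - c 0) \<le> M * exp (- pi * Im \<tau>)" if \<tau>: "Im \<tau> \<ge> \<delta>" for \<tau>
  proof -
    have \<tau>0: "Im \<tau> > 0" using \<tau> assms by simp
    define q where "q = exp (of_real pi * \<i> * \<tau>)"
    have q: "norm q \<le> x" unfolding q_def norm_q x_def using \<tau> by simp
    have "(\<lambda>n. c n * q ^ n) sums qser c \<tau>"
      using qser_sums[OF assms(1) \<tau>0] unfolding exp_qpow q_def .
    hence s: "(\<lambda>n. c (Suc n) * q ^ n * q) sums (qser c \<tau> - c 0)"
      using sums_Suc_iff[of "\<lambda>n. c n * q ^ n" "qser c \<tau> - c 0"] by (simp add: mult_ac)
    have b: "norm (c (Suc n) * q ^ n * q) \<le> (norm (c (Suc n)) * x ^ n) * norm q" for n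
      using q x by (auto simp: norm_mult norm_power intro!: mult_mono power_mono)
    have "norm (qser c \<tau> - c 0) \<le> (\<Sum>n. (norm (c (Suc n)) * x ^ n) * norm q)"
      unfolding sums_unique[OF s] by (rule norm_suminf_le[OF b summable_mult2[OF sum]])
    also have "\<dots> = M * norm q" unfolding M_def by (rule suminf_mult2[OF sum, symmetric])
    finally show ?thesis unfolding q_def norm_q .
  qed
  moreover have "M \<ge> 0" unfolding M_def using x by (intro suminf_nonneg[OF sum]) auto
  ultimately show ?thesis using that by blast
qed

lemma powser_sums_0_imp_coeff_0:
  fixes d :: "nat \<Rightarrow> complex"
  assumes "\<And>z. z \<noteq> 0 \<Longrightarrow> norm z < 1 \<Longrightarrow> (\<lambda>n. d n * z ^ n) sums 0"
  shows "d n = 0"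
  using assms
proof (induction n arbitrary: d)
  case 0
  have "((\<lambda>z::complex. 0::complex) \<longlongrightarrow> d 0) (at 0)"
    by (rule powser_limit_0_strong[where s = 1 and a = d]) (use 0 in auto)
  thus ?case by (simp add: tendsto_const_iff)
next
  case (Suc n)
  have d0: "d 0 = 0"
  proof -
    have "((\<lambda>z::complex. 0::complex) \<longlongrightarrow> d 0) (at 0)"
      by (rule powser_limit_0_strong[where s = 1 and a = d]) (use Suc.prems in auto)
    thus ?thesis by (simp add: tendsto_const_iff)
  qed
  show ?case
  proof (rule Suc.IH[of "\<lambda>n. d (Suc n)"])
    fix z :: complex assume z: "z \<noteq> 0" "norm z < 1"
    have "(\<lambda>n. d (Suc n) * z ^ Suc n) sums 0"
      using Suc.prems[OF z] d0 by (subst sums_Suc_iff) simp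
    from sums_mult[OF this, of "1/z"] z show "(\<lambda>n. d (Suc n) * z ^ n) sums 0"
      by (simp add: field_simps)
  qed
qed

text \<open>As \<open>\<tau>\<close> runs through the upper half plane, \<open>q = e\<^sup>\<pi>\<^sup>i\<^sup>\<tau>\<close> covers the punctured unit disc. A second expansion is
  therefore a power series with the same sum there, whatever the growth of its coefficients.\<close>

lemma fourier_coeff_eqI:
  assumes "poly_bounded c" "\<And>\<tau>. Im \<tau> > 0 \<Longrightarrow> f \<tau> = qser c \<tau>"
  shows "fourier_coeff f = c"
  unfolding fourier_coeff_def
proof (rule the_equality)
  have e: "e2pi (of_nat n * \<tau> / 2) = exp (of_real pi * \<i> * of_nat n * \<tau>)" for n \<tau>
    by (simp add: e2pi_def mult_ac)
  show "\<forall>\<tau>\<in>upper_half_plane. (\<lambda>n. c n * e2pi (of_nat n * \<tau> / 2)) sums f \<tau>"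
    using qser_sums[OF assms(1)] assms(2) unfolding e upper_half_plane_def by simp
  fix a assume a: "\<forall>\<tau>\<in>upper_half_plane. (\<lambda>n. a n * e2pi (of_nat n * \<tau> / 2)) sums f \<tau>"
  have s: "(\<lambda>n. (a n - c n) * z ^ n) sums 0" if z: "z \<noteq> 0" "norm z < 1" for z
  proof -
    define \<tau> where "\<tau> = Ln z / (of_real pi * \<i>)"
    have ez: "exp (of_real pi * \<i> * \<tau>) = z" using z by (simp add: \<tau>_def)
    have "Im \<tau> > 0"
      using norm_q[of \<tau>] z unfolding ez by (simp add: zero_less_mult_iff)
    hence "(\<lambda>n. a n * e2pi (of_nat n * \<tau> / 2)) sums f \<tau>"
      using a by (simp add: upper_half_plane_def)
    moreover have "(\<lambda>n. c n * z ^ n) sums f \<tau>"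
      using qser_sums[OF assms(1) \<open>Im \<tau> > 0\<close>] assms(2)[OF \<open>Im \<tau> > 0\<close>]
      unfolding exp_qpow ez by simp
    ultimately have "(\<lambda>n. a n * z ^ n) sums f \<tau>" "(\<lambda>n. c n * z ^ n) sums f \<tau>"
      unfolding e exp_qpow ez by simp_all
    from sums_diff[OF this] show ?thesis by (simp add: algebra_simps)
  qed
  have "a n - c n = 0" for n
    by (rule powser_sums_0_imp_coeff_0[of "\<lambda>n. a n - c n"]) (use s in auto)
  thus "a = c" by auto
qed

section \<open>Partial fractions of the cotangent and its derivatives\<close>

text \<open>The logarithmic derivative of the reflection formula of the Gamma function.\<close>

lemma Digamma_reflection_complex:
  fixes z :: complex
  assumes "z \<notin> \<int>"
  shows "Digamma (1 - z) - Digamma z = of_real pi * cot (of_real pi * z)"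
proof -
  have z: "z \<notin> \<int>\<^sub>\<le>\<^sub>0" "1 - z \<notin> \<int>\<^sub>\<le>\<^sub>0"
    using assms nonpos_Ints_Int[of z] nonpos_Ints_Int[of "1 - z"] Ints_diff[of 1 "1 - z"] by auto
  have sz: "sin (of_real pi * z) \<noteq> 0"
    using assms by (auto simp: sin_eq_0 Ints_def mult.commute)
  define G where "G = Gamma z * Gamma (1 - z)"
  have G: "G = of_real pi / sin (of_real pi * z)" unfolding G_def by (rule Gamma_reflection_complex)
  have G0: "G \<noteq> 0" unfolding G using sz by simp
  have "((\<lambda>z. Gamma z * Gamma (1 - z)) has_field_derivative G * (Digamma z - Digamma (1 - z))) (at z)"
    using z unfolding G_def by (auto intro!: derivative_eq_intros simp: algebra_simps)
  moreover have "((\<lambda>z. Gamma z * Gamma (1 - z)) has_field_derivative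
      G * (- of_real pi * cot (of_real pi * z))) (at z)"
    unfolding Gamma_reflection_complex G using sz
    by (auto intro!: derivative_eq_intros simp: cot_def power2_eq_square field_simps)
  ultimately have "G * (Digamma z - Digamma (1 - z)) = G * (- of_real pi * cot (of_real pi * z))"
    by (rule DERIV_unique)
  hence "Digamma z - Digamma (1 - z) = - of_real pi * cot (of_real pi * z)"
    using G0 mult_left_cancel by blast
  thus ?thesis by (metis minus_diff_eq minus_mult_left minus_minus)
qed

lemma open_Compl_Ints: "open (- \<int> :: complex set)"
  by (intro open_Compl closed_Ints)

lemma higher_deriv_pi_cot:
  fixes z :: complex
  assumes "z \<notin> \<int>"
  shows "(deriv ^^ n) (\<lambda>z. of_real pi * cot (of_real pi * z)) z =
      (-1) ^ n * Polygamma n (1 - z) - Polygamma n z"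
  using assms
proof (induction n arbitrary: z)
  case 0
  thus ?case using Digamma_reflection_complex by simp
next
  case (Suc n)
  have z: "z \<notin> \<int>\<^sub>\<le>\<^sub>0" "1 - z \<notin> \<int>\<^sub>\<le>\<^sub>0"
    using Suc.prems nonpos_Ints_Int[of z] nonpos_Ints_Int[of "1 - z"] Ints_diff[of 1 "1 - z"] by auto
  have "((\<lambda>z. (-1) ^ n * Polygamma n (1 - z) - Polygamma n z) has_field_derivative
       ((-1) ^ Suc n * Polygamma (Suc n) (1 - z) - Polygamma (Suc n) z)) (at z)"
    using z by (auto intro!: derivative_eq_intros)
  hence "((deriv ^^ n) (\<lambda>z. of_real pi * cot (of_real pi * z)) has_field_derivative
       ((-1) ^ Suc n * Polygamma (Suc n) (1 - z) - Polygamma (Suc n) z)) (at z)"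
    by (rule has_field_derivative_transform_within_open[OF _ open_Compl_Ints])
       (use Suc in auto)
  thus ?case by (simp add: DERIV_imp_deriv)
qed

lemma open_sin_nonzero: "open {z::complex. sin z \<noteq> 0}"
  by (intro open_Collect_neq continuous_intros)

lemma cot_holomorphic: "(cot :: complex \<Rightarrow> complex) holomorphic_on {z. sin z \<noteq> 0}"
  unfolding cot_def[abs_def] by (intro holomorphic_intros) auto

lemma sin_pi_nonzero: "(z::complex) \<notin> \<int> \<Longrightarrow> sin (of_real pi * z) \<noteq> 0"
  by (auto simp: sin_eq_0 Ints_def mult.commute)

text \<open>The partial fraction expansion of the derivatives of the cotangent, obtained by
  differentiating the reflection formula of the Gamma function.\<close>

lemma higher_deriv_cot_sums:
  fixes z :: complex
  assumes "z \<notin> \<int>"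
  shows "(\<lambda>l. 1 / (z + of_nat l) ^ Suc n - (-1) ^ n / (1 - z + of_nat l) ^ Suc n) sums
     ((-1) ^ n * of_real pi ^ Suc n * (deriv ^^ n) cot (of_real pi * z) / fact n)"
proof -
  have z0: "z \<noteq> 0" "1 - z \<noteq> 0" using assms by auto
  have "(deriv ^^ n) (\<lambda>z. of_real pi * cot (of_real pi * z)) z =
      of_real pi * (deriv ^^ n) (\<lambda>z. cot (of_real pi * z)) z"
    by (rule higher_deriv_cmult[OF _ _ open_Compl_Ints])
       (use assms sin_pi_nonzero in \<open>auto intro!: holomorphic_on_compose_gen[OF _ cot_holomorphic, unfolded o_def] holomorphic_intros\<close>)
  also have "(deriv ^^ n) (\<lambda>z. cot (of_real pi * z)) z =
      of_real pi ^ n * (deriv ^^ n) cot (of_real pi * z)"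
    by (rule higher_deriv_compose_linear[OF cot_holomorphic open_Compl_Ints open_sin_nonzero])
       (use assms sin_pi_nonzero in auto)
  finally have eq: "(-1) ^ n * Polygamma n (1 - z) - Polygamma n z =
      of_real pi ^ Suc n * (deriv ^^ n) cot (of_real pi * z)"
    unfolding higher_deriv_pi_cot[OF assms] by simp
  show ?thesis
  proof (cases "n = 0")
    case True
    have "(\<lambda>l. (inverse (of_nat (Suc l)) - inverse (1 - z + of_nat l)) -
            (inverse (of_nat (Suc l)) - inverse (z + of_nat l))) sums (Digamma (1 - z) - Digamma z)"
      using sums_diff[OF summable_sums[OF summable_Digamma[OF z0(2)]] summable_sums[OF summable_Digamma[OF z0(1)]]]
      by (simp add: Digamma_def)
    thus ?thesis using eq True by (simp add: divide_inverse)
  next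
    case False
    hence n: "Suc n \<ge> 2" by simp
    have P: "(\<lambda>l. inverse ((z + of_nat l) ^ Suc n)) sums ((-1) ^ Suc n * Polygamma n z / fact n)"
      if "z \<noteq> 0" for z :: complex
    proof -
      have "(\<lambda>l. inverse ((z + of_nat l) ^ Suc n)) sums (\<Sum>l. inverse ((z + of_nat l) ^ Suc n))"
        by (rule summable_sums[OF Polygamma_converges'[OF that n]])
      moreover have "(\<Sum>l. inverse ((z + of_nat l) ^ Suc n)) = (-1) ^ Suc n * Polygamma n z / fact n"
        using False unfolding Polygamma_def by (simp flip: power_add add: field_simps power_mult_distrib)
      ultimately show ?thesis by simp
    qed
    have "(\<lambda>l. inverse ((z + of_nat l) ^ Suc n) - (-1) ^ n * inverse ((1 - z + of_nat l) ^ Suc n)) sums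
        ((-1) ^ Suc n * Polygamma n z / fact n - (-1) ^ n * ((-1) ^ Suc n * Polygamma n (1 - z) / fact n))"
      by (intro sums_diff sums_mult P z0)
    also have "(-1) ^ Suc n * Polygamma n z / fact n - (-1) ^ n * ((-1) ^ Suc n * Polygamma n (1 - z) / fact n) =
        (-1) ^ n * ((-1) ^ n * Polygamma n (1 - z) - Polygamma n z) / fact n"
      by (simp add: field_simps)
    finally show ?thesis unfolding eq by (simp add: divide_inverse mult_ac)
  qed
qed

text \<open>The derivatives of the real cotangent are restrictions of those of the complex one, for which the partial
  fractions are proved.\<close>

lemma higher_deriv_cot_of_real:
  assumes "sin x \<noteq> (0::real)"
  shows "(deriv ^^ n) cot (complex_of_real x) = of_real ((deriv ^^ n) cot x)"
    and "((deriv ^^ n) cot has_real_derivative (deriv ^^ Suc n) cot x) (at x)"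
proof -
  have op: "open {x::real. sin x \<noteq> 0}" by (intro open_Collect_neq continuous_intros)
  have D: "((\<lambda>x. Re ((deriv ^^ n) cot (complex_of_real x))) has_real_derivative
       Re ((deriv ^^ Suc n) cot (complex_of_real x))) (at x)" if "sin x \<noteq> 0" for n x
  proof -
    have "sin (complex_of_real x) \<noteq> 0" using that by (simp add: sin_of_real)
    hence "((deriv ^^ n) cot has_field_derivative (deriv ^^ Suc n) cot (complex_of_real x)) (at (complex_of_real x))"
      using holomorphic_derivI[OF holomorphic_higher_deriv[OF cot_holomorphic open_sin_nonzero] open_sin_nonzero]
      by simp
    from has_vector_derivative_real_field[OF this, of UNIV]
    have "((\<lambda>x. (deriv ^^ n) cot (complex_of_real x)) has_vector_derivative (deriv ^^ Suc n) cot (complex_of_real x)) (at x)" .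
    from bounded_linear.has_vector_derivative[OF bounded_linear_Re this]
    show ?thesis by (simp add: has_real_derivative_iff_has_vector_derivative)
  qed
  have "sin x \<noteq> 0 \<Longrightarrow> (deriv ^^ n) cot (complex_of_real x) \<in> \<real> \<and>
      (deriv ^^ n) cot x = Re ((deriv ^^ n) cot (complex_of_real x))" for n x
  proof (induction n arbitrary: x)
    case 0
    have c: "cot (complex_of_real x) = of_real (cot x)"
      by (simp add: cot_def sin_of_real cos_of_real)
    show ?case by (simp add: c)
  next
    case (Suc n)
    have "((deriv ^^ n) cot has_real_derivative Re ((deriv ^^ Suc n) cot (complex_of_real x))) (at x)"
      by (rule has_field_derivative_transform_within_open[OF D[OF Suc.prems] op]) (use Suc in auto)
    hence 1: "(deriv ^^ Suc n) cot x = Re ((deriv ^^ Suc n) cot (complex_of_real x))"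
      by (simp add: DERIV_imp_deriv)
    have I: "((\<lambda>x. Im ((deriv ^^ n) cot (complex_of_real x))) has_real_derivative
       Im ((deriv ^^ Suc n) cot (complex_of_real x))) (at x)"
    proof -
      have "sin (complex_of_real x) \<noteq> 0" using Suc.prems by (simp add: sin_of_real)
      hence "((deriv ^^ n) cot has_field_derivative (deriv ^^ Suc n) cot (complex_of_real x)) (at (complex_of_real x))"
        using holomorphic_derivI[OF holomorphic_higher_deriv[OF cot_holomorphic open_sin_nonzero] open_sin_nonzero]
        by simp
      from has_vector_derivative_real_field[OF this, of UNIV]
      have "((\<lambda>x. (deriv ^^ n) cot (complex_of_real x)) has_vector_derivative (deriv ^^ Suc n) cot (complex_of_real x)) (at x)" .
      from bounded_linear.has_vector_derivative[OF bounded_linear_Im this]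
      show ?thesis by (simp add: has_real_derivative_iff_has_vector_derivative)
    qed
    have "((\<lambda>x. 0) has_real_derivative Im ((deriv ^^ Suc n) cot (complex_of_real x))) (at x)"
      by (rule has_field_derivative_transform_within_open[OF I op])
         (use Suc in \<open>auto simp: complex_is_Real_iff\<close>)
    hence "Im ((deriv ^^ Suc n) cot (complex_of_real x)) = 0"
      using DERIV_unique[OF DERIV_const] by metis
    thus ?case using 1 by (simp add: complex_is_Real_iff)
  qed
  note * = this
  show "(deriv ^^ n) cot (complex_of_real x) = of_real ((deriv ^^ n) cot x)"
    using *[OF assms, of n] by (simp add: complex_is_Real_iff complex_eq_iff)
  have "((deriv ^^ n) cot has_real_derivative Re ((deriv ^^ Suc n) cot (complex_of_real x))) (at x)"
    by (rule has_field_derivative_transform_within_open[OF D[OF assms] op]) (use * assms in auto)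
  thus "((deriv ^^ n) cot has_real_derivative (deriv ^^ Suc n) cot x) (at x)"
    using *[OF assms, of "Suc n"] by simp
qed

lemma higher_deriv_cot_sums_real:
  fixes z :: real
  assumes "0 < z" "z < 1"
  shows "(\<lambda>l. 1 / (z + of_nat l) ^ Suc n - (-1) ^ n / (1 - z + of_nat l) ^ Suc n) sums
     ((-1) ^ n * pi ^ Suc n * (deriv ^^ n) cot (pi * z) / fact n)"
proof -
  have "complex_of_real z \<notin> \<int>"
    using assms by (auto simp: Ints_def complex_eq_iff)
  moreover have "sin (pi * z) \<noteq> 0"
    using assms by (intro less_imp_neq[symmetric] sin_gt_zero) auto
  from higher_deriv_cot_of_real(1)[OF this, of n]
  have "(deriv ^^ n) cot (complex_of_real pi * complex_of_real z) = of_real ((deriv ^^ n) cot (pi * z))"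
    by simp
  ultimately have "(\<lambda>l. complex_of_real (1 / (z + of_nat l) ^ Suc n - (-1) ^ n / (1 - z + of_nat l) ^ Suc n)) sums
     complex_of_real ((-1) ^ n * pi ^ Suc n * (deriv ^^ n) cot (pi * z) / fact n)"
    using higher_deriv_cot_sums[of "complex_of_real z" n] by simp
  thus ?thesis by (simp only: sums_of_real_iff)
qed

text \<open>The cotangent series at \<open>(1 - y) / 2\<close>, with its two parts combined.\<close>

lemma tan_sums:
  fixes y :: complex
  assumes "(1 - y) / 2 \<notin> \<int>"
  shows "(\<lambda>i. 4 * y / ((2 * of_nat i + 1)\<^sup>2 - y\<^sup>2)) sums (of_real pi * tan (of_real pi * y / 2))"
proof -
  have "of_real pi * ((1 - y) / 2) = of_real (pi / 2) - of_real pi * y / 2"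
    by (simp add: field_simps)
  moreover have "cot (of_real (pi/2) - w) = tan w" for w :: complex
    unfolding cot_def tan_def cos_diff sin_diff sin_of_real cos_of_real by simp
  ultimately have "cot (of_real pi * ((1 - y) / 2)) = tan (of_real pi * y / 2)"
    by metis
  with higher_deriv_cot_sums[OF assms, of 0]
  have "(\<lambda>i. 1 / ((1 - y) / 2 + of_nat i) - 1 / (1 - (1 - y) / 2 + of_nat i)) sums
     (of_real pi * tan (of_real pi * y / 2))"
    by (simp del: times_divide_eq_right)
  also have "(\<lambda>i. 1 / ((1 - y) / 2 + of_nat i) - 1 / (1 - (1 - y) / 2 + of_nat i)) =
      (\<lambda>i. 4 * y / ((2 * of_nat i + 1)\<^sup>2 - y\<^sup>2))"
  proof
    fix i :: nat
    have n1: "2 * of_nat i + 1 - y \<noteq> 0"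
    proof
      assume "2 * of_nat i + 1 - y = 0"
      hence "y = 2 * of_nat i + 1" by (simp add: algebra_simps)
      hence "(1 - y) / 2 = - of_nat i" by simp
      thus False using assms by auto
    qed
    have n2: "2 * of_nat i + 1 + y \<noteq> 0"
    proof
      assume "2 * of_nat i + 1 + y = 0"
      hence y: "y = - (2 * of_nat i + 1)" by (rule add_eq_0_iff[THEN iffD1])
      have "(1 - y) / 2 = of_nat (i + 1)" unfolding y by simp
      thus False using assms Ints_of_nat by metis
    qed
    have e1: "(1 - y) / 2 + of_nat i = (2 * of_nat i + 1 - y) / 2"
      and e2: "1 - (1 - y) / 2 + of_nat i = (2 * of_nat i + 1 + y) / 2"
      and e3: "(2 * of_nat i + 1)\<^sup>2 - y\<^sup>2 = (2 * of_nat i + 1 - y) * (2 * of_nat i + 1 + y)"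
      by (simp_all add: field_simps power2_eq_square)
    show "1 / ((1 - y) / 2 + of_nat i) - 1 / (1 - (1 - y) / 2 + of_nat i) =
        4 * y / ((2 * of_nat i + 1)\<^sup>2 - y\<^sup>2)"
      unfolding e1 e2 e3 using n1 n2 by (simp add: divide_simps)
  qed
  finally show ?thesis .
qed

text \<open>From \<open>2 / sin w = cot (w / 2) + tan (w / 2)\<close>. The poles at even and odd integers have opposite signs, and
  in this pairing the series converges absolutely.\<close>

lemma cosecant_sums:
  fixes w :: complex
  assumes "w \<notin> \<int>"
  shows "(\<lambda>j. 2 * w / (w\<^sup>2 - (2 * of_nat j + 2)\<^sup>2) - 2 * w / (w\<^sup>2 - (2 * of_nat j + 1)\<^sup>2)) sums
     (of_real pi / sin (of_real pi * w) - 1 / w)"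
proof -
  have nz: "w + of_nat n \<noteq> 0" "w - of_nat n \<noteq> 0" for n
    using assms Ints_of_nat[of n] Ints_minus[OF Ints_of_nat[of n]]
    by (auto simp: add_eq_0_iff2)
  have half: "w / 2 \<notin> \<int>"
  proof
    assume "w / 2 \<in> \<int>"
    hence "2 * (w / 2) \<in> \<int>" by (intro Ints_mult) auto
    thus False using assms by simp
  qed
  have half': "(1 - w) / 2 \<notin> \<int>"
  proof
    assume "(1 - w) / 2 \<in> \<int>"
    hence "1 - 2 * ((1 - w) / 2) \<in> \<int>" by (intro Ints_mult Ints_diff) auto
    moreover have "1 - 2 * ((1 - w) / 2) = w" by (simp add: field_simps)
    ultimately show False using assms by metis
  qed
  have h1: "(\<lambda>l. 1 / (w / 2 + of_nat l) - 1 / (1 - w / 2 + of_nat l)) sums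
      (of_real pi * cot (of_real pi * (w / 2)))"
    using higher_deriv_cot_sums[OF half, of 0] by simp
  have h2: "(\<lambda>l. 1 / (w / 2 + of_nat (Suc l)) - 1 / (w / 2 + of_nat l)) sums (0 - 1 / (w / 2 + of_nat 0))"
    by (rule telescope_sums)
       (intro tendsto_divide_0[OF tendsto_const] tendsto_add_filterlim_at_infinity[OF tendsto_const] tendsto_of_nat)
  have cancel: "a - b + (b - c) = a - c" for a b c :: complex by simp
  have cot: "(\<lambda>l. 1 / (w / 2 + of_nat (Suc l)) - 1 / (1 - w / 2 + of_nat l)) sums
      (of_real pi * cot (of_real pi * (w / 2)) - 2 / w)"
    using sums_add[OF h2 h1] unfolding cancel by simp
  have "(\<lambda>l. (1 / (w / 2 + of_nat (Suc l)) - 1 / (1 - w / 2 + of_nat l)) / 2 +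
        4 * w / ((2 * of_nat l + 1)\<^sup>2 - w\<^sup>2) / 2) sums
     ((of_real pi * cot (of_real pi * (w / 2)) - 2 / w) / 2 + of_real pi * tan (of_real pi * w / 2) / 2)"
    by (intro sums_add sums_divide cot tan_sums half')
  also have "(\<lambda>l. (1 / (w / 2 + of_nat (Suc l)) - 1 / (1 - w / 2 + of_nat l)) / 2 +
        4 * w / ((2 * of_nat l + 1)\<^sup>2 - w\<^sup>2) / 2) =
     (\<lambda>j. 2 * w / (w\<^sup>2 - (2 * of_nat j + 2)\<^sup>2) - 2 * w / (w\<^sup>2 - (2 * of_nat j + 1)\<^sup>2))"
  proof
    fix j :: nat
    define m where "m = (2 * of_nat j + 2 :: complex)"
    have m: "w + m \<noteq> 0" "w - m \<noteq> 0"
      using nz[of "2 * j + 2"] by (auto simp: m_def add_ac)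
    have "1 / (w / 2 + of_nat (Suc j)) - 1 / (1 - w / 2 + of_nat j) = 2 / (w + m) - 2 / (m - w)"
    proof -
      have "w / 2 + of_nat (Suc j) = (w + m) / 2" "1 - w / 2 + of_nat j = (m - w) / 2"
        by (simp_all add: m_def field_simps)
      thus ?thesis by (simp only:) simp
    qed
    also have "\<dots> = 4 * w / (w\<^sup>2 - m\<^sup>2)"
    proof -
      have e: "w\<^sup>2 - m\<^sup>2 = - ((w + m) * (m - w))" by (simp add: algebra_simps power2_eq_square)
      have "2 / (w + m) - 2 / (m - w) = (2 * (m - w) - 2 * (w + m)) / ((w + m) * (m - w))"
        using m by (subst diff_frac_eq) auto
      thus ?thesis unfolding e by (simp add: minus_divide_right [symmetric])
    qed
    finally have 1: "1 / (w / 2 + of_nat (Suc j)) - 1 / (1 - w / 2 + of_nat j) = 4 * w / (w\<^sup>2 - m\<^sup>2)" .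
    have 2: "4 * w / ((2 * of_nat j + 1)\<^sup>2 - w\<^sup>2) = - (4 * w / (w\<^sup>2 - (2 * of_nat j + 1)\<^sup>2))"
      by (metis minus_diff_eq minus_divide_right)
    show "(1 / (w / 2 + of_nat (Suc j)) - 1 / (1 - w / 2 + of_nat j)) / 2 +
        4 * w / ((2 * of_nat j + 1)\<^sup>2 - w\<^sup>2) / 2 =
       2 * w / (w\<^sup>2 - (2 * of_nat j + 2)\<^sup>2) - 2 * w / (w\<^sup>2 - (2 * of_nat j + 1)\<^sup>2)"
    proof -
      have dbl: "4 * w / X = 2 * (2 * w / X)" for X by simp
      show ?thesis unfolding 1 2 m_def unfolding dbl by (simp del: times_divide_eq_right)
    qed
  qed
  also have "(of_real pi * cot (of_real pi * (w / 2)) - 2 / w) / 2 + of_real pi * tan (of_real pi * w / 2) / 2 =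
      of_real pi / sin (of_real pi * w) - 1 / w"
  proof -
    define v where "v = of_real pi * w / 2"
    have d: "of_real pi * w = 2 * v" "of_real pi * (w / 2) = v" by (simp_all add: v_def)
    have "sin (2 * v) \<noteq> 0" using sin_pi_nonzero[OF assms] unfolding d .
    hence sc: "sin v \<noteq> 0" "cos v \<noteq> 0" by (auto simp: sin_double)
    have "cot v + tan v = (cos v ^ 2 + sin v ^ 2) / (sin v * cos v)"
      using sc by (simp add: cot_def tan_def divide_simps power2_eq_square)
    also have "\<dots> = 2 / sin (2 * v)" using sc by (simp add: sin_double)
    finally have e: "cot v + tan v = 2 / sin (2 * v)" .
    have "(of_real pi * cot v - 2 / w) / 2 + of_real pi * tan v / 2 = of_real pi * (cot v + tan v) / 2 - 1 / w"
      by (simp add: algebra_simps add_divide_distrib diff_divide_distrib)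
    thus ?thesis unfolding d v_def[symmetric] e by simp
  qed
  finally show ?thesis .
qed

section \<open>Double series and Lambert series\<close>

text \<open>Rows and columns of an absolutely summable double series have the same total.\<close>

lemma double_series_swap:
  fixes f :: "nat \<Rightarrow> nat \<Rightarrow> complex"
  assumes "summable a" "summable b"
    and bound: "\<And>i j. norm (f i j) \<le> a i * b j"
    and rows: "\<And>i. (\<lambda>j. f i j) sums r i"
    and cols: "\<And>j. (\<lambda>i. f i j) sums c j"
    and nonneg: "\<And>i. a i \<ge> 0" "\<And>j. b j \<ge> 0"
  obtains S where "((\<lambda>(i, j). f i j) has_sum S) UNIV" "r sums S" "c sums S"
proof -
  have S0: "(\<lambda>(i, j). a i * b j) summable_on (UNIV \<times> UNIV)"
  proof (rule summable_on_SigmaI)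
    show "((\<lambda>y. (\<lambda>(i, j). a i * b j) (x, y)) has_sum a x * suminf b) UNIV" for x
      using has_sum_cmult_right[OF sums_nonneg_imp_has_sum[OF summable_sums[OF assms(2)]], of "a x"] nonneg
      by simp
    show "(\<lambda>x. a x * suminf b) summable_on UNIV"
      by (intro summable_on_cmult_left norm_summable_imp_summable_on)
         (use assms(1) nonneg in simp)
  qed (use nonneg in auto)
  have "(\<lambda>p. norm (case p of (i, j) \<Rightarrow> f i j)) summable_on (UNIV \<times> UNIV)"
    by (rule Infinite_Sum.abs_summable_on_comparison_test'[OF S0]) (use bound in auto)
  hence "(\<lambda>(i, j). f i j) summable_on (UNIV \<times> UNIV)"
    by (rule abs_summable_summable)
  then obtain S where S: "((\<lambda>(i, j). f i j) has_sum S) (UNIV \<times> UNIV)"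
    by (auto simp: summable_on_def)
  have sr: "summable (\<lambda>j. norm (f i j))" for i
    by (rule summable_comparison_test'[OF summable_mult[OF assms(2), of "a i"]]) (use bound in auto)
  have "(r has_sum S) UNIV"
    by (rule has_sum_SigmaD[OF S]) (simp add: norm_summable_imp_has_sum[OF sr rows])
  moreover have sc: "summable (\<lambda>i. norm (f i j))" for j
    by (rule summable_comparison_test'[OF summable_mult2[OF assms(1), of "b j"]]) (use bound in auto)
  have "(c has_sum S) UNIV"
    by (rule has_sum_SigmaD[OF iffD1[OF has_sum_swap S]])
       (simp add: norm_summable_imp_has_sum[OF sc cols])
  ultimately show ?thesis using that S by (simp add: has_sum_imp_sums)
qed

definition dirichlet_conv :: "(nat \<Rightarrow> complex) \<Rightarrow> (nat \<Rightarrow> complex) \<Rightarrow> nat \<Rightarrow> complex" where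
  "dirichlet_conv u v N = (if N = 0 then 0 else \<Sum>d | d dvd N. u d * v (N div d))"

text \<open>Collecting the terms with \<open>d m = N\<close> of the double series \<open>\<Sum> u(d) v(m) q\<^sup>d\<^sup>m\<close>.\<close>

lemma lambert_series:
  assumes u: "\<And>d. norm (u d) \<le> 1" and v: "\<And>m. norm (v m) \<le> 1" and q: "norm q < 1"
    and rows: "\<And>d. d > 0 \<Longrightarrow> (\<lambda>m. v (Suc m) * (q ^ d) ^ Suc m) sums r d"
  shows "(\<lambda>d. u (Suc d) * r (Suc d)) sums (\<Sum>N. dirichlet_conv u v N * q ^ N)"
proof -
  define f where "f = (\<lambda>d m. u (Suc d) * v (Suc m) * q ^ (Suc d * Suc m))"
  have bound: "norm (f d m) \<le> norm q ^ d * norm q ^ m" for d m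
  proof -
    have "norm (f d m) = norm (u (Suc d)) * norm (v (Suc m)) * norm q ^ (Suc d * Suc m)"
      by (simp add: f_def norm_mult norm_power)
    also have "\<dots> \<le> 1 * 1 * norm q ^ (d + m)"
      using q u v by (intro mult_mono power_decreasing) auto
    finally show ?thesis by (simp add: power_add)
  qed
  have geo: "summable (\<lambda>n. norm q ^ n)" using q by (intro summable_geometric) simp
  have r: "(\<lambda>m. f d m) sums (u (Suc d) * r (Suc d))" for d
    using sums_mult[OF rows[of "Suc d"], of "u (Suc d)"] unfolding f_def
    by (simp only: power_mult mult.assoc)
  have c: "(\<lambda>d. f d m) sums (\<Sum>d. f d m)" for m
  proof (rule summable_sums[OF summable_norm_cancel])
    show "summable (\<lambda>d. norm (f d m))"
      by (rule summable_comparison_test'[OF summable_mult2[OF geo, of "norm q ^ m"], of 0]) (simp add: bound)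
  qed
  obtain S where S: "((\<lambda>(d, m). f d m) has_sum S) UNIV" "(\<lambda>d. u (Suc d) * r (Suc d)) sums S"
    by (rule double_series_swap[OF geo geo bound r c]) simp_all
  have "((\<lambda>(N, d). u d * v (N div d) * q ^ N) has_sum S) (SIGMA N:{0<..}. {d. d dvd N})"
  proof -
    have "((\<lambda>(d, m). f d m) has_sum S) UNIV \<longleftrightarrow>
        ((\<lambda>(N, d). u d * v (N div d) * q ^ N) has_sum S) (SIGMA N:{0<..}. {d. d dvd N})"
    proof (rule has_sum_reindex_bij_witness[where j = "\<lambda>(d, m). (Suc d * Suc m, Suc d)"
            and i = "\<lambda>(N, d). (d - 1, N div d - 1)"])
      fix p :: "nat \<times> nat"
      show "(case case p of (d, m) \<Rightarrow> (Suc d * Suc m, Suc d) of (N, d) \<Rightarrow> (d - 1, N div d - 1)) = p"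
        by (cases p) (simp add: nonzero_mult_div_cancel_left del: mult_Suc mult_Suc_right)
      show "(case p of (d, m) \<Rightarrow> (Suc d * Suc m, Suc d)) \<in> (SIGMA N:{0<..}. {d. d dvd N})"
        by (cases p) (simp del: mult_Suc mult_Suc_right)
      show "(case case p of (d, m) \<Rightarrow> (Suc d * Suc m, Suc d) of (N, d) \<Rightarrow> u d * v (N div d) * q ^ N) =
          (case p of (d, m) \<Rightarrow> f d m)"
        by (cases p) (simp add: f_def nonzero_mult_div_cancel_left del: mult_Suc mult_Suc_right)
    next
      fix p :: "nat \<times> nat" assume "p \<in> (SIGMA N:{0<..}. {d. d dvd N})"
      then obtain N d where p: "p = (N, d)" "N > 0" "d dvd N" by auto
      then obtain e where e: "N = d * e" by auto
      show "(case case p of (N, d) \<Rightarrow> (d - 1, N div d - 1) of (d, m) \<Rightarrow> (Suc d * Suc m, Suc d)) = p"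
        using p(2) e by (simp add: p(1) del: mult_Suc mult_Suc_right)
    qed auto
    thus ?thesis using S(1) by simp
  qed
  hence "((\<lambda>N. \<Sum>d | d dvd N. u d * v (N div d) * q ^ N) has_sum S) {0<..}"
    by (rule has_sum_SigmaD) (simp add: has_sum_finite)
  also have "?this \<longleftrightarrow> ((\<lambda>N. dirichlet_conv u v N * q ^ N) has_sum S) UNIV"
    by (rule has_sum_cong_neutral) (auto simp: dirichlet_conv_def sum_distrib_right)
  finally have "(\<lambda>N. dirichlet_conv u v N * q ^ N) sums S" by (rule has_sum_imp_sums)
  thus ?thesis using S(2) by (simp add: sums_unique[symmetric])
qed

lemma dirichlet_conv_poly_bounded:
  assumes "\<And>d. norm (u d) \<le> 1" "\<And>m. norm (v m) \<le> 1"
  shows "poly_bounded (dirichlet_conv u v)"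
  unfolding poly_bounded_def
proof (intro exI allI)
  fix N :: nat
  have "norm (dirichlet_conv u v N) \<le> of_nat N"
  proof (cases "N = 0")
    case False
    have "norm (\<Sum>d | d dvd N. u d * v (N div d)) \<le> (\<Sum>d | d dvd N. 1 * 1)"
      unfolding norm_mult using assms
      by (intro sum_norm_le) (auto simp: norm_mult intro!: mult_le_one)
    also have "\<dots> = of_nat (card {d. d dvd N})" by simp
    also have "card {d. d dvd N} \<le> card {1..N}"
      using False by (intro card_mono) (auto dest: dvd_imp_le intro: Nat.gr0I)
    finally show ?thesis using False by (simp add: dirichlet_conv_def)
  qed (simp add: dirichlet_conv_def)
  thus "norm (dirichlet_conv u v N) \<le> 1 * (of_nat N + 1) ^ 1" by simp
qed

section \<open>The Eisenstein series as Fourier series\<close>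

definition odd_coeff :: "int \<Rightarrow> nat \<Rightarrow> complex" where
  "odd_coeff k n = (if odd n then divisor_sigma (k - 1) n else 0)"

lemma E_odd_eq_qser: "E_odd k = qser (odd_coeff k)"
  unfolding E_odd_def qser_def odd_coeff_def by (intro ext arg_cong[where f = suminf]) simp

lemma odd_coeff_neg:
  "odd_coeff (- int g) = dirichlet_conv (\<lambda>d. if odd d then 1 / of_nat d ^ Suc g else 0) (\<lambda>m. if odd m then 1 else 0)"
    (is "_ = dirichlet_conv ?u ?v")
proof
  fix N
  have pw: "of_nat d powi (- int g - 1) = (1 / of_nat d ^ Suc g :: complex)" for d
    by (simp add: power_int_def nat_add_distrib field_simps)
  show "odd_coeff (- int g) N = dirichlet_conv ?u ?v N"
  proof (cases "odd N")
    case True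
    hence "N \<noteq> 0" using odd_pos[of N] by simp
    have "(\<Sum>d | d dvd N. ?u d * ?v (N div d)) = (\<Sum>d | d dvd N. of_nat d powi (- int g - 1))"
    proof (rule sum.cong)
      fix d assume "d \<in> {d. d dvd N}"
      then obtain e where "N = d * e" by auto
      hence "odd d" "odd (N div d)" using True odd_pos[OF True] by auto
      thus "?u d * ?v (N div d) = of_nat d powi (- int g - 1)" by (simp only: pw) simp
    qed simp
    thus ?thesis using True \<open>N \<noteq> 0\<close> by (simp add: odd_coeff_def dirichlet_conv_def divisor_sigma_def)
  next
    case False
    have "(\<Sum>d | d dvd N. ?u d * ?v (N div d)) = 0"
    proof (rule sum.neutral, intro ballI)
      fix d assume "d \<in> {d. d dvd N}"
      then obtain e where e: "N = d * e" by auto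
      show "?u d * ?v (N div d) = 0"
        using False unfolding e by (cases "d = 0") auto
    qed
    thus ?thesis using False by (simp add: odd_coeff_def dirichlet_conv_def)
  qed
qed

lemma norm_inverse_power_le_1: "norm (1 / of_nat d ^ Suc g :: complex) \<le> 1"
proof (cases "d = 0")
  case False
  hence "1 \<le> real d ^ Suc g" by (intro one_le_power) simp
  thus ?thesis by (simp add: norm_divide norm_power norm_mult divide_simps)
qed simp

lemma poly_bounded_odd_coeff_neg: "poly_bounded (odd_coeff (- int g))"
  unfolding odd_coeff_neg
  by (rule dirichlet_conv_poly_bounded) (use norm_inverse_power_le_1 in auto)

text \<open>The weights \<open>g + 2\<close> and \<open>-g\<close> are exchanged by \<open>\<sigma>\<^bsub>g+1\<^esub>(n) = n\<^bsup>g+1\<^esup> \<sigma>\<^bsub>-g-1\<^esub>(n)\<close>: up to the factor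
  \<open>(\<pi>i)\<^bsup>g+1\<^esup>\<close> the series of weight \<open>-g\<close> is a \<open>(g+1)\<close>-fold primitive of the one of weight \<open>g + 2\<close>.\<close>

lemma odd_coeff_pos: "odd_coeff (int g + 2) n = of_nat n ^ Suc g * odd_coeff (- int g) n"
proof (cases "odd n")
  case True
  hence n: "n > 0" by (rule odd_pos)
  have "(\<Sum>d | d dvd n. (of_nat d :: complex) powi (int g + 2 - 1)) =
     (\<Sum>d | d dvd n. of_nat n ^ Suc g * of_nat d powi (- int g - 1))"
  proof (rule sum.reindex_bij_witness[of _ "\<lambda>d. n div d" "\<lambda>d. n div d"])
    fix d assume d: "d \<in> {d. d dvd n}"
    then obtain e where e: "n = d * e" by auto
    have de: "d > 0" "e > 0" using n e by auto
    have "(of_nat d :: complex) powi (int g + 2 - 1) = of_nat d ^ Suc g"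
      by (simp add: power_int_def nat_add_distrib)
    moreover have "(of_nat e :: complex) powi (- int g - 1) = 1 / of_nat e ^ Suc g"
      by (simp add: power_int_def nat_add_distrib field_simps)
    ultimately show "of_nat n ^ Suc g * of_nat (n div d) powi (- int g - 1) = (of_nat d :: complex) powi (int g + 2 - 1)"
      using de by (simp add: e power_mult_distrib)
  qed (use n in auto)
  thus ?thesis using True by (simp add: odd_coeff_def divisor_sigma_def sum_distrib_left)
qed (simp add: odd_coeff_def)

lemma poly_bounded_odd_coeff_pos: "poly_bounded (odd_coeff (int g + 2))"
  using poly_bounded_deriv[OF poly_bounded_odd_coeff_neg[of g], of 1 "Suc g"]
  unfolding odd_coeff_pos[abs_def] by simp

lemma higher_deriv_E_odd:
  assumes "Im \<tau> > 0"
  shows "(deriv ^^ Suc g) (E_odd (- int g)) \<tau> = (of_real pi * \<i>) ^ Suc g * E_odd (int g + 2) \<tau>"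
proof -
  have "(deriv ^^ Suc g) (E_odd (- int g)) \<tau> =
      qser (\<lambda>n. (of_real pi * \<i>) ^ Suc g * odd_coeff (int g + 2) n) \<tau>"
    unfolding E_odd_eq_qser higher_deriv_qser[OF poly_bounded_odd_coeff_neg assms] odd_coeff_pos
    by (simp add: power_mult_distrib mult_ac)
  thus ?thesis
    by (simp add: qser_const_mult[OF poly_bounded_odd_coeff_pos assms] E_odd_eq_qser)
qed

lemma E_odd_holomorphic: "E_odd (- int g) holomorphic_on upper_half_plane"
  unfolding E_odd_eq_qser by (rule qser_holomorphic[OF poly_bounded_odd_coeff_neg])

lemma norm_q_power_less_1:
  assumes "Im \<tau> > 0" "n > 0" shows "norm (exp (of_real pi * \<i> * \<tau>) ^ n) < 1"
  unfolding norm_power norm_q using assms by (intro power_less_one_iff[THEN iffD2]) auto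

lemma sin_eq_exp_minus: "sin z = - \<i> * (exp (\<i> * z) - exp (- (\<i> * z))) / 2"
  unfolding sin_exp_eq by (simp add: field_simps)

text \<open>For fixed odd \<open>d\<close> and \<open>w = q\<^sup>d\<close> the sum of \<open>w\<^sup>m\<close> over the odd \<open>m\<close> is \<open>w / (1 - w\<^sup>2) = i / (2 sin (\<pi> d \<tau>))\<close>.\<close>

lemma E_odd_sine_sums:
  assumes "Im \<tau> > 0"
  shows "(\<lambda>i. \<i> / (2 * (2 * of_nat i + 1) ^ Suc g * sin (of_real pi * (2 * of_nat i + 1) * \<tau>))) sums E_odd (- int g) \<tau>"
proof -
  define q where "q = exp (of_real pi * \<i> * \<tau>)"
  have q: "norm q < 1" "q \<noteq> 0" using norm_q_power_less_1[OF assms, of 1] by (auto simp: q_def)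
  let ?u = "\<lambda>d. if odd d then 1 / of_nat d ^ Suc g else 0 :: complex"
  let ?v = "\<lambda>m. if odd m then 1 else 0 :: complex"
  have rows: "(\<lambda>m. ?v (Suc m) * (q ^ d) ^ Suc m) sums (\<i> / (2 * sin (of_real pi * of_nat d * \<tau>)))"
    if d: "d > 0" for d
  proof -
    define w where "w = q ^ d"
    have w: "norm w < 1" "w \<noteq> 0" using norm_q_power_less_1[OF assms d] q by (auto simp: w_def q_def)
    have w2: "norm (w\<^sup>2) < 1" using w by (simp add: norm_power power_less_one_iff)
    hence "(\<lambda>i. (w\<^sup>2) ^ i * w) sums (1 / (1 - w\<^sup>2) * w)"
      by (intro sums_mult2 geometric_sums)
    hence "(\<lambda>i. ?v (Suc (2 * i)) * w ^ Suc (2 * i)) sums (w / (1 - w\<^sup>2))"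
      by (simp add: power_mult[symmetric] mult_ac)
    hence "(\<lambda>m. ?v (Suc m) * w ^ Suc m) sums (w / (1 - w\<^sup>2))"
      by (subst (asm) sums_mono_reindex[of "\<lambda>i. 2 * i"]) (auto simp: strict_mono_def elim!: evenE)
    moreover have "w / (1 - w\<^sup>2) = \<i> / (2 * sin (of_real pi * of_nat d * \<tau>))"
    proof -
      have w_eq: "exp (\<i> * (of_real pi * of_nat d * \<tau>)) = w"
        by (simp add: w_def q_def exp_of_nat_mult[symmetric] mult_ac)
      have "sin (of_real pi * of_nat d * \<tau>) = - \<i> * (w - 1 / w) / 2"
        unfolding sin_eq_exp_minus exp_minus w_eq inverse_eq_divide ..
      hence s: "2 * sin (of_real pi * of_nat d * \<tau>) = \<i> * (1 - w\<^sup>2) / w"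
        using w(2) by (simp add: field_simps power2_eq_square)
      show ?thesis unfolding s by simp
    qed
    ultimately show ?thesis by (simp add: w_def)
  qed
  have "(\<lambda>d. ?u (Suc d) * (\<i> / (2 * sin (of_real pi * of_nat (Suc d) * \<tau>)))) sums
      (\<Sum>N. dirichlet_conv ?u ?v N * q ^ N)"
    by (rule lambert_series[OF _ _ q(1) rows]) (use norm_inverse_power_le_1 in auto)
  also have "(\<Sum>N. dirichlet_conv ?u ?v N * q ^ N) = E_odd (- int g) \<tau>"
    unfolding E_odd_eq_qser qser_def odd_coeff_neg exp_qpow q_def ..
  finally have "(\<lambda>i. ?u (Suc (2 * i)) * (\<i> / (2 * sin (of_real pi * of_nat (Suc (2 * i)) * \<tau>)))) sums E_odd (- int g) \<tau>"
    by (subst sums_mono_reindex[of "\<lambda>i. 2 * i" "\<lambda>d. ?u (Suc d) * (\<i> / (2 * sin (of_real pi * of_nat (Suc d) * \<tau>)))"])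
       (auto simp: strict_mono_def elim!: evenE)
  thus ?thesis by (simp add: mult_ac add_ac)
qed

subsection \<open>The alternating tangent series\<close>

definition alt_zeta :: "nat \<Rightarrow> real" where
  "alt_zeta s = (\<Sum>n. (-1) ^ Suc n / real (Suc n) ^ s)"

lemma alt_zeta_sums:
  assumes "s > 0" shows "(\<lambda>n. (-1) ^ Suc n / real (Suc n) ^ s) sums alt_zeta s"
proof -
  have "summable (\<lambda>n. (-1) ^ n * (- (1 / real (Suc n) ^ s)))"
  proof (rule summable_Leibniz(1))
    have "(\<lambda>n. (1 / real (Suc n)) ^ s) \<longlonglongrightarrow> 0 ^ s"
      by (intro tendsto_power LIMSEQ_Suc lim_1_over_n)
    from tendsto_minus[OF this] show "(\<lambda>n. - (1 / real (Suc n) ^ s)) \<longlonglongrightarrow> 0"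
      using assms
      by (simp add: power_one_over zero_power del: of_nat_Suc)
    have "1 / real (Suc (Suc n)) ^ s \<le> 1 / real (Suc n) ^ s" for n
      by (intro divide_left_mono power_mono) auto
    thus "monoseq (\<lambda>n. - (1 / real (Suc n) ^ s))"
      by (intro mono_SucI1) auto
  qed
  thus ?thesis unfolding alt_zeta_def by (intro summable_sums) (simp add: field_simps)
qed

text \<open>The source of the logarithm in the defect of weight 2.\<close>

lemma alt_zeta_1: "alt_zeta 1 = - ln 2"
proof -
  have "(\<lambda>n. (-1) ^ Suc n / real (Suc n) ^ 1) sums (- ln 2)"
    using sums_minus[OF alternating_harmonic_series_sums] by simp
  thus ?thesis by (rule sums_unique2[OF alt_zeta_sums[OF zero_less_one]])
qed

definition tan_coeff :: "nat \<Rightarrow> nat \<Rightarrow> complex" where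
  "tan_coeff g = dirichlet_conv (\<lambda>n. (-1) ^ n / of_nat n ^ Suc g) (\<lambda>m. (-1) ^ m)"

lemma poly_bounded_tan_coeff: "poly_bounded (tan_coeff g)"
  unfolding tan_coeff_def
  by (rule dirichlet_conv_poly_bounded)
     (use norm_inverse_power_le_1 in \<open>auto simp: norm_divide norm_power norm_mult\<close>)

text \<open>With \<open>w = q\<^sup>n\<close> one has \<open>tan (\<pi> n \<tau> / 2) = i (1 - 2 w / (1 + w))\<close>: the constants \<open>i\<close> add up to the alternating
  zeta value, and the rest is a Lambert series.\<close>

lemma tan_series_sums:
  assumes "Im \<tau> > 0"
  shows "(\<lambda>n. (-1) ^ Suc n / of_nat (Suc n) ^ Suc g * tan (of_real pi * (of_nat (Suc n) * \<tau>) / 2)) sums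
      (\<i> * (of_real (alt_zeta (Suc g)) + 2 * qser (tan_coeff g) \<tau>))"
proof -
  define q where "q = exp (of_real pi * \<i> * \<tau>)"
  have q: "norm q < 1" "q \<noteq> 0" using norm_q_power_less_1[OF assms, of 1] by (auto simp: q_def)
  let ?u = "\<lambda>n. (-1) ^ n / of_nat n ^ Suc g :: complex"
  have rows: "(\<lambda>m. (-1) ^ Suc m * (q ^ d) ^ Suc m) sums (- (q ^ d) / (1 + q ^ d))" if d: "d > 0" for d
  proof -
    have "norm (- (q ^ d)) < 1" using norm_q_power_less_1[OF assms d] by (simp add: q_def)
    from sums_mult[OF geometric_sums[OF this], of "- (q ^ d)"]
    show ?thesis by (simp add: power_minus[of "q ^ d"] mult_ac)
  qed
  have "(\<lambda>d. ?u (Suc d) * (- (q ^ Suc d) / (1 + q ^ Suc d))) sums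
      (\<Sum>N. dirichlet_conv ?u (\<lambda>m. (-1) ^ m) N * q ^ N)"
    by (rule lambert_series[OF _ _ q(1) rows])
       (use norm_inverse_power_le_1 in \<open>auto simp: norm_divide norm_power norm_mult\<close>)
  also have "(\<Sum>N. dirichlet_conv ?u (\<lambda>m. (-1) ^ m) N * q ^ N) = qser (tan_coeff g) \<tau>"
    unfolding qser_def tan_coeff_def exp_qpow q_def ..
  finally have s1: "(\<lambda>d. ?u (Suc d) * (- (q ^ Suc d) / (1 + q ^ Suc d))) sums qser (tan_coeff g) \<tau>" .
  have "(\<lambda>n. complex_of_real ((-1) ^ Suc n / real (Suc n) ^ Suc g)) sums of_real (alt_zeta (Suc g))"
    by (intro sums_of_real alt_zeta_sums) simp
  hence s2: "(\<lambda>n. ?u (Suc n)) sums of_real (alt_zeta (Suc g))" by simp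
  have "(\<lambda>n. \<i> * (?u (Suc n) + 2 * (?u (Suc n) * (- (q ^ Suc n) / (1 + q ^ Suc n))))) sums
      (\<i> * (of_real (alt_zeta (Suc g)) + 2 * qser (tan_coeff g) \<tau>))"
    by (intro sums_mult sums_add s1 s2)
  also have "(\<lambda>n. \<i> * (?u (Suc n) + 2 * (?u (Suc n) * (- (q ^ Suc n) / (1 + q ^ Suc n))))) =
      (\<lambda>n. ?u (Suc n) * tan (of_real pi * (of_nat (Suc n) * \<tau>) / 2))"
  proof
    fix n
    define w where "w = q ^ Suc n"
    have w: "norm w < 1" using norm_q_power_less_1[OF assms, of "Suc n"] by (simp add: w_def q_def)
    hence w1: "1 + w \<noteq> 0" by (metis add_eq_0_iff less_irrefl norm_minus_cancel norm_one)
    define z where "z = of_real pi * (of_nat (Suc n) * \<tau>) / 2"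
    define e where "e = exp (\<i> * z)"
    have "2 * (\<i> * z) = of_nat (Suc n) * (of_real pi * \<i> * \<tau>)"
      by (simp add: z_def)
    hence e: "e \<noteq> 0" "e\<^sup>2 = w"
      unfolding e_def w_def q_def exp_double[symmetric] by (simp_all only: exp_of_nat_mult exp_not_eq_zero) simp
    have "sin z = - \<i> * (e - 1 / e) / 2" "cos z = (e + 1 / e) / 2"
      unfolding sin_eq_exp_minus cos_exp_eq exp_minus e_def[symmetric] inverse_eq_divide by simp_all
    hence sc: "sin z = - \<i> * (w - 1) / (2 * e)" "cos z = (w + 1) / (2 * e)"
      using e(1) by (simp_all add: e(2)[symmetric] field_simps power2_eq_square)
    have "tan z = - \<i> * (w - 1) / (w + 1)"
      unfolding tan_def sc using e(1) w1 by (simp add: add.commute)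
    also have "\<dots> = \<i> * (1 + 2 * (- w / (1 + w)))"
      using w1 by (simp add: field_simps)
    finally have tan: "tan z = \<i> * (1 + 2 * (- w / (1 + w)))" .
    have gen: "\<i> * (U + 2 * (U * X)) = U * (\<i> * (1 + 2 * X))" for U X
      by (simp add: algebra_simps)
    show "\<i> * (?u (Suc n) + 2 * (?u (Suc n) * (- (q ^ Suc n) / (1 + q ^ Suc n)))) = ?u (Suc n) * tan (of_real pi * (of_nat (Suc n) * \<tau>) / 2)"
      unfolding w_def[symmetric] z_def[symmetric] tan by (rule gen)
  qed
  finally show ?thesis .
qed

section \<open>The transformation under inversion\<close>

abbreviation cpoly :: "real poly \<Rightarrow> complex poly" where
  "cpoly \<equiv> map_poly of_real"

lemma cpoly_add: "cpoly (p + q) = cpoly p + cpoly q"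
  and cpoly_diff: "cpoly (p - q) = cpoly p - cpoly q"
  and cpoly_mult: "cpoly (p * q) = cpoly p * cpoly q"
  and cpoly_smult: "cpoly (smult c p) = smult (of_real c) (cpoly p)"
  by (simp_all add: poly_eq_iff coeff_map_poly coeff_mult)

lemma cpoly_sum: "cpoly (\<Sum>x\<in>A. f x) = (\<Sum>x\<in>A. cpoly (f x))"
  by (simp add: poly_eq_iff coeff_map_poly coeff_sum)

lemma cpoly_power: "cpoly (p ^ n) = cpoly p ^ n"
  by (induction n) (simp_all add: cpoly_mult)

definition odd_zeta :: "nat \<Rightarrow> real" where
  "odd_zeta s = (\<Sum>i. 1 / (2 * real i + 1) ^ s)"

lemma odd_zeta_sums:
  assumes "s \<ge> 2" shows "(\<lambda>i. 1 / (2 * real i + 1) ^ s) sums odd_zeta s"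
proof -
  have "summable (\<lambda>i. 1 / (2 * real i + 1) ^ s)"
  proof (rule summable_comparison_test')
    show "summable (\<lambda>i. inverse (real (Suc i) ^ 2))"
      by (subst summable_Suc_iff) (rule inverse_power_summable, simp)
    fix i :: nat
    have "real (Suc i) ^ 2 \<le> (2 * real i + 1) ^ 2" by (intro power_mono) auto
    also have "\<dots> \<le> (2 * real i + 1) ^ s" using assms by (intro power_increasing) auto
    finally show "norm (1 / (2 * real i + 1) ^ s) \<le> inverse (real (Suc i) ^ 2)"
      by (simp add: divide_simps)
  qed
  thus ?thesis unfolding odd_zeta_def by (rule summable_sums)
qed

lemma alt_zeta_pairs_sums:
  assumes "s > 0"
  shows "(\<lambda>j. 1 / (2 * real j + 2) ^ s - 1 / (2 * real j + 1) ^ s) sums alt_zeta s"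
proof -
  have "(\<lambda>j. \<Sum>n\<in>{j * 2..<j * 2 + 2}. (-1) ^ Suc n / real (Suc n) ^ s) sums alt_zeta s"
    by (rule sums_group[OF alt_zeta_sums[OF assms]]) simp
  also have "(\<lambda>j. \<Sum>n\<in>{j * 2..<j * 2 + 2}. (-1) ^ Suc n / real (Suc n) ^ s) =
      (\<lambda>j. 1 / (2 * real j + 2) ^ s - 1 / (2 * real j + 1) ^ s)"
  proof
    fix j :: nat
    have "{j * 2..<j * 2 + 2} = {2 * j, 2 * j + 1}" by auto
    thus "(\<Sum>n\<in>{j * 2..<j * 2 + 2}. (-1) ^ Suc n / real (Suc n) ^ s) =
        1 / (2 * real j + 2) ^ s - 1 / (2 * real j + 1) ^ s"
      by (simp add: add_ac)
  qed
  finally show ?thesis .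
qed

lemma summable_inverse_three_halves: "summable (\<lambda>i. 1 / sqrt (2 * real i + 1) ^ 3)"
proof (rule summable_comparison_test')
  show "summable (\<lambda>i. real (Suc i) powr (-3/2))"
    by (subst summable_Suc_iff) (simp add: summable_real_powr_iff)
  fix i :: nat
  have "real (Suc i) powr (3/2) \<le> (2 * real i + 1) powr (3/2)"
    by (intro powr_mono2) auto
  also have "\<dots> = sqrt (2 * real i + 1) ^ 3"
    by (simp add: powr_half_sqrt[symmetric] powr_realpow[symmetric] powr_powr)
  finally have "real (Suc i) powr (3/2) \<le> sqrt (2 * real i + 1) ^ 3" .
  hence "1 / sqrt (2 * real i + 1) ^ 3 \<le> 1 / real (Suc i) powr (3/2)"
    by (intro divide_left_mono) auto
  thus "norm (1 / sqrt (2 * real i + 1) ^ 3) \<le> real (Suc i) powr (-3/2)"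
    by (simp add: powr_minus_divide)
qed

text \<open>Repeated use of \<open>1 / (N (D - N T)) = T / (D (D - N T)) + 1 / (N D)\<close>.\<close>

lemma partial_fraction_powers:
  fixes N D T :: complex
  assumes "N \<noteq> 0" "D \<noteq> 0" "D - N * T \<noteq> 0"
  shows "1 / (D - N * T) / N ^ h = T ^ h / D ^ h * (1 / (D - N * T)) +
           (\<Sum>l<h. T ^ (h - 1 - l) / (N ^ Suc l * D ^ (h - l)))"
proof (induction h)
  case (Suc h)
  define V where "V = 1 / (D - N * T)"
  have V: "V / N = T * V / D + 1 / (N * D)"
    using assms unfolding V_def by (simp add: divide_simps)
  have "V / N ^ Suc h = (V / N ^ h) / N" by simp
  also have "\<dots> = T ^ h / D ^ h * (V / N) + (\<Sum>l<h. T ^ (h - 1 - l) / (N ^ Suc l * D ^ (h - l))) / N"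
    unfolding V_def[symmetric] Suc.IH[folded V_def] by (simp add: add_divide_distrib)
  also have "(\<Sum>l<h. T ^ (h - 1 - l) / (N ^ Suc l * D ^ (h - l))) / N =
      (\<Sum>l<h. T ^ (Suc h - 1 - Suc l) / (N ^ Suc (Suc l) * D ^ (Suc h - Suc l)))"
    by (simp add: sum_divide_distrib mult_ac)
  also have "T ^ h / D ^ h * (V / N) = T ^ Suc h / D ^ Suc h * V + T ^ h / (N * D ^ Suc h)"
    unfolding V by (simp add: algebra_simps)
  finally show ?case unfolding V_def[symmetric] by (subst sum.lessThan_Suc_shift) simp
qed simp

text \<open>A quantitative form of the linear independence of \<open>1\<close> and \<open>\<tau>\<close> over the real numbers.\<close>

lemma norm_real_plus_real_mult_ge:
  fixes d n :: real
  assumes "Im \<tau> > 0" "d \<ge> 0" "\<bar>n\<bar> = m"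
  shows "Im \<tau> / (Im \<tau> + norm \<tau> + 1) * (d + m) \<le> norm (of_real d + of_real n * \<tau>)"
proof -
  define z where "z = of_real d + of_real n * \<tau>"
  have 1: "m * Im \<tau> \<le> norm z"
    using abs_Im_le_cmod[of z] assms by (simp add: z_def abs_mult)
  have "d = norm (z - of_real n * \<tau>)" using assms(2) by (simp add: z_def)
  also have "\<dots> \<le> norm z + norm (of_real n * \<tau>)" by (rule norm_triangle_ineq4)
  also have "norm (of_real n * \<tau>) = m * norm \<tau>" using assms by (simp add: norm_mult)
  finally have "d \<le> norm z + m * norm \<tau>" .
  hence "d * Im \<tau> \<le> (norm z + m * norm \<tau>) * Im \<tau>"
    using assms by (intro mult_right_mono) auto
  also have "\<dots> = norm z * Im \<tau> + (m * Im \<tau>) * norm \<tau>" by (simp add: algebra_simps)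
  also have "\<dots> \<le> norm z * Im \<tau> + norm z * norm \<tau>"
    using 1 by (intro add_left_mono mult_right_mono) auto
  finally have "Im \<tau> * (d + m) \<le> norm z * (Im \<tau> + norm \<tau> + 1)"
    using 1 by (simp add: algebra_simps)
  moreover have "Im \<tau> + norm \<tau> + 1 > 0" using assms by (simp add: add_pos_nonneg)
  ultimately show ?thesis unfolding z_def[symmetric] by (simp add: field_simps)
qed

text \<open>The Fourier coefficients of \<open>\<tau>\<^sup>g E\<^bsub>-g\<^esub>(-1/\<tau>)\<close>, up to a polynomial of degree \<open>g + 1\<close>.\<close>

definition inversion_coeff :: "nat \<Rightarrow> nat \<Rightarrow> complex" where
  "inversion_coeff g n = (if n = 0 then of_real (alt_zeta (Suc g)) / 4 else tan_coeff g n / 2)"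

lemma tan_coeff_0 [simp]: "tan_coeff g 0 = 0"
  by (simp add: tan_coeff_def dirichlet_conv_def)

lemma poly_bounded_inversion_coeff: "poly_bounded (inversion_coeff g)"
proof -
  obtain C N where C: "C \<ge> 0" "\<And>n. norm (tan_coeff g n) \<le> C * (of_nat n + 1) ^ N"
    using poly_boundedE[OF poly_bounded_tan_coeff[of g]] by blast
  define C' where "C' = C + norm (inversion_coeff g 0)"
  have "norm (inversion_coeff g n) \<le> C' * (of_nat n + 1) ^ N" for n
  proof (cases "n = 0")
    case True
    thus ?thesis using C(1) by (simp add: C'_def)
  next
    case False
    have "norm (inversion_coeff g n) = norm (tan_coeff g n) / 2"
      using False by (simp add: inversion_coeff_def norm_divide)
    also have "\<dots> \<le> norm (tan_coeff g n)" by simp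
    also have "\<dots> \<le> C * (of_nat n + 1) ^ N" by (rule C(2))
    also have "\<dots> \<le> C' * (of_nat n + 1) ^ N" unfolding C'_def by (intro mult_right_mono) auto
    finally show ?thesis .
  qed
  thus ?thesis unfolding poly_bounded_def by blast
qed

lemma qser_inversion_coeff:
  assumes "Im \<tau> > 0"
  shows "qser (inversion_coeff g) \<tau> = (of_real (alt_zeta (Suc g)) + 2 * qser (tan_coeff g) \<tau>) / 4"
proof -
  have 1: "(\<lambda>n. if n = 0 then of_real (alt_zeta (Suc g)) / 4 else 0) sums (of_real (alt_zeta (Suc g)) / 4 :: complex)"
    using sums_If_finite_set[of "{0}" "\<lambda>_. of_real (alt_zeta (Suc g)) / 4 :: complex"] by simp
  have 2: "(\<lambda>n. tan_coeff g n * exp (of_real pi * \<i> * of_nat n * \<tau>) / 2) sums (qser (tan_coeff g) \<tau> / 2)"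
    by (intro sums_divide qser_sums poly_bounded_tan_coeff assms)
  have "(\<lambda>n. inversion_coeff g n * exp (of_real pi * \<i> * of_nat n * \<tau>)) =
     (\<lambda>n. (if n = 0 then of_real (alt_zeta (Suc g)) / 4 else 0) +
          tan_coeff g n * exp (of_real pi * \<i> * of_nat n * \<tau>) / 2)"
    by (auto simp: inversion_coeff_def fun_eq_iff)
  hence "qser (inversion_coeff g) \<tau> = of_real (alt_zeta (Suc g)) / 4 + qser (tan_coeff g) \<tau> / 2"
    using sums_unique[OF sums_add[OF 1 2]] by (simp add: qser_def)
  thus ?thesis by (simp add: add_divide_distrib)
qed

text \<open>Like the period polynomial of any Eisenstein series, its coefficients are products of two zeta values.\<close>

definition inversion_poly :: "nat \<Rightarrow> real poly" where
  "inversion_poly g = (\<Sum>l<g div 2.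
      monom (alt_zeta (2 * Suc l) * odd_zeta (2 * (g div 2 - l)) / pi) (Suc (2 * (g div 2 - 1 - l))))"

lemma inversion_poly_degree:
  assumes "even g"
  shows "inversion_poly g = 0 \<or> degree (inversion_poly g) < g"
proof (cases "g = 0")
  case False
  hence g: "g div 2 > 0" using assms by auto
  have "degree (inversion_poly g) \<le> g - 1"
    unfolding inversion_poly_def
  proof (rule degree_sum_le)
    fix l assume "l \<in> {..<g div 2}"
    hence "Suc (2 * (g div 2 - 1 - l)) \<le> g - 1" using g by auto
    thus "degree (monom (alt_zeta (2 * Suc l) * odd_zeta (2 * (g div 2 - l)) / pi) (Suc (2 * (g div 2 - 1 - l)))) \<le> g - 1"
      using degree_monom_le order_trans by blast
  qed simp
  hence "degree (inversion_poly g) < g" using False by linarith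
  thus ?thesis by simp
qed (simp add: inversion_poly_def)

text \<open>Expanding \<open>1/sin\<close> on the left and \<open>tan\<close> on the right into partial fractions turns both sides
  into the same double series over \<open>1 / (d\<^sup>2 - n\<^sup>2\<tau>\<^sup>2)\<close>, summed in the two possible orders; the powers
  \<open>d\<^bsup>-g\<^esup>\<close> and \<open>n\<^bsup>-g\<^esup>\<close> are exchanged by partial fractions, which produces the polynomial. The terms
  with \<open>n = 2j+1\<close> and \<open>n = 2j+2\<close> have to be taken together: for \<open>g = 0\<close> only the paired double series
  converges absolutely.\<close>

theorem E_odd_inversion:
  assumes g: "even g" and \<tau>: "Im \<tau> > 0"
  shows "\<tau> ^ g * E_odd (- int g) (- 1 / \<tau>) = qser (inversion_coeff g) \<tau>
      - \<i> * of_real (odd_zeta (g + 2) / (2 * pi)) * \<tau> ^ Suc g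
      + \<i> * poly (map_poly of_real (inversion_poly g)) \<tau>"
proof -
  define h where "h = g div 2"
  have gh: "g = 2 * h" using g by (simp add: h_def)
  define y \<rho> where "y = Im \<tau>" and "\<rho> = norm \<tau>"
  define c where "c = y / (y + \<rho> + 1)"
  have c: "c > 0" using \<tau> by (auto simp: c_def y_def \<rho>_def intro!: divide_pos_pos add_pos_nonneg)
  define d :: "nat \<Rightarrow> real" where "d = (\<lambda>i. 2 * real i + 1)"
  define D :: "nat \<Rightarrow> complex" where "D = (\<lambda>i. 2 * of_nat i + 1)"
  have D_d: "D i = of_real (d i)" for i by (simp add: D_def d_def)
  have d: "d i \<ge> 1" for i by (simp add: d_def)
  have D0: "D i \<noteq> 0" for i unfolding D_d of_real_eq_0_iff using d[of i] by simp
  define V where "V = (\<lambda>i (n::real). 1 / ((D i)\<^sup>2 - (of_real n)\<^sup>2 * \<tau>\<^sup>2))"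
  have \<tau>0: "\<tau> \<noteq> 0" using \<tau> by auto

  have den: "norm ((D i)\<^sup>2 - (of_real n)\<^sup>2 * \<tau>\<^sup>2) \<ge> (c * (d i + n))\<^sup>2" if "n \<ge> 0" for i n
  proof -
    have "(D i)\<^sup>2 - (of_real n)\<^sup>2 * \<tau>\<^sup>2 = (of_real (d i) + of_real n * \<tau>) * (of_real (d i) + of_real (- n) * \<tau>)"
      by (simp add: D_d algebra_simps power2_eq_square)
    hence "norm ((D i)\<^sup>2 - (of_real n)\<^sup>2 * \<tau>\<^sup>2) =
        norm (of_real (d i) + of_real n * \<tau>) * norm (of_real (d i) + of_real (- n) * \<tau>)"
      by (simp only: norm_mult)
    also have "\<dots> \<ge> (c * (d i + n)) * (c * (d i + n))"
      using that d[of i] c \<tau> unfolding c_def y_def \<rho>_def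
      by (intro mult_mono norm_real_plus_real_mult_ge) auto
    finally show ?thesis by (simp add: power2_eq_square)
  qed
  have den0: "(D i)\<^sup>2 - (of_real n)\<^sup>2 * \<tau>\<^sup>2 \<noteq> 0" if "n \<ge> 0" for i n
  proof -
    have "0 < (c * (d i + n))\<^sup>2" using c d[of i] that by (intro zero_less_power mult_pos_pos) auto
    thus ?thesis using den[OF that, of i] by auto
  qed
  have V_bound: "norm (V i n) \<le> 1 / (c\<^sup>2 * (d i + n)\<^sup>2)" if "n \<ge> 0" for i n
  proof -
    have "norm (V i n) = 1 / norm ((D i)\<^sup>2 - (of_real n)\<^sup>2 * \<tau>\<^sup>2)" by (simp add: V_def norm_divide)
    also have "\<dots> \<le> 1 / (c * (d i + n))\<^sup>2"
      using c d[of i] that den0[OF that, of i]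
      by (intro divide_left_mono den mult_pos_pos zero_less_power) auto
    finally show ?thesis by (simp add: power_mult_distrib)
  qed

  define F where "F = (\<lambda>i j. V i (2 * real j + 2) / (2 * of_nat j + 2) ^ g - V i (2 * real j + 1) / (2 * of_nat j + 1) ^ g)"
  \<comment> \<open>for \<open>g = 0\<close> a pair is \<open>O((d + n)\<^bsup>-3\<^esup>)\<close>, and \<open>(d + n)\<^bsup>-3\<^esup> \<le> d\<^bsup>-3/2\<^esup> n\<^bsup>-3/2\<^esup>\<close> separates the two indices\<close>
  define a where "a = (\<lambda>i. 1 / sqrt (2 * real i + 1) ^ 3)"
  define K where "K = 2 / c\<^sup>2 + 2 * \<rho>\<^sup>2 / c ^ 4"
  have a0: "a i \<ge> 0" for i by (simp add: a_def)
  have K0: "K \<ge> 0" using c by (simp add: K_def)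
  have F_bound: "norm (F i j) \<le> (K * a i) * a j" for i j
  proof (cases "g = 0")
    case True
    define n where "n = 2 * real j + 1"
    have n: "n \<ge> 1" by (simp add: n_def)
    define s where "s = d i + n"
    have s: "s \<ge> 1" using d[of i] n by (simp add: s_def)
    have nn: "2 * real j + 2 = n + 1" "2 * real j + 1 = n" by (simp_all add: n_def)
    have "F i j = V i (n + 1) - V i n" using True by (simp add: F_def nn)
    also have "\<dots> = \<tau>\<^sup>2 * of_real (2 * n + 1) * (V i (n + 1) * V i n)"
      using den0[of n i] den0[of "n + 1" i] n unfolding V_def
      by (simp add: divide_simps) (simp add: algebra_simps power2_eq_square)
    finally have Feq: "F i j = \<tau>\<^sup>2 * of_real (2 * n + 1) * (V i (n + 1) * V i n)" .
    have "norm (complex_of_real (2 * n + 1)) = 2 * n + 1"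
      unfolding norm_of_real using n by simp
    hence nF: "norm (F i j) = \<rho>\<^sup>2 * (2 * n + 1) * (norm (V i (n + 1)) * norm (V i n))"
      unfolding Feq by (simp only: norm_mult norm_power \<rho>_def)
    have b1: "norm (V i (n + 1)) \<le> 1 / (c\<^sup>2 * s\<^sup>2)"
    proof -
      have "norm (V i (n + 1)) \<le> 1 / (c\<^sup>2 * (d i + (n + 1))\<^sup>2)" by (rule V_bound) (use n in simp)
      also have "\<dots> \<le> 1 / (c\<^sup>2 * s\<^sup>2)"
        unfolding s_def using c d[of i] n
        by (intro divide_left_mono mult_left_mono power_mono mult_pos_pos zero_less_power) auto
      finally show ?thesis .
    qed
    have b2: "norm (V i n) \<le> 1 / (c\<^sup>2 * s\<^sup>2)" using V_bound[of n i] n by (simp add: s_def)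
    have b3: "2 * n + 1 \<le> 2 * s" using d[of i] by (simp add: s_def)
    have "norm (F i j) \<le> \<rho>\<^sup>2 * (2 * s) * (1 / (c\<^sup>2 * s\<^sup>2) * (1 / (c\<^sup>2 * s\<^sup>2)))"
      unfolding nF by (intro mult_mono b1 b2 b3 order_refl) (use n s in auto)
    also have "\<dots> = 2 * \<rho>\<^sup>2 / c ^ 4 * (1 / s ^ 3)"
      using s c by (simp add: field_simps power2_eq_square power3_eq_cube power4_eq_xxxx)
    also have "\<dots> \<le> K * (1 / s ^ 3)"
      using s c by (intro mult_right_mono) (auto simp: K_def)
    also have "\<dots> \<le> K * (a i * a j)"
    proof (rule mult_left_mono[OF _ K0])
      have "sqrt (d i) * sqrt n \<le> sqrt s * sqrt s"
        using d[of i] n by (intro mult_mono) (auto simp: s_def)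
      hence "(sqrt (d i) * sqrt n) ^ 3 \<le> s ^ 3"
        using s d[of i] n by (intro power_mono) auto
      hence "1 / s ^ 3 \<le> 1 / (sqrt (d i) * sqrt n) ^ 3"
        using s d[of i] n by (intro divide_left_mono) auto
      thus "1 / s ^ 3 \<le> a i * a j" unfolding a_def d_def n_def by (simp add: power_mult_distrib)
    qed
    finally show ?thesis by (simp add: mult_ac)
  next
    case False
    hence g2: "g \<ge> 2" using g by (auto elim!: evenE)
    define n where "n = 2 * real j + 1"
    have n: "n \<ge> 1" by (simp add: n_def)
    have Vm: "norm (V i m / of_real m ^ g) \<le> 1 / c\<^sup>2 * (a i * a j)" if "m \<ge> n" for m
    proof -
      have m: "m \<ge> 1" using that n by simp
      have "norm (V i m / of_real m ^ g) = norm (V i m) * (1 / m ^ g)"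
        using m by (simp add: norm_divide norm_power)
      also have "\<dots> \<le> 1 / (c\<^sup>2 * (d i)\<^sup>2) * (1 / n\<^sup>2)"
      proof (intro mult_mono)
        have "norm (V i m) \<le> 1 / (c\<^sup>2 * (d i + m)\<^sup>2)" by (rule V_bound) (use m in simp)
        also have "\<dots> \<le> 1 / (c\<^sup>2 * (d i)\<^sup>2)"
          using c d[of i] m
          by (intro divide_left_mono mult_left_mono power_mono mult_pos_pos zero_less_power) auto
        finally show "norm (V i m) \<le> 1 / (c\<^sup>2 * (d i)\<^sup>2)" .
        have "n\<^sup>2 \<le> m\<^sup>2" using that n by (intro power_mono) auto
        also have "\<dots> \<le> m ^ g" using m g2 by (intro power_increasing) auto
        finally show "1 / m ^ g \<le> 1 / n\<^sup>2" using n m by (intro divide_left_mono) auto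
      qed (use m in auto)
      also have "\<dots> = 1 / c\<^sup>2 * (1 / (d i)\<^sup>2 * (1 / n\<^sup>2))" by simp
      also have "\<dots> \<le> 1 / c\<^sup>2 * (a i * a j)"
      proof -
        have sq: "1 / x\<^sup>2 \<le> 1 / sqrt x ^ 3" if "x \<ge> 1" for x :: real
        proof -
          have "sqrt x ^ 3 \<le> sqrt x ^ 4" using that by (intro power_increasing) auto
          also have "sqrt x ^ 4 = (sqrt x ^ 2) ^ 2" by (simp only: power_mult[symmetric]) simp
          also have "\<dots> = x\<^sup>2" using that by simp
          finally show ?thesis using that by (intro divide_left_mono) auto
        qed
        have "1 / (d i)\<^sup>2 \<le> a i" "1 / n\<^sup>2 \<le> a j"
          using sq[OF d[of i]] sq[OF n] by (simp_all add: a_def d_def n_def)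
        thus ?thesis using c by (intro mult_left_mono mult_mono) (auto simp: a_def)
      qed
      finally show ?thesis .
    qed
    have "norm (F i j) \<le> norm (V i (2 * real j + 2) / of_real (2 * real j + 2) ^ g) + norm (V i n / of_real n ^ g)"
      unfolding F_def n_def using norm_triangle_ineq4 by (simp add: norm_triangle_ineq4)
    also have "\<dots> \<le> 1 / c\<^sup>2 * (a i * a j) + 1 / c\<^sup>2 * (a i * a j)"
      by (intro add_mono Vm) (auto simp: n_def)
    also have "\<dots> = 2 / c\<^sup>2 * (a i * a j)" by simp
    also have "\<dots> \<le> K * (a i * a j)"
      using a0 c by (intro mult_right_mono) (auto simp: K_def)
    finally show ?thesis by (simp add: mult_ac)
  qed

  define X where "X = (\<lambda>i. \<Sum>j. V i (2 * real j + 2) - V i (2 * real j + 1))"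
  have w: "- D i / \<tau> \<notin> \<int>" for i
  proof
    assume "- D i / \<tau> \<in> \<int>"
    then obtain k where "- D i / \<tau> = of_int k" by (rule Ints_cases)
    hence e: "- D i = of_int k * \<tau>" using \<tau>0 by (simp add: field_simps)
    have "Im (of_int k * \<tau>) = Im (- D i)" by (simp only: e)
    hence "k = 0" using \<tau> by (simp add: D_def)
    thus False using e D0[of i] by simp
  qed
  have X: "(\<lambda>j. V i (2 * real j + 2) - V i (2 * real j + 1)) sums X i"
    and X_sin: "of_real pi / sin (of_real pi * D i * (- 1 / \<tau>)) = - 2 * D i * \<tau> * X i - \<tau> / D i" for i
  proof -
    have tr: "2 * (- D i / \<tau>) / ((- D i / \<tau>)\<^sup>2 - (of_real n)\<^sup>2) = - 2 * D i * \<tau> * V i n" for n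
    proof -
      have "(- D i / \<tau>)\<^sup>2 - (of_real n)\<^sup>2 = ((D i)\<^sup>2 - (of_real n)\<^sup>2 * \<tau>\<^sup>2) / \<tau>\<^sup>2"
        using \<tau>0 by (simp add: power_divide diff_divide_distrib)
      thus ?thesis using \<tau>0 by (simp add: V_def power2_eq_square)
    qed
    have "(\<lambda>j. 2 * (- D i / \<tau>) / ((- D i / \<tau>)\<^sup>2 - (of_real (2 * real j + 2))\<^sup>2) -
               2 * (- D i / \<tau>) / ((- D i / \<tau>)\<^sup>2 - (of_real (2 * real j + 1))\<^sup>2)) sums
       (of_real pi / sin (of_real pi * (- D i / \<tau>)) - 1 / (- D i / \<tau>))"
      using cosecant_sums[OF w[of i]] by simp
    hence s: "(\<lambda>j. - 2 * D i * \<tau> * (V i (2 * real j + 2) - V i (2 * real j + 1))) sums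
       (of_real pi / sin (of_real pi * (- D i / \<tau>)) - 1 / (- D i / \<tau>))"
      unfolding tr by (simp add: algebra_simps)
    from sums_mult[OF s, of "1 / (- 2 * D i * \<tau>)"]
    have "(\<lambda>j. V i (2 * real j + 2) - V i (2 * real j + 1)) sums
       (1 / (- 2 * D i * \<tau>) * (of_real pi / sin (of_real pi * (- D i / \<tau>)) - 1 / (- D i / \<tau>)))"
      using D0[of i] \<tau>0 by (simp add: mult.assoc[symmetric])
    thus X: "(\<lambda>j. V i (2 * real j + 2) - V i (2 * real j + 1)) sums X i"
      unfolding X_def using sums_summable summable_sums by blast
    have "- 2 * D i * \<tau> * X i = of_real pi / sin (of_real pi * (- D i / \<tau>)) - 1 / (- D i / \<tau>)"
      by (rule sums_unique2[OF sums_mult[OF X] s])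
    moreover have "of_real pi * D i * (- 1 / \<tau>) = of_real pi * (- D i / \<tau>)" by simp
    ultimately show "of_real pi / sin (of_real pi * D i * (- 1 / \<tau>)) = - 2 * D i * \<tau> * X i - \<tau> / D i"
      by (simp only:) simp
  qed

  define r where "r = (\<lambda>i. \<tau> ^ g / D i ^ g * X i +
      (\<Sum>l<h. \<tau> ^ (2 * (h - 1 - l)) / D i ^ (2 * (h - l)) * of_real (alt_zeta (2 * Suc l))))"
  have rows: "(\<lambda>j. F i j) sums r i" for i
  proof -
    have pf: "V i n / of_real n ^ g = \<tau> ^ g / D i ^ g * V i n +
        (\<Sum>l<h. \<tau> ^ (2 * (h - 1 - l)) / D i ^ (2 * (h - l)) * of_real (1 / n ^ (2 * Suc l)))"
      if "n > 0" for n
    proof -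
      have Vi: "1 / ((D i)\<^sup>2 - (of_real n)\<^sup>2 * \<tau>\<^sup>2) = V i n" by (simp add: V_def)
      have "1 / ((D i)\<^sup>2 - (of_real n)\<^sup>2 * \<tau>\<^sup>2) / ((of_real n)\<^sup>2) ^ h =
         (\<tau>\<^sup>2) ^ h / ((D i)\<^sup>2) ^ h * (1 / ((D i)\<^sup>2 - (of_real n)\<^sup>2 * \<tau>\<^sup>2)) +
         (\<Sum>l<h. (\<tau>\<^sup>2) ^ (h - 1 - l) / (((of_real n)\<^sup>2) ^ Suc l * ((D i)\<^sup>2) ^ (h - l)))"
        by (rule partial_fraction_powers) (use D0 that den0[of n i] in auto)
      thus ?thesis unfolding Vi power_mult[symmetric] gh by (simp add: mult_ac)
    qed
    have "(\<lambda>j. \<tau> ^ g / D i ^ g * (V i (2 * real j + 2) - V i (2 * real j + 1)) +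
        (\<Sum>l<h. \<tau> ^ (2 * (h - 1 - l)) / D i ^ (2 * (h - l)) *
             of_real (1 / (2 * real j + 2) ^ (2 * Suc l) - 1 / (2 * real j + 1) ^ (2 * Suc l)))) sums r i"
      unfolding r_def by (intro sums_add sums_mult X sums_sum sums_of_real alt_zeta_pairs_sums) auto
    also have "(\<lambda>j. \<tau> ^ g / D i ^ g * (V i (2 * real j + 2) - V i (2 * real j + 1)) +
        (\<Sum>l<h. \<tau> ^ (2 * (h - 1 - l)) / D i ^ (2 * (h - l)) *
             of_real (1 / (2 * real j + 2) ^ (2 * Suc l) - 1 / (2 * real j + 1) ^ (2 * Suc l)))) = (\<lambda>j. F i j)"
    proof
      fix j :: nat
      have "F i j = V i (2 * real j + 2) / of_real (2 * real j + 2) ^ g - V i (2 * real j + 1) / of_real (2 * real j + 1) ^ g"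
        by (simp add: F_def)
      also have "\<dots> = \<tau> ^ g / D i ^ g * (V i (2 * real j + 2) - V i (2 * real j + 1)) +
        (\<Sum>l<h. \<tau> ^ (2 * (h - 1 - l)) / D i ^ (2 * (h - l)) *
             of_real (1 / (2 * real j + 2) ^ (2 * Suc l) - 1 / (2 * real j + 1) ^ (2 * Suc l)))"
        unfolding of_real_diff right_diff_distrib sum_subtractf
        by (subst (1 2) pf) (simp_all add: add_pos_nonneg del: of_real_divide of_real_power)
      finally show "\<tau> ^ g / D i ^ g * (V i (2 * real j + 2) - V i (2 * real j + 1)) +
        (\<Sum>l<h. \<tau> ^ (2 * (h - 1 - l)) / D i ^ (2 * (h - l)) *
             of_real (1 / (2 * real j + 2) ^ (2 * Suc l) - 1 / (2 * real j + 1) ^ (2 * Suc l))) = F i j"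
        by (rule sym)
    qed
    finally show ?thesis .
  qed

  define C where "C = (\<lambda>n. of_real pi / (4 * \<tau>) * (1 / of_nat n ^ Suc g * tan (of_real pi * (of_nat n * \<tau>) / 2)))"
  have cols: "(\<lambda>i. F i j) sums (C (Suc (2 * j + 1)) - C (Suc (2 * j)))" for j
  proof -
    have *: "(\<lambda>i. V i (real n) / of_nat n ^ g) sums C n" if "n > 0" for n
    proof -
      have nz: "(1 - of_nat n * \<tau>) / 2 \<notin> \<int>"
      proof
        assume "(1 - of_nat n * \<tau>) / 2 \<in> \<int>"
        then obtain k where "(1 - of_nat n * \<tau>) / 2 = of_int k" by (rule Ints_cases)
        hence "Im ((1 - of_nat n * \<tau>) / 2) = 0" by simp
        thus False using that \<tau> by simp
      qed
      have "(\<lambda>i. 1 / (4 * (of_nat n * \<tau>)) * (4 * (of_nat n * \<tau>) / ((2 * of_nat i + 1)\<^sup>2 - (of_nat n * \<tau>)\<^sup>2)) / of_nat n ^ g) sums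
          (1 / (4 * (of_nat n * \<tau>)) * (of_real pi * tan (of_real pi * (of_nat n * \<tau>) / 2)) / of_nat n ^ g)"
        by (intro sums_mult sums_divide tan_sums nz)
      also have "(\<lambda>i. 1 / (4 * (of_nat n * \<tau>)) * (4 * (of_nat n * \<tau>) / ((2 * of_nat i + 1)\<^sup>2 - (of_nat n * \<tau>)\<^sup>2)) / of_nat n ^ g) =
          (\<lambda>i. V i (real n) / of_nat n ^ g)"
        using that \<tau>0 by (simp add: V_def D_def power_mult_distrib)
      also have "1 / (4 * (of_nat n * \<tau>)) * (of_real pi * tan (of_real pi * (of_nat n * \<tau>) / 2)) / of_nat n ^ g = C n"
        by (simp add: C_def)
      finally show ?thesis .
    qed
    from sums_diff[OF *[of "Suc (2 * j + 1)"] *[of "Suc (2 * j)"]] show ?thesis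
      by (simp add: F_def add_ac)
  qed
  have C_sums: "(\<lambda>j. C (Suc (2 * j + 1)) - C (Suc (2 * j))) sums
      (of_real pi / (4 * \<tau>) * (\<i> * (of_real (alt_zeta (Suc g)) + 2 * qser (tan_coeff g) \<tau>)))"
  proof -
    have "(\<lambda>n. of_real pi / (4 * \<tau>) * ((-1) ^ Suc n / of_nat (Suc n) ^ Suc g * tan (of_real pi * (of_nat (Suc n) * \<tau>) / 2)))
        sums (of_real pi / (4 * \<tau>) * (\<i> * (of_real (alt_zeta (Suc g)) + 2 * qser (tan_coeff g) \<tau>)))"
      by (intro sums_mult tan_series_sums \<tau>)
    hence "(\<lambda>n. (-1) ^ Suc n * C (Suc n)) sums
        (of_real pi / (4 * \<tau>) * (\<i> * (of_real (alt_zeta (Suc g)) + 2 * qser (tan_coeff g) \<tau>)))"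
      by (simp add: C_def mult_ac)
    from sums_group[OF this, of 2]
    have "(\<lambda>j. \<Sum>n\<in>{j * 2..<j * 2 + 2}. (-1) ^ Suc n * C (Suc n)) sums
        (of_real pi / (4 * \<tau>) * (\<i> * (of_real (alt_zeta (Suc g)) + 2 * qser (tan_coeff g) \<tau>)))" by simp
    also have "(\<lambda>j. \<Sum>n\<in>{j * 2..<j * 2 + 2}. (-1) ^ Suc n * C (Suc n)) = (\<lambda>j. C (Suc (2 * j + 1)) - C (Suc (2 * j)))"
    proof
      fix j :: nat
      have "{j * 2..<j * 2 + 2} = {2 * j, 2 * j + 1}" by auto
      thus "(\<Sum>n\<in>{j * 2..<j * 2 + 2}. (-1) ^ Suc n * C (Suc n)) = C (Suc (2 * j + 1)) - C (Suc (2 * j))"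
        by simp
    qed
    finally show ?thesis .
  qed
  obtain S where S: "r sums S" "(\<lambda>j. C (Suc (2 * j + 1)) - C (Suc (2 * j))) sums S"
  proof (rule double_series_swap[OF _ _ F_bound rows cols])
    show "summable (\<lambda>i. K * a i)" "summable a"
      unfolding a_def by (intro summable_mult summable_inverse_three_halves)+
  qed (use a0 K0 in auto)
  have S_eq: "S = of_real pi / (4 * \<tau>) * (4 * \<i> * qser (inversion_coeff g) \<tau>)"
    using sums_unique2[OF S(2) C_sums] by (simp add: qser_inversion_coeff[OF \<tau>])

  have "(\<lambda>i. \<tau> ^ g * (\<i> / (2 * (2 * of_nat i + 1) ^ Suc g * sin (of_real pi * (2 * of_nat i + 1) * (- 1 / \<tau>))))) sums
     (\<tau> ^ g * E_odd (- int g) (- 1 / \<tau>))"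
  proof (intro sums_mult E_odd_sine_sums)
    have "Im (- 1 / \<tau>) = Im \<tau> / (norm \<tau>)\<^sup>2" by (simp add: Im_divide cmod_power2)
    thus "Im (- 1 / \<tau>) > 0" using \<tau> \<tau>0 by simp
  qed
  also have "(\<lambda>i. \<tau> ^ g * (\<i> / (2 * (2 * of_nat i + 1) ^ Suc g * sin (of_real pi * (2 * of_nat i + 1) * (- 1 / \<tau>))))) =
     (\<lambda>i. - (\<i> * \<tau> / of_real pi) * (r i -
        (\<Sum>l<h. \<tau> ^ (2 * (h - 1 - l)) * of_real (alt_zeta (2 * Suc l)) * of_real (1 / (2 * real i + 1) ^ (2 * (h - l)))))
      - \<i> * \<tau> ^ Suc g / (2 * of_real pi) * of_real (1 / (2 * real i + 1) ^ (g + 2)))"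
  proof
    fix i
    have Di: "of_real (1 / (2 * real i + 1) ^ m) = 1 / D i ^ m" for m by (simp add: D_def)
    have "(2 * of_nat i + 1) = D i" by (simp add: D_def)
    hence "\<tau> ^ g * (\<i> / (2 * (2 * of_nat i + 1) ^ Suc g * sin (of_real pi * (2 * of_nat i + 1) * (- 1 / \<tau>)))) =
       \<tau> ^ g * \<i> / (2 * of_real pi * D i ^ Suc g) * (of_real pi / sin (of_real pi * D i * (- 1 / \<tau>)))"
      by (simp only:) simp
    also have "\<dots> = - (\<i> * \<tau> / of_real pi) * (\<tau> ^ g / D i ^ g * X i) - \<i> * \<tau> ^ Suc g / (2 * of_real pi) * (1 / D i ^ (g + 2))"
      unfolding X_sin using D0[of i] by (simp add: field_simps)
    also have "\<tau> ^ g / D i ^ g * X i = r i -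
        (\<Sum>l<h. \<tau> ^ (2 * (h - 1 - l)) * of_real (alt_zeta (2 * Suc l)) * of_real (1 / (2 * real i + 1) ^ (2 * (h - l))))"
      unfolding Di by (simp add: r_def mult_ac)
    finally show "\<tau> ^ g * (\<i> / (2 * (2 * of_nat i + 1) ^ Suc g * sin (of_real pi * (2 * of_nat i + 1) * (- 1 / \<tau>)))) =
       - (\<i> * \<tau> / of_real pi) * (r i -
        (\<Sum>l<h. \<tau> ^ (2 * (h - 1 - l)) * of_real (alt_zeta (2 * Suc l)) * of_real (1 / (2 * real i + 1) ^ (2 * (h - l)))))
      - \<i> * \<tau> ^ Suc g / (2 * of_real pi) * of_real (1 / (2 * real i + 1) ^ (g + 2))"
      unfolding Di .
  qed
  finally have s1: "(\<lambda>i. - (\<i> * \<tau> / of_real pi) * (r i -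
        (\<Sum>l<h. \<tau> ^ (2 * (h - 1 - l)) * of_real (alt_zeta (2 * Suc l)) * of_real (1 / (2 * real i + 1) ^ (2 * (h - l)))))
      - \<i> * \<tau> ^ Suc g / (2 * of_real pi) * of_real (1 / (2 * real i + 1) ^ (g + 2))) sums
     (\<tau> ^ g * E_odd (- int g) (- 1 / \<tau>))" .
  have "(\<lambda>i. - (\<i> * \<tau> / of_real pi) * (r i -
        (\<Sum>l<h. \<tau> ^ (2 * (h - 1 - l)) * of_real (alt_zeta (2 * Suc l)) * of_real (1 / (2 * real i + 1) ^ (2 * (h - l)))))
      - \<i> * \<tau> ^ Suc g / (2 * of_real pi) * of_real (1 / (2 * real i + 1) ^ (g + 2))) sums
     (- (\<i> * \<tau> / of_real pi) * (S -
        (\<Sum>l<h. \<tau> ^ (2 * (h - 1 - l)) * of_real (alt_zeta (2 * Suc l)) * of_real (odd_zeta (2 * (h - l)))))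
      - \<i> * \<tau> ^ Suc g / (2 * of_real pi) * of_real (odd_zeta (g + 2)))"
    by (intro sums_diff sums_mult S(1) sums_sum sums_of_real odd_zeta_sums) auto
  from sums_unique2[OF s1 this]
  have "\<tau> ^ g * E_odd (- int g) (- 1 / \<tau>) =
     - (\<i> * \<tau> / of_real pi) * (S -
        (\<Sum>l<h. \<tau> ^ (2 * (h - 1 - l)) * of_real (alt_zeta (2 * Suc l)) * of_real (odd_zeta (2 * (h - l)))))
      - \<i> * \<tau> ^ Suc g / (2 * of_real pi) * of_real (odd_zeta (g + 2))" .
  also have "\<dots> = - (\<i> * \<tau> / of_real pi) * S - \<i> * of_real (odd_zeta (g + 2) / (2 * pi)) * \<tau> ^ Suc g +
      \<i> * (\<tau> / of_real pi *
        (\<Sum>l<h. \<tau> ^ (2 * (h - 1 - l)) * of_real (alt_zeta (2 * Suc l)) * of_real (odd_zeta (2 * (h - l)))))"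
    by (simp add: right_diff_distrib mult_ac)
  also have "- (\<i> * \<tau> / of_real pi) * S = qser (inversion_coeff g) \<tau>"
    unfolding S_eq using \<tau>0 by simp
  also have "\<tau> / of_real pi *
        (\<Sum>l<h. \<tau> ^ (2 * (h - 1 - l)) * of_real (alt_zeta (2 * Suc l)) * of_real (odd_zeta (2 * (h - l)))) =
      poly (map_poly of_real (inversion_poly g)) \<tau>"
    unfolding inversion_poly_def h_def[symmetric] cpoly_sum poly_sum sum_distrib_left
    by (intro sum.cong) (simp_all add: map_poly_monom poly_monom mult_ac)
  finally show ?thesis .
qed

section \<open>Modularity up to polynomials\<close>

lemma moebius_denom_nonzero:
  fixes c d :: int
  assumes "Im \<tau> > 0" "c \<noteq> 0 \<or> d \<noteq> 0"
  shows "of_int c * \<tau> + of_int d \<noteq> 0"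
proof
  assume e: "of_int c * \<tau> + of_int d = 0"
  hence "Im (of_int c * \<tau> + of_int d) = 0" by simp
  hence "c = 0" using assms by simp
  thus False using e assms by simp
qed

lemma Im_moebius:
  fixes a b c d :: int
  assumes "a * d - b * c = 1" "Im \<tau> > 0"
  shows "Im ((of_int a * \<tau> + of_int b) / (of_int c * \<tau> + of_int d)) = Im \<tau> / (norm (of_int c * \<tau> + of_int d))\<^sup>2"
    and "Im ((of_int a * \<tau> + of_int b) / (of_int c * \<tau> + of_int d)) > 0"
proof -
  have nz: "of_int c * \<tau> + of_int d \<noteq> 0"
    by (rule moebius_denom_nonzero[OF assms(2)]) (use assms(1) in auto)
  have "Im ((of_int a * \<tau> + of_int b) / (of_int c * \<tau> + of_int d)) =
      (of_int (a * d - b * c) * Im \<tau>) / (norm (of_int c * \<tau> + of_int d))\<^sup>2"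
    unfolding Im_complex_div_eq_0 Im_divide cmod_power2 by (simp add: algebra_simps)
  thus *: "Im ((of_int a * \<tau> + of_int b) / (of_int c * \<tau> + of_int d)) = Im \<tau> / (norm (of_int c * \<tau> + of_int d))\<^sup>2"
    using assms(1) by simp
  show "Im ((of_int a * \<tau> + of_int b) / (of_int c * \<tau> + of_int d)) > 0"
    unfolding * using assms(2) nz by simp
qed

text \<open>\<open>slash_rel g a b c d \<psi> \<phi>\<close>: the weight \<open>-g\<close> action of the matrix on \<open>\<psi>\<close> gives \<open>\<phi>\<close> up to \<open>i\<close> times a real
  polynomial of degree at most \<open>g\<close>. Both conditions on the polynomial matter: polynomials of degree
  at most \<open>g\<close> are what a \<open>(g+1)\<close>-fold derivative kills, and the reality determines the real parts of the
  values at the cusps.\<close>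

definition slash_rel :: "nat \<Rightarrow> int \<Rightarrow> int \<Rightarrow> int \<Rightarrow> int \<Rightarrow> (complex \<Rightarrow> complex) \<Rightarrow> (complex \<Rightarrow> complex) \<Rightarrow> bool" where
  "slash_rel g a b c d \<psi> \<phi> \<longleftrightarrow> (\<exists>R. degree R \<le> g \<and> (\<forall>\<tau>. Im \<tau> > 0 \<longrightarrow>
     (of_int c * \<tau> + of_int d) ^ g * \<psi> ((of_int a * \<tau> + of_int b) / (of_int c * \<tau> + of_int d)) =
     \<phi> \<tau> + \<i> * poly (cpoly R) \<tau>))"

lemma slash_relI:
  assumes "degree R \<le> g" "\<And>\<tau>. Im \<tau> > 0 \<Longrightarrow>
     (of_int c * \<tau> + of_int d) ^ g * \<psi> ((of_int a * \<tau> + of_int b) / (of_int c * \<tau> + of_int d)) =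
     \<phi> \<tau> + \<i> * poly (cpoly R) \<tau>"
  shows "slash_rel g a b c d \<psi> \<phi>"
  using assms unfolding slash_rel_def by blast

lemma slash_relE:
  assumes "slash_rel g a b c d \<psi> \<phi>"
  obtains R where "degree R \<le> g" "\<And>\<tau>. Im \<tau> > 0 \<Longrightarrow>
     (of_int c * \<tau> + of_int d) ^ g * \<psi> ((of_int a * \<tau> + of_int b) / (of_int c * \<tau> + of_int d)) =
     \<phi> \<tau> + \<i> * poly (cpoly R) \<tau>"
  using assms unfolding slash_rel_def by blast

definition poly_slash :: "nat \<Rightarrow> int \<Rightarrow> int \<Rightarrow> int \<Rightarrow> int \<Rightarrow> real poly \<Rightarrow> real poly" where
  "poly_slash g a b c d R = (\<Sum>k\<le>g. smult (coeff R k) ([:of_int b, of_int a:] ^ k * [:of_int d, of_int c:] ^ (g - k)))"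

lemma degree_poly_slash: "degree (poly_slash g a b c d R) \<le> g"
  unfolding poly_slash_def
proof (rule degree_sum_le)
  fix k assume k: "k \<in> {..g}"
  have lin: "degree ([:u, v:] ^ n) \<le> n" for u v :: real and n
    by (rule order_trans[OF degree_power_le]) (simp add: degree_pCons_le)
  have "degree ([:of_int b, of_int a:] ^ k * [:of_int d, of_int c:] ^ (g - k) :: real poly) \<le> k + (g - k)"
    by (rule order_trans[OF degree_mult_le]) (intro add_mono lin)
  thus "degree (smult (coeff R k) ([:of_int b, of_int a:] ^ k * [:of_int d, of_int c:] ^ (g - k))) \<le> g"
    using k order_trans[OF degree_smult_le] by force
qed simp

lemma poly_poly_slash:
  assumes "degree R \<le> g" "of_int c * \<tau> + of_int d \<noteq> 0"
  shows "poly (cpoly (poly_slash g a b c d R)) \<tau> =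
     (of_int c * \<tau> + of_int d) ^ g * poly (cpoly R) ((of_int a * \<tau> + of_int b) / (of_int c * \<tau> + of_int d))"
proof -
  define J where "J = of_int c * \<tau> + of_int d"
  have R: "poly (cpoly R) z = (\<Sum>k\<le>g. of_real (coeff R k) * z ^ k)" for z
  proof -
    have "poly (cpoly R) z = (\<Sum>k\<le>degree R. of_real (coeff R k) * z ^ k)"
      by (simp add: poly_altdef degree_map_poly coeff_map_poly)
    also have "\<dots> = (\<Sum>k\<le>g. of_real (coeff R k) * z ^ k)"
      by (rule sum.mono_neutral_left) (use assms(1) in \<open>auto simp: coeff_eq_0\<close>)
    finally show ?thesis .
  qed
  have lin: "cpoly [:u, v:] = [:of_real u, of_real v:]" for u v
    by (simp add: map_poly_pCons)
  have "poly (cpoly (poly_slash g a b c d R)) \<tau> =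
     (\<Sum>k\<le>g. of_real (coeff R k) * ((of_int a * \<tau> + of_int b) ^ k * J ^ (g - k)))"
    unfolding poly_slash_def cpoly_sum cpoly_smult cpoly_mult cpoly_power lin poly_sum J_def
    by (simp add: mult_ac add_ac)
  also have "\<dots> = (\<Sum>k\<le>g. J ^ g * (of_real (coeff R k) * ((of_int a * \<tau> + of_int b) / J) ^ k))"
  proof (rule sum.cong)
    fix k assume "k \<in> {..g}"
    hence "J ^ g = J ^ k * J ^ (g - k)" by (simp flip: power_add)
    thus "of_real (coeff R k) * ((of_int a * \<tau> + of_int b) ^ k * J ^ (g - k)) =
        J ^ g * (of_real (coeff R k) * ((of_int a * \<tau> + of_int b) / J) ^ k)"
      using assms(2) by (simp add: power_divide J_def[symmetric])
  qed simp
  also have "\<dots> = J ^ g * poly (cpoly R) ((of_int a * \<tau> + of_int b) / J)"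
    unfolding R by (simp add: sum_distrib_left)
  finally show ?thesis unfolding J_def .
qed

lemma moebius_compose:
  fixes a b c d a' b' c' d' :: int
  assumes "of_int c' * \<tau> + of_int d' \<noteq> (0::complex)"
  shows "of_int c * ((of_int a' * \<tau> + of_int b') / (of_int c' * \<tau> + of_int d')) + of_int d =
           (of_int (c * a' + d * c') * \<tau> + of_int (c * b' + d * d')) / (of_int c' * \<tau> + of_int d')"
  using assms by (simp add: field_simps)

lemma cpoly_minus: "cpoly (- p) = - cpoly p"
  by (simp add: poly_eq_iff coeff_map_poly)

lemma slash_rel_compose:
  assumes 1: "slash_rel g a b c d \<psi> \<phi>" and 2: "slash_rel g a' b' c' d' \<phi> \<omega>"
    and det: "a * d - b * c = 1" "a' * d' - b' * c' = 1"
  shows "slash_rel g (a * a' + b * c') (a * b' + b * d') (c * a' + d * c') (c * b' + d * d') \<psi> \<omega>"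
proof -
  obtain R where R: "degree R \<le> g" "\<And>\<tau>. Im \<tau> > 0 \<Longrightarrow>
     (of_int c * \<tau> + of_int d) ^ g * \<psi> ((of_int a * \<tau> + of_int b) / (of_int c * \<tau> + of_int d)) =
     \<phi> \<tau> + \<i> * poly (cpoly R) \<tau>" using slash_relE[OF 1] by blast
  obtain R' where R': "degree R' \<le> g" "\<And>\<tau>. Im \<tau> > 0 \<Longrightarrow>
     (of_int c' * \<tau> + of_int d') ^ g * \<phi> ((of_int a' * \<tau> + of_int b') / (of_int c' * \<tau> + of_int d')) =
     \<omega> \<tau> + \<i> * poly (cpoly R') \<tau>" using slash_relE[OF 2] by blast
  show ?thesis
  proof (rule slash_relI[where R = "R' + poly_slash g a' b' c' d' R"])
    show "degree (R' + poly_slash g a' b' c' d' R) \<le> g"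
      using R'(1) degree_poly_slash by (rule degree_add_le)
    fix \<tau> :: complex assume \<tau>: "Im \<tau> > 0"
    define J' where "J' = of_int c' * \<tau> + of_int d'"
    have J': "J' \<noteq> 0" unfolding J'_def by (rule moebius_denom_nonzero[OF \<tau>]) (use det in auto)
    define \<sigma> where "\<sigma> = (of_int a' * \<tau> + of_int b') / J'"
    have \<sigma>: "Im \<sigma> > 0" unfolding \<sigma>_def J'_def by (rule Im_moebius(2)[OF det(2) \<tau>])
    define J where "J = of_int c * \<sigma> + of_int d"
    have den: "of_int (c * a' + d * c') * \<tau> + of_int (c * b' + d * d') = J * J'"
      using moebius_compose[of c' \<tau> d' c a' b' d] J' unfolding J_def \<sigma>_def J'_def by simp
    have num: "of_int (a * a' + b * c') * \<tau> + of_int (a * b' + b * d') = (of_int a * \<sigma> + of_int b) * J'"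
      using moebius_compose[of c' \<tau> d' a a' b' b] J' unfolding \<sigma>_def J'_def by simp
    have q: "(of_int a * \<sigma> + of_int b) * J' / (J * J') = (of_int a * \<sigma> + of_int b) / J"
      using J' by simp
    have "(J * J') ^ g * \<psi> ((of_int a * \<sigma> + of_int b) / J) = J' ^ g * (J ^ g * \<psi> ((of_int a * \<sigma> + of_int b) / J))"
      by (simp add: power_mult_distrib)
    also have "\<dots> = J' ^ g * \<phi> \<sigma> + \<i> * (J' ^ g * poly (cpoly R) \<sigma>)"
      using R(2)[OF \<sigma>] by (simp add: J_def algebra_simps)
    also have "J' ^ g * \<phi> \<sigma> = \<omega> \<tau> + \<i> * poly (cpoly R') \<tau>"
      using R'(2)[OF \<tau>] by (simp add: J'_def \<sigma>_def)
    also have "J' ^ g * poly (cpoly R) \<sigma> = poly (cpoly (poly_slash g a' b' c' d' R)) \<tau>"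
      using poly_poly_slash[OF R(1), of c' \<tau> d' a' b'] J' by (simp add: J'_def \<sigma>_def)
    finally show "(of_int (c * a' + d * c') * \<tau> + of_int (c * b' + d * d')) ^ g *
        \<psi> ((of_int (a * a' + b * c') * \<tau> + of_int (a * b' + b * d')) /
           (of_int (c * a' + d * c') * \<tau> + of_int (c * b' + d * d'))) =
        \<omega> \<tau> + \<i> * poly (cpoly (R' + poly_slash g a' b' c' d' R)) \<tau>"
      unfolding den num q by (simp add: cpoly_add algebra_simps)
  qed
qed

lemma slash_rel_inverse:
  assumes 1: "slash_rel g a b c d \<psi> \<phi>" and det: "a * d - b * c = 1"
  shows "slash_rel g d (- b) (- c) a \<phi> \<psi>"
proof -
  obtain R where R: "degree R \<le> g" "\<And>\<tau>. Im \<tau> > 0 \<Longrightarrow>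
     (of_int c * \<tau> + of_int d) ^ g * \<psi> ((of_int a * \<tau> + of_int b) / (of_int c * \<tau> + of_int d)) =
     \<phi> \<tau> + \<i> * poly (cpoly R) \<tau>" using slash_relE[OF 1] by blast
  have det': "d * a - (- b) * (- c) = 1" using det by (simp add: mult.commute)
  show ?thesis
  proof (rule slash_relI[where R = "- poly_slash g d (- b) (- c) a R"])
    show "degree (- poly_slash g d (- b) (- c) a R) \<le> g" by (simp add: degree_poly_slash)
    fix \<tau> :: complex assume \<tau>: "Im \<tau> > 0"
    define J' where "J' = of_int (- c) * \<tau> + of_int a"
    have J': "J' \<noteq> 0" unfolding J'_def by (rule moebius_denom_nonzero[OF \<tau>]) (use det in auto)
    define \<sigma> where "\<sigma> = (of_int d * \<tau> + of_int (- b)) / J'"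
    have \<sigma>: "Im \<sigma> > 0" unfolding \<sigma>_def J'_def by (rule Im_moebius(2)[OF det' \<tau>])
    have detc: "of_int a * of_int d - of_int b * of_int c = (1::complex)"
      using arg_cong[OF det, of "of_int :: int \<Rightarrow> complex"] by simp
    have den: "of_int c * \<sigma> + of_int d = 1 / J'"
      using J' detc unfolding \<sigma>_def by (simp add: field_simps J'_def)
    have num: "of_int a * \<sigma> + of_int b = \<tau> / J'"
    proof -
      have "of_int a * \<sigma> + of_int b = (of_int a * of_int d - of_int b * of_int c) * \<tau> / J'"
        using J' unfolding \<sigma>_def by (simp add: field_simps) (simp add: J'_def algebra_simps)
      thus ?thesis using detc by simp
    qed
    have "J' ^ g * ((1 / J') ^ g * \<psi> \<tau>) = J' ^ g * (\<phi> \<sigma> + \<i> * poly (cpoly R) \<sigma>)"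
      using R(2)[OF \<sigma>] J' unfolding den num by simp
    hence "\<psi> \<tau> = J' ^ g * \<phi> \<sigma> + \<i> * (J' ^ g * poly (cpoly R) \<sigma>)"
      using J' by (simp add: algebra_simps power_divide)
    also have "J' ^ g * poly (cpoly R) \<sigma> = poly (cpoly (poly_slash g d (- b) (- c) a R)) \<tau>"
      using poly_poly_slash[OF R(1), of "- c" \<tau> a d "- b"] J' unfolding J'_def \<sigma>_def by simp
    finally have "J' ^ g * \<phi> \<sigma> = \<psi> \<tau> + \<i> * poly (cpoly (- poly_slash g d (- b) (- c) a R)) \<tau>"
      by (simp add: cpoly_minus)
    thus "(of_int (- c) * \<tau> + of_int a) ^ g * \<phi> ((of_int d * \<tau> + of_int (- b)) / (of_int (- c) * \<tau> + of_int a)) =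
        \<psi> \<tau> + \<i> * poly (cpoly (- poly_slash g d (- b) (- c) a R)) \<tau>"
      unfolding J'_def \<sigma>_def by simp
  qed
qed

lemma slash_rel_uminus:
  assumes "slash_rel g a b c d \<psi> \<phi>"
  shows "slash_rel g a b c d (\<lambda>\<tau>. - \<psi> \<tau>) (\<lambda>\<tau>. - \<phi> \<tau>)"
proof -
  obtain R where R: "degree R \<le> g" "\<And>\<tau>. Im \<tau> > 0 \<Longrightarrow>
     (of_int c * \<tau> + of_int d) ^ g * \<psi> ((of_int a * \<tau> + of_int b) / (of_int c * \<tau> + of_int d)) =
     \<phi> \<tau> + \<i> * poly (cpoly R) \<tau>" using slash_relE[OF assms] by blast
  show ?thesis
    by (rule slash_relI[where R = "- R"]) (use R in \<open>simp_all add: cpoly_minus\<close>)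
qed

subsection \<open>The generators\<close>

text \<open>The shape of \<open>E\<^bsub>-g\<^esub>\<close> at a cusp. The term \<open>i \<mu> \<tau>\<^bsup>g+1\<^esup>\<close> is what integrating a nonzero constant Fourier coefficient
  of weight \<open>g + 2\<close> leaves behind.\<close>

definition qser_plus :: "nat \<Rightarrow> (nat \<Rightarrow> complex) \<Rightarrow> real \<Rightarrow> complex \<Rightarrow> complex" where
  "qser_plus g c \<mu> \<tau> = qser c \<tau> + \<i> * of_real \<mu> * \<tau> ^ Suc g"

lemma E_odd_qser_plus: "E_odd (- int g) = qser_plus g (odd_coeff (- int g)) 0"
  by (simp add: qser_plus_def E_odd_eq_qser fun_eq_iff)

lemma qser_shift: "qser c (\<tau> + of_int k) = qser (\<lambda>n. c n * exp (of_real pi * \<i> * of_nat n * of_int k)) \<tau>"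
  by (simp add: qser_def algebra_simps exp_add mult_ac)

lemma norm_exp_shift: "norm (exp (of_real pi * \<i> * of_nat n * of_int k)) = 1"
proof -
  have "of_real pi * \<i> * of_nat n * of_int k = \<i> * of_real (pi * real n * of_int k)" by simp
  thus ?thesis by (simp only: norm_exp_i_times)
qed

lemma poly_bounded_shift:
  "poly_bounded c \<Longrightarrow> poly_bounded (\<lambda>n. c n * exp (of_real pi * \<i> * of_nat n * of_int k))"
  unfolding poly_bounded_def norm_mult norm_exp_shift by simp

lemma slash_rel_translation:
  "slash_rel g 1 k 0 1 (qser_plus g c \<mu>) (qser_plus g (\<lambda>n. c n * exp (of_real pi * \<i> * of_nat n * of_int k)) \<mu>)"
proof -
  define P :: "real poly" where "P = [:of_int k, 1:] ^ Suc g - [:0, 1:] ^ Suc g"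
  have lin: "cpoly [:u, v:] = [:of_real u, of_real v:]" for u v by (simp add: map_poly_pCons)
  have "degree P < Suc g"
  proof -
    have X: "[:0, 1:] ^ Suc g = (monom 1 (Suc g) :: real poly)" by (simp add: monom_altdef)
    have le: "degree P \<le> Suc g"
      unfolding P_def by (intro degree_diff_le) (simp_all add: degree_linear_power del: power_Suc)
    have "coeff P (Suc g) = 0"
    proof -
      have "coeff ([:of_int k, 1:] ^ Suc g :: real poly) (Suc g) = 1"
        using lead_coeff_power[of "[:of_int k, 1:] :: real poly" "Suc g"]
        by (simp add: degree_linear_power del: power_Suc)
      thus ?thesis unfolding P_def X by simp
    qed
    with le show ?thesis
      by (metis le_neq_implies_less leading_coeff_0_iff degree_0 zero_less_Suc)
  qed
  show ?thesis
  proof (rule slash_relI[where R = "smult \<mu> P"])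
    show "degree (smult \<mu> P) \<le> g"
      using \<open>degree P < Suc g\<close> by (intro order_trans[OF degree_smult_le]) simp
    fix \<tau> :: complex
    have "poly (cpoly P) \<tau> = (\<tau> + of_int k) ^ Suc g - \<tau> ^ Suc g"
      unfolding P_def cpoly_diff cpoly_power lin by (simp add: add_ac del: power_Suc)
    thus "(of_int 0 * \<tau> + of_int 1) ^ g * qser_plus g c \<mu> ((of_int 1 * \<tau> + of_int k) / (of_int 0 * \<tau> + of_int 1)) =
          qser_plus g (\<lambda>n. c n * exp (of_real pi * \<i> * of_nat n * of_int k)) \<mu> \<tau> + \<i> * poly (cpoly (smult \<mu> P)) \<tau>"
      by (simp add: qser_plus_def qser_shift cpoly_smult right_diff_distrib mult_ac del: power_Suc)
  qed
qed

lemma exp_shift_even: "even k \<Longrightarrow> exp (of_real pi * \<i> * of_nat n * of_int k) = 1"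
proof (elim evenE)
  fix l assume "k = 2 * l"
  thus ?thesis unfolding exp_eq_1 by (auto intro!: exI[of _ "int n * l"])
qed

lemma E_odd_shift_even:
  "even k \<Longrightarrow> E_odd (- int g) (\<tau> + of_int k) = E_odd (- int g) \<tau>"
  unfolding E_odd_eq_qser qser_shift by (simp add: exp_shift_even)

lemma slash_rel_even_translation:
  "even k \<Longrightarrow> slash_rel g 1 k 0 1 (qser_plus g c \<mu>) (qser_plus g c \<mu>)"
  using slash_rel_translation[of g k c \<mu>] by (simp add: exp_shift_even)

lemma slash_rel_E_translation: "even k \<Longrightarrow> slash_rel g 1 k 0 1 (E_odd (- int g)) (E_odd (- int g))"
  unfolding E_odd_qser_plus by (rule slash_rel_even_translation)

lemma E_odd_plus_1:
  assumes "Im \<tau> > 0" shows "E_odd (- int g) (\<tau> + 1) = - E_odd (- int g) \<tau>"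
proof -
  have "E_odd (- int g) (\<tau> + of_int 1) = qser (\<lambda>n. odd_coeff (- int g) n * exp (of_real pi * \<i> * of_nat n * of_int 1)) \<tau>"
    unfolding E_odd_eq_qser by (rule qser_shift)
  also have "(\<lambda>n. odd_coeff (- int g) n * exp (of_real pi * \<i> * of_nat n * of_int 1)) = (\<lambda>n. (-1) * odd_coeff (- int g) n)"
  proof
    fix n
    have "exp (of_real pi * \<i> * of_nat n * of_int 1) = (-1) ^ n"
      using exp_qpow[of n 1] by simp
    thus "odd_coeff (- int g) n * exp (of_real pi * \<i> * of_nat n * of_int 1) = (-1) * odd_coeff (- int g) n"
      by (simp add: odd_coeff_def)
  qed
  also have "qser (\<lambda>n. (-1) * odd_coeff (- int g) n) \<tau> = - E_odd (- int g) \<tau>"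
    unfolding E_odd_eq_qser qser_const_mult[OF poly_bounded_odd_coeff_neg assms] by simp
  finally show ?thesis by simp
qed

lemma slash_rel_E_inversion:
  assumes "even g"
  shows "slash_rel g 0 (-1) 1 0 (E_odd (- int g))
     (qser_plus g (inversion_coeff g) (- odd_zeta (g + 2) / (2 * pi)))"
proof (rule slash_relI[where R = "inversion_poly g"])
  show "degree (inversion_poly g) \<le> g"
    using inversion_poly_degree[OF assms] by auto
  fix \<tau> :: complex assume "Im \<tau> > 0"
  from E_odd_inversion[OF assms this]
  show "(of_int 1 * \<tau> + of_int 0) ^ g * E_odd (- int g) ((of_int 0 * \<tau> + of_int (- 1)) / (of_int 1 * \<tau> + of_int 0)) =
        qser_plus g (inversion_coeff g) (- odd_zeta (g + 2) / (2 * pi)) \<tau> + \<i> * poly (cpoly (inversion_poly g)) \<tau>"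
    by (simp add: qser_plus_def)
qed

text \<open>These substitutions are conjugate under \<open>\<tau> \<mapsto> -1/\<tau>\<close> to \<open>\<tau> \<mapsto> \<tau> \<mp> 2\<close>, and the right hand side of the inversion
  formula is invariant under the latter up to a polynomial.\<close>

lemma slash_rel_E_lower:
  assumes "even g" "k = 2 \<or> k = - 2"
  shows "slash_rel g 1 0 k 1 (E_odd (- int g)) (E_odd (- int g))"
proof -
  let ?\<Phi> = "qser_plus g (inversion_coeff g) (- odd_zeta (g + 2) / (2 * pi))"
  have S: "slash_rel g 0 (-1) 1 0 (E_odd (- int g)) ?\<Phi>" by (rule slash_rel_E_inversion[OF assms(1)])
  have "slash_rel g 1 (- k) 0 1 ?\<Phi> ?\<Phi>"
    by (rule slash_rel_even_translation) (use assms(2) in auto)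
  from slash_rel_compose[OF S this] have "slash_rel g 0 (-1) 1 (- k) (E_odd (- int g)) ?\<Phi>" by simp
  from slash_rel_compose[OF this slash_rel_inverse[OF S]] show ?thesis by simp
qed

lemma abs_reduce:
  fixes x y :: int assumes "0 < \<bar>y\<bar>" "\<bar>y\<bar> < \<bar>x\<bar>"
  obtains k where "k = 2 \<or> k = - 2" "\<bar>x - k * y\<bar> < \<bar>x\<bar>"
proof (cases "(x > 0) = (y > 0)")
  case True
  show ?thesis by (rule that[of 2]) (use assms True in auto)
next
  case False
  show ?thesis by (rule that[of "-2"]) (use assms False in auto)
qed

text \<open>The two substitutions \<open>\<tau> \<mapsto> \<tau> \<plusminus> 2\<close> and \<open>\<tau> \<mapsto> \<tau> / (\<plusminus>2\<tau> + 1)\<close> generate \<open>\<Gamma>(2)\<close> up to sign, by a Euclidean descent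
  on the first column of the matrix.\<close>

theorem slash_rel_E_Gamma2:
  assumes "even g" "Gamma2 a b c d"
  shows "slash_rel g a b c d (E_odd (- int g)) (E_odd (- int g))"
  using assms(2)
proof (induction "nat (\<bar>a\<bar> + \<bar>c\<bar>)" arbitrary: a b c d rule: less_induct)
  case less
  note G = less.prems
  have det: "a * d - b * c = 1" and par: "odd a" "even b" "even c" "odd d"
    using G by (auto simp: Gamma2_def)
  have ne: "\<bar>a\<bar> \<noteq> \<bar>c\<bar>" using par by (auto simp: abs_if split: if_splits)
  consider "c = 0" | "c \<noteq> 0" "\<bar>c\<bar> < \<bar>a\<bar>" | "\<bar>a\<bar> < \<bar>c\<bar>" using ne by linarith
  thus ?case
  proof cases
    case 1
    hence "a * d = 1" using det by simp
    hence ad: "a = d" "d = 1 \<or> d = -1" by (auto simp: zmult_eq_1_iff)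
    show ?thesis
    proof (rule slash_relI[where R = 0])
      fix \<tau> :: complex
      have "(of_int a * \<tau> + of_int b) / (of_int c * \<tau> + of_int d) = \<tau> + of_int (d * b)"
        using 1 ad by auto
      moreover have "E_odd (- int g) (\<tau> + of_int (d * b)) = E_odd (- int g) \<tau>"
        using par by (intro E_odd_shift_even) simp
      moreover have "of_int d ^ g = (1::complex)" using ad assms(1) by auto
      ultimately show "(of_int c * \<tau> + of_int d) ^ g * E_odd (- int g) ((of_int a * \<tau> + of_int b) / (of_int c * \<tau> + of_int d)) =
          E_odd (- int g) \<tau> + \<i> * poly (cpoly 0) \<tau>"
        using 1 by simp
    qed simp
  next
    case 2
    then obtain k where k: "k = 2 \<or> k = - 2" "\<bar>a - k * c\<bar> < \<bar>a\<bar>" using abs_reduce[of c a] by auto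
    have "slash_rel g (a - k * c) (b - k * d) c d (E_odd (- int g)) (E_odd (- int g))"
    proof (rule less.hyps)
      show "nat (\<bar>a - k * c\<bar> + \<bar>c\<bar>) < nat (\<bar>a\<bar> + \<bar>c\<bar>)" using k by linarith
      show "Gamma2 (a - k * c) (b - k * d) c d"
        using det par k(1) by (auto simp: Gamma2_def algebra_simps)
    qed
    moreover have "slash_rel g 1 k 0 1 (E_odd (- int g)) (E_odd (- int g))"
      using k by (intro slash_rel_E_translation) auto
    ultimately have "slash_rel g (1 * (a - k * c) + k * c) (1 * (b - k * d) + k * d)
        (0 * (a - k * c) + 1 * c) (0 * (b - k * d) + 1 * d) (E_odd (- int g)) (E_odd (- int g))"
      by (intro slash_rel_compose) (use det in \<open>auto simp: algebra_simps\<close>)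
    thus ?thesis by simp
  next
    case 3
    have "a \<noteq> 0" using par by auto
    then obtain k where k: "k = 2 \<or> k = - 2" "\<bar>c - k * a\<bar> < \<bar>c\<bar>" using abs_reduce[of a c] 3 by auto
    have "slash_rel g a b (c - k * a) (d - k * b) (E_odd (- int g)) (E_odd (- int g))"
    proof (rule less.hyps)
      show "nat (\<bar>a\<bar> + \<bar>c - k * a\<bar>) < nat (\<bar>a\<bar> + \<bar>c\<bar>)" using k by linarith
      show "Gamma2 a b (c - k * a) (d - k * b)"
        using det par k(1) by (auto simp: Gamma2_def algebra_simps)
    qed
    moreover have "slash_rel g 1 0 k 1 (E_odd (- int g)) (E_odd (- int g))"
      using k by (intro slash_rel_E_lower assms)
    ultimately have "slash_rel g (1 * a + 0 * (c - k * a)) (1 * b + 0 * (d - k * b))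
        (k * a + 1 * (c - k * a)) (k * b + 1 * (d - k * b)) (E_odd (- int g)) (E_odd (- int g))"
      by (intro slash_rel_compose) (use det in \<open>auto simp: algebra_simps\<close>)
    thus ?thesis by simp
  qed
qed

text \<open>The three classes of cusps of \<open>\<Gamma>(2)\<close>: the value is \<open>0\<close> at \<open>i\<infinity>\<close>, \<open>1\<close> at \<open>0\<close> and \<open>-1\<close> at \<open>1\<close>.\<close>

definition cusp_sign :: "int \<Rightarrow> int \<Rightarrow> real" where
  "cusp_sign r p = (if odd p then (if even r then 1 else -1) else 0)"

text \<open>The behaviour at every cusp: modulo \<open>\<Gamma>(2)\<close> and translations, a matrix of \<open>SL\<^sub>2(\<int>)\<close> is the identity,
  \<open>S\<close> or \<open>TS\<close>, and which of the three is decided by the parities of its first column.\<close>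

theorem E_odd_cusp_expansion:
  assumes g: "even g" and det: "r * p' - r' * p = 1"
  obtains c where "poly_bounded c" "c 0 = of_real (cusp_sign r p * alt_zeta (Suc g) / 4)"
    "slash_rel g r r' p p' (E_odd (- int g)) (qser_plus g c (- cusp_sign r p * odd_zeta (g + 2) / (2 * pi)))"
proof -
  let ?E = "E_odd (- int g)" and ?\<mu> = "- odd_zeta (g + 2) / (2 * pi)"
  let ?\<Phi> = "qser_plus g (inversion_coeff g) ?\<mu>"
  have T: "slash_rel g 1 1 0 1 ?E (\<lambda>\<tau>. - ?E \<tau>)"
    by (rule slash_relI[where R = 0]) (simp_all add: E_odd_plus_1)
  have mE: "(\<lambda>\<tau>. - qser_plus g c \<mu> \<tau>) = qser_plus g (\<lambda>n. - c n) (- \<mu>)" if "\<And>\<tau>. qser (\<lambda>n. - c n) \<tau> = - qser c \<tau>" for c \<mu>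
    using that by (simp add: qser_plus_def fun_eq_iff)
  have odd_case: "\<exists>c. poly_bounded c \<and> c 0 = of_real (alt_zeta (Suc g) / 4) \<and> slash_rel g r r' p p' ?E (qser_plus g c ?\<mu>)"
    if det: "r * p' - r' * p = 1" and par: "odd p" "even r" for r r' p p'
  proof -
    \<comment> \<open>a translation by \<open>j\<close> brings the matrix into \<open>\<Gamma>(2) S\<close>\<close>
    define j :: int where "j = (if even p' then 0 else 1)"
    have "odd (r' * p)"
    proof
      assume "even (r' * p)"
      hence "even (r * p' - r' * p)" using par by simp
      thus False using det by simp
    qed
    hence r': "odd r'" by simp
    have j: "even (p' + j * p)" using par by (auto simp: j_def)
    have "Gamma2 (- (r' + j * r)) r (- (p' + j * p)) p"
      using det par r' j by (auto simp: Gamma2_def algebra_simps)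
    note G = slash_rel_E_Gamma2[OF g this]
    have "slash_rel g r (r' + j * r) p (p' + j * p) ?E ?\<Phi>"
      using slash_rel_compose[OF G slash_rel_E_inversion[OF g]] det by (simp add: algebra_simps)
    from slash_rel_compose[OF this slash_rel_translation[of g "- j"]]
    have "slash_rel g r r' p p' ?E (qser_plus g (\<lambda>n. inversion_coeff g n * exp (of_real pi * \<i> * of_nat n * of_int (- j))) ?\<mu>)"
      using det by (simp add: algebra_simps)
    thus ?thesis
      using poly_bounded_shift[OF poly_bounded_inversion_coeff[of g], of "- j"]
      by (intro exI[of _ "\<lambda>n. inversion_coeff g n * exp (of_real pi * \<i> * of_nat n * of_int (- j))"])
         (simp add: inversion_coeff_def)
  qed
  have neg: "slash_rel g a b c d (\<lambda>\<tau>. - \<psi> \<tau>) (qser_plus g (\<lambda>n. - c' n) (- \<mu>))"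
    if "slash_rel g a b c d \<psi> (qser_plus g c' \<mu>)" "poly_bounded c'" for a b c d \<psi> c' \<mu>
  proof -
    have "slash_rel g a b c d (\<lambda>\<tau>. - \<psi> \<tau>) (\<lambda>\<tau>. - qser_plus g c' \<mu> \<tau>)"
      using that(1) by (rule slash_rel_uminus)
    moreover have "- qser_plus g c' \<mu> \<tau> = qser_plus g (\<lambda>n. - c' n) (- \<mu>) \<tau>" if "Im \<tau> > 0" for \<tau>
      using qser_const_mult[OF \<open>poly_bounded c'\<close> that, of "-1"] by (simp add: qser_plus_def)
    ultimately show ?thesis unfolding slash_rel_def by simp
  qed
  have pbm: "poly_bounded (\<lambda>n. - c n)" if "poly_bounded c" for c
    using poly_bounded_const_mult[OF that, of "-1"] by simp
  show ?thesis
  proof (cases "odd p")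
    case odd: True
    show ?thesis
    proof (cases "even r")
      case True
      from odd_case[OF det odd True] show ?thesis
        using that odd True by (auto simp: cusp_sign_def)
    next
      case False
      have "(r - p) * p' - (r' - p') * p = 1" using det by (simp add: algebra_simps)
      from odd_case[OF this] odd False obtain c where c: "poly_bounded c" "c 0 = of_real (alt_zeta (Suc g) / 4)"
        "slash_rel g (r - p) (r' - p') p p' ?E (qser_plus g c ?\<mu>)" by auto
      from slash_rel_compose[OF T neg[OF c(3,1)]]
      have "slash_rel g r r' p p' ?E (qser_plus g (\<lambda>n. - c n) (- ?\<mu>))"
        using det by (simp add: algebra_simps)
      thus ?thesis using that[of "\<lambda>n. - c n"] c pbm[OF c(1)] odd False by (simp add: cusp_sign_def)
    qed
  next
    case ev: False
    have "odd (r * p')"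
    proof
      assume "even (r * p')"
      hence "even (r * p' - r' * p)" using ev by simp
      thus False using det by simp
    qed
    hence par: "odd r" "odd p'" by auto
    show ?thesis
    proof (cases "even r'")
      case True
      have "Gamma2 r r' p p'" using det par ev True by (auto simp: Gamma2_def)
      from slash_rel_E_Gamma2[OF g this] show ?thesis
        using that[of "odd_coeff (- int g)"] ev poly_bounded_odd_coeff_neg
        by (simp add: cusp_sign_def E_odd_qser_plus odd_coeff_def)
    next
      case False
      have "Gamma2 r (r' - r) p (p' - p)" using det par ev False by (auto simp: Gamma2_def algebra_simps)
      from slash_rel_compose[OF slash_rel_E_Gamma2[OF g this] T]
      have "slash_rel g r r' p p' ?E (\<lambda>\<tau>. - ?E \<tau>)" using det by (simp add: algebra_simps)
      moreover have "- ?E \<tau> = qser_plus g (\<lambda>n. - odd_coeff (- int g) n) 0 \<tau>" if "Im \<tau> > 0" for \<tau>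
        using qser_const_mult[OF poly_bounded_odd_coeff_neg that, of "-1" g] by (simp add: qser_plus_def E_odd_eq_qser)
      ultimately have "slash_rel g r r' p p' ?E (qser_plus g (\<lambda>n. - odd_coeff (- int g) n) 0)"
        unfolding slash_rel_def by simp
      thus ?thesis using that[of "\<lambda>n. - odd_coeff (- int g) n"] ev pbm[OF poly_bounded_odd_coeff_neg]
        by (simp add: cusp_sign_def odd_coeff_def)
    qed
  qed
qed

section \<open>Expansions at the cusps\<close>

lemma higher_deriv_linear_mult:
  fixes G :: "complex \<Rightarrow> complex"
  assumes "G holomorphic_on S" "open S" "z \<in> S"
  shows "(deriv ^^ Suc m) (\<lambda>z. (c * z + d) * G z) z =
      (c * z + d) * (deriv ^^ Suc m) G z + of_nat (Suc m) * c * (deriv ^^ m) G z"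
  using assms(3)
proof (induction m arbitrary: z)
  have D: "((deriv ^^ n) G has_field_derivative (deriv ^^ Suc n) G z) (at z)" if "z \<in> S" for n z
    using holomorphic_derivI[OF holomorphic_higher_deriv[OF assms(1,2)] assms(2) that] by simp
  {
    case 0
    have "((\<lambda>z. (c * z + d) * G z) has_field_derivative c * G z + deriv G z * (c * z + d)) (at z)"
      using D[OF 0, of 0] by (auto intro!: derivative_eq_intros)
    thus ?case by (simp add: DERIV_imp_deriv algebra_simps)
  next
    case (Suc m)
    have "((\<lambda>z. (c * z + d) * (deriv ^^ Suc m) G z + of_nat (Suc m) * c * (deriv ^^ m) G z) has_field_derivative
        (c * (deriv ^^ Suc m) G z + (deriv ^^ Suc (Suc m)) G z * (c * z + d) + of_nat (Suc m) * c * (deriv ^^ Suc m) G z)) (at z)"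
      by (rule derivative_eq_intros D[OF Suc.prems] refl | simp)+
    hence "((deriv ^^ Suc m) (\<lambda>z. (c * z + d) * G z) has_field_derivative
        (c * (deriv ^^ Suc m) G z + (deriv ^^ Suc (Suc m)) G z * (c * z + d) + of_nat (Suc m) * c * (deriv ^^ Suc m) G z)) (at z)"
      by (rule has_field_derivative_transform_within_open[OF _ assms(2) Suc.prems]) (simp only: Suc.IH)
    hence "(deriv ^^ Suc (Suc m)) (\<lambda>z. (c * z + d) * G z) z =
        c * (deriv ^^ Suc m) G z + (deriv ^^ Suc (Suc m)) G z * (c * z + d) + of_nat (Suc m) * c * (deriv ^^ Suc m) G z"
      by (simp add: DERIV_imp_deriv)
    thus ?case by (simp add: algebra_simps)
  }
qed

text \<open>Bol's identity: the \<open>(n+1)\<close>-fold derivative intertwines the actions of weight \<open>-n\<close> and \<open>n + 2\<close>.\<close>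

lemma bol_identity:
  fixes a b c d :: int and h :: "complex \<Rightarrow> complex"
  assumes det: "a * d - b * c = 1" and h: "h holomorphic_on upper_half_plane" and \<tau>: "Im \<tau> > 0"
  shows "(deriv ^^ Suc n) (\<lambda>\<tau>. (of_int c * \<tau> + of_int d) ^ n * h ((of_int a * \<tau> + of_int b) / (of_int c * \<tau> + of_int d))) \<tau> =
     (deriv ^^ Suc n) h ((of_int a * \<tau> + of_int b) / (of_int c * \<tau> + of_int d)) / (of_int c * \<tau> + of_int d) ^ (n + 2)"
proof -
  define J where "J = (\<lambda>\<tau>::complex. of_int c * \<tau> + of_int d)"
  define \<gamma> where "\<gamma> = (\<lambda>\<tau>::complex. (of_int a * \<tau> + of_int b) / J \<tau>)"
  have J0: "J \<tau> \<noteq> 0" if "Im \<tau> > 0" for \<tau>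
    unfolding J_def by (rule moebius_denom_nonzero[OF that]) (use det in auto)
  have \<gamma>: "Im (\<gamma> \<tau>) > 0" if "Im \<tau> > 0" for \<tau>
    unfolding \<gamma>_def J_def by (rule Im_moebius(2)[OF det that])
  have detc: "of_int a * of_int d - of_int b * of_int c = (1::complex)"
    using arg_cong[OF det, of "of_int :: int \<Rightarrow> complex"] by simp
  have DJ: "(J has_field_derivative of_int c) (at \<tau>)" for \<tau>
    unfolding J_def by (auto intro!: derivative_eq_intros)
  have D\<gamma>: "(\<gamma> has_field_derivative 1 / J \<tau> ^ 2) (at \<tau>)" if "Im \<tau> > 0" for \<tau>
  proof -
    have "(\<gamma> has_field_derivative (of_int a * J \<tau> - (of_int a * \<tau> + of_int b) * of_int c) / (J \<tau> * J \<tau>)) (at \<tau>)"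
      unfolding \<gamma>_def using J0[OF that] by (auto intro!: derivative_eq_intros DJ)
    also have "of_int a * J \<tau> - (of_int a * \<tau> + of_int b) * of_int c = of_int a * of_int d - of_int b * of_int c"
      by (simp add: J_def algebra_simps)
    finally show ?thesis unfolding detc by (simp add: power2_eq_square)
  qed
  have Dh: "((deriv ^^ n) h has_field_derivative (deriv ^^ Suc n) h z) (at z)" if "Im z > 0" for n z
    using holomorphic_derivI[OF holomorphic_higher_deriv[OF h open_upper_half_plane] open_upper_half_plane] that
    by (simp add: upper_half_plane_def)
  have Dh\<gamma>: "((\<lambda>\<tau>. (deriv ^^ n) h (\<gamma> \<tau>)) has_field_derivative (deriv ^^ Suc n) h (\<gamma> \<tau>) * (1 / J \<tau> ^ 2)) (at \<tau>)"
    if "Im \<tau> > 0" for n \<tau>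
    by (rule DERIV_chain2[OF Dh[OF \<gamma>[OF that]] D\<gamma>[OF that]])
  have hol: "(\<lambda>\<tau>. J \<tau> ^ n * h (\<gamma> \<tau>)) holomorphic_on upper_half_plane" for n
  proof -
    have "(\<lambda>\<tau>. h (\<gamma> \<tau>)) holomorphic_on upper_half_plane"
      unfolding holomorphic_on_open[OF open_upper_half_plane]
      using Dh\<gamma>[of _ 0] by (auto simp: upper_half_plane_def)
    moreover have "J holomorphic_on upper_half_plane" unfolding J_def by (intro holomorphic_intros)
    ultimately show ?thesis by (intro holomorphic_intros)
  qed
  have "(deriv ^^ Suc n) (\<lambda>\<tau>. J \<tau> ^ n * h (\<gamma> \<tau>)) \<tau> = (deriv ^^ Suc n) h (\<gamma> \<tau>) / J \<tau> ^ (n + 2)"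
    using \<tau>
  proof (induction n arbitrary: \<tau>)
    case 0
    show ?case using DERIV_imp_deriv[OF Dh\<gamma>[OF 0, of 0]] by (simp add: power2_eq_square)
  next
    case (Suc n)
    note \<tau> = Suc.prems
    let ?G = "\<lambda>\<tau>. J \<tau> ^ n * h (\<gamma> \<tau>)"
    have "((\<lambda>\<tau>. (deriv ^^ Suc n) h (\<gamma> \<tau>) / J \<tau> ^ (n + 2)) has_field_derivative
        ((deriv ^^ Suc (Suc n)) h (\<gamma> \<tau>) * (1 / J \<tau> ^ 2) * J \<tau> ^ (n + 2) -
         (deriv ^^ Suc n) h (\<gamma> \<tau>) * (of_nat (n + 2) * (of_int c * J \<tau> ^ (n + 2 - Suc 0)))) / (J \<tau> ^ (n + 2) * J \<tau> ^ (n + 2))) (at \<tau>)"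
      using J0[OF \<tau>] by (intro DERIV_divide Dh\<gamma>[OF \<tau>] DERIV_power DJ) simp
    hence "((deriv ^^ Suc n) ?G has_field_derivative
        ((deriv ^^ Suc (Suc n)) h (\<gamma> \<tau>) * (1 / J \<tau> ^ 2) * J \<tau> ^ (n + 2) -
         (deriv ^^ Suc n) h (\<gamma> \<tau>) * (of_nat (n + 2) * (of_int c * J \<tau> ^ (n + 2 - Suc 0)))) / (J \<tau> ^ (n + 2) * J \<tau> ^ (n + 2))) (at \<tau>)"
      by (rule has_field_derivative_transform_within_open[OF _ open_upper_half_plane])
         (use \<tau> Suc.IH in \<open>auto simp: upper_half_plane_def\<close>)
    hence D2: "(deriv ^^ Suc (Suc n)) ?G \<tau> =
        ((deriv ^^ Suc (Suc n)) h (\<gamma> \<tau>) * (1 / J \<tau> ^ 2) * J \<tau> ^ (n + 2) -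
         (deriv ^^ Suc n) h (\<gamma> \<tau>) * (of_nat (n + 2) * (of_int c * J \<tau> ^ (n + 2 - Suc 0)))) / (J \<tau> ^ (n + 2) * J \<tau> ^ (n + 2))"
      by (simp add: DERIV_imp_deriv)
    have "(\<lambda>\<tau>. J \<tau> ^ Suc n * h (\<gamma> \<tau>)) = (\<lambda>\<tau>. (of_int c * \<tau> + of_int d) * ?G \<tau>)"
      by (simp add: J_def mult_ac)
    hence "(deriv ^^ Suc (Suc n)) (\<lambda>\<tau>. J \<tau> ^ Suc n * h (\<gamma> \<tau>)) \<tau> =
        J \<tau> * (deriv ^^ Suc (Suc n)) ?G \<tau> + of_nat (Suc (Suc n)) * of_int c * (deriv ^^ Suc n) ?G \<tau>"
      using higher_deriv_linear_mult[OF hol open_upper_half_plane, of \<tau> "Suc n" "of_int c" "of_int d" n] \<tau>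
      by (simp only: J_def upper_half_plane_def mem_Collect_eq)
    also have "\<dots> = (deriv ^^ Suc (Suc n)) h (\<gamma> \<tau>) / J \<tau> ^ (Suc n + 2)"
      unfolding D2 Suc.IH[OF \<tau>] using J0[OF \<tau>]
      by (simp add: divide_simps power2_eq_square del: funpow.simps)
    finally show ?case .
  qed
  thus ?thesis unfolding J_def \<gamma>_def .
qed

lemma higher_deriv_poly: "(deriv ^^ n) (poly q) = poly ((pderiv ^^ n) q)" for q :: "complex poly"
proof (induction n arbitrary: q)
  case (Suc n)
  have "deriv (poly q) = poly (pderiv q)" for q :: "complex poly"
    by (rule ext) (simp add: DERIV_imp_deriv[OF poly_DERIV])
  thus ?case using Suc by simp
qed simp

lemma higher_pderiv_top:
  assumes "degree (q :: complex poly) \<le> n"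
  shows "(pderiv ^^ n) q = [:fact n * coeff q n:]"
  using assms
proof (induction n arbitrary: q)
  case 0
  thus ?case by (metis One_nat_def degree_eq_zeroE coeff_pCons_0 fact_0 funpow_0 le_zero_eq mult_1)
next
  case (Suc n)
  have "(pderiv ^^ Suc n) q = (pderiv ^^ n) (pderiv q)" by (simp add: funpow_swap1)
  also have "\<dots> = [:fact n * coeff (pderiv q) n:]"
    by (rule Suc.IH) (use Suc.prems in \<open>simp add: degree_pderiv\<close>)
  finally show ?case by (simp add: coeff_pderiv mult_ac)
qed

text \<open>The \<open>(g+1)\<close>-fold derivative of the term \<open>i \<mu> \<tau>\<^bsup>g+1\<^esup>\<close> in the expansion of \<open>E\<^bsub>-g\<^esub>\<close>, divided by \<open>(\<pi>i)\<^bsup>g+1\<^esup>\<close>.\<close>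

definition cusp_value :: "nat \<Rightarrow> int \<Rightarrow> int \<Rightarrow> complex" where
  "cusp_value g r p = \<i> * of_real (- cusp_sign r p * odd_zeta (g + 2) / (2 * pi)) * fact (Suc g) / (of_real pi * \<i>) ^ Suc g"

text \<open>By Bol's identity this is the \<open>(g+1)\<close>-fold derivative of the expansion in weight \<open>-g\<close>. It kills the polynomial
  and turns \<open>i \<mu> \<tau>\<^bsup>g+1\<^esup>\<close> into the constant term.\<close>

lemma slash_E_odd_expansion:
  assumes g: "even g" and det: "r * p' - r' * p = 1"
  obtains c where "poly_bounded c" "c 0 = cusp_value g r p"
    "\<And>\<tau>. Im \<tau> > 0 \<Longrightarrow> slash (g + 2) r r' p p' (E_odd (int g + 2)) \<tau> = qser c \<tau>"
proof -
  define \<mu> where "\<mu> = - cusp_sign r p * odd_zeta (g + 2) / (2 * pi)"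
  obtain c where c: "poly_bounded c" "slash_rel g r r' p p' (E_odd (- int g)) (qser_plus g c \<mu>)"
    using E_odd_cusp_expansion[OF g det] unfolding \<mu>_def by blast
  obtain R where R: "degree R \<le> g" "\<And>\<tau>. Im \<tau> > 0 \<Longrightarrow>
     (of_int p * \<tau> + of_int p') ^ g * E_odd (- int g) ((of_int r * \<tau> + of_int r') / (of_int p * \<tau> + of_int p')) =
     qser_plus g c \<mu> \<tau> + \<i> * poly (cpoly R) \<tau>" using slash_relE[OF c(2)] by blast
  define Q where "Q = smult \<i> (cpoly (monom \<mu> (Suc g) + R))"
  have degQ: "degree Q \<le> Suc g"
  proof -
    have "degree Q = degree (monom \<mu> (Suc g) + R)" by (simp add: Q_def degree_map_poly)
    also have "\<dots> \<le> Suc g" by (intro degree_add_le degree_monom_le) (use R in auto)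
    finally show ?thesis .
  qed
  have coeffQ: "coeff Q (Suc g) = \<i> * of_real \<mu>"
    using R(1) by (simp add: Q_def coeff_map_poly coeff_eq_0)
  define v where "v = cusp_value g r p"
  have v_eq: "v = \<i> * of_real \<mu> * fact (Suc g) / (of_real pi * \<i>) ^ Suc g"
    unfolding v_def cusp_value_def \<mu>_def ..
  define c' where "c' = (\<lambda>n. if n = 0 then v else of_nat n ^ Suc g * c n)"
  have pi0: "(of_real pi * \<i>) ^ Suc g \<noteq> (0::complex)" by simp
  have slash: "slash (g + 2) r r' p p' (E_odd (int g + 2)) \<tau> = qser (\<lambda>n. of_nat n ^ Suc g * c n) \<tau> + v" if \<tau>: "Im \<tau> > 0" for \<tau>
  proof -
    define J where "J = of_int p * \<tau> + of_int p'"
    define z where "z = (of_int r * \<tau> + of_int r') / J"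
    have z: "Im z > 0" unfolding z_def J_def by (rule Im_moebius(2)[OF det \<tau>])
    have "(of_real pi * \<i>) ^ Suc g * E_odd (int g + 2) z / J ^ (g + 2) =
       (deriv ^^ Suc g) (\<lambda>\<tau>. (of_int p * \<tau> + of_int p') ^ g * E_odd (- int g) ((of_int r * \<tau> + of_int r') / (of_int p * \<tau> + of_int p'))) \<tau>"
      unfolding bol_identity[OF det E_odd_holomorphic \<tau>]
      using higher_deriv_E_odd[OF z, of g] by (simp add: z_def J_def)
    also have "\<dots> = (deriv ^^ Suc g) (\<lambda>\<tau>. qser c \<tau> + poly Q \<tau>) \<tau>"
    proof (rule higher_deriv_cong_ev)
      have "eventually (\<lambda>\<tau>. \<tau> \<in> upper_half_plane) (nhds \<tau>)"
        by (rule eventually_nhds_in_open[OF open_upper_half_plane]) (use \<tau> in \<open>simp add: upper_half_plane_def\<close>)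
      thus "\<forall>\<^sub>F \<tau> in nhds \<tau>. (of_int p * \<tau> + of_int p') ^ g * E_odd (- int g) ((of_int r * \<tau> + of_int r') / (of_int p * \<tau> + of_int p')) =
          qser c \<tau> + poly Q \<tau>"
        by eventually_elim (subst R(2), simp_all add: upper_half_plane_def qser_plus_def Q_def cpoly_add map_poly_monom poly_monom algebra_simps)
    qed simp
    also have "\<dots> = (deriv ^^ Suc g) (qser c) \<tau> + (deriv ^^ Suc g) (poly Q) \<tau>"
      by (rule higher_deriv_add[OF qser_holomorphic[OF c(1)] _ open_upper_half_plane])
         (use \<tau> in \<open>auto simp: upper_half_plane_def intro!: holomorphic_intros\<close>)
    also have "(deriv ^^ Suc g) (poly Q) \<tau> = fact (Suc g) * (\<i> * of_real \<mu>)"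
      unfolding higher_deriv_poly higher_pderiv_top[OF degQ] coeffQ by simp
    also have "(deriv ^^ Suc g) (qser c) \<tau> = qser (\<lambda>n. (of_real pi * \<i>) ^ Suc g * (of_nat n ^ Suc g * c n)) \<tau>"
      unfolding higher_deriv_qser[OF c(1) \<tau>] by (simp add: power_mult_distrib mult_ac)
    also have "\<dots> = (of_real pi * \<i>) ^ Suc g * qser (\<lambda>n. of_nat n ^ Suc g * c n) \<tau>"
      by (rule qser_const_mult[OF _ \<tau>]) (use poly_bounded_deriv[OF c(1), of 1 "Suc g"] in simp)
    also have "fact (Suc g) * (\<i> * of_real \<mu>) = (of_real pi * \<i>) ^ Suc g * v"
      using pi0 unfolding v_eq by (simp add: mult_ac del: power_Suc fact_Suc)
    finally have "(of_real pi * \<i>) ^ Suc g * (E_odd (int g + 2) z / J ^ (g + 2)) =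
        (of_real pi * \<i>) ^ Suc g * (qser (\<lambda>n. of_nat n ^ Suc g * c n) \<tau> + v)"
      by (simp add: algebra_simps)
    hence "E_odd (int g + 2) z / J ^ (g + 2) = qser (\<lambda>n. of_nat n ^ Suc g * c n) \<tau> + v"
      using pi0 mult_left_cancel by blast
    moreover have "J powi (- int (g + 2)) = 1 / J ^ (g + 2)"
      by (simp only: power_int_minus power_int_of_nat inverse_eq_divide)
    ultimately show ?thesis unfolding slash_def z_def J_def by simp
  qed
  have pb: "poly_bounded (\<lambda>n. of_nat n ^ Suc g * c n)" using poly_bounded_deriv[OF c(1), of 1 "Suc g"] by simp
  have sum: "qser c' \<tau> = qser (\<lambda>n. of_nat n ^ Suc g * c n) \<tau> + v" if "Im \<tau> > 0" for \<tau>
  proof -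
    have 1: "(\<lambda>n. if n = 0 then v else 0) sums v"
      using sums_If_finite_set[of "{0}" "\<lambda>_. v"] by simp
    have "(\<lambda>n. c' n * exp (of_real pi * \<i> * of_nat n * \<tau>)) =
        (\<lambda>n. of_nat n ^ Suc g * c n * exp (of_real pi * \<i> * of_nat n * \<tau>) + (if n = 0 then v else 0))"
      by (auto simp: c'_def fun_eq_iff)
    thus ?thesis using sums_unique[OF sums_add[OF qser_sums[OF pb that] 1]] by (simp add: qser_def)
  qed
  have "poly_bounded c'"
  proof -
    obtain C N where C: "C \<ge> 0" "\<And>n. norm (of_nat n ^ Suc g * c n) \<le> C * (of_nat n + 1) ^ N"
      using poly_boundedE[OF pb] by blast
    have "norm (c' n) \<le> (C + norm v) * (of_nat n + 1) ^ N" for n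
    proof (cases "n = 0")
      case True thus ?thesis using C(1) by (simp add: c'_def)
    next
      case False
      hence "norm (c' n) \<le> C * (of_nat n + 1) ^ N" using C(2)[of n] by (simp add: c'_def)
      also have "\<dots> \<le> (C + norm v) * (of_nat n + 1) ^ N" by (intro mult_right_mono) auto
      finally show ?thesis .
    qed
    thus ?thesis unfolding poly_bounded_def by blast
  qed
  thus ?thesis using that[of c'] slash sum by (simp add: c'_def v_def)
qed

lemma quotient_of_eq:
  assumes "p > 0" "coprime r p" "x = of_int r / of_int p"
  shows "quotient_of x = (r, p)"
  using assms by (simp add: Fract_of_int_quotient [symmetric] quotient_of_Fract normalize_stable)

lemma cusp_const_eq_cusp_value:
  assumes "even g" "quotient_of x = (r, p)"
  shows "cusp_const (g + 2) (E_odd (int g + 2)) x = cusp_value g r p"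
proof -
  have fc: "fourier_coeff (slash (g + 2) r r' p p' (E_odd (int g + 2))) 0 = cusp_value g r p"
    if det: "r * p' - r' * p = 1" for r' p'
  proof -
    obtain c where c: "poly_bounded c" "c 0 = cusp_value g r p"
    "\<And>\<tau>. Im \<tau> > 0 \<Longrightarrow> slash (g + 2) r r' p p' (E_odd (int g + 2)) \<tau> = qser c \<tau>"
      using slash_E_odd_expansion[OF assms(1) det] by blast
    show ?thesis using fourier_coeff_eqI[OF c(1,3)] c(2) by simp
  qed
  have "coprime r p" using assms(2) by (rule quotient_of_coprime)
  then obtain u v where uv: "u * r + v * p = 1" using bezout_int[of r p] by auto
  have ex: "r * u - (- v) * p = 1" using uv by (simp add: algebra_simps)
  show ?thesis unfolding cusp_const_def assms(2) Let_def prod.case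
  proof (rule the_equality)
    show "\<forall>r' p'. r * p' - r' * p = 1 \<longrightarrow> fourier_coeff (slash (g + 2) r r' p p' (E_odd (int g + 2))) 0 = cusp_value g r p"
      using fc by blast
    fix v' assume "\<forall>r' p'. r * p' - r' * p = 1 \<longrightarrow> fourier_coeff (slash (g + 2) r r' p p' (E_odd (int g + 2))) 0 = v'"
    thus "v' = cusp_value g r p" using fc[OF ex] ex by blast
  qed
qed

section \<open>Asymptotics at the cusps\<close>

lemma coprime_bezout_matrix:
  fixes r p :: int assumes "coprime r p"
  obtains r' p' where "r * p' - r' * p = 1"
proof -
  obtain u v where "u * r + v * p = 1" using assms bezout_int[of r p] by auto
  hence "r * u - (- v) * p = 1" by (simp add: algebra_simps)
  thus ?thesis using that by blast
qed

text \<open>Every point \<open>x + \<tau>\<close> near the cusp \<open>x = r/p\<close> is the image of a point with imaginary part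
  \<open>Im \<tau> / (p|\<tau>|)\<^sup>2\<close> under a matrix with first column \<open>(r, p)\<close>.\<close>

lemma cusp_coordinate:
  fixes r p r' p' :: int
  assumes "p > 0" "r * p' - r' * p = 1" "Im \<tau> > 0"
  defines "\<sigma> \<equiv> - of_int p' / of_int p - 1 / ((of_int p)\<^sup>2 * \<tau>)"
  shows "of_int p * \<sigma> + of_int p' = - 1 / (of_int p * \<tau>)"
    and "(of_int r * \<sigma> + of_int r') / (of_int p * \<sigma> + of_int p') = of_int r / of_int p + \<tau>"
    and "Im \<sigma> = Im \<tau> / (of_int p * norm \<tau>)\<^sup>2"
proof -
  have \<tau>: "\<tau> \<noteq> 0" using assms(3) by auto
  have p: "(of_int p :: complex) \<noteq> 0" using assms(1) by simp
  have det: "of_int r * of_int p' - of_int r' * of_int p = (1::complex)"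
    using arg_cong[OF assms(2), of "of_int :: int \<Rightarrow> complex"] by simp
  show 1: "of_int p * \<sigma> + of_int p' = - 1 / (of_int p * \<tau>)"
    using p \<tau> unfolding \<sigma>_def by (simp add: field_simps power2_eq_square)
  have "of_int r * \<sigma> + of_int r' = - (of_int r * of_int p' - of_int r' * of_int p) / of_int p - of_int r / ((of_int p)\<^sup>2 * \<tau>)"
    using p \<tau> unfolding \<sigma>_def by (simp add: field_simps)
  hence num: "of_int r * \<sigma> + of_int r' = - 1 / of_int p - of_int r / ((of_int p)\<^sup>2 * \<tau>)"
    unfolding det by simp
  show "(of_int r * \<sigma> + of_int r') / (of_int p * \<sigma> + of_int p') = of_int r / of_int p + \<tau>"
    unfolding 1 num using p \<tau> by (simp add: field_simps power2_eq_square)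
  have "Im (of_int p' / of_int p :: complex) = 0" by (simp add: Im_divide)
  moreover have "Im (1 / ((of_int p)\<^sup>2 * \<tau>)) = - Im \<tau> / (of_int p * norm \<tau>)\<^sup>2"
  proof -
    have "(of_int p)\<^sup>2 * \<tau> = of_real (of_int p ^ 2) * \<tau>" by simp
    hence "1 / ((of_int p)\<^sup>2 * \<tau>) = of_real (1 / of_int p ^ 2) * (1 / \<tau>)" by simp
    moreover have "Im (of_real a * z) = a * Im z" for a z by simp
    ultimately have "Im (1 / ((of_int p)\<^sup>2 * \<tau>)) = 1 / of_int p ^ 2 * Im (1 / \<tau>)" by (simp only:)
    also have "Im (1 / \<tau>) = - Im \<tau> / (norm \<tau>)\<^sup>2" by (simp add: Im_divide cmod_power2)
    finally show ?thesis by (simp add: power_mult_distrib)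
  qed
  ultimately show "Im \<sigma> = Im \<tau> / (of_int p * norm \<tau>)\<^sup>2" unfolding \<sigma>_def by simp
qed

text \<open>In the coordinate of the cusp the imaginary part is \<open>1 / (p\<^sup>2 t)\<close>, so that all Fourier coefficients but the
  constant one are exponentially small in \<open>1 / t\<close>.\<close>

lemma E_odd_pos_near_cusp:
  assumes g: "even g" and p: "p > 0" "coprime r p"
  obtains M where "M \<ge> 0" "\<And>t. 0 < t \<Longrightarrow> t \<le> 1 \<Longrightarrow>
     norm (E_odd (int g + 2) (of_int r / of_int p + \<i> * of_real t) - cusp_value g r p / (of_int p * (\<i> * of_real t)) ^ (g + 2))
       \<le> M / t ^ (g + 2) * exp (- pi / (of_int p ^ 2 * t))"
proof -
  obtain r' p' where det: "r * p' - r' * p = 1" using coprime_bezout_matrix[OF p(2)] by blast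
  obtain c where c: "poly_bounded c" "c 0 = cusp_value g r p"
    "\<And>\<tau>. Im \<tau> > 0 \<Longrightarrow> slash (g + 2) r r' p p' (E_odd (int g + 2)) \<tau> = qser c \<tau>"
    using slash_E_odd_expansion[OF g det] by blast
  have pos: "1 / (of_int p :: real) ^ 2 > 0" using p by simp
  obtain M where M: "M \<ge> 0" "\<And>\<tau>. Im \<tau> \<ge> 1 / of_int p ^ 2 \<Longrightarrow> norm (qser c \<tau> - c 0) \<le> M * exp (- pi * Im \<tau>)"
    using qser_minus_const_bound[OF c(1) pos] by blast
  show ?thesis
  proof (rule that[of M])
    fix t :: real assume t: "0 < t" "t \<le> 1"
    define \<tau> where "\<tau> = \<i> * of_real t"
    have \<tau>: "Im \<tau> > 0" "norm \<tau> = t" using t by (simp_all add: \<tau>_def norm_mult)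
    define \<sigma> where "\<sigma> = - of_int p' / of_int p - 1 / ((of_int p)\<^sup>2 * \<tau>)"
    note cc = cusp_coordinate[OF p(1) det \<tau>(1), folded \<sigma>_def]
    have Im\<sigma>: "Im \<sigma> = 1 / (of_int p ^ 2 * t)" unfolding cc(3) \<tau>(2) using t by (simp add: \<tau>_def power2_eq_square)
    have Im\<sigma>': "Im \<sigma> > 0" "Im \<sigma> \<ge> 1 / of_int p ^ 2"
    proof -
      show "Im \<sigma> > 0" unfolding Im\<sigma> using t p by simp
      have "of_int p ^ 2 * t \<le> of_int p ^ 2 * 1" using t by (intro mult_left_mono) auto
      thus "Im \<sigma> \<ge> 1 / of_int p ^ 2" unfolding Im\<sigma> using t p by (intro divide_left_mono) auto
    qed
    have "slash (g + 2) r r' p p' (E_odd (int g + 2)) \<sigma> =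
        (- 1 / (of_int p * \<tau>)) powi (- int (g + 2)) * E_odd (int g + 2) (of_int r / of_int p + \<tau>)"
      unfolding slash_def cc(2) unfolding cc(1) ..
    also have "(- 1 / (of_int p * \<tau>)) powi (- int (g + 2)) = (of_int p * \<tau>) ^ (g + 2)"
    proof -
      have "(- 1 / (of_int p * \<tau>)) powi (- int (g + 2)) = inverse ((- 1 / (of_int p * \<tau>)) ^ (g + 2))"
        by (simp only: power_int_minus power_int_of_nat)
      also have "\<dots> = (- (of_int p * \<tau>)) ^ (g + 2)"
      proof -
        have "inverse (- 1 / (of_int p * \<tau>)) = - (of_int p * \<tau>)" by simp
        thus ?thesis by (simp only: power_inverse[symmetric])
      qed
      finally show ?thesis using g by (simp add: power_minus_even)
    qed
    finally have sl: "slash (g + 2) r r' p p' (E_odd (int g + 2)) \<sigma> =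
        (of_int p * \<tau>) ^ (g + 2) * E_odd (int g + 2) (of_int r / of_int p + \<tau>)" .
    have e: "E_odd (int g + 2) (of_int r / of_int p + \<tau>) = qser c \<sigma> / (of_int p * \<tau>) ^ (g + 2)"
    proof -
      have h: "X = Q / A" if "S = A * X" "S = Q" "A \<noteq> 0" for A X Q S :: complex
        using that by auto
      have "(of_int p * \<tau>) ^ (g + 2) \<noteq> 0" using p \<tau>(1) by auto
      from h[OF sl c(3)[OF Im\<sigma>'(1)] this] show ?thesis .
    qed
    have "norm (E_odd (int g + 2) (of_int r / of_int p + \<tau>) - cusp_value g r p / (of_int p * \<tau>) ^ (g + 2)) =
        norm (qser c \<sigma> - c 0) / (of_int p * t) ^ (g + 2)"
      unfolding e c(2)[symmetric] using p \<tau>(2)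
      by (simp add: diff_divide_distrib[symmetric] norm_divide norm_power norm_mult)
    also have "\<dots> \<le> M * exp (- pi * Im \<sigma>) / t ^ (g + 2)"
    proof (rule frac_le)
      have "1 * t \<le> of_int p * t" using p t by (intro mult_right_mono) auto
      thus "t ^ (g + 2) \<le> (of_int p * t) ^ (g + 2)" using t by (intro power_mono) auto
    qed (use t M Im\<sigma>' in auto)
    finally show "norm (E_odd (int g + 2) (of_int r / of_int p + \<i> * of_real t) - cusp_value g r p / (of_int p * (\<i> * of_real t)) ^ (g + 2))
       \<le> M / t ^ (g + 2) * exp (- pi / (of_int p ^ 2 * t))"
      unfolding Im\<sigma> \<tau>_def by simp
  qed (rule M(1))
qed

text \<open>The constant Fourier coefficient at the cusp for \<open>g = 0\<close>. For \<open>g > 0\<close> that coefficient is multiplied by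
  \<open>\<tau>\<^sup>g\<close> and does not reach the constant term.\<close>

definition defect :: "nat \<Rightarrow> int \<Rightarrow> int \<Rightarrow> real" where
  "defect g r p = (if g = 0 then - cusp_sign r p * ln 2 / 4 else 0)"

lemma degree_pcompose_linear_le: "degree (pcompose P [:u, v:]) \<le> degree (P :: real poly)"
  by (simp add: degree_pcompose)

text \<open>The expansion of \<open>E\<^bsub>-g\<^esub>\<close> at a cusp up to first order. Only the real part of the constant term is
  identified here; it comes from the constant Fourier coefficient, all other contributions being \<open>i\<close> times
  real numbers.\<close>

lemma E_odd_neg_near_cusp:
  assumes g: "even g" and p: "p > 0" "coprime r p"
  obtains b :: real where "\<And>s. s > 0 \<Longrightarrow> \<exists>K. \<forall>\<tau>. 0 < norm \<tau> \<longrightarrow> norm \<tau> \<le> 1 \<longrightarrow> s * norm \<tau> \<le> Im \<tau> \<longrightarrow>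
     norm (E_odd (- int g) (of_int r / of_int p + \<tau>) -
        (\<i> * of_real (cusp_sign r p * odd_zeta (g + 2) / (2 * pi * of_int p ^ (g + 2))) / \<tau> + \<i> * of_real b + of_real (defect g r p)))
      \<le> K * norm \<tau>"
proof -
  define \<mu> where "\<mu> = - cusp_sign r p * odd_zeta (g + 2) / (2 * pi)"
  obtain r' p' where det: "r * p' - r' * p = 1" using coprime_bezout_matrix[OF p(2)] by blast
  obtain c where c: "poly_bounded c" "c 0 = of_real (cusp_sign r p * alt_zeta (Suc g) / 4)"
     "slash_rel g r r' p p' (E_odd (- int g)) (qser_plus g c \<mu>)"
    using E_odd_cusp_expansion[OF g det] unfolding \<mu>_def by blast
  obtain R where R: "degree R \<le> g" "\<And>\<tau>. Im \<tau> > 0 \<Longrightarrow>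
     (of_int p * \<tau> + of_int p') ^ g * E_odd (- int g) ((of_int r * \<tau> + of_int r') / (of_int p * \<tau> + of_int p')) =
     qser_plus g c \<mu> \<tau> + \<i> * poly (cpoly R) \<tau>" using slash_relE[OF c(3)] by blast
  define u v where "u = - of_int p' / (of_int p :: real)" and "v = - 1 / (of_int p :: real)^2"
  \<comment> \<open>the nonperiodic part as a polynomial in \<open>1/\<tau>\<close>: after multiplication with \<open>\<tau>\<^sup>g\<close> its top coefficient belongs to the pole
      and the next one to the constant term\<close>
  define P where "P = smult (of_int p ^ g) (pcompose (monom \<mu> (Suc g) + R) [:u, v:])"
  have degP: "degree P \<le> Suc g"
  proof -
    have "degree P \<le> degree (monom \<mu> (Suc g) + R)"
      unfolding P_def by (rule order_trans[OF degree_smult_le degree_pcompose_linear_le])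
    also have "\<dots> \<le> Suc g" by (intro degree_add_le degree_monom_le) (use R in auto)
    finally show ?thesis .
  qed
  have topP: "coeff P (Suc g) = - \<mu> / of_int p ^ (g + 2)"
  proof -
    have "coeff (pcompose (monom \<mu> (Suc g)) [:u, v:]) (Suc g) = \<mu> * v ^ Suc g"
    proof -
      have "pcompose (monom \<mu> (Suc g)) [:u, v:] = smult \<mu> ([:u, v:] ^ Suc g)"
      proof -
        have "pcompose (q ^ n) w = pcompose q w ^ n" for q w :: "real poly" and n
          by (induction n) (simp_all add: pcompose_mult pcompose_1)
        thus ?thesis by (simp add: monom_altdef pcompose_smult pcompose_pCons del: power_Suc)
      qed
      moreover have "coeff ([:u, v:] ^ Suc g) (Suc g) = v ^ Suc g"
      proof (cases "v = 0")
        case False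
        have "degree ([:u, v:] ^ Suc g) = Suc g" using False by (subst degree_power_eq) auto
        thus ?thesis using lead_coeff_power[of "[:u, v:]" "Suc g"] False by simp
      qed (use p in \<open>simp add: v_def\<close>)
      ultimately show ?thesis by simp
    qed
    moreover have "coeff (pcompose R [:u, v:]) (Suc g) = 0"
      by (intro coeff_eq_0 order.strict_trans1[OF degree_pcompose_linear_le]) (use R in simp)
    moreover have "of_int p ^ g * (\<mu> * v ^ Suc g) = - \<mu> / of_int p ^ (g + 2)"
    proof -
      have "v ^ Suc g = - (1 / (of_int p ^ g * of_int p ^ (g + 2)))"
        using g by (simp add: v_def power_divide power_mult_distrib power2_eq_square mult_ac)
      thus ?thesis using p by simp
    qed
    ultimately show ?thesis unfolding P_def pcompose_add by simp
  qed
  define a1 where "a1 = cusp_sign r p * odd_zeta (g + 2) / (2 * pi * of_int p ^ (g + 2))"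
  have a1: "coeff P (Suc g) = a1" unfolding topP a1_def \<mu>_def by simp
  define b where "b = coeff P g"
  define \<delta> where "\<delta> = (if g = 0 then c 0 else 0)"
  have \<delta>: "\<delta> = of_real (defect g r p)"
    using alt_zeta_1 by (simp add: \<delta>_def defect_def c(2))
  show ?thesis
  proof (rule that[of b])
    fix s :: real assume s: "s > 0"
    have pos: "s / (of_int p :: real) ^ 2 > 0" using p s by simp
    obtain M where M: "M \<ge> 0" "\<And>\<tau>. Im \<tau> \<ge> s / of_int p ^ 2 \<Longrightarrow> norm (qser c \<tau> - c 0) \<le> M * exp (- pi * Im \<tau>)"
      using qser_minus_const_bound[OF c(1) pos] by blast
    define K1 where "K1 = (\<Sum>k<g. \<bar>coeff P k\<bar>)"
    define K2 where "K2 = of_int p ^ g * (norm (c 0) + M + M * of_int p ^ 2 / (pi * s))"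
    show "\<exists>K. \<forall>\<tau>. 0 < norm \<tau> \<longrightarrow> norm \<tau> \<le> 1 \<longrightarrow> s * norm \<tau> \<le> Im \<tau> \<longrightarrow>
       norm (E_odd (- int g) (of_int r / of_int p + \<tau>) -
        (\<i> * of_real (cusp_sign r p * odd_zeta (g + 2) / (2 * pi * of_int p ^ (g + 2))) / \<tau> + \<i> * of_real b + of_real (defect g r p)))
        \<le> K * norm \<tau>"
    proof (intro exI[of _ "K1 + K2"] allI impI)
      fix \<tau> :: complex assume n\<tau>: "0 < norm \<tau>" "norm \<tau> \<le> 1" and sec: "s * norm \<tau> \<le> Im \<tau>"
      have Im\<tau>: "Im \<tau> > 0" using mult_pos_pos[OF s n\<tau>(1)] sec by simp
      have \<tau>0: "\<tau> \<noteq> 0" using n\<tau> by auto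
      define \<sigma> where "\<sigma> = - of_int p' / of_int p - 1 / ((of_int p)\<^sup>2 * \<tau>)"
      note cc = cusp_coordinate[OF p(1) det Im\<tau>, folded \<sigma>_def]
      have \<sigma>_eq: "\<sigma> = of_real u + of_real v * (1 / \<tau>)" by (simp add: \<sigma>_def u_def v_def)
      have Im\<sigma>: "Im \<sigma> \<ge> s / (of_int p ^ 2 * norm \<tau>)"
      proof -
        have "s / (of_int p ^ 2 * norm \<tau>) = s * norm \<tau> / (of_int p * norm \<tau>)\<^sup>2"
          using n\<tau> p by (simp add: power2_eq_square divide_simps)
        also have "\<dots> \<le> Im \<sigma>" unfolding cc(3) using sec by (intro divide_right_mono) auto
        finally show ?thesis .
      qed
      moreover have "s / of_int p ^ 2 \<le> s / (of_int p ^ 2 * norm \<tau>)"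
        using n\<tau> s p by (intro divide_left_mono) (auto simp: mult_le_cancel_left1)
      ultimately have Im\<sigma>': "Im \<sigma> \<ge> s / of_int p ^ 2" by simp
      hence Im\<sigma>0: "Im \<sigma> > 0" using pos by simp
      have h1: "(- 1 / (of_int p * \<tau>)) ^ g * E_odd (- int g) (of_int r / of_int p + \<tau>) = qser_plus g c \<mu> \<sigma> + \<i> * poly (cpoly R) \<sigma>"
        using R(2)[OF Im\<sigma>0] unfolding cc(2) unfolding cc(1) .
      have h2: "(- 1 / (of_int p * \<tau>)) ^ g = 1 / (of_int p * \<tau>) ^ g"
        using g by (simp add: power_divide)
      have h3: "X = Y" if "A * X = Q" "A = 1 / B" "B \<noteq> 0" "Y = B * Q" for A B X Y Q :: complex
        using that by auto
      have "(of_int p * \<tau>) ^ g \<noteq> 0" using p \<tau>0 by simp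
      from h3[OF h1 h2 this refl] have "E_odd (- int g) (of_int r / of_int p + \<tau>) = (of_int p * \<tau>) ^ g * (qser_plus g c \<mu> \<sigma> + \<i> * poly (cpoly R) \<sigma>)"
        .
      also have "qser_plus g c \<mu> \<sigma> + \<i> * poly (cpoly R) \<sigma> = qser c \<sigma> + \<i> * poly (cpoly (monom \<mu> (Suc g) + R)) \<sigma>"
        by (simp add: qser_plus_def cpoly_add map_poly_monom poly_monom algebra_simps)
      also have "(of_int p * \<tau>) ^ g * (qser c \<sigma> + \<i> * poly (cpoly (monom \<mu> (Suc g) + R)) \<sigma>) =
          (of_int p * \<tau>) ^ g * qser c \<sigma> + \<i> * (\<tau> ^ g * poly (cpoly P) (1 / \<tau>))"
      proof -
        have "cpoly (pcompose q [:u, v:]) = pcompose (cpoly q) [:of_real u, of_real v:]" for q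
        proof (induction q)
          case (pCons a q)
          have "cpoly [:u, v:] = [:of_real u, of_real v:]" "cpoly [:a:] = [:of_real a:]" by (simp_all add: map_poly_pCons)
          thus ?case using pCons by (simp add: pcompose_pCons cpoly_add cpoly_mult cpoly_smult map_poly_pCons)
        qed simp
        hence "poly (cpoly P) (1 / \<tau>) = of_int p ^ g * poly (cpoly (monom \<mu> (Suc g) + R)) \<sigma>"
          unfolding P_def cpoly_smult by (simp add: poly_pcompose \<sigma>_eq mult_ac)
        thus ?thesis by (simp add: power_mult_distrib algebra_simps)
      qed
      also have "\<tau> ^ g * poly (cpoly P) (1 / \<tau>) = of_real a1 / \<tau> + of_real b + (\<Sum>k<g. of_real (coeff P k) * \<tau> ^ (g - k))"
      proof -
        have "poly (cpoly P) (1 / \<tau>) = (\<Sum>k\<le>degree P. of_real (coeff P k) * (1 / \<tau>) ^ k)"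
          by (simp add: poly_altdef degree_map_poly coeff_map_poly)
        also have "\<dots> = (\<Sum>k\<le>Suc g. of_real (coeff P k) * (1 / \<tau>) ^ k)"
          by (rule sum.mono_neutral_left) (use degP in \<open>auto simp: coeff_eq_0\<close>)
        also have "\<tau> ^ g * \<dots> = (\<Sum>k\<le>g. of_real (coeff P k) * (\<tau> ^ g * (1 / \<tau>) ^ k)) + of_real a1 * (\<tau> ^ g * (1 / \<tau>) ^ Suc g)"
          by (simp add: a1 algebra_simps sum_distrib_left)
        also have "(\<Sum>k\<le>g. of_real (coeff P k) * (\<tau> ^ g * (1 / \<tau>) ^ k)) = (\<Sum>k\<le>g. of_real (coeff P k) * \<tau> ^ (g - k))"
        proof (rule sum.cong)
          fix k assume "k \<in> {..g}"
          hence "\<tau> ^ g = \<tau> ^ k * \<tau> ^ (g - k)" by (simp flip: power_add)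
          thus "of_real (coeff P k) * (\<tau> ^ g * (1 / \<tau>) ^ k) = of_real (coeff P k) * \<tau> ^ (g - k)"
            using \<tau>0 by (simp add: power_divide)
        qed simp
        also have "\<dots> = (\<Sum>k<g. of_real (coeff P k) * \<tau> ^ (g - k)) + of_real b"
          by (simp add: b_def flip: lessThan_Suc_atMost)
        also have "\<tau> ^ g * (1 / \<tau>) ^ Suc g = 1 / \<tau>" using \<tau>0 by (simp add: power_divide)
        finally show ?thesis by simp
      qed
      finally have E_eq: "E_odd (- int g) (of_int r / of_int p + \<tau>) - (\<i> * of_real a1 / \<tau> + \<i> * of_real b + \<delta>) =
         \<i> * (\<Sum>k<g. of_real (coeff P k) * \<tau> ^ (g - k)) + ((of_int p * \<tau>) ^ g * qser c \<sigma> - \<delta>)"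
        by (simp add: algebra_simps)
      have B1: "norm (\<i> * (\<Sum>k<g. of_real (coeff P k) * \<tau> ^ (g - k))) \<le> K1 * norm \<tau>"
      proof -
        have "norm (\<Sum>k<g. of_real (coeff P k) * \<tau> ^ (g - k)) \<le> (\<Sum>k<g. \<bar>coeff P k\<bar> * norm \<tau>)"
        proof (rule sum_norm_le)
          fix k assume "k \<in> {..<g}"
          hence "norm \<tau> ^ (g - k) \<le> norm \<tau> ^ 1" using n\<tau> by (intro power_decreasing) auto
          thus "norm (of_real (coeff P k) * \<tau> ^ (g - k)) \<le> \<bar>coeff P k\<bar> * norm \<tau>"
            by (simp add: norm_mult norm_power mult_left_mono)
        qed
        thus ?thesis by (simp add: norm_mult K1_def sum_distrib_right)
      qed
      have E1: "exp (- pi * Im \<sigma>) \<le> of_int p ^ 2 / (pi * s) * norm \<tau>"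
      proof -
        define y where "y = pi * (s / (of_int p ^ 2 * norm \<tau>))"
        have y: "y > 0" using s n\<tau> p by (simp add: y_def)
        have "y \<le> pi * Im \<sigma>" unfolding y_def by (rule mult_left_mono[OF Im\<sigma>]) simp
        hence "exp (- pi * Im \<sigma>) \<le> exp (- y)" by simp
        also have "\<dots> = 1 / exp y" by (simp add: exp_minus inverse_eq_divide)
        also have "\<dots> \<le> 1 / y"
          using y order_trans[OF _ exp_ge_add_one_self[of y], of y] by (intro divide_left_mono) auto
        also have "\<dots> = of_int p ^ 2 / (pi * s) * norm \<tau>" by (simp add: y_def)
        finally show ?thesis .
      qed
      have q: "norm (qser c \<sigma> - c 0) \<le> M * of_int p ^ 2 / (pi * s) * norm \<tau>"
        using order_trans[OF M(2)[OF Im\<sigma>'] mult_left_mono[OF E1 M(1)]] by (simp add: mult_ac)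
      have q': "norm (qser c \<sigma>) \<le> norm (c 0) + M"
      proof -
        have "norm (qser c \<sigma>) \<le> norm (c 0) + norm (qser c \<sigma> - c 0)" by (metis add_diff_cancel_left' add.commute diff_add_cancel norm_triangle_ineq)
        also have "norm (qser c \<sigma> - c 0) \<le> M * exp (- pi * Im \<sigma>)" by (rule M(2)[OF Im\<sigma>'])
        also have "\<dots> \<le> M * 1" using Im\<sigma>0 M(1) by (intro mult_left_mono) auto
        finally show ?thesis by simp
      qed
      have B2: "norm ((of_int p * \<tau>) ^ g * qser c \<sigma> - \<delta>) \<le> K2 * norm \<tau>"
      proof (cases "g = 0")
        case True
        hence "norm ((of_int p * \<tau>) ^ g * qser c \<sigma> - \<delta>) = norm (qser c \<sigma> - c 0)" by (simp add: \<delta>_def)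
        also have "\<dots> \<le> M * of_int p ^ 2 / (pi * s) * norm \<tau>" by (rule q)
        also have "\<dots> \<le> K2 * norm \<tau>" using True M(1) by (intro mult_right_mono) (auto simp: K2_def)
        finally show ?thesis .
      next
        case False
        hence "norm \<tau> ^ g \<le> norm \<tau> ^ 1" using n\<tau> by (intro power_decreasing) auto
        hence "of_int p ^ g * norm \<tau> ^ g * norm (qser c \<sigma>) \<le> of_int p ^ g * norm \<tau> * (norm (c 0) + M)"
          using p q' by (intro mult_mono mult_left_mono) auto
        also have "\<dots> = of_int p ^ g * (norm (c 0) + M) * norm \<tau>" by simp
        also have "\<dots> \<le> K2 * norm \<tau>" unfolding K2_def
          using p s M(1) by (intro mult_right_mono mult_left_mono) auto
        finally show ?thesis using False p by (simp add: \<delta>_def norm_mult norm_power power_mult_distrib)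
      qed
      have "norm (E_odd (- int g) (of_int r / of_int p + \<tau>) - (\<i> * of_real a1 / \<tau> + \<i> * of_real b + \<delta>)) \<le> (K1 + K2) * norm \<tau>"
        unfolding E_eq using norm_triangle_mono[OF B1 B2] by (simp add: algebra_simps)
      thus "norm (E_odd (- int g) (of_int r / of_int p + \<tau>) -
        (\<i> * of_real (cusp_sign r p * odd_zeta (g + 2) / (2 * pi * of_int p ^ (g + 2))) / \<tau> + \<i> * of_real b + of_real (defect g r p)))
        \<le> (K1 + K2) * norm \<tau>"
        unfolding a1_def \<delta> .
    qed
  qed
qed

section \<open>The cotangent sum as a value at the cusp\<close>

lemma higher_deriv_cot_reflect:
  assumes "0 < z" "z < 1"
  shows "(deriv ^^ n) cot (pi * (1 - z)) = - ((-1) ^ n * (deriv ^^ n) cot (pi * z))"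
proof -
  define f where "f = (\<lambda>l::nat. 1 / (z + real l) ^ Suc n - (-1) ^ n / (1 - z + real l) ^ Suc n)"
  have "(\<lambda>l. 1 / ((1 - z) + real l) ^ Suc n - (-1) ^ n / (1 - (1 - z) + real l) ^ Suc n) sums
     ((-1) ^ n * pi ^ Suc n * (deriv ^^ n) cot (pi * (1 - z)) / fact n)"
    by (rule higher_deriv_cot_sums_real) (use assms in auto)
  also have "(\<lambda>l. 1 / ((1 - z) + real l) ^ Suc n - (-1) ^ n / (1 - (1 - z) + real l) ^ Suc n) = (\<lambda>l. - ((-1) ^ n) * f l)"
    by (auto simp: f_def fun_eq_iff right_diff_distrib simp del: power_Suc)
  finally have 1: "(\<lambda>l. - ((-1) ^ n) * f l) sums ((-1) ^ n * pi ^ Suc n * (deriv ^^ n) cot (pi * (1 - z)) / fact n)" .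
  have "(\<lambda>l. - ((-1) ^ n) * f l) sums (- ((-1) ^ n) * ((-1) ^ n * pi ^ Suc n * (deriv ^^ n) cot (pi * z) / fact n))"
    unfolding f_def by (intro sums_mult higher_deriv_cot_sums_real assms)
  from sums_unique2[OF 1 this]
  have "((-1) ^ n * pi ^ Suc n / fact n) * (deriv ^^ n) cot (pi * (1 - z)) =
      ((-1) ^ n * pi ^ Suc n / fact n) * (- ((-1) ^ n * (deriv ^^ n) cot (pi * z)))"
    by (simp add: mult_ac)
  thus ?thesis by (simp only: mult_cancel_left) simp
qed

definition odd_residues :: "int \<Rightarrow> int set" where
  "odd_residues p = {b. 1 \<le> b \<and> b < 2 * p \<and> odd b}"

lemma finite_odd_residues [simp]: "finite (odd_residues p)"
  by (rule finite_subset[of _ "{1..2*p}"]) (auto simp: odd_residues_def)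

lemma sum_odd_residues_nat:
  assumes "p > 0"
  shows "(\<Sum>b\<in>odd_residues p. f b) = (\<Sum>j<nat p. f (2 * int j + 1))"
  by (rule sum.reindex_bij_witness[of _ "\<lambda>j. 2 * int j + 1" "\<lambda>b. nat (b div 2)"])
     (use assms in \<open>auto simp: odd_residues_def elim!: oddE\<close>)

lemma sum_odd_residues_reflect:
  "(\<Sum>b\<in>odd_residues p. f b) = (\<Sum>b\<in>odd_residues p. f (2 * p - b))"
  by (rule sum.reindex_bij_witness[of _ "\<lambda>b. 2 * p - b" "\<lambda>b. 2 * p - b"])
     (auto simp: odd_residues_def)

lemma sin_reflect:
  assumes "p > 0"
  shows "sin (pi * of_int (2 * p - b) * (of_int r / of_int p)) = - sin (pi * of_int b * (of_int r / of_int p))"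
proof -
  have "pi * of_int (2 * p - b) * (of_int r / of_int p) = - (pi * of_int b * (of_int r / of_int p)) + of_int r * (2 * pi)"
    using assms by (simp add: field_simps)
  also have "sin \<dots> = sin (- (pi * of_int b * (of_int r / of_int p)))"
    using sin.plus_of_int[of "- (pi * of_int b * (of_int r / of_int p))" r] by simp
  finally show ?thesis by simp
qed

text \<open>The reflection \<open>n \<mapsto> 2p - n\<close> preserves the summand, so the sum may be extended to all odd
  residues; at \<open>n = p\<close> the convention \<open>1 / 0 = 0\<close> makes the term vanish.\<close>

lemma S_odd_full_sum:
  assumes g: "even g" and q: "quotient_of x = (r, p)"
  shows "S_odd g x = 1 / (2 * of_int p ^ (g + 1)) * (\<Sum>n\<in>odd_residues p.
     (deriv ^^ g) cot (pi * of_int n / (2 * of_int p)) / sin (pi * of_int n * (of_int r / of_int p)))"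
proof -
  have p: "p > 0" using q by (rule quotient_of_denom_pos)
  have x: "(of_rat x :: real) = of_int r / of_int p"
    using quotient_of_div[OF q] by (simp add: of_rat_divide)
  define f where "f = (\<lambda>n::int. (deriv ^^ g) cot (pi * of_int n / (2 * of_int p)) / sin (pi * of_int n * (of_int r / of_int p)))"
  have refl: "f (2 * p - n) = f n" if "1 \<le> n" "n < 2 * p" for n
  proof -
    define z where "z = of_int n / (2 * of_int p :: real)"
    have z: "0 < z" "z < 1" using that p by (auto simp: z_def divide_simps)
    have "pi * of_int (2 * p - n) / (2 * of_int p) = pi * (1 - z)"
      using p by (simp add: z_def field_simps)
    hence "(deriv ^^ g) cot (pi * of_int (2 * p - n) / (2 * of_int p)) = - (deriv ^^ g) cot (pi * z)"
      using higher_deriv_cot_reflect[OF z, of g] g by simp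
    thus ?thesis unfolding f_def sin_reflect[OF p] by (simp add: z_def)
  qed
  let ?A = "{n. 1 \<le> n \<and> n \<le> p - 1 \<and> odd n}" and ?B = "{n. p + 1 \<le> n \<and> n < 2 * p \<and> odd n}" and ?C = "{n. n = p \<and> odd n}"
  have fin: "finite ?A" "finite ?B" "finite ?C"
    by (rule finite_subset[of _ "{1..2*p}"], auto)+
  have "odd_residues p = ?A \<union> ?B \<union> ?C" using p by (auto simp: odd_residues_def)
  hence "(\<Sum>n\<in>odd_residues p. f n) = sum f (?A \<union> ?B \<union> ?C)" by simp
  also have "\<dots> = sum f ?A + sum f ?B + sum f ?C"
    by (subst sum.union_disjoint; (subst sum.union_disjoint)?) (use fin in auto)
  also have "sum f ?C = 0"
    by (rule sum.neutral) (use p in \<open>auto simp: f_def\<close>)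
  also have "sum f ?B = sum f ?A"
    by (rule sum.reindex_bij_witness[of _ "\<lambda>n. 2 * p - n" "\<lambda>n. 2 * p - n"]) (use refl p in auto)
  finally have "(\<Sum>n\<in>odd_residues p. f n) = 2 * sum f ?A" by simp
  moreover have "S_odd g x = 1 / of_int p ^ (g + 1) * sum f ?A"
    unfolding S_odd_def Let_def q x f_def by simp
  ultimately show ?thesis unfolding f_def by simp
qed

definition csc_kernel :: "real \<Rightarrow> real \<Rightarrow> real" where
  "csc_kernel \<alpha> u = sin \<alpha> * cosh u / ((sin \<alpha>)\<^sup>2 + (sinh u)\<^sup>2)"

lemma Re_inverse_sin: "Re (1 / sin (Complex \<alpha> u)) = csc_kernel \<alpha> u"
proof -
  have re: "Re (sin (Complex \<alpha> u)) = sin \<alpha> * cosh u" by (simp add: Re_sin cosh_def)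
  have im: "Im (sin (Complex \<alpha> u)) = cos \<alpha> * sinh u" by (simp add: Im_sin sinh_def)
  have "(sin \<alpha> * cosh u)\<^sup>2 + (cos \<alpha> * sinh u)\<^sup>2 = (sin \<alpha>)\<^sup>2 + (sinh u)\<^sup>2"
    unfolding power_mult_distrib cosh_square_eq cos_squared_eq by (simp add: algebra_simps)
  thus ?thesis unfolding Re_divide re im csc_kernel_def by simp
qed

lemma csc_kernel_0: "csc_kernel \<alpha> 0 = 1 / sin \<alpha>"
  by (simp add: csc_kernel_def power2_eq_square)

lemma csc_kernel_abs: "\<bar>csc_kernel \<alpha> u\<bar> = \<bar>sin \<alpha>\<bar> * (cosh u / ((cosh u)\<^sup>2 - (cos \<alpha>)\<^sup>2))"
proof -
  have e: "(sin \<alpha>)\<^sup>2 + (sinh u)\<^sup>2 = (cosh u)\<^sup>2 - (cos \<alpha>)\<^sup>2"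
    by (simp add: cosh_square_eq sin_squared_eq)
  have "(sin \<alpha>)\<^sup>2 + (sinh u)\<^sup>2 \<ge> 0" by simp
  thus ?thesis unfolding csc_kernel_def e by (simp add: abs_mult)
qed

lemma csc_kernel_antimono:
  assumes "sin \<alpha> \<noteq> 0" "0 \<le> u" "u \<le> v"
  shows "\<bar>csc_kernel \<alpha> v\<bar> \<le> \<bar>csc_kernel \<alpha> u\<bar>"
proof -
  define q where "q = (cos \<alpha>)\<^sup>2"
  have q: "q \<ge> 0" "q < 1" using assms(1) by (simp add: q_def, simp add: q_def cos_squared_eq)
  define c1 c2 where "c1 = cosh u" and "c2 = cosh v"
  have c: "1 \<le> c1" "c1 \<le> c2"
    using assms by (auto simp: c1_def c2_def cosh_real_ge_1 cosh_real_nonneg_le_iff)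
  have d: "c1\<^sup>2 - q > 0" "c2\<^sup>2 - q > 0" using q c one_le_power[of c1 2] one_le_power[of c2 2] by linarith+
  have "c1 * (c2\<^sup>2 - q) - c2 * (c1\<^sup>2 - q) = (c1 * c2 + q) * (c2 - c1)"
    by (simp add: algebra_simps power2_eq_square)
  also have "\<dots> \<ge> 0" using c q by (intro mult_nonneg_nonneg add_nonneg_nonneg) auto
  finally have "c2 / (c2\<^sup>2 - q) \<le> c1 / (c1\<^sup>2 - q)"
    using d by (simp add: divide_simps)
  thus ?thesis unfolding csc_kernel_abs c1_def c2_def q_def by (intro mult_left_mono) auto
qed

lemma csc_kernel_sign: "\<bar>csc_kernel \<alpha> u\<bar> = sgn (sin \<alpha>) * csc_kernel \<alpha> u"
proof -
  have "cosh u / ((sin \<alpha>)\<^sup>2 + (sinh u)\<^sup>2) \<ge> 0" by simp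
  thus ?thesis unfolding csc_kernel_def by (simp add: abs_mult sgn_if)
qed

text \<open>The two progressions \<open>s + 2pl\<close> and \<open>2p - s + 2pl\<close> have one element each in every interval
  \<open>[2pl, 2p(l+1)]\<close>, and the kernel decreases; so the series of differences has telescoping majorants
  and converges uniformly in \<open>y\<close>, although the two separate series diverge at \<open>y = 0\<close> when \<open>g = 0\<close>.\<close>

lemma paired_series_limit:
  fixes p s V \<alpha> y :: real and g :: nat
  assumes p: "p > (0::real)" and s: "0 < s" "s < 2 * p" and V:
    "(\<lambda>l. (1 / (s + 2 * p * real l) ^ Suc g - 1 / (2 * p - s + 2 * p * real l) ^ Suc g)) sums V"
  defines "a \<equiv> (\<lambda>y l. csc_kernel \<alpha> (pi * (s + 2 * p * real l) * y) / (s + 2 * p * real l) ^ Suc g -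
                     csc_kernel \<alpha> (pi * (2 * p - s + 2 * p * real l) * y) / (2 * p - s + 2 * p * real l) ^ Suc g)"
  shows "y > 0 \<Longrightarrow> summable (a y)" and "((\<lambda>y. \<Sum>l. a y l) \<longlongrightarrow> V / sin \<alpha>) (at_right 0)"
proof -
  have "(y > 0 \<longrightarrow> summable (a y)) \<and> ((\<lambda>y. \<Sum>l. a y l) \<longlongrightarrow> V / sin \<alpha>) (at_right 0)" for y
  proof (cases "sin \<alpha> = 0")
    case True
    hence "a = (\<lambda>y l. 0)" by (simp add: a_def csc_kernel_def)
    thus ?thesis using True by simp
  next
    case False
    define \<phi> where "\<phi> = (\<lambda>y v. \<bar>csc_kernel \<alpha> (pi * v * y)\<bar> / v ^ Suc g)"
    have \<phi>_anti: "\<phi> y w \<le> \<phi> y v" if "0 < v" "v \<le> w" "y > 0" for v w y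
      unfolding \<phi>_def
    proof (rule frac_le)
      show "\<bar>csc_kernel \<alpha> (pi * w * y)\<bar> \<le> \<bar>csc_kernel \<alpha> (pi * v * y)\<bar>"
        using False that by (intro csc_kernel_antimono) auto
      show "v ^ Suc g \<le> w ^ Suc g" using that by (intro power_mono) auto
    qed (use that in auto)
    have \<phi>_nonneg: "\<phi> y v \<ge> 0" if "v > 0" for y v using that by (simp add: \<phi>_def)
    define C where "C = \<bar>1 / sin \<alpha>\<bar>"
    have \<phi>_bound: "\<phi> y (2 * p * real l) \<le> C / (2 * p) ^ Suc g * (1 / real l)" if "y > 0" "l > 0" for y l
    proof -
      have "\<phi> y (2 * p * real l) \<le> C / (2 * p * real l) ^ Suc g"
        unfolding \<phi>_def C_def csc_kernel_0[symmetric]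
        by (intro divide_right_mono csc_kernel_antimono) (use that p False in auto)
      also have "\<dots> = C / (2 * p) ^ Suc g * (1 / real l ^ Suc g)" by (simp add: power_mult_distrib)
      also have "\<dots> \<le> C / (2 * p) ^ Suc g * (1 / real l)"
      proof (rule mult_left_mono)
        have "real l ^ 1 \<le> real l ^ Suc g" using that by (intro power_increasing) auto
        thus "1 / real l ^ Suc g \<le> 1 / real l" using that by (intro divide_left_mono) auto
      qed (use p in \<open>simp add: C_def\<close>)
      finally show ?thesis .
    qed
    have a_eq: "a y l = sgn (sin \<alpha>) * (\<phi> y (s + 2 * p * real l) - \<phi> y (2 * p - s + 2 * p * real l))" for y l
      unfolding a_def \<phi>_def csc_kernel_sign using False by (simp add: right_diff_distrib sgn_if)
    have a_bound: "\<bar>a y l\<bar> \<le> \<phi> y (2 * p * real l) - \<phi> y (2 * p * real (Suc l))" if "y > 0" "l > 0" for y l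
    proof -
      have in1: "\<phi> y v \<in> {\<phi> y (2 * p * real (Suc l)).. \<phi> y (2 * p * real l)}"
        if "2 * p * real l \<le> v" "v \<le> 2 * p * real (Suc l)" for v
      proof -
        have l0: "0 < 2 * p * real l" using p \<open>l > 0\<close> by simp
        hence "0 < v" using that by linarith
        with l0 show ?thesis
          using \<phi>_anti[of "2 * p * real l" v y] \<phi>_anti[of v "2 * p * real (Suc l)" y] that \<open>y > 0\<close> by simp
      qed
      have "\<phi> y (s + 2 * p * real l) \<in> {\<phi> y (2 * p * real (Suc l)).. \<phi> y (2 * p * real l)}"
           "\<phi> y (2 * p - s + 2 * p * real l) \<in> {\<phi> y (2 * p * real (Suc l)).. \<phi> y (2 * p * real l)}"
        by (rule in1; use s in \<open>simp add: algebra_simps\<close>)+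
      moreover have "\<bar>a y l\<bar> = \<bar>\<phi> y (s + 2 * p * real l) - \<phi> y (2 * p - s + 2 * p * real l)\<bar>"
        unfolding a_eq using False by (simp add: abs_mult)
      ultimately show ?thesis by auto
    qed
    have \<phi>_lim: "(\<lambda>l. \<phi> y (2 * p * real l)) \<longlonglongrightarrow> 0" if "y > 0" for y
    proof (rule real_tendsto_sandwich)
      show "\<forall>\<^sub>F l in sequentially. 0 \<le> \<phi> y (2 * p * real l)"
        using eventually_gt_at_top[of 0] by eventually_elim (use p \<phi>_nonneg in simp)
      show "\<forall>\<^sub>F l in sequentially. \<phi> y (2 * p * real l) \<le> C / (2 * p) ^ Suc g * (1 / real l)"
        using eventually_gt_at_top[of 0] by eventually_elim (use that in \<open>rule \<phi>_bound\<close>)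
      show "(\<lambda>l. C / (2 * p) ^ Suc g * (1 / real l)) \<longlonglongrightarrow> 0"
        by (intro tendsto_mult_right_zero lim_1_over_n)
    qed simp
    have tail: "summable (\<lambda>l. a y (l + L))" "\<bar>\<Sum>l. a y (l + L)\<bar> \<le> C / (2 * p) ^ Suc g * (1 / real L)"
      if y: "y > 0" and L: "L > 0" for y L
    proof -
      have lim: "(\<lambda>l. \<phi> y (2 * p * real (l + L))) \<longlonglongrightarrow> 0"
        using LIMSEQ_ignore_initial_segment[OF \<phi>_lim[OF y], of L] .
      have tel: "(\<lambda>l. \<phi> y (2 * p * real (l + L)) - \<phi> y (2 * p * real (Suc (l + L)))) sums \<phi> y (2 * p * real L)"
        using telescope_sums'[OF lim] by simp
      have b: "norm (a y (l + L)) \<le> \<phi> y (2 * p * real (l + L)) - \<phi> y (2 * p * real (Suc (l + L)))" for l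
        using a_bound[OF y, of "l + L"] L by simp
      show s: "summable (\<lambda>l. a y (l + L))"
        by (rule summable_comparison_test'[OF sums_summable[OF tel], of 0]) (rule b)
      have "norm (\<Sum>l. a y (l + L)) \<le> (\<Sum>l. \<phi> y (2 * p * real (l + L)) - \<phi> y (2 * p * real (Suc (l + L))))"
        by (rule norm_suminf_le[OF b sums_summable[OF tel]])
      also have "\<dots> = \<phi> y (2 * p * real L)" using tel by (rule sums_unique[symmetric])
      also have "\<dots> \<le> C / (2 * p) ^ Suc g * (1 / real L)" by (rule \<phi>_bound[OF y L])
      finally show "\<bar>\<Sum>l. a y (l + L)\<bar> \<le> C / (2 * p) ^ Suc g * (1 / real L)" by simp
    qed
    have summ: "summable (a y)" if "y > 0" for y
      using tail(1)[OF that, of 1] summable_iff_shift[of "a y" 1] by simp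
    have term_lim: "((\<lambda>y. a y l) \<longlongrightarrow> (1 / (s + 2 * p * real l) ^ Suc g - 1 / (2 * p - s + 2 * p * real l) ^ Suc g) / sin \<alpha>) (at 0 within {0<..})" for l
    proof -
      have cont: "isCont (\<lambda>y. csc_kernel \<alpha> (pi * v * y)) 0" for v
        unfolding csc_kernel_def using False by (intro continuous_intros) auto
      have lim: "((\<lambda>y. csc_kernel \<alpha> (pi * v * y)) \<longlongrightarrow> 1 / sin \<alpha>) (at 0 within {0<..})" for v
        using cont[of v] unfolding isCont_def
        by (simp add: csc_kernel_0) (rule filterlim_mono[OF _ order_refl at_le], auto)
      have "((\<lambda>y. a y l) \<longlongrightarrow> 1 / sin \<alpha> / (s + 2 * p * real l) ^ Suc g - 1 / sin \<alpha> / (2 * p - s + 2 * p * real l) ^ Suc g) (at 0 within {0<..})"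
      proof -
        have "s + 2 * p * real l > 0" "2 * p - s + 2 * p * real l > 0"
          using p s by (auto intro: add_pos_nonneg)
        thus ?thesis unfolding a_def by (intro tendsto_diff tendsto_divide lim tendsto_const) auto
      qed
      thus ?thesis
        by (simp add: diff_divide_distrib mult.commute)
    qed
    have "((\<lambda>y. \<Sum>l. a y l) \<longlongrightarrow> V / sin \<alpha>) (at 0 within {0<..})"
    proof (rule swap_uniform_limit)
      show "\<forall>\<^sub>F L in sequentially. ((\<lambda>y. \<Sum>l<L. a y l) \<longlongrightarrow> (\<Sum>l<L.
          (1 / (s + 2 * p * real l) ^ Suc g - 1 / (2 * p - s + 2 * p * real l) ^ Suc g) / sin \<alpha>)) (at 0 within {0<..})"
        by (intro always_eventually allI tendsto_sum term_lim)
      show "(\<lambda>L. \<Sum>l<L. (1 / (s + 2 * p * real l) ^ Suc g - 1 / (2 * p - s + 2 * p * real l) ^ Suc g) / sin \<alpha>) \<longlonglongrightarrow> V / sin \<alpha>"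
        using sums_divide[OF V, of "sin \<alpha>"] by (simp add: sums_def)
      show "uniform_limit {0<..} (\<lambda>L y. \<Sum>l<L. a y l) (\<lambda>y. \<Sum>l. a y l) sequentially"
      proof (rule uniform_limitI)
        fix e :: real assume e: "e > 0"
        have "(\<lambda>L. C / (2 * p) ^ Suc g * (1 / real L)) \<longlonglongrightarrow> 0"
          by (intro tendsto_mult_right_zero lim_1_over_n)
        hence "\<forall>\<^sub>F L in sequentially. C / (2 * p) ^ Suc g * (1 / real L) < e \<and> L > 0"
          using e by (intro eventually_conj order_tendstoD eventually_gt_at_top) auto
        thus "\<forall>\<^sub>F L in sequentially. \<forall>y\<in>{0<..}. dist (\<Sum>l<L. a y l) (\<Sum>l. a y l) < e"
        proof (eventually_elim, intro ballI)
          fix L and y :: real assume L: "C / (2 * p) ^ Suc g * (1 / real L) < e \<and> L > 0" and y: "y \<in> {0<..}"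
          have "(\<Sum>l. a y l) = (\<Sum>l. a y (l + L)) + (\<Sum>l<L. a y l)"
            using suminf_split_initial_segment[OF summ, of y L] y by simp
          hence "dist (\<Sum>l<L. a y l) (\<Sum>l. a y l) = \<bar>\<Sum>l. a y (l + L)\<bar>" by (simp add: dist_real_def)
          also have "\<dots> < e" using tail(2)[of y L] L y by force
          finally show "dist (\<Sum>l<L. a y l) (\<Sum>l. a y l) < e" .
        qed
      qed
    qed simp
    thus ?thesis using summ by simp
  qed
  thus "y > 0 \<Longrightarrow> summable (a y)" and "((\<lambda>y. \<Sum>l. a y l) \<longlongrightarrow> V / sin \<alpha>) (at_right 0)" by blast+
qed

lemma Im_E_odd_sums:
  assumes "y > 0"
  shows "(\<lambda>i. csc_kernel (pi * (2 * real i + 1) * X) (pi * (2 * real i + 1) * y) / (2 * real i + 1) ^ Suc g / 2) sums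
    Im (E_odd (- int g) (of_real X + \<i> * of_real y))"
proof -
  have "(\<lambda>i. Im (\<i> / (2 * (2 * of_nat i + 1) ^ Suc g * sin (of_real pi * (2 * of_nat i + 1) * (of_real X + \<i> * of_real y))))) sums
     Im (E_odd (- int g) (of_real X + \<i> * of_real y))"
    by (intro sums_Im E_odd_sine_sums) (use assms in simp)
  also have "(\<lambda>i. Im (\<i> / (2 * (2 * of_nat i + 1) ^ Suc g * sin (of_real pi * (2 * of_nat i + 1) * (of_real X + \<i> * of_real y))))) =
     (\<lambda>i. csc_kernel (pi * (2 * real i + 1) * X) (pi * (2 * real i + 1) * y) / (2 * real i + 1) ^ Suc g / 2)"
  proof
    fix i
    define D where "D = 2 * real i + 1"
    have arg: "of_real pi * (2 * of_nat i + 1) * (of_real X + \<i> * of_real y) = Complex (pi * D * X) (pi * D * y)"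
      by (simp add: D_def complex_eq_iff algebra_simps)
    define w where "w = sin (Complex (pi * D * X) (pi * D * y))"
    have Dc: "2 * of_nat i + 1 = complex_of_real D" by (simp add: D_def)
    have "\<i> / (2 * (2 * of_nat i + 1) ^ Suc g * w) = of_real (1 / (2 * D ^ Suc g)) * (\<i> * (1 / w))"
      unfolding Dc by simp
    moreover have "Im (of_real c * (\<i> * z)) = c * Re z" for c z by simp
    ultimately have "Im (\<i> / (2 * (2 * of_nat i + 1) ^ Suc g * w)) = 1 / (2 * D ^ Suc g) * Re (1 / w)"
      by (simp only:)
    also have "Re (1 / w) = csc_kernel (pi * D * X) (pi * D * y)"
      unfolding w_def by (rule Re_inverse_sin)
    finally show "Im (\<i> / (2 * (2 * of_nat i + 1) ^ Suc g * sin (of_real pi * (2 * of_nat i + 1) * (of_real X + \<i> * of_real y)))) =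
      csc_kernel (pi * (2 * real i + 1) * X) (pi * (2 * real i + 1) * y) / (2 * real i + 1) ^ Suc g / 2"
      unfolding arg w_def by (simp add: D_def mult_ac)
  qed
  finally show ?thesis .
qed

text \<open>The cosecant only depends on the residue \<open>b\<close> of the frequency modulo \<open>2p\<close>, up to the height. So in the limit the
  residue class of \<open>b\<close>, paired with that of \<open>2p - b\<close>, contributes the partial fraction series of
  \<open>cot\<^bsup>(g)\<^esup> (\<pi> b / 2p)\<close> divided by \<open>sin (\<pi> b x)\<close>.\<close>

lemma Im_E_odd_limit:
  assumes g: "even g" and q: "quotient_of x = (r, p)"
  shows "((\<lambda>y. Im (E_odd (- int g) (of_real (of_int r / of_int p) + \<i> * of_real y))) \<longlongrightarrow>
     pi ^ (g + 1) / (2 ^ (g + 2) * fact g) * S_odd g x) (at_right 0)"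
proof -
  have p: "p > 0" using q by (rule quotient_of_denom_pos)
  define P where "P = (of_int p :: real)"
  have P: "P > 0" using p by (simp add: P_def)
  define X where "X = (of_int r / of_int p :: real)"
  define \<alpha> where "\<alpha> = (\<lambda>b::int. pi * of_int b * X)"
  define a where "a = (\<lambda>b (y::real) (l::nat).
     csc_kernel (\<alpha> b) (pi * (of_int b + 2 * P * real l) * y) / (of_int b + 2 * P * real l) ^ Suc g -
     csc_kernel (\<alpha> b) (pi * (2 * P - of_int b + 2 * P * real l) * y) / (2 * P - of_int b + 2 * P * real l) ^ Suc g)"
  define V where "V = (\<lambda>b::int. (pi / (2 * P)) ^ Suc g * (deriv ^^ g) cot (pi * of_int b / (2 * of_int p)) / fact g)"
  have V: "(\<lambda>l. 1 / (of_int b + 2 * P * real l) ^ Suc g - 1 / (2 * P - of_int b + 2 * P * real l) ^ Suc g) sums V b"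
    if "b \<in> odd_residues p" for b
  proof -
    define z where "z = of_int b / (2 * P)"
    have z: "0 < z" "z < 1" using that P by (auto simp: z_def odd_residues_def P_def divide_simps)
    have "(\<lambda>l. 1 / (2 * P) ^ Suc g * (1 / (z + real l) ^ Suc g - (-1) ^ g / (1 - z + real l) ^ Suc g)) sums
       (1 / (2 * P) ^ Suc g * ((-1) ^ g * pi ^ Suc g * (deriv ^^ g) cot (pi * z) / fact g))"
      by (intro sums_mult higher_deriv_cot_sums_real z)
    also have "(\<lambda>l. 1 / (2 * P) ^ Suc g * (1 / (z + real l) ^ Suc g - (-1) ^ g / (1 - z + real l) ^ Suc g)) =
       (\<lambda>l. 1 / (of_int b + 2 * P * real l) ^ Suc g - 1 / (2 * P - of_int b + 2 * P * real l) ^ Suc g)"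
    proof
      fix l
      have "of_int b + 2 * P * real l = 2 * P * (z + real l)" "2 * P - of_int b + 2 * P * real l = 2 * P * (1 - z + real l)"
        using P by (simp_all add: z_def field_simps)
      thus "1 / (2 * P) ^ Suc g * (1 / (z + real l) ^ Suc g - (-1) ^ g / (1 - z + real l) ^ Suc g) =
         1 / (of_int b + 2 * P * real l) ^ Suc g - 1 / (2 * P - of_int b + 2 * P * real l) ^ Suc g"
        using g by (simp only: power_mult_distrib) (simp add: right_diff_distrib)
    qed
    also have "1 / (2 * P) ^ Suc g * ((-1) ^ g * pi ^ Suc g * (deriv ^^ g) cot (pi * z) / fact g) = V b"
      using g by (simp add: V_def z_def power_divide P_def)
    finally show ?thesis .
  qed
  have lim: "summable (a b y)" if "y > 0" "b \<in> odd_residues p" for b y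
    unfolding a_def using that V[of b] P
    by (intro paired_series_limit(1)[where V = "V b"]) (auto simp: odd_residues_def P_def)
  have lim': "((\<lambda>y. \<Sum>l. a b y l) \<longlongrightarrow> V b / sin (\<alpha> b)) (at_right 0)" if "b \<in> odd_residues p" for b
    unfolding a_def using that V[of b] P
    by (intro paired_series_limit(2)[where V = "V b"]) (auto simp: odd_residues_def P_def)
  have eq: "Im (E_odd (- int g) (of_real X + \<i> * of_real y)) = (\<Sum>b\<in>odd_residues p. \<Sum>l. a b y l) / 4" if y: "y > 0" for y
  proof -
    define h where "h = (\<lambda>i::nat. csc_kernel (pi * (2 * real i + 1) * X) (pi * (2 * real i + 1) * y) / (2 * real i + 1) ^ Suc g / 2)"
    define H where "H = (\<lambda>b v. csc_kernel (\<alpha> b) (pi * v * y) / v ^ Suc g)"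
    have "(\<lambda>l. \<Sum>i\<in>{l * nat p..<l * nat p + nat p}. h i) sums Im (E_odd (- int g) (of_real X + \<i> * of_real y))"
      unfolding h_def by (rule sums_group[OF Im_E_odd_sums[OF y]]) (use p in simp)
    also have "(\<lambda>l. \<Sum>i\<in>{l * nat p..<l * nat p + nat p}. h i) = (\<lambda>l. \<Sum>b\<in>odd_residues p. a b y l / 4)"
    proof
      fix l :: nat
      have "(\<Sum>i\<in>{l * nat p..<l * nat p + nat p}. h i) = (\<Sum>j<nat p. h (l * nat p + j))"
        by (rule sum.reindex_bij_witness[of _ "\<lambda>j. l * nat p + j" "\<lambda>i. i - l * nat p"]) auto
      also have "\<dots> = (\<Sum>j<nat p. H (2 * int j + 1) (of_int (2 * int j + 1) + 2 * P * real l) / 2)"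
      proof (rule sum.cong)
        fix j
        have v: "2 * real (l * nat p + j) + 1 = of_int (2 * int j + 1) + 2 * P * real l"
          using p by (simp add: P_def)
        have "csc_kernel (pi * (of_int (2 * int j + 1) + 2 * P * real l) * X) = csc_kernel (\<alpha> (2 * int j + 1))"
        proof -
          have "pi * (of_int (2 * int j + 1) + 2 * P * real l) * X = \<alpha> (2 * int j + 1) + of_int (int l * r) * (2 * pi)"
            using p by (simp add: \<alpha>_def X_def P_def field_simps)
          moreover have "sin (\<alpha> (2 * int j + 1) + of_int (int l * r) * (2 * pi)) = sin (\<alpha> (2 * int j + 1))"
            using sin.plus_of_int[of "\<alpha> (2 * int j + 1)" "int l * r"] by simp
          ultimately have "sin (pi * (of_int (2 * int j + 1) + 2 * P * real l) * X) = sin (\<alpha> (2 * int j + 1))"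
            by (simp only:)
          thus ?thesis by (simp add: csc_kernel_def fun_eq_iff)
        qed
        thus "h (l * nat p + j) = H (2 * int j + 1) (of_int (2 * int j + 1) + 2 * P * real l) / 2"
          unfolding h_def v H_def by simp
      qed simp
      also have "\<dots> = (\<Sum>b\<in>odd_residues p. H b (of_int b + 2 * P * real l) / 2)"
        by (rule sum_odd_residues_nat[OF p, symmetric])
      finally have 1: "(\<Sum>i\<in>{l * nat p..<l * nat p + nat p}. h i) = (\<Sum>b\<in>odd_residues p. H b (of_int b + 2 * P * real l) / 2)" .
      also have "\<dots> = (\<Sum>b\<in>odd_residues p. H (2 * p - b) (of_int (2 * p - b) + 2 * P * real l) / 2)"
        by (rule sum_odd_residues_reflect)
      also have "\<dots> = (\<Sum>b\<in>odd_residues p. - H b (2 * P - of_int b + 2 * P * real l) / 2)"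
      proof (rule sum.cong)
        fix b
        have "sin (\<alpha> (2 * p - b)) = - sin (\<alpha> b)" unfolding \<alpha>_def X_def by (rule sin_reflect[OF p])
        hence "H (2 * p - b) v = - H b v" for v by (simp add: H_def csc_kernel_def)
        thus "H (2 * p - b) (of_int (2 * p - b) + 2 * P * real l) / 2 = - H b (2 * P - of_int b + 2 * P * real l) / 2"
          by (simp add: P_def)
      qed simp
      finally have 2: "(\<Sum>i\<in>{l * nat p..<l * nat p + nat p}. h i) = (\<Sum>b\<in>odd_residues p. - H b (2 * P - of_int b + 2 * P * real l) / 2)" .
      \<comment> \<open>the average of the block and its reflection consists of the paired terms\<close>
      have "2 * (\<Sum>i\<in>{l * nat p..<l * nat p + nat p}. h i) = (\<Sum>b\<in>odd_residues p. a b y l / 2)"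
        unfolding mult_2 by (subst 1, subst 2) (simp add: sum.distrib[symmetric] a_def H_def diff_divide_distrib)
      thus "(\<Sum>i\<in>{l * nat p..<l * nat p + nat p}. h i) = (\<Sum>b\<in>odd_residues p. a b y l / 4)"
        by (simp add: sum_divide_distrib[symmetric])
    qed
    finally have s1: "(\<lambda>l. \<Sum>b\<in>odd_residues p. a b y l / 4) sums Im (E_odd (- int g) (of_real X + \<i> * of_real y))" .
    have "(\<lambda>l. \<Sum>b\<in>odd_residues p. a b y l / 4) sums (\<Sum>b\<in>odd_residues p. (\<Sum>l. a b y l) / 4)"
      by (intro sums_sum sums_divide summable_sums lim y)
    from sums_unique2[OF s1 this] show ?thesis by (simp add: sum_divide_distrib)
  qed
  have "((\<lambda>y. (\<Sum>b\<in>odd_residues p. \<Sum>l. a b y l) / 4) \<longlongrightarrow> (\<Sum>b\<in>odd_residues p. V b / sin (\<alpha> b)) / 4) (at_right 0)"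
    by (intro tendsto_intros lim') simp_all
  also have "?this \<longleftrightarrow> ((\<lambda>y. Im (E_odd (- int g) (of_real X + \<i> * of_real y))) \<longlongrightarrow> (\<Sum>b\<in>odd_residues p. V b / sin (\<alpha> b)) / 4) (at_right 0)"
    by (rule tendsto_cong) (use eq in \<open>auto simp: eventually_at_right_field intro: exI[of _ 1]\<close>)
  also have "(\<Sum>b\<in>odd_residues p. V b / sin (\<alpha> b)) / 4 = pi ^ (g + 1) / (2 ^ (g + 2) * fact g) * S_odd g x"
  proof -
    have "(\<Sum>b\<in>odd_residues p. V b / sin (\<alpha> b)) = (pi / (2 * P)) ^ Suc g / fact g * (\<Sum>b\<in>odd_residues p.
        (deriv ^^ g) cot (pi * of_int b / (2 * of_int p)) / sin (pi * of_int b * (of_int r / of_int p)))"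
      by (simp add: sum_distrib_left V_def \<alpha>_def X_def)
    also have "(\<Sum>b\<in>odd_residues p.
        (deriv ^^ g) cot (pi * of_int b / (2 * of_int p)) / sin (pi * of_int b * (of_int r / of_int p))) =
        2 * P ^ Suc g * S_odd g x"
      unfolding S_odd_full_sum[OF g q] using P by (simp add: P_def)
    also have "(pi / (2 * P)) ^ Suc g / fact g * (2 * P ^ Suc g * S_odd g x) / 4 = pi ^ (g + 1) / (2 ^ (g + 2) * fact g) * S_odd g x"
      using P by (simp add: power_divide power_mult_distrib)
    finally show ?thesis .
  qed
  finally show ?thesis unfolding X_def .
qed

lemma tendsto_linear_bound_at_right:
  fixes f :: "real \<Rightarrow> real"
  assumes "\<And>y. 0 < y \<Longrightarrow> y \<le> 1 \<Longrightarrow> \<bar>f y - b\<bar> \<le> K * y"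
  shows "(f \<longlongrightarrow> b) (at_right 0)"
proof -
  have "((\<lambda>y. K * y) \<longlongrightarrow> K * 0) (at_right 0)" by (intro tendsto_intros)
  moreover have "\<forall>\<^sub>F y in at_right 0. norm (f y - b) \<le> K * y"
    using eventually_at_right_real[OF zero_less_one] by eventually_elim (use assms in auto)
  ultimately have "((\<lambda>y. f y - b) \<longlongrightarrow> 0) (at_right 0)"
    using Lim_null_comparison[of "\<lambda>y. f y - b" "\<lambda>y. K * y"] by simp
  thus ?thesis by (simp add: Lim_null[of f])
qed

definition cusp_constant_term :: "nat \<Rightarrow> rat \<Rightarrow> complex" where
  "cusp_constant_term g x = \<i> * of_real (pi ^ (g + 1) / (2 ^ (g + 2) * fact g) * S_odd g x) + of_real (weight2_defect g x)"

lemma weight2_defect_eq: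
  assumes "quotient_of x = (r, p)" shows "weight2_defect g x = defect g r p"
  using assms by (auto simp: weight2_defect_def defect_def cusp_sign_def)

text \<open>The expansion is known up to the imaginary part of its constant term, which the radial limit supplies.\<close>

theorem E_odd_asymptotics:
  assumes g: "even g" and q: "quotient_of x = (r, p)" and s: "s > 0"
  shows "\<exists>K. \<forall>\<tau>. 0 < norm \<tau> \<longrightarrow> norm \<tau> \<le> 1 \<longrightarrow> s * norm \<tau> \<le> Im \<tau> \<longrightarrow>
     norm (E_odd (- int g) (of_rat x + \<tau>) -
        (\<i> * of_real (cusp_sign r p * odd_zeta (g + 2) / (2 * pi * of_int p ^ (g + 2))) / \<tau> + cusp_constant_term g x))
      \<le> K * norm \<tau>"
proof -
  have p: "p > 0" "coprime r p" using q quotient_of_denom_pos quotient_of_coprime by blast+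
  have x: "(of_rat x :: complex) = of_int r / of_int p"
    using quotient_of_div[OF q] by (simp add: of_rat_divide)
  define a where "a = cusp_sign r p * odd_zeta (g + 2) / (2 * pi * of_int p ^ (g + 2))"
  obtain b :: real where b: "\<And>s. s > 0 \<Longrightarrow> \<exists>K. \<forall>\<tau>. 0 < norm \<tau> \<longrightarrow> norm \<tau> \<le> 1 \<longrightarrow> s * norm \<tau> \<le> Im \<tau> \<longrightarrow>
     norm (E_odd (- int g) (of_int r / of_int p + \<tau>) -
        (\<i> * of_real a / \<tau> + \<i> * of_real b + of_real (defect g r p))) \<le> K * norm \<tau>"
    using E_odd_neg_near_cusp[OF g p] unfolding a_def by blast
  obtain K where K: "\<And>\<tau>. 0 < norm \<tau> \<Longrightarrow> norm \<tau> \<le> 1 \<Longrightarrow> 1 * norm \<tau> \<le> Im \<tau> \<Longrightarrow>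
     norm (E_odd (- int g) (of_int r / of_int p + \<tau>) -
        (\<i> * of_real a / \<tau> + \<i> * of_real b + of_real (defect g r p))) \<le> K * norm \<tau>"
    using b[of 1] by auto
  let ?X = "complex_of_real (of_int r / of_int p)"
  have "((\<lambda>y. Im (E_odd (- int g) (?X + \<i> * of_real y))) \<longlongrightarrow> b) (at_right 0)"
  proof (rule tendsto_linear_bound_at_right)
    fix y :: real assume y: "0 < y" "y \<le> 1"
    define w where "w = E_odd (- int g) (of_int r / of_int p + \<i> * of_real y) -
        (\<i> * of_real a / (\<i> * of_real y) + \<i> * of_real b + of_real (defect g r p))"
    have "\<i> * of_real a / (\<i> * of_real y) = complex_of_real (a / y)" by simp
    hence "Im w = Im (E_odd (- int g) (?X + \<i> * of_real y)) - b" by (simp add: w_def)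
    hence "\<bar>Im (E_odd (- int g) (?X + \<i> * of_real y)) - b\<bar> \<le> norm w" using abs_Im_le_cmod[of w] by simp
    also have "\<dots> \<le> K * y" using K[of "\<i> * of_real y"] y by (simp add: w_def norm_mult)
    finally show "\<bar>Im (E_odd (- int g) (?X + \<i> * of_real y)) - b\<bar> \<le> K * y" .
  qed
  from tendsto_unique[OF _ this Im_E_odd_limit[OF g q]]
  have "b = pi ^ (g + 1) / (2 ^ (g + 2) * fact g) * S_odd g x" by simp
  hence "cusp_constant_term g x = \<i> * of_real b + of_real (defect g r p)"
    by (simp add: cusp_constant_term_def weight2_defect_eq[OF q])
  thus ?thesis using b[OF s] unfolding x a_def by (simp add: add.assoc)
qed

section \<open>Bernoulli polynomials and finite Fourier analysis\<close>

text \<open>With complex coefficients, because it is summed against roots of unity.\<close>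

definition bernpoly_fps :: "complex \<Rightarrow> complex fps" where
  "bernpoly_fps \<alpha> = (fps_X * fps_exp \<alpha>) / (fps_exp 1 - 1)"

lemma fps_exp_minus_1_dvd:
  "fps_exp 1 - 1 \<noteq> (0 :: 'a :: field_char_0 fps)" "(fps_exp 1 - 1 :: 'a fps) dvd fps_X * fps_exp \<alpha>"
proof -
  have c: "fps_nth (fps_exp 1 - 1 :: 'a fps) 1 \<noteq> 0" "fps_nth (fps_exp 1 - 1 :: 'a fps) 0 = 0" by simp_all
  thus nz: "fps_exp 1 - 1 \<noteq> (0 :: 'a fps)" by (metis fps_zero_nth)
  have "subdegree (fps_exp 1 - 1 :: 'a fps) \<le> 1" using c by (intro subdegree_leI)
  moreover have "subdegree (fps_X * fps_exp \<alpha> :: 'a fps) \<ge> 1"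
    by (intro subdegree_geI) (auto simp: fps_eq_iff intro!: exI[of _ 1])
  moreover have "fps_X * fps_exp \<alpha> \<noteq> (0 :: 'a fps)" by simp
  ultimately show "(fps_exp 1 - 1 :: 'a fps) dvd fps_X * fps_exp \<alpha>"
    using nz by (subst fps_dvd_iff) auto
qed

lemma bernpoly_fps_mult: "bernpoly_fps \<alpha> * (fps_exp 1 - 1) = fps_X * fps_exp \<alpha>"
  unfolding bernpoly_fps_def by (rule dvd_div_mult_self[OF fps_exp_minus_1_dvd(2)])

lemma bernpoly_eq_fps: "of_real (bernpoly k \<alpha>) = fact k * fps_nth (bernpoly_fps (of_real \<alpha>)) k"
proof -
  define Q where "Q = (fps_X * fps_exp \<alpha>) / (fps_exp 1 - 1 :: real fps)"
  define C where "C = (\<lambda>A::real fps. Abs_fps (\<lambda>n. complex_of_real (fps_nth A n)))"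
  have mult: "C (A * B) = C A * C B" for A B
    by (simp add: C_def fps_eq_iff fps_mult_nth)
  have "Q * (fps_exp 1 - 1) = fps_X * fps_exp \<alpha>"
    unfolding Q_def by (rule dvd_div_mult_self[OF fps_exp_minus_1_dvd(2)])
  hence "C Q * C (fps_exp 1 - 1) = C fps_X * C (fps_exp \<alpha>)" by (simp only: mult[symmetric])
  also have "C (fps_exp 1 - 1) = fps_exp 1 - 1" by (auto simp: C_def fps_eq_iff)
  also have "C fps_X = fps_X" by (auto simp: C_def fps_eq_iff)
  also have "C (fps_exp \<alpha>) = fps_exp (of_real \<alpha>)" by (auto simp: C_def fps_eq_iff)
  finally have "C Q * (fps_exp 1 - 1) = bernpoly_fps (of_real \<alpha>) * (fps_exp 1 - 1)"
    by (simp add: bernpoly_fps_mult)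
  hence "C Q = bernpoly_fps (of_real \<alpha>)" using fps_exp_minus_1_dvd(1) by simp
  hence "fps_nth (bernpoly_fps (of_real \<alpha>)) k = of_real (fps_nth Q k)" by (metis C_def fps_nth_Abs_fps)
  thus ?thesis unfolding bernpoly_def Q_def by simp
qed

lemma bernpoly_1: "bernpoly 1 \<alpha> = \<alpha> - 1 / 2"
proof -
  define Q where "Q = (fps_X * fps_exp \<alpha>) / (fps_exp 1 - 1 :: real fps)"
  have e: "Q * (fps_exp 1 - 1) = fps_X * fps_exp \<alpha>"
    unfolding Q_def by (rule dvd_div_mult_self[OF fps_exp_minus_1_dvd(2)])
  have c1: "fps_nth Q 0 = 1" using arg_cong[OF e, of "\<lambda>F. fps_nth F 1"]
    by (simp add: fps_mult_nth)
  have "fps_nth Q 0 * (1 / 2) + fps_nth Q 1 = \<alpha>" using arg_cong[OF e, of "\<lambda>F. fps_nth F 2"]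
    by (simp add: fps_mult_nth numeral_2_eq_2 fact_numeral)
  thus ?thesis using c1 by (simp add: bernpoly_def Q_def)
qed

lemma cot_exp: "cot z = \<i> + 2 * \<i> / (exp (2 * \<i> * z) - 1)" if "sin z \<noteq> 0"
proof -
  define e where "e = exp (\<i> * z)"
  have e0: "e \<noteq> 0" by (simp add: e_def)
  have e2: "exp (2 * \<i> * z) = e\<^sup>2" by (simp add: e_def exp_double[symmetric] mult.assoc)
  have s: "sin z = - \<i> * (e - 1 / e) / 2" "cos z = (e + 1 / e) / 2"
    unfolding sin_eq_exp_minus cos_exp_eq exp_minus e_def[symmetric] inverse_eq_divide by simp_all
  have n: "e\<^sup>2 - 1 \<noteq> 0" using that e0 unfolding s by (auto simp: field_simps power2_eq_square)
  have rot: "A / (- \<i> * B) = \<i> * (A / B)" for A B :: complex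
    by (cases "B = 0") (simp_all add: field_simps)
  have half: "A / 2 / (B / 2) = A / B" for A B :: complex by simp
  have "cot z = (e + 1 / e) / (- \<i> * (e - 1 / e))" unfolding cot_def s by (rule half)
  also have "\<dots> = \<i> * ((e + 1 / e) / (e - 1 / e))" by (rule rot)
  also have "(e + 1 / e) / (e - 1 / e) = (e\<^sup>2 + 1) / (e\<^sup>2 - 1)" using e0 n by (simp add: field_simps power2_eq_square)
  also have "\<i> * ((e\<^sup>2 + 1) / (e\<^sup>2 - 1)) = \<i> + 2 * \<i> / (e\<^sup>2 - 1)" using n by (simp add: field_simps)
  finally show ?thesis unfolding e2 .
qed

text \<open>The finite Fourier transform of a Bernoulli polynomial: summing the generating functions over the
  residues is a geometric sum and leaves \<open>t / (\<omega>e\<^bsup>t/N\<^esup> - 1)\<close>, which is a cotangent of a linear argument.\<close>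

lemma bernpoly_dft:
  fixes N l :: nat
  assumes "0 < l" "l < N"
  shows "(\<Sum>j<N. of_real (bernpoly (Suc n) (real j / real N)) * e2pi (of_nat (j * l) / of_nat N)) =
     of_nat (Suc n) * (1 / (2 * \<i>)) * (- \<i> / (2 * of_nat N)) ^ n * of_real ((deriv ^^ n) cot (pi * real l / real N))
       - (if n = 0 then 1 / 2 else 0)"
proof -
  have N: "N > 0" using assms by simp
  define \<omega> where "\<omega> = e2pi (of_nat l / of_nat N)"
  define c where "c = pi * real l / real N"
  have c: "0 < c" "c < pi" using assms by (auto simp: c_def divide_simps)
  have \<omega>_c: "\<omega> = exp (2 * \<i> * of_real c)" by (simp add: \<omega>_def c_def e2pi_def mult_ac)
  have sinc: "sin c \<noteq> 0" using c sin_gt_zero[of c] by simp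
  have \<omega>N: "\<omega> ^ N = 1"
  proof -
    have "\<omega> ^ N = exp (of_nat N * (2 * of_real pi * \<i> * (of_nat l / of_nat N)))"
      by (simp only: \<omega>_def e2pi_def exp_of_nat_mult)
    also have "of_nat N * (2 * of_real pi * \<i> * (of_nat l / of_nat N)) = 2 * of_real pi * \<i> * of_nat l"
      using N by simp
    also have "exp \<dots> = 1" unfolding exp_eq_1 by (auto intro!: exI[of _ "int l"])
    finally show ?thesis .
  qed
  have sinc': "sin (complex_of_real c) \<noteq> 0" using sinc by (simp add: sin_of_real)
  have \<omega>1: "\<omega> \<noteq> 1"
  proof
    assume "\<omega> = 1"
    hence "exp (\<i> * of_real c) * exp (\<i> * of_real c) = 1"
      unfolding \<omega>_c by (simp add: exp_add[symmetric] mult_2[symmetric] mult.assoc)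
    hence "exp (\<i> * of_real c) = 1 / exp (\<i> * of_real c)" by (simp add: field_simps)
    hence "sin (complex_of_real c) = 0" unfolding sin_eq_exp_minus exp_minus inverse_eq_divide by simp
    thus False using sinc' by simp
  qed
  define Z :: "complex fps" where "Z = fps_const \<omega> * fps_exp (1 / of_nat N)"
  have Zj: "Z ^ j = fps_const (\<omega> ^ j) * fps_exp (of_nat j / of_nat N)" for j
    unfolding Z_def power_mult_distrib fps_exp_power_mult fps_const_power by simp
  define T where "T = (\<Sum>j<N. fps_const (\<omega> ^ j) * bernpoly_fps (of_nat j / of_nat N))"
  have "T * (fps_exp 1 - 1) * (Z - 1) = fps_X * (\<Sum>j<N. Z ^ j) * (Z - 1)"
  proof -
    have "T * (fps_exp 1 - 1) = (\<Sum>j<N. fps_const (\<omega> ^ j) * (bernpoly_fps (of_nat j / of_nat N) * (fps_exp 1 - 1)))"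
      unfolding T_def sum_distrib_right by (simp add: mult.assoc)
    also have "\<dots> = (\<Sum>j<N. fps_X * Z ^ j)" unfolding bernpoly_fps_mult Zj by (simp add: mult_ac)
    finally show ?thesis by (simp add: sum_distrib_left)
  qed
  also have "\<dots> = fps_X * (Z ^ N - 1)" by (simp add: power_diff_1_eq mult_ac)
  also have "Z ^ N = fps_exp 1" unfolding Zj \<omega>N using N by simp
  finally have "(T * (Z - 1)) * (fps_exp 1 - 1) = fps_X * (fps_exp 1 - 1)" by (simp add: mult_ac)
  hence TZ: "T * (Z - 1) = fps_X" using fps_exp_minus_1_dvd(1) by simp
  have Z0: "fps_nth (Z - 1) 0 \<noteq> 0" using \<omega>1 by (simp add: Z_def)
  have "T = fps_X * inverse (Z - 1)"
  proof -
    have "T = T * ((Z - 1) * inverse (Z - 1))" using inverse_mult_eq_1'[OF Z0] by simp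
    thus ?thesis by (simp only: mult.assoc[symmetric] TZ)
  qed
  hence T_nth: "fps_nth T (Suc n) = fps_nth (inverse (Z - 1)) n" by simp
  have exp: "(\<lambda>t. inverse (\<omega> * exp (1 / of_nat N * t) - 1)) has_fps_expansion inverse (Z - 1)"
    unfolding Z_def by (intro has_fps_expansion_inverse fps_expansion_intros) (use \<omega>1 in simp)
  define u where "u = - \<i> / (2 * of_nat N)"
  have ev: "\<forall>\<^sub>F t in nhds 0. inverse (\<omega> * exp (1 / of_nat N * t) - 1) = 1 / (2 * \<i>) * cot (u * t + of_real c) + - 1 / 2"
  proof -
    have "\<forall>\<^sub>F t in nhds 0. sin (u * t + of_real c) \<noteq> 0"
    proof (rule eventually_nhds_in_open[THEN eventually_mono])
      show "open {t. sin (u * t + of_real c) \<noteq> 0}" by (intro open_Collect_neq continuous_intros)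
      show "0 \<in> {t. sin (u * t + of_real c) \<noteq> 0}" using sinc' by simp
    qed simp
    thus ?thesis
    proof eventually_elim
      case (elim t)
      have "\<omega> * exp (1 / of_nat N * t) = exp (2 * \<i> * (u * t + of_real c))"
      proof -
        have "2 * \<i> * (u * t + of_real c) = 2 * \<i> * of_real c + 1 / of_nat N * t"
          unfolding u_def by (simp add: distrib_left right_diff_distrib)
        thus ?thesis by (simp only: \<omega>_c exp_add)
      qed
      moreover have "inverse W = 1 / (2 * \<i>) * (\<i> + 2 * \<i> / W) + - 1 / 2" for W :: complex
        by (cases "W = 0") (simp_all add: field_simps)
      ultimately show ?case unfolding cot_exp[OF elim] by (simp only:)
    qed
  qed
  have "fps_nth (inverse (Z - 1)) n = (deriv ^^ n) (\<lambda>t. inverse (\<omega> * exp (1 / of_nat N * t) - 1)) 0 / fact n"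
    by (rule fps_nth_fps_expansion[OF exp])
  also have "(deriv ^^ n) (\<lambda>t. inverse (\<omega> * exp (1 / of_nat N * t) - 1)) 0 =
      (deriv ^^ n) (\<lambda>t. 1 / (2 * \<i>) * cot (u * t + of_real c) + - 1 / 2) 0"
    by (rule higher_deriv_cong_ev[OF ev refl])
  also have "\<dots> = 1 / (2 * \<i>) * (u ^ n * (deriv ^^ n) cot (of_real c)) - (if n = 0 then 1 / 2 else 0)"
  proof -
    define S where "S = {t. sin (u * t + of_real c) \<noteq> 0}"
    have S: "open S" "0 \<in> S"
      unfolding S_def using sinc' by (auto intro!: open_Collect_neq continuous_intros)
    have hol: "(\<lambda>t. cot (u * t + of_real c)) holomorphic_on S"
      unfolding cot_def S_def by (intro holomorphic_intros) auto
    have "(deriv ^^ n) (\<lambda>t. 1 / (2 * \<i>) * cot (u * t + of_real c) + - 1 / 2) 0 =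
        (deriv ^^ n) (\<lambda>t. 1 / (2 * \<i>) * cot (u * t + of_real c)) 0 + (deriv ^^ n) (\<lambda>t. - 1 / 2) 0"
      by (rule higher_deriv_add[OF _ _ S]) (intro holomorphic_intros hol)+
    also have "(deriv ^^ n) (\<lambda>t. 1 / (2 * \<i>) * cot (u * t + of_real c)) 0 =
        1 / (2 * \<i>) * (deriv ^^ n) (\<lambda>t. cot (u * t + of_real c)) 0"
      by (rule higher_deriv_cmult[OF hol S(2,1)])
    also have "(deriv ^^ n) (\<lambda>t. cot (u * t + of_real c)) 0 = u ^ n * (deriv ^^ n) cot (u * 0 + of_real c)"
      by (rule higher_deriv_compose_linear'[OF cot_holomorphic S(1) open_sin_nonzero S(2)]) (auto simp: S_def)
    also have "(deriv ^^ n) (\<lambda>t. - 1 / 2 :: complex) 0 = - (if n = 0 then 1 / 2 else 0)"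
      by (simp add: higher_deriv_const)
    finally show ?thesis by simp
  qed
  finally have T_val: "fps_nth T (Suc n) = (1 / (2 * \<i>) * (u ^ n * of_real ((deriv ^^ n) cot c)) - (if n = 0 then 1 / 2 else 0)) / fact n"
    unfolding T_nth higher_deriv_cot_of_real(1)[OF sinc] .
  have "(\<Sum>j<N. of_real (bernpoly (Suc n) (real j / real N)) * e2pi (of_nat (j * l) / of_nat N)) = fact (Suc n) * fps_nth T (Suc n)"
  proof -
    have "e2pi (of_nat (j * l) / of_nat N) = \<omega> ^ j" for j
      by (simp add: \<omega>_def e2pi_def exp_of_nat_mult[symmetric] mult_ac)
    thus ?thesis unfolding T_def fps_sum_nth bernpoly_eq_fps
      by (simp add: sum_distrib_left mult_ac del: fact_Suc)
  qed
  also have "\<dots> = of_nat (Suc n) * (fact n * fps_nth T (Suc n))" by simp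
  also have "fact n * fps_nth T (Suc n) = 1 / (2 * \<i>) * (u ^ n * of_real ((deriv ^^ n) cot c)) - (if n = 0 then 1 / 2 else 0)"
    unfolding T_val by simp
  finally show ?thesis by (auto simp: u_def c_def algebra_simps)
qed

text \<open>From \<open>t e\<^bsup>t/2\<^esup> / (e\<^sup>t - 1) = 2 (t/2) / (e\<^bsup>t/2\<^esup> - 1) - t / (e\<^sup>t - 1)\<close>; \<open>D\<close> below is the substitution \<open>t \<mapsto> t/2\<close>.\<close>

lemma bernpoly_half: "bernpoly k (1 / 2) = (2 / 2 ^ k - 1) * bernpoly k 0"
proof -
  define G where "G = (\<lambda>\<alpha>::real. (fps_X * fps_exp \<alpha>) / (fps_exp 1 - 1) :: real fps)"
  have G: "G \<alpha> * (fps_exp 1 - 1) = fps_X * fps_exp \<alpha>" for \<alpha>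
    unfolding G_def by (rule dvd_div_mult_self[OF fps_exp_minus_1_dvd(2)])
  define D where "D = (\<lambda>A::real fps. Abs_fps (\<lambda>n. (1 / 2) ^ n * fps_nth A n))"
  have mult: "D (A * B) = D A * D B" for A B
  proof (rule fps_ext)
    fix n
    have "(1 / 2) ^ n * (\<Sum>i=0..n. fps_nth A i * fps_nth B (n - i)) =
        (\<Sum>i=0..n. ((1 / 2) ^ i * fps_nth A i) * ((1 / 2) ^ (n - i) * fps_nth B (n - i)))"
      unfolding sum_distrib_left
    proof (rule sum.cong)
      fix i assume "i \<in> {0..n}"
      hence "(1 / 2 :: real) ^ n = (1 / 2) ^ i * (1 / 2) ^ (n - i)" by (simp flip: power_add)
      thus "(1 / 2) ^ n * (fps_nth A i * fps_nth B (n - i)) = ((1 / 2) ^ i * fps_nth A i) * ((1 / 2) ^ (n - i) * fps_nth B (n - i))"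
        by simp
    qed simp
    thus "fps_nth (D (A * B)) n = fps_nth (D A * D B) n" by (simp add: D_def fps_mult_nth)
  qed
  have D1: "D (fps_exp 1 - 1) = fps_exp (1/2) - 1" by (auto simp: D_def fps_eq_iff power_one_over)
  have DX: "D fps_X = fps_const (1/2) * fps_X" by (auto simp: D_def fps_eq_iff fps_X_def)
  have "D (G 0) * D (fps_exp 1 - 1) = D fps_X" using G[of 0] by (simp add: mult[symmetric])
  hence DG: "D (G 0) * (fps_exp (1/2) - 1) = fps_const (1/2) * fps_X" by (simp only: D1 DX)
  have e: "fps_exp 1 = fps_exp (1/2) * fps_exp (1/2 :: real)" by (simp flip: fps_exp_add_mult)
  have "2 * D (G 0) * (fps_exp 1 - 1) = 2 * (D (G 0) * (fps_exp (1/2) - 1)) * (fps_exp (1/2) + 1)"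
    unfolding e by (simp add: algebra_simps)
  also have "\<dots> = (2 * fps_const (1/2)) * fps_X * (fps_exp (1/2) + 1)" unfolding DG by (simp add: mult_ac)
  also have "2 * fps_const (1/2 :: real) = 1" by (simp add: numeral_fps_const)
  finally have "(2 * D (G 0) - G 0) * (fps_exp 1 - 1) = fps_X * (fps_exp (1/2) + 1) - fps_X"
    using G[of 0] by (simp add: left_diff_distrib)
  hence "(2 * D (G 0) - G 0) * (fps_exp 1 - 1) = G (1/2) * (fps_exp 1 - 1)"
    unfolding G by (simp add: algebra_simps)
  hence "G (1/2) = 2 * D (G 0) - G 0" using fps_exp_minus_1_dvd(1)[where 'a = real] by simp
  hence "fps_nth (G (1/2)) k = fps_nth (D (G 0) + D (G 0) - G 0) k" by (simp only: mult_2)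
  also have "\<dots> = (2 / 2 ^ k - 1) * fps_nth (G 0) k"
    by (simp add: D_def power_one_over left_diff_distrib)
  finally have "fps_nth (G (1/2)) k = (2 / 2 ^ k - 1) * fps_nth (G 0) k" .
  moreover have "bernpoly k \<alpha> = fact k * fps_nth (G \<alpha>) k" for \<alpha> by (simp add: bernpoly_def G_def)
  ultimately show ?thesis by simp
qed

text \<open>The value of the finite Fourier transform at the nontrivial character modulo 2, compared with the
  partial fractions of the cotangent at \<open>\<pi>/2\<close>, evaluates the odd zeta sums.\<close>

lemma odd_zeta_bernoulli:
  assumes "even g"
  shows "odd_zeta (g + 2) = (-1) ^ (g div 2) * pi ^ (g + 2) * (2 ^ (g + 2) - 1) * bernpoly (g + 2) 0 / (2 * fact (g + 2))"
proof -
  define n where "n = Suc g"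
  have n: "odd n" using assms by (simp add: n_def)
  define T where "T = (deriv ^^ n) cot (pi / 2)"
  define B where "B = bernpoly (Suc n) 0"
  have Z: "odd_zeta (Suc n) = - (pi ^ Suc n * T / (fact n * 2 * 2 ^ Suc n))"
  proof -
    have 1: "(\<lambda>l. 1 / (1/2 + real l) ^ Suc n - (-1) ^ n / (1 - 1/2 + real l) ^ Suc n) sums
       ((-1) ^ n * pi ^ Suc n * (deriv ^^ n) cot (pi * (1/2)) / fact n)"
      by (rule higher_deriv_cot_sums_real) auto
    have "(\<lambda>l. 2 * 2 ^ Suc n * (1 / (2 * real l + 1) ^ Suc n)) sums (2 * 2 ^ Suc n * odd_zeta (Suc n))"
      by (intro sums_mult odd_zeta_sums) (simp add: n_def)
    also have "(\<lambda>l. 2 * 2 ^ Suc n * (1 / (2 * real l + 1) ^ Suc n)) =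
        (\<lambda>l. 1 / (1/2 + real l) ^ Suc n - (-1) ^ n / (1 - 1/2 + real l) ^ Suc n)"
    proof
      fix l
      have "1/2 + real l = (2 * real l + 1) / 2" "1 - 1/2 + real l = (2 * real l + 1) / 2" by (simp_all add: field_simps)
      thus "2 * 2 ^ Suc n * (1 / (2 * real l + 1) ^ Suc n) = 1 / (1/2 + real l) ^ Suc n - (-1) ^ n / (1 - 1/2 + real l) ^ Suc n"
        using n by (simp only: power_divide) simp
    qed
    finally have "2 * 2 ^ Suc n * odd_zeta (Suc n) = (-1) ^ n * pi ^ Suc n * (deriv ^^ n) cot (pi * (1/2)) / fact n"
      using 1 by (rule sums_unique2)
    hence "2 * 2 ^ Suc n * odd_zeta (Suc n) = - (pi ^ Suc n * T / fact n)" using n by (simp add: T_def)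
    hence "odd_zeta (Suc n) = - (pi ^ Suc n * T / fact n) / (2 * 2 ^ Suc n)" by (simp add: field_simps)
    thus ?thesis by simp
  qed
  have T: "T = - ((-1) ^ (g div 2)) * (2 * 4 ^ n * (2 - 2 / 2 ^ Suc n) / real (Suc n)) * B"
  proof -
    have "(\<Sum>j<2. complex_of_real (bernpoly (Suc n) (real j / real 2)) * e2pi (of_nat (j * 1) / of_nat 2)) =
     of_nat (Suc n) * (1 / (2 * \<i>)) * (- \<i> / (2 * of_nat 2)) ^ n * of_real ((deriv ^^ n) cot (pi * real 1 / real 2))
       - (if n = 0 then 1 / 2 else 0)"
      by (rule bernpoly_dft) auto
    also have "(\<Sum>j<2. complex_of_real (bernpoly (Suc n) (real j / real 2)) * e2pi (of_nat (j * 1) / of_nat 2)) =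
       of_real (B - bernpoly (Suc n) (1/2))"
    proof -
      have "e2pi (1 / 2) = -1" by (simp add: e2pi_def)
      thus ?thesis by (simp add: numeral_2_eq_2 B_def e2pi_def)
    qed
    also have "B - bernpoly (Suc n) (1/2) = (2 - 2 / 2 ^ Suc n) * B"
      unfolding bernpoly_half B_def by (simp add: algebra_simps)
    also have "of_nat (Suc n) * (1 / (2 * \<i>)) * (- \<i> / (2 * of_nat 2)) ^ n * of_real ((deriv ^^ n) cot (pi * real 1 / real 2))
       - (if n = 0 then 1 / 2 else 0) = complex_of_real (- (real (Suc n) * ((-1) ^ (g div 2) / (2 * 4 ^ n)) * T))"
    proof -
      obtain h where h: "g = 2 * h" using assms by (auto elim: evenE)
      have "- \<i> / (2 * of_nat 2) = (- \<i>) / 4" by simp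
      hence "(- \<i> / (2 * of_nat 2)) ^ n = (- \<i>) ^ n / 4 ^ n" by (simp only: power_divide)
      also have "(- \<i>) ^ n = - \<i> * (-1) ^ h" unfolding n_def h by (simp add: power_mult)
      finally have "1 / (2 * \<i>) * (- \<i> / (2 * of_nat 2)) ^ n = - ((-1) ^ h / (2 * 4 ^ n))" by simp
      thus ?thesis using n by (simp add: T_def h n_def mult.assoc)
    qed
    finally have "(2 - 2 / 2 ^ Suc n) * B = - (real (Suc n) * ((-1) ^ (g div 2) / (2 * 4 ^ n)) * T)"
      by (simp only: of_real_eq_iff)
    moreover have "T' = - s * (2 * q * Y / m) * B'" if "Y * B' = - (m * (s / (2 * q)) * T')" "s * s = 1" "q \<noteq> 0" "m \<noteq> 0"
      for T' s q Y m B' :: real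
    proof -
      have "- s * (2 * q * Y / m) * B' = - s * (2 * q / m) * (Y * B')" by simp
      also have "\<dots> = (s * s) * T'" unfolding that(1) using that(3,4) by simp
      finally show ?thesis using that(2) by simp
    qed
    moreover have "(-1 :: real) ^ (g div 2) * (-1) ^ (g div 2) = 1" by (simp flip: power_mult_distrib)
    ultimately show ?thesis by simp
  qed
  have gen: "- (P * (- s * (W / m) * b) / (F * 2 * Q)) = s * P * b * (W / (m * F * 2 * Q))" for P s W m b F Q :: real
    by (simp add: mult_ac)
  have "odd_zeta (Suc n) = (-1) ^ (g div 2) * pi ^ Suc n * B * ((2 * 4 ^ n * (2 - 2 / 2 ^ Suc n)) / (real (Suc n) * fact n * 2 * 2 ^ Suc n))"
    unfolding Z T by (rule gen)
  also have "(2 * 4 ^ n * (2 - 2 / 2 ^ Suc n)) / (real (Suc n) * fact n * 2 * 2 ^ Suc n) = (2 ^ Suc n - 1) / (2 * fact (Suc n))"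
  proof -
    have "(4 :: real) ^ n = 2 ^ n * 2 ^ n" by (simp flip: power_mult_distrib)
    moreover have gen: "(2 * (t * t) * (2 - 2 / (2 * t))) / (m * F * 2 * (2 * t)) = (2 * t - 1) / (2 * (m * F))"
      if "t \<noteq> 0" "m \<noteq> 0" "F \<noteq> 0" for t m F :: real
      using that by (simp add: field_simps)
    moreover have "fact (Suc n) = real (Suc n) * fact n" by simp
    ultimately show ?thesis by (simp only: power_Suc) (rule gen, auto)
  qed
  finally show ?thesis by (simp add: n_def B_def)
qed

lemma cusp_value_bernoulli:
  assumes "even g"
  shows "cusp_value g r p = of_real (of_bool (odd p) * (- 1) powi (r + 1) *
          ((2 ^ (g + 2) - 1) / (4 * (of_nat g + 2))) * bernpoly (g + 2) 0)"
proof -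
  obtain h where h: "g = 2 * h" using assms by (auto elim: evenE)
  have sgn: "- cusp_sign r p = of_bool (odd p) * (- 1) powi (r + 1)"
    by (auto simp: cusp_sign_def)
  have "(of_real pi * \<i>) ^ Suc g = of_real (pi ^ Suc g * (-1) ^ h) * \<i>"
  proof -
    have "\<i> ^ Suc g = (-1) ^ h * \<i>" by (simp add: h power_mult)
    thus ?thesis by (simp only: power_mult_distrib) simp
  qed
  hence "cusp_value g r p = of_real (- cusp_sign r p * (odd_zeta (g + 2) / (2 * pi) * fact (Suc g) / (pi ^ Suc g * (-1) ^ h)))"
    unfolding cusp_value_def by simp
  also have "odd_zeta (g + 2) / (2 * pi) * fact (Suc g) / (pi ^ Suc g * (-1) ^ h) = (2 ^ (g + 2) - 1) / (4 * (of_nat g + 2)) * bernpoly (g + 2) 0"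
  proof -
    have "odd_zeta (g + 2) = (-1) ^ h * (pi ^ Suc g * pi) * (2 ^ (g + 2) - 1) * bernpoly (g + 2) 0 / (2 * (real (g + 2) * fact (Suc g)))"
      unfolding odd_zeta_bernoulli[OF assms] using h by (simp add: mult_ac)
    moreover have "s * (P * pi) * K * B / (2 * (k * F)) / (2 * pi) * F / (P * s) = K / (4 * k) * B"
      if "s \<noteq> 0" "P \<noteq> 0" "F \<noteq> 0" for s P K B k F :: real using that by simp
    ultimately show ?thesis by (simp only:) simp
  qed
  finally show ?thesis unfolding sgn by (simp add: mult_ac)
qed

subsection \<open>The finite formulas for the cotangent sum\<close>

lemma e2pi_add: "e2pi (a + b) = e2pi a * e2pi b"
  by (simp add: e2pi_def distrib_left exp_add)

lemma e2pi_int: "e2pi (of_int k) = 1"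
  unfolding e2pi_def exp_eq_1 by (auto intro!: exI[of _ k])

lemma e2pi_power: "e2pi z ^ n = e2pi (of_nat n * z)"
  by (simp add: e2pi_def exp_of_nat_mult[symmetric] mult_ac)

lemma odd_geometric_moment:
  fixes z :: complex
  assumes z2: "z\<^sup>2 \<noteq> 1" and zn: "z ^ (2 * n) = 1" and n: "n > 0"
  shows "(\<Sum>j<n. z ^ (2 * j + 1)) = 0"
    and "(\<Sum>j<n. z ^ (2 * j + 1) * of_real ((2 * real j + 1) / (2 * real n) - 1 / 2)) = 1 / (z - 1 / z)"
proof -
  define w where "w = z\<^sup>2"
  have w: "w \<noteq> 1" "w ^ n = 1" using z2 zn by (simp_all add: w_def power_mult)
  have z0: "z \<noteq> 0" using zn n by (auto simp: power_0_left)
  have pw: "z ^ (2 * j + 1) = z * w ^ j" for j by (simp add: w_def power_mult)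
  have s0: "(\<Sum>j<n. w ^ j) = 0"
  proof -
    have "(w - 1) * (\<Sum>j<n. w ^ j) = w ^ n - 1" by (rule power_diff_1_eq[symmetric])
    thus ?thesis using w by simp
  qed
  show s0': "(\<Sum>j<n. z ^ (2 * j + 1)) = 0"
    unfolding pw sum_distrib_left[symmetric] s0 by simp
  have "(w - 1) * (\<Sum>j<m. of_nat j * w ^ j) = of_nat m * w ^ m - w * (\<Sum>j<m. w ^ j)" for m
    by (induction m) (simp_all add: algebra_simps)
  from this[of n] have s1: "(\<Sum>j<n. of_nat j * w ^ j) = of_nat n / (w - 1)"
    using w s0 by (simp add: field_simps)
  have "(\<Sum>j<n. z ^ (2 * j + 1) * of_real ((2 * real j + 1) / (2 * real n) - 1 / 2)) =
      (\<Sum>j<n. z / of_nat n * (of_nat j * w ^ j) + (1 / (2 * of_nat n) - 1 / 2) * z ^ (2 * j + 1))"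
    unfolding pw using n by (intro sum.cong) (simp_all add: field_simps)
  also have "\<dots> = z / of_nat n * (of_nat n / (w - 1))"
    unfolding sum.distrib sum_distrib_left[symmetric] s1 s0' by simp
  also have "\<dots> = 1 / (z - 1 / z)"
    using n z0 w(1) by (simp add: w_def field_simps power2_eq_square)
  finally show "(\<Sum>j<n. z ^ (2 * j + 1) * of_real ((2 * real j + 1) / (2 * real n) - 1 / 2)) = 1 / (z - 1 / z)" .
qed

lemma e2pi_half_angle:
  "e2pi (of_real y / 2) - 1 / e2pi (of_real y / 2) = 2 * \<i> * of_real (sin (pi * y))"
proof -
  have e: "e2pi (of_real y / 2) = exp (\<i> * of_real (pi * y))" by (simp add: e2pi_def mult_ac)
  have "sin (complex_of_real (pi * y)) = - \<i> * (e2pi (of_real y / 2) - 1 / e2pi (of_real y / 2)) / 2"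
    unfolding sin_eq_exp_minus exp_minus e inverse_eq_divide ..
  hence "2 * \<i> * sin (complex_of_real (pi * y)) = e2pi (of_real y / 2) - 1 / e2pi (of_real y / 2)" by simp
  thus ?thesis by (simp only: sin_of_real)
qed

text \<open>The first Bernoulli polynomial is the finite Fourier transform of \<open>1 / sin\<close>. When the sine
  vanishes both sides are \<open>0\<close>.\<close>

lemma bernpoly_1_dft:
  fixes n r p :: int
  assumes p: "p > 0" and n: "odd n"
  defines "X \<equiv> of_int r / of_int p :: real"
  shows "(\<Sum>m\<in>odd_residues p. e2pi (of_int (m * n) * of_real X / 2) * of_real (bernpoly 1 (of_int m / (2 * of_int p)))) =
     of_real (1 / sin (pi * of_int n * X)) / (2 * \<i>)"
proof -
  define z where "z = e2pi (of_real (of_int n * X) / 2)"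
  have zz: "z - 1 / z = 2 * \<i> * of_real (sin (pi * of_int n * X))"
    unfolding z_def e2pi_half_angle by (simp add: mult.assoc)
  have z0: "z \<noteq> 0" by (simp add: z_def e2pi_def)
  have "(\<Sum>m\<in>odd_residues p. e2pi (of_int (m * n) * of_real X / 2) * of_real (bernpoly 1 (of_int m / (2 * of_int p)))) =
     (\<Sum>j<nat p. z ^ (2 * j + 1) * of_real ((2 * real j + 1) / (2 * real (nat p)) - 1 / 2))"
    unfolding sum_odd_residues_nat[OF p]
  proof (rule sum.cong)
    fix j
    have "e2pi (of_int ((2 * int j + 1) * n) * of_real X / 2) = z ^ (2 * j + 1)"
      unfolding z_def e2pi_power by (simp add: mult_ac add_ac)
    moreover have "bernpoly 1 (of_int (2 * int j + 1) / (2 * of_int p)) = (2 * real j + 1) / (2 * real (nat p)) - 1 / 2"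
      using p by (subst bernpoly_1) simp
    ultimately show "e2pi (of_int ((2 * int j + 1) * n) * of_real X / 2) * of_real (bernpoly 1 (of_int (2 * int j + 1) / (2 * of_int p))) =
       z ^ (2 * j + 1) * of_real ((2 * real j + 1) / (2 * real (nat p)) - 1 / 2)" by simp
  qed simp
  also have "\<dots> = 1 / (z - 1 / z)"
  proof (cases "z\<^sup>2 = 1")
    case False
    have "z ^ (2 * nat p) = e2pi (of_int (n * r))"
      using p unfolding z_def e2pi_power by (simp add: X_def)
    thus ?thesis using False p by (intro odd_geometric_moment) (simp_all only: e2pi_int, simp_all)
  next
    case True
    have "(\<Sum>j<m. 2 * real j + 1) = real m ^ 2" for m
      by (induction m) (simp_all add: power2_eq_square algebra_simps)
    from this[of "nat p"] have "(\<Sum>j<nat p. (2 * real j + 1) / (2 * real (nat p)) - 1 / 2) = 0"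
      using p by (simp add: sum_subtractf sum_divide_distrib[symmetric] power2_eq_square)
    moreover have "z ^ (2 * j + 1) = z" for j using True by (simp add: power_mult)
    ultimately have "(\<Sum>j<nat p. z ^ (2 * j + 1) * of_real ((2 * real j + 1) / (2 * real (nat p)) - 1 / 2)) = 0"
      by (simp only: sum_distrib_left[symmetric] of_real_sum[symmetric]) simp
    moreover have "z - 1 / z = 0" using True z0 by (simp add: field_simps power2_eq_square)
    ultimately show ?thesis by simp
  qed
  also have "\<dots> = of_real (1 / sin (pi * of_int n * X)) / (2 * \<i>)"
    unfolding zz by (simp only: of_real_divide of_real_1 divide_divide_eq_left mult.commute)
  finally show ?thesis .
qed

theorem S_odd_double_sum:
  assumes g: "even g" and q: "quotient_of x = (r, p)"
  shows "complex_of_real (S_odd g x) = \<i> / of_int p ^ (g + 1) *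
        (\<Sum>m\<in>odd_residues p. \<Sum>n\<in>odd_residues p.
           e2pi (of_int m * of_int n * of_rat x / 2) *
           of_real (bernpoly 1 (of_int m / (2 * of_int p))) *
           of_real ((deriv ^^ g) cot (pi * of_int n / (2 * of_int p))))"
proof -
  have p: "p > 0" using q by (rule quotient_of_denom_pos)
  define X where "X = (of_int r / of_int p :: real)"
  have x: "of_rat x = complex_of_real X" using quotient_of_div[OF q] by (simp add: of_rat_divide X_def)
  define C where "C = (\<lambda>n. (deriv ^^ g) cot (pi * of_int n / (2 * of_int p)))"
  have "(\<Sum>m\<in>odd_residues p. \<Sum>n\<in>odd_residues p.
           e2pi (of_int m * of_int n * of_rat x / 2) * of_real (bernpoly 1 (of_int m / (2 * of_int p))) * of_real (C n)) =
        (\<Sum>n\<in>odd_residues p. \<Sum>m\<in>odd_residues p.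
           e2pi (of_int m * of_int n * of_rat x / 2) * of_real (bernpoly 1 (of_int m / (2 * of_int p))) * of_real (C n))"
    by (rule sum.swap)
  also have "\<dots> = (\<Sum>n\<in>odd_residues p. of_real (1 / sin (pi * of_int n * X)) / (2 * \<i>) * of_real (C n))"
  proof (rule sum.cong)
    fix n assume "n \<in> odd_residues p"
    hence "odd n" by (simp add: odd_residues_def)
    from bernpoly_1_dft[OF p this, of r] show "(\<Sum>m\<in>odd_residues p.
           e2pi (of_int m * of_int n * of_rat x / 2) * of_real (bernpoly 1 (of_int m / (2 * of_int p))) * of_real (C n)) =
           of_real (1 / sin (pi * of_int n * X)) / (2 * \<i>) * of_real (C n)"
      unfolding sum_distrib_right[symmetric] X_def[symmetric] x by simp
  qed simp
  also have "\<dots> = 1 / (2 * \<i>) * of_real (\<Sum>n\<in>odd_residues p. C n / sin (pi * of_int n * X))"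
    by (simp add: sum_distrib_left mult_ac)
  finally have "(\<Sum>m\<in>odd_residues p. \<Sum>n\<in>odd_residues p.
           e2pi (of_int m * of_int n * of_rat x / 2) * of_real (bernpoly 1 (of_int m / (2 * of_int p))) * of_real (C n)) =
        1 / (2 * \<i>) * of_real (\<Sum>n\<in>odd_residues p. C n / sin (pi * of_int n * X))" .
  moreover have "S_odd g x = 1 / (2 * of_int p ^ (g + 1)) * (\<Sum>n\<in>odd_residues p. C n / sin (pi * of_int n * X))"
    unfolding S_odd_full_sum[OF g q] C_def X_def ..
  ultimately show ?thesis unfolding C_def by simp
qed

text \<open>Adding \<open>p\<close> to \<open>v\<close> changes the sign of every odd character, hence the second value.\<close>

lemma odd_character_sum:
  fixes v p :: int
  assumes p: "p > 0"
  shows "(\<Sum>l\<in>odd_residues p. e2pi (of_int (l * v) / of_int (2 * p))) =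
     (if 2 * p dvd v then of_int p else if 2 * p dvd v - p then - of_int p else 0)"
proof -
  define z where "z = e2pi (of_int v / of_int (2 * p))"
  have "(\<Sum>l\<in>odd_residues p. e2pi (of_int (l * v) / of_int (2 * p))) = (\<Sum>j<nat p. z ^ (2 * j + 1))"
    unfolding sum_odd_residues_nat[OF p] z_def e2pi_power by (simp add: mult_ac add_ac)
  also have "\<dots> = (if 2 * p dvd v then of_int p else if 2 * p dvd v - p then - of_int p else 0)"
  proof -
    consider "2 * p dvd v" | "2 * p dvd v - p" "\<not> 2 * p dvd v" | "\<not> 2 * p dvd v" "\<not> 2 * p dvd v - p" by blast
    thus ?thesis
    proof cases
      case 1
      then obtain k where "v = 2 * p * k" by (auto elim: dvdE)
      hence "z = e2pi (of_int k)" using p by (simp add: z_def)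
      hence "z = 1" by (simp only: e2pi_int)
      thus ?thesis using 1 p by simp
    next
      case 2
      then obtain k where "v - p = 2 * p * k" by (auto elim: dvdE)
      hence "v = 2 * p * k + p" by simp
      hence "of_int v / of_int (2 * p) = (of_int k + 1 / 2 :: complex)" using p by (simp add: field_simps)
      hence "z = e2pi (of_int k + 1 / 2)" by (simp only: z_def)
      also have "\<dots> = -1" by (simp only: e2pi_add e2pi_int) (simp add: e2pi_def)
      finally have "z ^ (2 * j + 1) = -1" for j by simp
      thus ?thesis using 2 p by simp
    next
      case 3
      have "z\<^sup>2 \<noteq> 1"
      proof
        assume "z\<^sup>2 = 1"
        moreover have "of_nat 2 * (of_int v / of_int (2 * p)) = (of_int v / of_int p :: complex)" by simp
        ultimately have "e2pi (of_int v / of_int p) = 1" unfolding z_def e2pi_power by (simp only:)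
        hence "exp (2 * of_real pi * \<i> * (of_int v / of_int p)) = 1" by (simp only: e2pi_def)
        then obtain k :: int where "Im (2 * of_real pi * \<i> * (of_int v / of_int p)) = of_int (2 * k) * pi"
          unfolding exp_eq_1 by blast
        moreover define t where "t = real_of_int v / real_of_int p"
        have "2 * of_real pi * \<i> * (of_int v / of_int p) = \<i> * of_real (2 * pi * t)" by (simp add: t_def)
        hence "Im (2 * of_real pi * \<i> * (of_int v / of_int p)) = 2 * pi * t" by (simp only:) simp
        ultimately have "2 * pi * t = of_int (2 * k) * pi" by (simp only:)
        hence "t = real_of_int k" by simp
        hence "of_int v / of_int p = real_of_int k" by (simp only: t_def)
        hence "real_of_int v = of_int (k * p)" using p by (simp add: field_simps)
        hence v: "v = k * p" by (simp only: of_int_eq_iff)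
        show False using 3 unfolding v by (cases "even k") (auto elim!: evenE oddE simp: algebra_simps)
      qed
      moreover have "z ^ (2 * nat p) = e2pi (of_int v)" using p by (simp add: z_def e2pi_power)
      hence "z ^ (2 * nat p) = 1" by (simp only: e2pi_int)
      ultimately have "(\<Sum>j<nat p. z ^ (2 * j + 1)) = 0" using p by (intro odd_geometric_moment(1)) auto
      thus ?thesis using 3 by simp
    qed
  qed
  finally show ?thesis .
qed

lemma frac_int_quotient:
  assumes "(N :: int) > 0" shows "frac (of_int u / of_int N :: real) = of_int (u mod N) / of_int N"
proof -
  have "u = N * (u div N) + u mod N" by simp
  hence "(of_int u :: real) = of_int N * of_int (u div N) + of_int (u mod N)" by (metis of_int_add of_int_mult)
  hence "(of_int u / of_int N :: real) - of_int (u mod N) / of_int N = of_int (u div N)"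
    using assms by (simp add: field_simps)
  moreover have "0 \<le> (of_int (u mod N) / of_int N :: real)" "(of_int (u mod N) / of_int N :: real) < 1"
    using assms by (simp_all add: divide_simps)
  ultimately show ?thesis by (subst frac_unique_iff) auto
qed

text \<open>Fourier inversion over the odd characters modulo \<open>2p\<close>.\<close>

lemma bernpoly_per_difference:
  fixes u p :: int
  assumes p: "p > 0"
  shows "of_int p * of_real (bernpoly_per (Suc n) (of_int u / of_int (2 * p)) - bernpoly_per (Suc n) (of_int (u + p) / of_int (2 * p))) =
    (\<Sum>l\<in>odd_residues p. e2pi (of_int (- (l * u)) / of_int (2 * p)) *
        (of_nat (Suc n) * (1 / (2 * \<i>)) * (- \<i> / (4 * of_int p)) ^ n * of_real ((deriv ^^ n) cot (pi * of_int l / (2 * of_int p)))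
          - (if n = 0 then 1 / 2 else 0)))"
proof -
  define N where "N = 2 * p"
  have N: "N > 0" using p by (simp add: N_def)
  define B where "B = (\<lambda>s::int. bernpoly (Suc n) (of_int s / of_int N))"
  have dft: "of_nat (Suc n) * (1 / (2 * \<i>)) * (- \<i> / (4 * of_int p)) ^ n * of_real ((deriv ^^ n) cot (pi * of_int l / (2 * of_int p)))
          - (if n = 0 then 1 / 2 else 0) = (\<Sum>s\<in>{0..<N}. of_real (B s) * e2pi (of_int (s * l) / of_int N))"
    if l: "l \<in> odd_residues p" for l
  proof -
    have l': "0 < nat l" "nat l < nat N" using l by (auto simp: odd_residues_def N_def)
    have "(\<Sum>s\<in>{0..<N}. of_real (B s) * e2pi (of_int (s * l) / of_int N)) =
        (\<Sum>j<nat N. of_real (bernpoly (Suc n) (real j / real (nat N))) * e2pi (of_nat (j * nat l) / of_nat (nat N)))"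
      by (rule sum.reindex_bij_witness[of _ int nat]) (use N l' in \<open>auto simp: B_def\<close>)
    thus ?thesis unfolding bernpoly_dft[OF l'] using N l' by (simp add: N_def)
  qed
  have "(\<Sum>l\<in>odd_residues p. e2pi (of_int (- (l * u)) / of_int N) * (\<Sum>s\<in>{0..<N}. of_real (B s) * e2pi (of_int (s * l) / of_int N))) =
     (\<Sum>l\<in>odd_residues p. \<Sum>s\<in>{0..<N}. of_real (B s) * e2pi (of_int (l * (s - u)) / of_int N))"
    unfolding sum_distrib_left
  proof (intro sum.cong refl)
    fix l s
    have "e2pi (of_int (l * (s - u)) / of_int N) = e2pi (of_int (- (l * u)) / of_int N) * e2pi (of_int (s * l) / of_int N)"
      unfolding e2pi_add[symmetric] by (simp add: diff_divide_distrib algebra_simps)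
    thus "e2pi (of_int (- (l * u)) / of_int N) * (of_real (B s) * e2pi (of_int (s * l) / of_int N)) =
        of_real (B s) * e2pi (of_int (l * (s - u)) / of_int N)" by simp
  qed
  also have "\<dots> = (\<Sum>s\<in>{0..<N}. of_real (B s) * (\<Sum>l\<in>odd_residues p. e2pi (of_int (l * (s - u)) / of_int N)))"
    by (subst sum.swap) (simp add: sum_distrib_left)
  also have "\<dots> = (\<Sum>s\<in>{0..<N}. (if s = u mod N then of_int p * of_real (B s) else 0) - (if s = (u + p) mod N then of_int p * of_real (B s) else 0))"
  proof (rule sum.cong)
    fix s assume s: "s \<in> {0..<N}"
    have e1: "N dvd s - u \<longleftrightarrow> s = u mod N" using s by (auto simp: mod_eq_dvd_iff[symmetric])
    have e2: "N dvd s - u - p \<longleftrightarrow> s = (u + p) mod N"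
      using s mod_eq_dvd_iff[of s N "u + p"] by (auto simp: algebra_simps)
    have ne: "u mod N \<noteq> (u + p) mod N"
    proof
      assume "u mod N = (u + p) mod N"
      hence "N dvd u - (u + p)" by (simp add: mod_eq_dvd_iff)
      hence "N dvd p" by simp
      thus False using p zdvd_imp_le[of N p] by (simp add: N_def)
    qed
    show "of_real (B s) * (\<Sum>l\<in>odd_residues p. e2pi (of_int (l * (s - u)) / of_int N)) =
       (if s = u mod N then of_int p * of_real (B s) else 0) - (if s = (u + p) mod N then of_int p * of_real (B s) else 0)"
      unfolding N_def odd_character_sum[OF p] unfolding N_def[symmetric] e1 e2 using ne by auto
  qed simp
  also have "\<dots> = of_int p * of_real (B (u mod N)) - of_int p * of_real (B ((u + p) mod N))"
    using N by (simp add: sum_subtractf)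
  also have "\<dots> = of_int p * of_real (bernpoly_per (Suc n) (of_int u / of_int N) - bernpoly_per (Suc n) (of_int (u + p) / of_int N))"
    unfolding bernpoly_per_def B_def frac_int_quotient[OF N] by (simp add: right_diff_distrib)
  finally have "of_int p * of_real (bernpoly_per (Suc n) (of_int u / of_int N) - bernpoly_per (Suc n) (of_int (u + p) / of_int N)) =
     (\<Sum>l\<in>odd_residues p. e2pi (of_int (- (l * u)) / of_int N) * (\<Sum>s\<in>{0..<N}. of_real (B s) * e2pi (of_int (s * l) / of_int N)))" ..
  also have "\<dots> = (\<Sum>l\<in>odd_residues p. e2pi (of_int (- (l * u)) / of_int N) *
     (of_nat (Suc n) * (1 / (2 * \<i>)) * (- \<i> / (4 * of_int p)) ^ n * of_real ((deriv ^^ n) cot (pi * of_int l / (2 * of_int p)))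
          - (if n = 0 then 1 / 2 else 0)))"
    by (rule sum.cong[OF refl]) (simp only: dft)
  finally show ?thesis unfolding N_def .
qed

text \<open>Parseval's formula for the two finite Fourier transforms.\<close>

theorem S_odd_bernoulli_sum:
  assumes g: "even g" and q: "quotient_of x = (r, p)"
  shows "S_odd g x = (- 1) ^ (g div 2) * 2 ^ (2 * g + 1) / (of_nat g + 1) *
        (\<Sum>m\<in>odd_residues p.
           (bernpoly_per (g + 1) (of_int m * of_rat x / 2) - bernpoly_per (g + 1) (of_int m * of_rat x / 2 + 1 / 2)) *
           bernpoly 1 (of_int m / (2 * of_int p)))"
proof -
  have p: "p > 0" using q by (rule quotient_of_denom_pos)
  define X where "X = (of_int r / of_int p :: real)"
  have x: "of_rat x = X" using quotient_of_div[OF q] by (simp add: of_rat_divide X_def)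
  obtain h where h: "g = 2 * h" using g by (auto elim: evenE)
  define C where "C = (\<lambda>n. (deriv ^^ g) cot (pi * of_int n / (2 * of_int p)))"
  define b1 where "b1 = (\<lambda>m::int. bernpoly 1 (of_int m / (2 * of_int p)))"
  define A where "A = complex_of_real (real (Suc g) * ((-1) ^ h / (4 * of_int p) ^ g))"
  define \<delta> where "\<delta> = (if g = 0 then 1 / 2 else 0 :: complex)"
  define \<Delta> where "\<Delta> = (\<lambda>m::int. bernpoly_per (g + 1) (of_int m * of_rat x / 2) - bernpoly_per (g + 1) (of_int m * of_rat x / 2 + 1 / 2))"
  have \<Delta>: "of_int p * complex_of_real (\<Delta> m) =
     (\<Sum>l\<in>odd_residues p. e2pi (of_int (m * - l) * of_real X / 2) * (A / (2 * \<i>) * of_real (C l) - \<delta>))" for m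
  proof -
    have e1: "of_int m * of_rat x / 2 = (of_int (m * r) / of_int (2 * p) :: real)"
      unfolding x X_def by simp
    have e2: "of_int m * of_rat x / 2 + 1 / 2 = (of_int (m * r + p) / of_int (2 * p) :: real)"
      unfolding x X_def using p by (simp add: field_simps)
    have e3: "e2pi (of_int (- (l * (m * r))) / of_int (2 * p)) = e2pi (of_int (m * - l) * of_real X / 2)" for l
      by (rule arg_cong[where f = e2pi]) (simp add: X_def mult_ac)
    have "- \<i> / (4 * of_int p) = (- \<i>) * (1 / (4 * of_int p))" by simp
    hence "(- \<i> / (4 * of_int p)) ^ g = (- \<i>) ^ g * (1 / (4 * of_int p)) ^ g" by (simp only: power_mult_distrib)
    also have "(- \<i>) ^ g = (-1) ^ h" unfolding h by (simp add: power_mult)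
    finally have pow: "(- \<i> / (4 * of_int p)) ^ g = (-1) ^ h * (1 / (4 * of_int p)) ^ g" .
    have A: "of_nat (Suc g) * (1 / (2 * \<i>)) * (- \<i> / (4 * of_int p)) ^ g = A / (2 * \<i>)"
      unfolding pow A_def by (simp add: power_one_over mult_ac)
    show ?thesis
      unfolding \<Delta>_def e2 unfolding e1 Suc_eq_plus1[symmetric] bernpoly_per_difference[OF p, of g "m * r"] e3 A \<delta>_def C_def ..
  qed
  have "of_int p * (\<Sum>m\<in>odd_residues p. complex_of_real (\<Delta> m * b1 m)) =
     (\<Sum>m\<in>odd_residues p. (of_int p * complex_of_real (\<Delta> m)) * of_real (b1 m))"
    by (simp add: sum_distrib_left mult_ac)
  also have "\<dots> = (\<Sum>m\<in>odd_residues p. \<Sum>l\<in>odd_residues p. e2pi (of_int (m * - l) * of_real X / 2) * of_real (b1 m) * (A / (2 * \<i>) * of_real (C l) - \<delta>))"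
    unfolding \<Delta> sum_distrib_right by (simp add: mult_ac)
  also have "\<dots> = (\<Sum>l\<in>odd_residues p. (\<Sum>m\<in>odd_residues p. e2pi (of_int (m * - l) * of_real X / 2) * of_real (b1 m)) * (A / (2 * \<i>) * of_real (C l) - \<delta>))"
    unfolding sum_distrib_right by (rule sum.swap)
  also have "\<dots> = (\<Sum>l\<in>odd_residues p. A / 4 * of_real (C l / sin (pi * of_int l * X)) + \<delta> / (2 * \<i>) * of_real (1 / sin (pi * of_int l * X)))"
  proof (rule sum.cong)
    fix l assume "l \<in> odd_residues p"
    hence "odd (- l)" by (simp add: odd_residues_def)
    from bernpoly_1_dft[OF p this, of r]
    have "(\<Sum>m\<in>odd_residues p. e2pi (of_int (m * - l) * of_real X / 2) * of_real (b1 m)) = of_real (1 / sin (pi * of_int (- l) * X)) / (2 * \<i>)"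
      unfolding b1_def X_def .
    also have "\<dots> = - of_real (1 / sin (pi * of_int l * X)) / (2 * \<i>)" by simp
    finally have W: "(\<Sum>m\<in>odd_residues p. e2pi (of_int (m * - l) * of_real X / 2) * of_real (b1 m)) = - of_real (1 / sin (pi * of_int l * X)) / (2 * \<i>)" .
    have alg: "- S / (2 * \<i>) * (A / (2 * \<i>) * c - \<delta>) = A / 4 * (c * S) + \<delta> / (2 * \<i>) * S" for S c :: complex
      by (simp add: field_simps)
    show "(\<Sum>m\<in>odd_residues p. e2pi (of_int (m * - l) * of_real X / 2) * of_real (b1 m)) * (A / (2 * \<i>) * of_real (C l) - \<delta>) =
        A / 4 * of_real (C l / sin (pi * of_int l * X)) + \<delta> / (2 * \<i>) * of_real (1 / sin (pi * of_int l * X))"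
      unfolding W alg by simp
  qed simp
  also have "\<dots> = A / 4 * of_real (\<Sum>l\<in>odd_residues p. C l / sin (pi * of_int l * X)) + \<delta> / (2 * \<i>) * of_real (\<Sum>l\<in>odd_residues p. 1 / sin (pi * of_int l * X))"
    by (simp only: sum.distrib sum_distrib_left of_real_sum)
  \<comment> \<open>oddness under \<open>l \<mapsto> 2p - l\<close> disposes of the constant \<open>1/2\<close> that the transform carries for \<open>g = 0\<close>\<close>
  also have "(\<Sum>l\<in>odd_residues p. 1 / sin (pi * of_int l * X)) = 0"
  proof -
    have "(\<Sum>l\<in>odd_residues p. 1 / sin (pi * of_int l * X)) = (\<Sum>l\<in>odd_residues p. 1 / sin (pi * of_int (2 * p - l) * X))"
      by (rule sum_odd_residues_reflect)
    also have "\<dots> = - (\<Sum>l\<in>odd_residues p. 1 / sin (pi * of_int l * X))"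
      unfolding X_def sin_reflect[OF p] by (simp add: sum_negf)
    finally show ?thesis by simp
  qed
  also have "(\<Sum>l\<in>odd_residues p. C l / sin (pi * of_int l * X)) = 2 * of_int p ^ (g + 1) * S_odd g x"
    unfolding S_odd_full_sum[OF g q] C_def X_def using p by simp
  finally have "complex_of_real (of_int p * (\<Sum>m\<in>odd_residues p. \<Delta> m * b1 m)) =
      complex_of_real (real (Suc g) * ((-1) ^ h / (4 * of_int p) ^ g) / 4 * (2 * of_int p ^ (g + 1) * S_odd g x))"
    by (simp add: A_def)
  hence "of_int p * (\<Sum>m\<in>odd_residues p. \<Delta> m * b1 m) = real (Suc g) * ((-1) ^ h / (4 * of_int p) ^ g) / 4 * (2 * of_int p ^ (g + 1) * S_odd g x)"
    by (simp only: of_real_eq_iff)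
  also have "\<dots> = of_int p * (real (Suc g) * (-1) ^ h / (2 * 4 ^ g) * S_odd g x)"
    using p by (simp add: power_mult_distrib)
  finally have "(\<Sum>m\<in>odd_residues p. \<Delta> m * b1 m) = real (Suc g) * (-1) ^ h / (2 * 4 ^ g) * S_odd g x"
    using p by (simp only: mult_cancel_left) simp
  moreover have "(2::real) ^ (2 * g + 1) = 2 * 4 ^ g" by (simp add: power_mult)
  moreover have "(-1::real) ^ h * (-1) ^ h = 1" by (simp flip: power_mult_distrib)
  moreover have "S = s * (2 * Q) / m * Y" if "Y = m * s / (2 * Q) * S" "s * s = 1" "Q \<noteq> 0" "m \<noteq> 0" for S s Q m Y :: real
  proof -
    have "s * (2 * Q) / m * Y = (s * s) * S" unfolding that(1) using that(3,4) by simp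
    thus ?thesis using that(2) by simp
  qed
  ultimately have "S_odd g x = (-1) ^ h * (2 * 4 ^ g) / real (Suc g) * (\<Sum>m\<in>odd_residues p. \<Delta> m * b1 m)" by simp
  moreover have "g div 2 = h" "real (Suc g) = of_nat g + 1" using h by simp_all
  ultimately show ?thesis unfolding \<Delta>_def b1_def \<open>2 ^ (2 * g + 1) = 2 * 4 ^ g\<close> by simp
qed

section \<open>Period integrals\<close>

lemma has_integral_atLeast_FTC:
  fixes F :: "real \<Rightarrow> complex"
  assumes D: "\<And>t. t \<ge> 0 \<Longrightarrow> (F has_vector_derivative f t) (at t)" and lim: "(F \<longlongrightarrow> L) at_top"
  shows "(f has_integral (L - F 0)) {0..}"
  unfolding has_integral_alt'[of f]
proof (intro conjI allI impI)
  have int: "((\<lambda>x. if x \<in> {0..} then f x else 0) has_integral (F (max b 0) - F 0)) (cbox a b)" if "a \<le> 0" for a b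
  proof (cases "b \<ge> 0")
    case True
    have "(f has_integral (F b - F 0)) {0..b}"
      using True by (intro fundamental_theorem_of_calculus) (auto intro!: has_vector_derivative_at_within D)
    hence "((\<lambda>x. if x \<in> {0..b} then f x else 0) has_integral (F b - F 0)) (cbox a b)"
      using that by (subst has_integral_restrict) (auto simp: True)
    hence "((\<lambda>x. if x \<in> {0..} then f x else 0) has_integral (F b - F 0)) (cbox a b)"
      by (rule has_integral_eq[rotated]) auto
    thus ?thesis using True by (simp add: max_def)
  next
    case False
    hence "((\<lambda>x. if x \<in> {0..} then f x else 0) has_integral 0) (cbox a b)"
      by (intro has_integral_is_0) auto
    thus ?thesis using False by simp
  qed
  show "(\<lambda>x. if x \<in> {0..} then f x else 0) integrable_on cbox a b" for a b
  proof -
    have "(\<lambda>x. if x \<in> {0..} then f x else 0) integrable_on cbox (min a 0) b" using int[of "min a 0" b] by auto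
    thus ?thesis by (rule integrable_on_subcbox) auto
  qed
  fix e :: real assume "e > 0"
  with lim have "\<forall>\<^sub>F t in at_top. dist (F t) L < e" by (rule tendstoD)
  then obtain T where T: "\<And>t. t \<ge> T \<Longrightarrow> dist (F t) L < e" unfolding eventually_at_top_linorder by blast
  show "\<exists>B>0. \<forall>a b. ball 0 B \<subseteq> cbox a b \<longrightarrow> norm (integral (cbox a b) (\<lambda>x. if x \<in> {0..} then f x else 0) - (L - F 0)) < e"
  proof (intro exI[of _ "max 1 (\<bar>T\<bar> + 1)"] conjI allI impI)
    fix a b :: real assume sub: "ball 0 (max 1 (\<bar>T\<bar> + 1)) \<subseteq> cbox a b"
    have "0 \<in> ball 0 (max 1 (\<bar>T\<bar> + 1))" "\<bar>T\<bar> \<in> ball 0 (max 1 (\<bar>T\<bar> + 1))"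
      "(1 / 2 :: real) \<in> ball 0 (max 1 (\<bar>T\<bar> + 1))" by (auto simp: dist_real_def)
    hence "0 \<in> cbox a b" "\<bar>T\<bar> \<in> cbox a b" "1 / 2 \<in> cbox a b" using sub by blast+
    hence "a \<le> 0" "b \<ge> \<bar>T\<bar>" "b > 0" by auto
    hence "integral (cbox a b) (\<lambda>x. if x \<in> {0..} then f x else 0) = F b - F 0"
      using int[of a b] by (intro integral_unique) (simp add: max_def)
    thus "norm (integral (cbox a b) (\<lambda>x. if x \<in> {0..} then f x else 0) - (L - F 0)) < e"
      using T[of b] \<open>b \<ge> \<bar>T\<bar>\<close> by (simp add: dist_norm)
  qed simp
qed

lemma has_vector_derivative_vertical:
  assumes "(G has_field_derivative h (z + \<i> * of_real t)) (at (z + \<i> * of_real t))"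
  shows "((\<lambda>t. G (z + \<i> * of_real t)) has_vector_derivative (h (z + \<i> * of_real t) * \<i>)) (at t)"
proof -
  have "((\<lambda>t. z + \<i> * of_real t) has_vector_derivative \<i>) (at t)"
    by (auto intro!: derivative_eq_intros)
  from field_vector_diff_chain_at[OF this assms] show ?thesis by (simp add: o_def mult.commute)
qed

lemma complex_of_rat: "(of_rat s :: complex) = of_real (of_rat s)"
  by (cases s) (simp add: of_rat_rat)

text \<open>A primitive that has limits at the two cusps computes the cusp integral, along every path.\<close>

lemma cusp_integral_eq_primitive:
  fixes G h :: "complex \<Rightarrow> complex"
  assumes D: "\<And>z. Im z > 0 \<Longrightarrow> (G has_field_derivative h z) (at z)"
    and inf: "\<And>z. Im z > 0 \<Longrightarrow> ((\<lambda>t. G (z + \<i> * of_real t)) \<longlongrightarrow> 0) at_top"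
    and v: "v = None \<and> L = 0 \<or> (\<exists>s. v = Some s \<and> ((\<lambda>t. G (of_rat s + \<i> * of_real t)) \<longlongrightarrow> L) (at_right 0))"
  shows "cusp_integral h None v = L"
proof -
  have vert_inf: "has_vertical_integral h (- G z) z None" if "Im z > 0" for z
  proof -
    have "((\<lambda>t. h (z + \<i> * of_real t) * \<i>) has_integral (0 - G (z + \<i> * of_real 0))) {0..}"
      by (rule has_integral_atLeast_FTC) (use that inf in \<open>auto intro!: has_vector_derivative_vertical D\<close>)
    thus ?thesis by simp
  qed
  have vert: "has_vertical_integral h (L - G z) z v" if "above_cusp z v" for z
    using v
  proof (elim disjE conjE exE)
    assume "v = None" "L = 0"
    thus ?thesis using vert_inf that by simp
  next
    fix s assume s: "v = Some s" "((\<lambda>t. G (of_rat s + \<i> * of_real t)) \<longlongrightarrow> L) (at_right 0)"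
    have z: "Im z > 0" "Re z = of_rat s" using that s(1) by auto
    define S :: complex where "S = of_rat s"
    have S: "Re S = of_rat s" "Im S = 0" unfolding S_def by (simp_all add: complex_of_rat)
    have lp: "linepath z S t = S + \<i> * of_real ((1 - t) * Im z)" for t
      using z S by (simp add: linepath_def complex_eq_iff scaleR_conv_of_real algebra_simps)
    define H where "H = (\<lambda>t. if t < 1 then G (linepath z S t) else L)"
    have D': "(H has_vector_derivative (h (linepath z S t) * (S - z))) (at t)" if "t < 1" for t
    proof -
      have "Im (linepath z S t) > 0" unfolding lp using that z S by simp
      moreover have "(linepath z S has_vector_derivative (S - z)) (at t)"
        unfolding linepath_def by (auto intro!: derivative_eq_intros simp: algebra_simps)
      ultimately have "((\<lambda>t. G (linepath z S t)) has_vector_derivative (h (linepath z S t) * (S - z))) (at t)"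
        using field_vector_diff_chain_at[OF _ D, of "linepath z S" "S - z" t] by (simp add: o_def mult.commute)
      thus ?thesis
        by (rule has_vector_derivative_transform_within_open[where S = "{..<1}"]) (use that in \<open>auto simp: H_def\<close>)
    qed
    have "((\<lambda>t. h (linepath z S t) * (S - z)) has_integral (H 1 - H 0)) {0..1}"
    proof (rule fundamental_theorem_of_calculus_interior)
      show "continuous_on {0..1} H"
        unfolding continuous_on_eq_continuous_within
      proof
        fix t :: real assume t: "t \<in> {0..1}"
        show "continuous (at t within {0..1}) H"
        proof (cases "t = 1")
          case False
          hence "isCont H t" using has_vector_derivative_continuous[OF D'] t by auto
          thus ?thesis by (rule continuous_at_imp_continuous_at_within)
        next
          case True
          have "((\<lambda>t. G (S + \<i> * of_real ((1 - t) * Im z))) \<longlongrightarrow> L) (at_left 1)"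
          proof (rule filterlim_compose[OF s(2)[folded S_def]])
            show "filterlim (\<lambda>t. (1 - t) * Im z) (at_right 0) (at_left 1)"
              unfolding filterlim_at
            proof
              show "((\<lambda>t. (1 - t) * Im z) \<longlongrightarrow> 0) (at_left 1)" by (auto intro!: tendsto_eq_intros)
              show "\<forall>\<^sub>F t in at_left 1. (1 - t) * Im z \<in> {0<..} \<and> (1 - t) * Im z \<noteq> 0"
                using z(1) unfolding eventually_at_left_field by (intro exI[of _ 0]) simp
            qed
          qed
          moreover have "\<forall>\<^sub>F t in at_left 1. G (S + \<i> * of_real ((1 - t) * Im z)) = H t"
            unfolding eventually_at_left_field by (intro exI[of _ 0]) (simp add: H_def lp)
          ultimately have "(H \<longlongrightarrow> L) (at_left 1)" by (rule Lim_transform_eventually)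
          hence "(H \<longlongrightarrow> H 1) (at 1 within {0..1})"
            by (simp add: H_def at_within_Icc_at_left)
          thus ?thesis unfolding True continuous_within .
        qed
      qed
    qed (use D' in auto)
    hence "((\<lambda>t. h (linepath z S t) * (S - z)) has_integral (L - G z)) {0..1}" by (simp add: H_def linepath_def)
    thus ?thesis unfolding s(1) by (simp add: has_contour_integral_linepath S_def)
  qed
  have main: "has_cusp_integral h L None \<delta> v"
    if \<delta>: "valid_path \<delta>" "path_image \<delta> \<subseteq> upper_half_plane" "above_cusp (pathstart \<delta>) None" "above_cusp (pathfinish \<delta>) v" for \<delta>
  proof -
    have c: "(h has_contour_integral (G (pathfinish \<delta>) - G (pathstart \<delta>))) \<delta>"
      by (rule contour_integral_primitive[OF _ \<delta>(1,2)])
         (auto simp: upper_half_plane_def intro!: has_field_derivative_at_within D)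
    have "L = - (- G (pathstart \<delta>)) + (G (pathfinish \<delta>) - G (pathstart \<delta>)) + (L - G (pathfinish \<delta>))" by simp
    thus ?thesis unfolding has_cusp_integral_def using c vert[OF \<delta>(4)] vert_inf[of "pathstart \<delta>"] \<delta>(3)
      by (metis above_cusp.simps(1))
  qed
  have uniq: "I = L" if I: "\<forall>\<delta>. valid_path \<delta> \<and> path_image \<delta> \<subseteq> upper_half_plane \<and>
     above_cusp (pathstart \<delta>) None \<and> above_cusp (pathfinish \<delta>) v \<longrightarrow> has_cusp_integral h I None \<delta> v" for I
  proof -
    define w where "w = (case v of None \<Rightarrow> \<i> | Some s \<Rightarrow> of_rat s + \<i>)"
    have w: "Im w > 0" "above_cusp w v"
      by (cases v; simp add: w_def complex_of_rat)+
    have \<delta>: "valid_path (linepath w w)" "path_image (linepath w w) \<subseteq> upper_half_plane"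
       "above_cusp (pathstart (linepath w w)) None" "above_cusp (pathfinish (linepath w w)) v"
      using w by (auto simp: upper_half_plane_def)
    have vu: "i = j" if "has_vertical_integral h i w u" "has_vertical_integral h j w u" for i j u
      using that by (cases u) (auto intro: has_integral_unique has_contour_integral_unique)
    from I \<delta> have "has_cusp_integral h I None (linepath w w) v" by blast
    then obtain I1 I2 I3 where 1: "has_vertical_integral h I1 w None" "(h has_contour_integral I2) (linepath w w)"
       "has_vertical_integral h I3 w v" "I = - I1 + I2 + I3" unfolding has_cusp_integral_def by auto
    from main[OF \<delta>] obtain J1 J2 J3 where 2: "has_vertical_integral h J1 w None" "(h has_contour_integral J2) (linepath w w)"
       "has_vertical_integral h J3 w v" "L = - J1 + J2 + J3" unfolding has_cusp_integral_def by auto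
    show ?thesis
      using vu[OF 1(1) 2(1)] vu[OF 1(3) 2(3)] has_contour_integral_unique[OF 1(2) 2(2)] 1(4) 2(4) by simp
  qed
  show ?thesis unfolding cusp_integral_def
    by (rule the_equality) (use main uniq in blast)+
qed

definition taylor_sum :: "nat \<Rightarrow> (complex \<Rightarrow> complex) \<Rightarrow> complex \<Rightarrow> complex \<Rightarrow> complex" where
  "taylor_sum n h X z = (\<Sum>k\<le>n. (X - z) ^ k / fact k * (deriv ^^ k) h z)"

lemma DERIV_taylor_sum:
  assumes "h holomorphic_on S" "open S" "z \<in> S"
  shows "(taylor_sum n h X has_field_derivative (X - z) ^ n / fact n * (deriv ^^ Suc n) h z) (at z)"
proof (induction n)
  have D: "((deriv ^^ k) h has_field_derivative (deriv ^^ Suc k) h z) (at z)" for k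
    using holomorphic_derivI[OF holomorphic_higher_deriv[OF assms(1,2)] assms(2,3)] by simp
  {
    case 0
    show ?case using D[of 0] by (simp add: taylor_sum_def[abs_def])
  next
    case (Suc n)
    have "((\<lambda>z. taylor_sum n h X z + (X - z) ^ Suc n / fact (Suc n) * (deriv ^^ Suc n) h z) has_field_derivative
       (X - z) ^ n / fact n * (deriv ^^ Suc n) h z +
       ((real (Suc n) * (X - z) ^ n * (-1)) / fact (Suc n) * (deriv ^^ Suc n) h z + (deriv ^^ Suc (Suc n)) h z * ((X - z) ^ Suc n / fact (Suc n)))) (at z)"
      by (rule derivative_eq_intros Suc.IH D refl | simp del: power_Suc fact_Suc funpow.simps)+
    also have "(\<lambda>z. taylor_sum n h X z + (X - z) ^ Suc n / fact (Suc n) * (deriv ^^ Suc n) h z) = taylor_sum (Suc n) h X"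
      by (simp add: taylor_sum_def[abs_def])
    also have "(X - z) ^ n / fact n * (deriv ^^ Suc n) h z +
       ((real (Suc n) * (X - z) ^ n * (-1)) / fact (Suc n) * (deriv ^^ Suc n) h z + (deriv ^^ Suc (Suc n)) h z * ((X - z) ^ Suc n / fact (Suc n))) =
       (X - z) ^ Suc n / fact (Suc n) * (deriv ^^ Suc (Suc n)) h z"
      by (simp add: fact_Suc del: funpow.simps of_nat_Suc)
    finally show ?case .
  }
qed

lemma taylor_sum_poly:
  assumes "degree (q :: complex poly) \<le> n"
  shows "taylor_sum n (poly q) X z = poly q X"
proof -
  have D: "((\<lambda>z. taylor_sum n (poly q) X z) has_field_derivative 0) (at z)" for z
  proof -
    have "(pderiv ^^ Suc n) q = 0"
      using higher_pderiv_top[OF assms] by simp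
    hence "(deriv ^^ Suc n) (poly q) z = 0" unfolding higher_deriv_poly by simp
    moreover have "(\<lambda>z. poly q z) holomorphic_on UNIV" by (intro holomorphic_intros)
    ultimately show ?thesis using DERIV_taylor_sum[of "poly q" UNIV z n X] by simp
  qed
  obtain c where c: "\<And>z. taylor_sum n (poly q) X z = c"
    using has_field_derivative_zero_constant[of UNIV "taylor_sum n (poly q) X"] D by auto
  have "taylor_sum n (poly q) X X = (\<Sum>k\<le>n. if k = 0 then poly q X else 0)"
    unfolding taylor_sum_def by (intro sum.cong) (auto simp: power_0_left)
  also have "\<dots> = poly q X" by simp
  finally show ?thesis using c[of z] c[of X] by simp
qed

lemma taylor_sum_qser_at_infinity:
  assumes c: "poly_bounded c" "c 0 = 0" and z: "Im z > 0"
  shows "((\<lambda>t. taylor_sum n (qser c) X (z + \<i> * of_real t)) \<longlongrightarrow> 0) at_top"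
  unfolding taylor_sum_def
proof (rule tendsto_null_sum)
  fix k
  have pb: "poly_bounded (\<lambda>n. (of_real pi * \<i> * of_nat n) ^ k * c n)" by (rule poly_bounded_deriv[OF c(1)])
  obtain M where M: "M \<ge> 0" "\<And>\<tau>. Im \<tau> \<ge> Im z \<Longrightarrow> norm (qser (\<lambda>n. (of_real pi * \<i> * of_nat n) ^ k * c n) \<tau> - 0) \<le> M * exp (- pi * Im \<tau>)"
    using qser_minus_const_bound[OF pb z] c(2) by auto
  define A where "A = norm (X - z)"
  show "((\<lambda>t. (X - (z + \<i> * of_real t)) ^ k / fact k * (deriv ^^ k) (qser c) (z + \<i> * of_real t)) \<longlongrightarrow> 0) at_top"
  proof (rule Lim_null_comparison)
    show "\<forall>\<^sub>F t in at_top. norm ((X - (z + \<i> * of_real t)) ^ k / fact k * (deriv ^^ k) (qser c) (z + \<i> * of_real t)) \<le> M * exp A * ((A + t) ^ k / exp (A + t))"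
      using eventually_ge_at_top[of 0]
    proof eventually_elim
      fix t :: real assume t: "t \<ge> 0"
      have Im: "Im (z + \<i> * of_real t) > 0" "Im (z + \<i> * of_real t) \<ge> Im z" using z t by auto
      have n1: "norm (X - (z + \<i> * of_real t)) \<le> A + t"
        using norm_triangle_ineq4[of "X - z" "\<i> * of_real t"] t by (simp add: A_def norm_mult algebra_simps)
      have "norm ((deriv ^^ k) (qser c) (z + \<i> * of_real t)) \<le> M * exp (- pi * Im (z + \<i> * of_real t))"
        unfolding higher_deriv_qser[OF c(1) Im(1)] using M(2)[OF Im(2)] by simp
      also have "\<dots> \<le> M * exp (- t)"
      proof (intro mult_left_mono M(1))
        have "1 * t \<le> pi * (Im z + t)" using pi_ge_two t z by (intro mult_mono) auto
        thus "exp (- pi * Im (z + \<i> * of_real t)) \<le> exp (- t)" by simp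
      qed
      finally have n2: "norm ((deriv ^^ k) (qser c) (z + \<i> * of_real t)) \<le> M * exp (- t)" .
      have "norm ((X - (z + \<i> * of_real t)) ^ k / fact k * (deriv ^^ k) (qser c) (z + \<i> * of_real t)) =
          norm (X - (z + \<i> * of_real t)) ^ k / fact k * norm ((deriv ^^ k) (qser c) (z + \<i> * of_real t))"
        by (simp add: norm_mult norm_divide norm_power)
      also have "\<dots> \<le> (A + t) ^ k / 1 * (M * exp (- t))"
        using n1 n2 t by (intro mult_mono frac_le power_mono) (auto simp: fact_ge_1 A_def)
      also have "\<dots> = M * exp A * ((A + t) ^ k / exp (A + t))" by (simp add: exp_add exp_minus field_simps)
      finally show "norm ((X - (z + \<i> * of_real t)) ^ k / fact k * (deriv ^^ k) (qser c) (z + \<i> * of_real t)) \<le> M * exp A * ((A + t) ^ k / exp (A + t))" .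
    qed
    have "filterlim (\<lambda>t. A + t) at_top at_top" by (intro filterlim_tendsto_add_at_top[OF tendsto_const] filterlim_ident)
    from filterlim_compose[OF tendsto_power_div_exp_0 this]
    show "((\<lambda>t. M * exp A * ((A + t) ^ k / exp (A + t))) \<longlongrightarrow> 0) at_top"
      by (rule tendsto_mult_right_zero)
  qed
qed

lemma tendsto_powr_exp_inverse_0:
  fixes \<kappa> m :: real assumes "\<kappa> > 0"
  shows "((\<lambda>t. t powr m * exp (- \<kappa> / t)) \<longlongrightarrow> 0) (at_right 0)"
  using assms by real_asymp

text \<open>At the cusp \<open>-d/c\<close> the matrix sends the imaginary part to infinity, where a Fourier series without constant
  term decays exponentially in \<open>1 / t\<close>. Differentiation lowers the weight, so the induction runs over all
  integers \<open>m\<close>.\<close>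

lemma higher_deriv_slash_decay:
  fixes a b c d :: int
  assumes det: "a * d - b * c = 1" and c: "c \<noteq> 0" and e: "poly_bounded e" "e 0 = 0"
  shows "((\<lambda>t. (deriv ^^ k) (\<lambda>z. (of_int c * z + of_int d) powi m * qser e ((of_int a * z + of_int b) / (of_int c * z + of_int d)))
     (of_real (- of_int d / of_int c) + \<i> * of_real t)) \<longlongrightarrow> 0) (at_right 0)"
  using e
proof (induction k arbitrary: m e)
  case 0
  obtain M where M: "M \<ge> 0" "\<And>\<tau>. Im \<tau> \<ge> 1 \<Longrightarrow> norm (qser e \<tau> - 0) \<le> M * exp (- pi * Im \<tau>)"
    using qser_minus_const_bound[OF 0(1), of 1] 0(2) by auto
  define \<kappa> where "\<kappa> = pi / of_int c ^ 2"
  have \<kappa>: "\<kappa> > 0" using c by (simp add: \<kappa>_def)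
  define B where "B = \<bar>of_int c\<bar> powi m * M"
  show ?case
  proof (rule Lim_null_comparison)
    show "\<forall>\<^sub>F t in at_right 0. norm ((deriv ^^ 0) (\<lambda>z. (of_int c * z + of_int d) powi m * qser e ((of_int a * z + of_int b) / (of_int c * z + of_int d)))
     (of_real (- of_int d / of_int c) + \<i> * of_real t)) \<le> B * (t powr of_int m * exp (- \<kappa> / t))"
    proof -
      have "1 / (of_int c ^ 2 :: real) > 0" using c by simp
      from eventually_at_right_real[OF this] show ?thesis
      proof eventually_elim
        fix t :: real assume t: "t \<in> {0<..<1 / of_int c ^ 2}"
        define z where "z = of_real (- of_int d / of_int c) + \<i> * of_real t"
        have J: "of_int c * z + of_int d = \<i> * of_real (of_int c * t)" using c by (simp add: z_def algebra_simps)
        have z: "Im z > 0" "Im z = t" using t by (simp_all add: z_def)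
        have nJ: "norm (of_int c * z + of_int d) = \<bar>of_int c\<bar> * t" unfolding J using t by (simp add: norm_mult abs_mult)
        have Im: "Im ((of_int a * z + of_int b) / (of_int c * z + of_int d)) = 1 / (of_int c ^ 2 * t)"
          unfolding Im_moebius(1)[OF det z(1)] nJ z(2) using t by (simp add: power_mult_distrib power2_eq_square)
        have "of_int c ^ 2 * t \<le> 1" using t c by (simp add: field_simps)
        hence "1 / (of_int c ^ 2 * t) \<ge> 1" using t c by simp
        hence "norm (qser e ((of_int a * z + of_int b) / (of_int c * z + of_int d))) \<le> M * exp (- pi * (1 / (of_int c ^ 2 * t)))"
          using M(2)[of "(of_int a * z + of_int b) / (of_int c * z + of_int d)"] unfolding Im by simp
        also have "- pi * (1 / (of_int c ^ 2 * t)) = - \<kappa> / t" by (simp add: \<kappa>_def)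
        finally have "norm ((of_int c * z + of_int d) powi m * qser e ((of_int a * z + of_int b) / (of_int c * z + of_int d))) \<le>
            (\<bar>of_int c\<bar> * t) powi m * (M * exp (- \<kappa> / t))"
          unfolding norm_mult norm_power_int nJ using t by (intro mult_left_mono) auto
        also have "\<dots> = B * (t powr of_int m * exp (- \<kappa> / t))"
          using t by (simp add: B_def power_int_mult_distrib powr_real_of_int')
        finally show "norm ((deriv ^^ 0) (\<lambda>z. (of_int c * z + of_int d) powi m * qser e ((of_int a * z + of_int b) / (of_int c * z + of_int d)))
     (of_real (- of_int d / of_int c) + \<i> * of_real t)) \<le> B * (t powr of_int m * exp (- \<kappa> / t))"
          by (simp add: z_def)
      qed
    qed
    show "((\<lambda>t. B * (t powr of_int m * exp (- \<kappa> / t))) \<longlongrightarrow> 0) (at_right 0)"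
      by (rule tendsto_mult_right_zero[OF tendsto_powr_exp_inverse_0[OF \<kappa>]])
  qed
next
  case (Suc k)
  define J where "J = (\<lambda>z::complex. of_int c * z + of_int d)"
  define \<gamma> where "\<gamma> = (\<lambda>z::complex. (of_int a * z + of_int b) / J z)"
  define F where "F = (\<lambda>m e z. J z powi m * qser e (\<gamma> z))"
  define e' where "e' = (\<lambda>n. (of_real pi * \<i> * of_nat n) * e n)"
  have pb': "poly_bounded e'" using poly_bounded_deriv[OF Suc.prems(1), of "of_real pi * \<i>" 1] by (simp add: e'_def)
  have J0: "J \<tau> \<noteq> 0" if "Im \<tau> > 0" for \<tau>
    unfolding J_def by (rule moebius_denom_nonzero[OF that]) (use c in auto)
  have \<gamma>: "Im (\<gamma> \<tau>) > 0" if "Im \<tau> > 0" for \<tau>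
    unfolding \<gamma>_def J_def by (rule Im_moebius(2)[OF det that])
  have detc: "of_int a * of_int d - of_int b * of_int c = (1::complex)"
    using arg_cong[OF det, of "of_int :: int \<Rightarrow> complex"] by simp
  have DJ: "(J has_field_derivative of_int c) (at \<tau>)" for \<tau>
    unfolding J_def by (auto intro!: derivative_eq_intros)
  have D\<gamma>: "(\<gamma> has_field_derivative 1 / J \<tau> ^ 2) (at \<tau>)" if "Im \<tau> > 0" for \<tau>
  proof -
    have "(\<gamma> has_field_derivative (of_int a * J \<tau> - (of_int a * \<tau> + of_int b) * of_int c) / (J \<tau> * J \<tau>)) (at \<tau>)"
      unfolding \<gamma>_def using J0[OF that] by (auto intro!: derivative_eq_intros DJ)
    also have "of_int a * J \<tau> - (of_int a * \<tau> + of_int b) * of_int c = of_int a * of_int d - of_int b * of_int c"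
      by (simp add: J_def algebra_simps)
    finally show ?thesis unfolding detc by (simp add: power2_eq_square)
  qed
  have DF: "(F m e has_field_derivative (of_int m * of_int c) * F (m - 1) e z + F (m - 2) (\<lambda>n. (of_real pi * \<i> * of_nat n) * e n) z) (at z)"
    if "Im z > 0" "poly_bounded e" for m e z
  proof -
    have "((\<lambda>z. qser e (\<gamma> z)) has_field_derivative qser (\<lambda>n. (of_real pi * \<i> * of_nat n) * e n) (\<gamma> z) * (1 / J z ^ 2)) (at z)"
      by (rule DERIV_chain2[OF DERIV_qser[OF that(2) \<gamma>[OF that(1)]] D\<gamma>[OF that(1)]])
    moreover have "((\<lambda>z. J z powi m) has_field_derivative of_int m * J z powi (m - 1) * of_int c) (at z)"
      using J0[OF that(1)] by (auto intro!: derivative_eq_intros DJ)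
    ultimately have "(F m e has_field_derivative (of_int m * J z powi (m - 1) * of_int c) * qser e (\<gamma> z) +
        (qser (\<lambda>n. (of_real pi * \<i> * of_nat n) * e n) (\<gamma> z) * (1 / J z ^ 2)) * J z powi m) (at z)"
      unfolding F_def by (rule DERIV_mult[rotated])
    moreover have "J z powi (m - 2) = J z powi m * (1 / J z ^ 2)"
      using J0[OF that(1)] by (simp add: power_int_diff)
    ultimately show ?thesis by (simp add: F_def mult_ac)
  qed
  have hol: "F m e holomorphic_on upper_half_plane" if "poly_bounded e" for m e
    unfolding holomorphic_on_open[OF open_upper_half_plane] using DF that by (auto simp: upper_half_plane_def)
  have eq: "(deriv ^^ Suc k) (F m e) z = (of_int m * of_int c) * (deriv ^^ k) (F (m - 1) e) z + (deriv ^^ k) (F (m - 2) e') z"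
    if z: "z \<in> upper_half_plane" for z
  proof -
    have "(deriv ^^ Suc k) (F m e) z = (deriv ^^ k) (deriv (F m e)) z" by (simp only: funpow_Suc_right o_def)
    also have "\<dots> = (deriv ^^ k) (\<lambda>z. (of_int m * of_int c) * F (m - 1) e z + F (m - 2) e' z) z"
    proof (rule higher_deriv_cong_ev)
      show "\<forall>\<^sub>F z in nhds z. deriv (F m e) z = (of_int m * of_int c) * F (m - 1) e z + F (m - 2) e' z"
        using eventually_nhds_in_open[OF open_upper_half_plane z]
        by eventually_elim (auto simp: upper_half_plane_def e'_def intro!: DERIV_imp_deriv DF Suc.prems)
    qed simp
    also have "\<dots> = (deriv ^^ k) (\<lambda>z. (of_int m * of_int c) * F (m - 1) e z) z + (deriv ^^ k) (F (m - 2) e') z"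
      by (rule higher_deriv_add[OF _ hol[OF pb'] open_upper_half_plane z])
         (intro holomorphic_intros hol Suc.prems)
    also have "(deriv ^^ k) (\<lambda>z. (of_int m * of_int c) * F (m - 1) e z) z = (of_int m * of_int c) * (deriv ^^ k) (F (m - 1) e) z"
      by (rule higher_deriv_cmult[OF hol[OF Suc.prems(1)] z open_upper_half_plane])
    finally show ?thesis .
  qed
  have I1: "((\<lambda>t. (deriv ^^ k) (F (m - 1) e) (of_real (- of_int d / of_int c) + \<i> * of_real t)) \<longlongrightarrow> 0) (at_right 0)"
    using Suc.IH[OF Suc.prems, of "m - 1"] unfolding F_def J_def \<gamma>_def .
  have I2: "((\<lambda>t. (deriv ^^ k) (F (m - 2) e') (of_real (- of_int d / of_int c) + \<i> * of_real t)) \<longlongrightarrow> 0) (at_right 0)"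
    using Suc.IH[OF pb', of "m - 2"] unfolding F_def J_def \<gamma>_def by (simp add: e'_def)
  have "((\<lambda>t. (of_int m * of_int c) * (deriv ^^ k) (F (m - 1) e) (of_real (- of_int d / of_int c) + \<i> * of_real t) +
       (deriv ^^ k) (F (m - 2) e') (of_real (- of_int d / of_int c) + \<i> * of_real t)) \<longlongrightarrow> (of_int m * of_int c) * 0 + 0) (at_right 0)"
    by (intro tendsto_intros I1 I2)
  moreover have "\<forall>\<^sub>F t in at_right 0. (of_int m * of_int c) * (deriv ^^ k) (F (m - 1) e) (of_real (- of_int d / of_int c) + \<i> * of_real t) +
       (deriv ^^ k) (F (m - 2) e') (of_real (- of_int d / of_int c) + \<i> * of_real t) = (deriv ^^ Suc k) (F m e) (of_real (- of_int d / of_int c) + \<i> * of_real t)"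
    using eventually_at_right_less[of 0] by eventually_elim (subst eq, auto simp: upper_half_plane_def)
  ultimately have "((\<lambda>t. (deriv ^^ Suc k) (F m e) (of_real (- of_int d / of_int c) + \<i> * of_real t)) \<longlongrightarrow> (of_int m * of_int c) * 0 + 0) (at_right 0)"
    by (rule Lim_transform_eventually)
  thus ?case unfolding F_def J_def \<gamma>_def by simp
qed

text \<open>The period polynomial is, up to a constant, the polynomial by which \<open>E\<^bsub>-g\<^esub>\<close> fails to be invariant: the
  Taylor sum of \<open>E\<^bsub>-g\<^esub>\<close> is a primitive of the integrand, it vanishes at \<open>i\<infinity>\<close>, and at the other cusp only
  the Taylor sum of the polynomial survives, which is the polynomial itself.\<close>

theorem period_R_eq:
  assumes g: "even g" and \<gamma>: "Gamma2 a b c d"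
  obtains R :: "real poly" where "degree R \<le> g"
    "\<And>\<tau>. Im \<tau> > 0 \<Longrightarrow> (of_int c * \<tau> + of_int d) ^ g * E_odd (- int g) ((of_int a * \<tau> + of_int b) / (of_int c * \<tau> + of_int d)) =
       E_odd (- int g) \<tau> + \<i> * poly (cpoly R) \<tau>"
    "\<And>X. period_R g (E_odd (int g + 2)) a b c d X = - (fact g / (of_real pi * \<i>) ^ Suc g) * (\<i> * poly (cpoly R) X)"
proof -
  have det: "a * d - b * c = 1" using \<gamma> by (simp add: Gamma2_def)
  let ?E = "E_odd (- int g)"
  define K where "K = fact g / (of_real pi * \<i>) ^ Suc g"
  have pi0: "(of_real pi * \<i>) ^ Suc g \<noteq> (0::complex)" by simp
  have D: "((\<lambda>z. K * taylor_sum g ?E X z) has_field_derivative E_odd (int g + 2) z * (X - z) ^ g) (at z)"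
    if "Im z > 0" for X z
  proof -
    have "((\<lambda>z. K * taylor_sum g ?E X z) has_field_derivative K * ((X - z) ^ g / fact g * (deriv ^^ Suc g) ?E z)) (at z)"
      by (intro DERIV_cmult DERIV_taylor_sum[OF E_odd_holomorphic open_upper_half_plane])
         (use that in \<open>simp add: upper_half_plane_def\<close>)
    moreover have "K * ((X - z) ^ g / fact g * ((of_real pi * \<i>) ^ Suc g * E_odd (int g + 2) z)) = E_odd (int g + 2) z * (X - z) ^ g"
      using pi0 unfolding K_def by (simp del: power_Suc)
    ultimately show ?thesis unfolding higher_deriv_E_odd[OF that] by simp
  qed
  have inf: "((\<lambda>t. K * taylor_sum g ?E X (z + \<i> * of_real t)) \<longlongrightarrow> 0) at_top" if "Im z > 0" for X z
    unfolding E_odd_eq_qser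
    by (intro tendsto_mult_right_zero taylor_sum_qser_at_infinity poly_bounded_odd_coeff_neg that) (simp add: odd_coeff_def)
  show ?thesis
  proof (cases "c = 0")
    case True
    have ad: "a * d = 1" "even b" using det True \<gamma> by (auto simp: Gamma2_def)
    hence ad': "a = d" "d = 1 \<or> d = -1" by (auto simp: zmult_eq_1_iff)
    have "period_R g (E_odd (int g + 2)) a b c d X = 0" for X
      unfolding period_R_def
      by (rule cusp_integral_eq_primitive[where G = "\<lambda>z. K * taylor_sum g ?E X z"])
         (use D inf True in \<open>auto simp: moebius_infinity_def\<close>)
    moreover have "(of_int c * \<tau> + of_int d) ^ g * ?E ((of_int a * \<tau> + of_int b) / (of_int c * \<tau> + of_int d)) = ?E \<tau>" for \<tau>
    proof -
      have "(of_int a * \<tau> + of_int b) / (of_int c * \<tau> + of_int d) = \<tau> + of_int (d * b)"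
        using True ad' by auto
      moreover have "of_int d ^ g = (1::complex)" using ad' g by auto
      ultimately show ?thesis using True ad(2) E_odd_shift_even[of "d * b" g \<tau>] by simp
    qed
    ultimately show ?thesis using that[of 0] by simp
  next
    case c: False
    obtain R where R: "degree R \<le> g" "\<And>\<tau>. Im \<tau> > 0 \<Longrightarrow>
     (of_int c * \<tau> + of_int d) ^ g * ?E ((of_int a * \<tau> + of_int b) / (of_int c * \<tau> + of_int d)) =
     ?E \<tau> + \<i> * poly (cpoly R) \<tau>" using slash_relE[OF slash_rel_E_Gamma2[OF g \<gamma>]] by blast
    define s where "s = complex_of_real (- of_int d / of_int c)"
    define \<phi> where "\<phi> = (\<lambda>z. (of_int c * z + of_int d) powi int g * ?E ((of_int a * z + of_int b) / (of_int c * z + of_int d)))"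
    define Q where "Q = smult \<i> (cpoly R)"
    have degQ: "degree Q \<le> g" using R(1) by (simp add: Q_def degree_map_poly)
    have \<phi>_eq: "\<phi> z = ?E z + poly Q z" if "z \<in> upper_half_plane" for z
      using R(2)[of z] that by (simp add: \<phi>_def Q_def upper_half_plane_def)
    have polyhol: "poly Q holomorphic_on upper_half_plane"
    proof -
      have "(\<lambda>z. poly Q z) holomorphic_on upper_half_plane" by (intro holomorphic_intros)
      thus ?thesis .
    qed
    have hol: "\<phi> holomorphic_on upper_half_plane"
      by (rule holomorphic_transform[of "\<lambda>z. ?E z + poly Q z"])
         (use \<phi>_eq polyhol in \<open>auto intro!: holomorphic_intros E_odd_holomorphic\<close>)
    have ts: "taylor_sum g ?E X z = taylor_sum g \<phi> X z - poly Q X" if z: "z \<in> upper_half_plane" for X z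
    proof -
      have "(deriv ^^ k) ?E z = (deriv ^^ k) \<phi> z - (deriv ^^ k) (poly Q) z" for k
      proof -
        have "(deriv ^^ k) ?E z = (deriv ^^ k) (\<lambda>z. \<phi> z - poly Q z) z"
        proof (rule higher_deriv_cong_ev)
          show "\<forall>\<^sub>F z in nhds z. ?E z = \<phi> z - poly Q z"
            using eventually_nhds_in_open[OF open_upper_half_plane z] by eventually_elim (simp add: \<phi>_eq)
        qed simp
        also have "\<dots> = (deriv ^^ k) \<phi> z - (deriv ^^ k) (poly Q) z"
          by (rule higher_deriv_diff[OF hol polyhol open_upper_half_plane z])
        finally show ?thesis .
      qed
      hence "taylor_sum g ?E X z = taylor_sum g \<phi> X z - taylor_sum g (poly Q) X z"
        by (simp add: taylor_sum_def right_diff_distrib sum_subtractf)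
      thus ?thesis by (simp add: taylor_sum_poly[OF degQ])
    qed
    \<comment> \<open>\<open>\<phi>\<close> is the Fourier series in the coordinate of the finite cusp\<close>
    have lim0: "((\<lambda>t. taylor_sum g \<phi> X (s + \<i> * of_real t)) \<longlongrightarrow> 0) (at_right 0)" for X
      unfolding taylor_sum_def
    proof (rule tendsto_null_sum)
      fix k
      have 1: "((\<lambda>t. (X - (s + \<i> * of_real t)) ^ k / fact k) \<longlongrightarrow> (X - (s + \<i> * of_real 0)) ^ k / fact k) (at_right 0)"
        by (intro tendsto_intros) auto
      have 2: "((\<lambda>t. (deriv ^^ k) \<phi> (s + \<i> * of_real t)) \<longlongrightarrow> 0) (at_right 0)"
        unfolding \<phi>_def s_def E_odd_eq_qser
        by (rule higher_deriv_slash_decay[OF det c poly_bounded_odd_coeff_neg]) (simp add: odd_coeff_def)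
      from tendsto_mult[OF 1 2] show "((\<lambda>t. (X - (s + \<i> * of_real t)) ^ k / fact k * (deriv ^^ k) \<phi> (s + \<i> * of_real t)) \<longlongrightarrow> 0) (at_right 0)"
        by simp
    qed
    have "period_R g (E_odd (int g + 2)) a b c d X = K * (0 - poly Q X)" for X
      unfolding period_R_def
    proof (rule cusp_integral_eq_primitive[where G = "\<lambda>z. K * taylor_sum g ?E X z"])
      have "((\<lambda>t. K * (taylor_sum g \<phi> X (s + \<i> * of_real t) - poly Q X)) \<longlongrightarrow> K * (0 - poly Q X)) (at_right 0)"
        by (intro tendsto_intros lim0)
      moreover have "\<forall>\<^sub>F t in at_right 0. K * (taylor_sum g \<phi> X (s + \<i> * of_real t) - poly Q X) = K * taylor_sum g ?E X (s + \<i> * of_real t)"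
        using eventually_at_right_less[of 0] by eventually_elim (simp add: ts upper_half_plane_def s_def)
      ultimately have "((\<lambda>t. K * taylor_sum g ?E X (s + \<i> * of_real t)) \<longlongrightarrow> K * (0 - poly Q X)) (at_right 0)"
        by (rule Lim_transform_eventually)
      moreover have "s = of_rat (of_int d / of_int (- c))" by (simp add: s_def of_rat_divide of_rat_minus)
      ultimately show "moebius_infinity d (- b) (- c) a = None \<and> K * (0 - poly Q X) = 0 \<or>
         (\<exists>s. moebius_infinity d (- b) (- c) a = Some s \<and> ((\<lambda>t. K * taylor_sum g ?E X (of_rat s + \<i> * of_real t)) \<longlongrightarrow> K * (0 - poly Q X)) (at_right 0))"
        using c by (simp add: moebius_infinity_def)
    qed (use D inf in auto)
    thus ?thesis using that[OF R] by (simp add: K_def Q_def)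
  qed
qed

section \<open>The reciprocity law\<close>

text \<open>The residue of \<open>E\<^bsub>-g\<^esub>\<close> at the cusp in terms of the constant term of weight \<open>g + 2\<close>.\<close>

lemma pole_coefficient:
  "\<i> * of_real (cusp_sign r p * odd_zeta (g + 2) / (2 * pi * of_int p ^ (g + 2))) =
     - ((of_real pi * \<i>) ^ (g + 1) / fact (g + 1) * (cusp_value g r p / of_int p ^ (g + 2)))"
proof -
  have "(of_real pi * \<i>) ^ Suc g \<noteq> (0::complex)" by simp
  hence "(of_real pi * \<i>) ^ Suc g / fact (Suc g) * (cusp_value g r p / of_int p ^ (g + 2)) =
     \<i> * of_real (- cusp_sign r p * odd_zeta (g + 2) / (2 * pi)) / of_int p ^ (g + 2)"
    unfolding cusp_value_def by (simp del: power_Suc fact_Suc)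
  thus ?thesis by simp
qed

lemma quotient_of_moebius:
  assumes \<gamma>: "Gamma2 a b c d" and q: "quotient_of x = (r, p)" and nz: "of_int c * x + of_int d \<noteq> 0"
  obtains s where "s = 1 \<or> s = -1"
    "quotient_of ((of_int a * x + of_int b) / (of_int c * x + of_int d)) = (s * (a * r + b * p), s * (c * r + d * p))"
    "c * r + d * p \<noteq> 0" "cusp_sign (s * (a * r + b * p)) (s * (c * r + d * p)) = cusp_sign r p"
proof -
  have det: "a * d - b * c = 1" and par: "odd a" "even b" "even c" "odd d" using \<gamma> by (auto simp: Gamma2_def)
  have p: "p > 0" and x: "x = of_int r / of_int p" and cop: "coprime r p"
    using q quotient_of_denom_pos quotient_of_div quotient_of_coprime by blast+
  define r2 p2 where "r2 = a * r + b * p" and "p2 = c * r + d * p"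
  have den: "of_int c * x + of_int d = of_int p2 / of_int p" and num: "of_int a * x + of_int b = of_int r2 / of_int p"
    using p by (simp_all add: x r2_def p2_def field_simps)
  have p20: "p2 \<noteq> 0" using nz unfolding den by auto
  define s where "s = sgn p2"
  have s: "s = 1 \<or> s = -1" "s * p2 > 0" using p20 by (auto simp: s_def sgn_if)
  have r: "r = d * r2 - b * p2" "p = a * p2 - c * r2"
  proof -
    have "d * r2 - b * p2 = (a * d - b * c) * r" by (simp add: r2_def p2_def algebra_simps)
    thus "r = d * r2 - b * p2" using det by simp
    have "a * p2 - c * r2 = (a * d - b * c) * p" by (simp add: r2_def p2_def algebra_simps)
    thus "p = a * p2 - c * r2" using det by simp
  qed
  have "coprime r2 p2"
  proof (rule coprimeI)
    fix e assume "e dvd r2" "e dvd p2"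
    hence "e dvd r" "e dvd p" unfolding r by auto
    thus "is_unit e" using cop by (meson coprime_common_divisor)
  qed
  hence "coprime (s * r2) (s * p2)" using s(1) by auto
  moreover have "(of_int a * x + of_int b) / (of_int c * x + of_int d) = of_int (s * r2) / of_int (s * p2)"
    unfolding den num using p s(1) by auto
  ultimately have "quotient_of ((of_int a * x + of_int b) / (of_int c * x + of_int d)) = (s * r2, s * p2)"
    using s(2) by (intro quotient_of_eq)
  moreover have "cusp_sign (s * r2) (s * p2) = cusp_sign r p"
    using s(1) par by (auto simp: cusp_sign_def r2_def p2_def)
  ultimately show ?thesis using that[OF s(1)] p20 unfolding r2_def p2_def by blast
qed

lemma tendsto_power_difference_quotient:
  fixes D c :: complex
  shows "((\<lambda>y. ((D + c * (\<i> * of_real y)) ^ Suc n - D ^ Suc n) / (\<i> * of_real y)) \<longlongrightarrow> of_nat (Suc n) * c * D ^ n) (at_right 0)"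
proof -
  have "((\<lambda>t. (D + c * t) ^ Suc n) has_field_derivative (of_nat (Suc n) * c * D ^ n)) (at 0)"
    by (rule derivative_eq_intros refl)+ (simp add: algebra_simps)
  hence "((\<lambda>t. ((D + c * t) ^ Suc n - D ^ Suc n) / t) \<longlongrightarrow> of_nat (Suc n) * c * D ^ n) (at 0)"
    by (simp add: has_field_derivative_iff)
  moreover have "filterlim (\<lambda>y. \<i> * complex_of_real y) (at 0) (at_right 0)"
    unfolding filterlim_at
  proof
    have "((\<lambda>y. \<i> * complex_of_real y) \<longlongrightarrow> \<i> * of_real 0) (at_right 0)" by (intro tendsto_intros)
    thus "((\<lambda>y. \<i> * complex_of_real y) \<longlongrightarrow> 0) (at_right 0)" by simp
    show "\<forall>\<^sub>F y in at_right 0. \<i> * complex_of_real y \<in> UNIV \<and> \<i> * complex_of_real y \<noteq> 0"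
      using eventually_at_right_less[of 0] by eventually_elim auto
  qed
  ultimately show ?thesis by (rule filterlim_compose)
qed

text \<open>Comparing the expansions of \<open>E\<^bsub>-g\<^esub>\<close> at \<open>x\<close> and at \<open>\<gamma>x\<close> through the transformation law. The pole at \<open>\<gamma>x\<close>
  contributes to the constant term because the local coordinates differ at second order.\<close>

lemma cusp_constant_term_moebius:
  assumes g: "even g" and \<gamma>: "Gamma2 a b c d" and q: "quotient_of x = (r, p)" and nz: "of_int c * x + of_int d \<noteq> 0"
    and R: "\<And>\<tau>. Im \<tau> > 0 \<Longrightarrow> (of_int c * \<tau> + of_int d) ^ g * E_odd (- int g) ((of_int a * \<tau> + of_int b) / (of_int c * \<tau> + of_int d)) =
       E_odd (- int g) \<tau> + \<i> * poly (cpoly R) \<tau>"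
  defines "D \<equiv> of_rat (of_int c * x + of_int d) :: complex"
  defines "A \<equiv> \<i> * of_real (cusp_sign r p * odd_zeta (g + 2) / (2 * pi * of_int p ^ (g + 2)))"
  shows "D ^ g * cusp_constant_term g ((of_int a * x + of_int b) / (of_int c * x + of_int d)) - cusp_constant_term g x =
     \<i> * poly (cpoly R) (of_rat x) - of_nat (g + 1) * of_int c * A / D"
proof -
  have det: "a * d - b * c = 1" using \<gamma> by (simp add: Gamma2_def)
  have p: "p > 0" and xr: "x = of_int r / of_int p" using q quotient_of_denom_pos quotient_of_div by blast+
  define y where "y = (of_int a * x + of_int b) / (of_int c * x + of_int d)"
  obtain s where s: "s = 1 \<or> s = -1" "quotient_of y = (s * (a * r + b * p), s * (c * r + d * p))"
    "c * r + d * p \<noteq> 0" "cusp_sign (s * (a * r + b * p)) (s * (c * r + d * p)) = cusp_sign r p"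
    using quotient_of_moebius[OF \<gamma> q nz] unfolding y_def by metis
  define X where "X = (of_rat x :: complex)"
  have D0: "D \<noteq> 0" using nz by (simp add: D_def)
  have D_X: "D = of_int c * X + of_int d" by (simp add: D_def X_def of_rat_add of_rat_mult)
  have D_real: "D = of_real (of_rat (of_int c * x + of_int d))" by (simp only: D_def complex_of_rat)
  have D_p: "D = of_int (c * r + d * p) / of_int p"
    unfolding D_X X_def xr using p by (simp add: of_rat_divide field_simps)
  have Y: "(of_rat y :: complex) = (of_int a * X + of_int b) / D"
    by (simp add: y_def D_def X_def of_rat_divide of_rat_add of_rat_mult)
  define A' where "A' = \<i> * of_real (cusp_sign (s * (a * r + b * p)) (s * (c * r + d * p)) * odd_zeta (g + 2) / (2 * pi * of_int (s * (c * r + d * p)) ^ (g + 2)))"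
  have A': "A' * D ^ (g + 2) = A"
  proof -
    have "(of_int (s * (c * r + d * p)) :: complex) ^ (g + 2) = of_int (c * r + d * p) ^ (g + 2)"
      unfolding of_int_mult[of s] power_mult_distrib using s(1) g by auto
    hence "A' = \<i> * of_real (cusp_sign r p * odd_zeta (g + 2) / (2 * pi)) / of_int (c * r + d * p) ^ (g + 2)"
      unfolding A'_def s(4) by simp
    thus ?thesis unfolding A_def D_p using s(3) p by (simp add: power_divide del: of_int_add of_int_mult power_Suc)
  qed
  obtain K where K: "\<And>\<tau>. 0 < norm \<tau> \<Longrightarrow> norm \<tau> \<le> 1 \<Longrightarrow> 1 * norm \<tau> \<le> Im \<tau> \<Longrightarrow>
     norm (E_odd (- int g) (X + \<tau>) - (A / \<tau> + cusp_constant_term g x)) \<le> K * norm \<tau>"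
    using E_odd_asymptotics[OF g q, of 1] unfolding A_def X_def by auto
  obtain K' where K': "\<And>\<tau>. 0 < norm \<tau> \<Longrightarrow> norm \<tau> \<le> 1 \<Longrightarrow> 1 / 2 * norm \<tau> \<le> Im \<tau> \<Longrightarrow>
     norm (E_odd (- int g) (of_rat y + \<tau>) - (A' / \<tau> + cusp_constant_term g y)) \<le> K' * norm \<tau>"
    using E_odd_asymptotics[OF g s(2), of "1/2"] unfolding A'_def by auto
  define t where "t = (\<lambda>v::real. \<i> * of_real v)"
  define J where "J = (\<lambda>v. D + of_int c * t v)"
  define t' where "t' = (\<lambda>v. t v / (D * J v))"
  have t_lim: "(t \<longlongrightarrow> 0) (at_right 0)"
  proof -
    have "((\<lambda>v. \<i> * complex_of_real v) \<longlongrightarrow> \<i> * of_real 0) (at_right 0)" by (intro tendsto_intros)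
    thus ?thesis by (simp add: t_def[abs_def])
  qed
  have J_lim: "(J \<longlongrightarrow> D) (at_right 0)"
  proof -
    have "(J \<longlongrightarrow> D + of_int c * 0) (at_right 0)" unfolding J_def[abs_def] by (intro tendsto_intros t_lim)
    thus ?thesis by simp
  qed
  have t'_lim: "(t' \<longlongrightarrow> 0) (at_right 0)"
  proof -
    have "(t' \<longlongrightarrow> 0 / (D * D)) (at_right 0)" unfolding t'_def[abs_def] by (intro tendsto_intros t_lim J_lim) (use D0 in auto)
    thus ?thesis by simp
  qed
  have J_eq: "J v = of_int c * (X + t v) + of_int d" for v by (simp add: J_def D_X algebra_simps)
  have J0: "J v \<noteq> 0" if "v > 0" for v
  proof -
    have "Im (X + t v) > 0" using that by (simp add: t_def X_def complex_of_rat)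
    from moebius_denom_nonzero[OF this, of c d] det show ?thesis unfolding J_eq by (cases "c = 0") auto
  qed
  have moeb: "(of_int a * (X + t v) + of_int b) / (of_int c * (X + t v) + of_int d) = of_rat y + t' v" if "v > 0" for v
  proof -
    have detc: "of_int a * of_int d - of_int b * of_int c = (1::complex)"
      using arg_cong[OF det, of "of_int :: int \<Rightarrow> complex"] by simp
    have "(of_int a * (X + t v) + of_int b) * D = (of_int a * X + of_int b) * J v + (of_int a * of_int d - of_int b * of_int c) * t v"
      by (simp add: J_def D_X algebra_simps)
    hence "(of_int a * (X + t v) + of_int b) * D = (of_int a * X + of_int b) * J v + t v" unfolding detc by simp
    hence "(of_int a * (X + t v) + of_int b) / J v = (of_int a * X + of_int b) / D + t v / (D * J v)"
      using D0 J0[OF that] by (simp add: divide_simps mult_ac)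
    thus ?thesis unfolding J_eq[symmetric] Y t'_def .
  qed
  have t'_Im: "Im (t' v) = v / (norm (J v))\<^sup>2" if "v > 0" for v
  proof -
    have im: "Im (X + t v) = v" "Im (X + t v) > 0" using that by (simp_all add: t_def X_def complex_of_rat)
    have "Im (of_rat y + t' v) = v / (norm (J v))\<^sup>2"
      unfolding moeb[OF that, symmetric] Im_moebius(1)[OF det im(2)] im(1) J_eq ..
    thus ?thesis by (simp add: complex_of_rat)
  qed
  have U: "((\<lambda>v. E_odd (- int g) (X + t v) - A / t v) \<longlongrightarrow> cusp_constant_term g x) (at_right 0)"
  proof (rule LIM_zero_cancel, rule Lim_null_comparison)
    show "\<forall>\<^sub>F v in at_right 0. norm (E_odd (- int g) (X + t v) - A / t v - cusp_constant_term g x) \<le> K * v"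
      using eventually_at_right_real[OF zero_less_one]
      by eventually_elim (use K[of "t v" for v] in \<open>simp add: t_def norm_mult diff_diff_eq\<close>)
    have "((\<lambda>v. K * v) \<longlongrightarrow> K * 0) (at_right 0)" by (intro tendsto_intros)
    thus "((\<lambda>v. K * v) \<longlongrightarrow> 0) (at_right 0)" by simp
  qed
  have V: "((\<lambda>v. E_odd (- int g) (of_rat y + t' v) - A' / t' v) \<longlongrightarrow> cusp_constant_term g y) (at_right 0)"
  proof (rule LIM_zero_cancel, rule Lim_null_comparison)
    have "\<forall>\<^sub>F v in at_right 0. norm (t' v) < 1" using order_tendstoD(2)[OF tendsto_norm[OF t'_lim], of 1] by simp
    moreover have "\<forall>\<^sub>F v in at_right 0. norm (J v) < 2 * norm D"
      using order_tendstoD(2)[OF tendsto_norm[OF J_lim], of "2 * norm D"] D0 by simp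
    ultimately show "\<forall>\<^sub>F v in at_right 0. norm (E_odd (- int g) (of_rat y + t' v) - A' / t' v - cusp_constant_term g y) \<le> K' * norm (t' v)"
      using eventually_at_right_less[of 0]
    proof eventually_elim
      case (elim v)
      have n: "norm (t' v) = v / (norm D * norm (J v))" using elim(3) by (simp add: t'_def t_def norm_divide norm_mult)
      have jp: "norm (J v) > 0" "norm D > 0" using J0[OF elim(3)] D0 by auto
      have "1 / 2 * norm (t' v) \<le> Im (t' v)"
        unfolding n t'_Im[OF elim(3)] using jp elim by (simp add: divide_simps power2_eq_square)
      moreover have "norm (t' v) > 0" unfolding n using jp elim(3) by simp
      ultimately show ?case using K'[of "t' v"] elim(1) by (simp add: diff_diff_eq)
    qed
    show "((\<lambda>v. K' * norm (t' v)) \<longlongrightarrow> 0) (at_right 0)"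
      using tendsto_mult_right_zero[OF tendsto_norm_zero[OF t'_lim]] .
  qed
  \<comment> \<open>\<open>J\<^sup>g\<close> times the pole at \<open>y\<close>, minus the pole at \<open>x\<close>, is a difference quotient of \<open>J\<^bsup>g+1\<^esup>\<close>\<close>
  have "((\<lambda>v. J v ^ g * (E_odd (- int g) (of_rat y + t' v) - A' / t' v) +
          (A' * D * ((J v ^ Suc g - D ^ Suc g) / t v) - (E_odd (- int g) (X + t v) - A / t v) - \<i> * poly (cpoly R) (X + t v))) \<longlongrightarrow>
        D ^ g * cusp_constant_term g y + (A' * D * (of_nat (Suc g) * of_int c * D ^ g) - cusp_constant_term g x - \<i> * poly (cpoly R) (X + 0))) (at_right 0)"
    unfolding J_def t_def
    by (intro tendsto_add tendsto_diff tendsto_mult tendsto_const tendsto_power U[unfolded t_def] V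
          J_lim[unfolded J_def[abs_def] t_def] tendsto_power_difference_quotient tendsto_poly t_lim[unfolded t_def[abs_def]])
  moreover have "\<forall>\<^sub>F v in at_right 0. J v ^ g * (E_odd (- int g) (of_rat y + t' v) - A' / t' v) +
          (A' * D * ((J v ^ Suc g - D ^ Suc g) / t v) - (E_odd (- int g) (X + t v) - A / t v) - \<i> * poly (cpoly R) (X + t v)) = 0"
    using eventually_at_right_less[of 0]
  proof eventually_elim
    case (elim v)
    have im: "Im (X + t v) > 0" using elim by (simp add: t_def X_def complex_of_rat)
    have t0: "t v \<noteq> 0" using elim by (simp add: t_def)
    have E: "J v ^ g * E_odd (- int g) (of_rat y + t' v) = E_odd (- int g) (X + t v) + \<i> * poly (cpoly R) (X + t v)"
      using R[OF im] unfolding moeb[OF elim] J_eq .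
    have 1: "J v ^ g * (A' / t' v) = A' * D * (J v ^ Suc g / t v)"
      using t0 D0 J0[OF elim] by (simp add: t'_def field_simps)
    have 2: "A / t v = A' * D * (D ^ Suc g / t v)" unfolding A'[symmetric] by simp
    show ?case unfolding right_diff_distrib E 1 2 diff_divide_distrib by simp
  qed
  ultimately have "((\<lambda>v::real. 0) \<longlongrightarrow> D ^ g * cusp_constant_term g y + (A' * D * (of_nat (Suc g) * of_int c * D ^ g) - cusp_constant_term g x - \<i> * poly (cpoly R) (X + 0))) (at_right 0)"
    by (rule Lim_transform_eventually)
  hence z: "D ^ g * cusp_constant_term g y + (A' * D * (of_nat (Suc g) * of_int c * D ^ g) - cusp_constant_term g x - \<i> * poly (cpoly R) X) = 0"
    using tendsto_unique[OF _ tendsto_const] by (metis add.right_neutral trivial_limit_at_right_real)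
  have "A' * D * (of_nat (Suc g) * of_int c * D ^ g) = of_nat (g + 1) * of_int c * A / D"
    unfolding A'[symmetric] using D0 by (simp add: field_simps power2_eq_square)
  with z show ?thesis unfolding y_def[symmetric] X_def[symmetric] by (simp add: algebra_simps)
qed

text \<open>The imaginary part of the previous comparison. The real part cancels: the defect takes the same value
  at \<open>x\<close> and \<open>\<gamma>x\<close>, and it is zero unless the weight factor is \<open>1\<close>.\<close>

theorem S_odd_reciprocity:
  assumes g: "even g" and \<gamma>: "Gamma2 a b c d" and q: "quotient_of x = (r, p)" and nz: "of_int c * x + of_int d \<noteq> 0"
  shows "of_rat (of_int c * x + of_int d) ^ g * of_real (S_odd g ((of_int a * x + of_int b) / (of_int c * x + of_int d)))
        - complex_of_real (S_odd g x) =
        (- 1) ^ (g div 2 + 1) * 2 ^ (g + 2) * period_R g (E_odd (int g + 2)) a b c d (of_rat x)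
        + (- 1) ^ (g div 2) * 2 ^ (g + 2) * cusp_value g r p * (of_int c / (of_int p ^ (g + 1) * of_int (c * r + d * p)))"
proof -
  have p: "p > 0" and xr: "x = of_int r / of_int p" using q quotient_of_denom_pos quotient_of_div by blast+
  define y where "y = (of_int a * x + of_int b) / (of_int c * x + of_int d)"
  obtain s where s: "s = 1 \<or> s = -1" "quotient_of y = (s * (a * r + b * p), s * (c * r + d * p))"
    "c * r + d * p \<noteq> 0" "cusp_sign (s * (a * r + b * p)) (s * (c * r + d * p)) = cusp_sign r p"
    using quotient_of_moebius[OF \<gamma> q nz] unfolding y_def by metis
  define D where "D = (of_rat (of_int c * x + of_int d) :: complex)"
  have D_p: "D = of_int (c * r + d * p) / of_int p"
    unfolding D_def xr using p by (simp add: of_rat_divide of_rat_add of_rat_mult field_simps)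
  obtain R where R: "\<And>\<tau>. Im \<tau> > 0 \<Longrightarrow> (of_int c * \<tau> + of_int d) ^ g * E_odd (- int g) ((of_int a * \<tau> + of_int b) / (of_int c * \<tau> + of_int d)) =
       E_odd (- int g) \<tau> + \<i> * poly (cpoly R) \<tau>"
    "\<And>X. period_R g (E_odd (int g + 2)) a b c d X = - (fact g / (of_real pi * \<i>) ^ Suc g) * (\<i> * poly (cpoly R) X)"
    using period_R_eq[OF g \<gamma>] by metis
  define w where "w = (of_real pi * \<i>) ^ Suc g"
  have w0: "w \<noteq> 0" by (simp add: w_def)
  have Req: "\<i> * poly (cpoly R) (of_rat x) = - (w / fact g) * period_R g (E_odd (int g + 2)) a b c d (of_rat x)"
    unfolding R(2) w_def[symmetric] using w0 by simp
  have pole: "\<i> * of_real (cusp_sign r p * odd_zeta (g + 2) / (2 * pi * of_int p ^ (g + 2))) =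
      - (w / fact g) * (cusp_value g r p / (of_nat (g + 1) * of_int p ^ (g + 2)))"
    unfolding pole_coefficient by (simp add: w_def mult_ac)
  have main: "D ^ g * cusp_constant_term g y - cusp_constant_term g x =
     - (w / fact g) * period_R g (E_odd (int g + 2)) a b c d (of_rat x) + (w / fact g) * (of_int c * cusp_value g r p / (of_int p ^ (g + 2) * D))"
  proof -
    have *: "n * c' * (- k * (v / (n * P))) / D' = - (k * (c' * v / (P * D')))" if "n \<noteq> 0" for n c' k v P D' :: complex
      using that by (simp add: field_simps)
    have "of_nat (g + 1) * of_int c * (- (w / fact g) * (cusp_value g r p / (of_nat (g + 1) * of_int p ^ (g + 2)))) / D =
       - ((w / fact g) * (of_int c * cusp_value g r p / (of_int p ^ (g + 2) * D)))"
      by (rule *) (use of_nat_neq_0[of g, where 'a = complex] in simp)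
    thus ?thesis
      using cusp_constant_term_moebius[OF g \<gamma> q nz R(1)] unfolding Req pole D_def[symmetric] y_def[symmetric] by simp
  qed
  define \<kappa> where "\<kappa> = complex_of_real (pi ^ (g + 1) / (2 ^ (g + 2) * fact g))"
  have \<kappa>: "\<i> * \<kappa> \<noteq> 0" by (simp add: \<kappa>_def)
  have defect: "D ^ g * of_real (weight2_defect g y) = of_real (weight2_defect g x)"
    unfolding weight2_defect_eq[OF q] weight2_defect_eq[OF s(2)] defect_def s(4) by simp
  have diff: "D ^ g * cusp_constant_term g y - cusp_constant_term g x = (\<i> * \<kappa>) * (D ^ g * of_real (S_odd g y) - of_real (S_odd g x))"
    unfolding cusp_constant_term_def distrib_left defect of_real_mult[of _ "S_odd g _"] \<kappa>_def[symmetric]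
    by (simp add: algebra_simps)
  obtain h where h: "g = 2 * h" using g by (auto elim: evenE)
  have wk: "w / fact g = (\<i> * \<kappa>) * ((-1) ^ h * 2 ^ (g + 2))"
  proof -
    have "\<i> ^ Suc g = (-1) ^ h * \<i>" by (simp add: h power_mult)
    hence "w = of_real (pi ^ Suc g) * ((-1) ^ h * \<i>)" unfolding w_def power_mult_distrib by simp
    thus ?thesis by (simp add: \<kappa>_def)
  qed
  have pD: "of_int p ^ (g + 2) * D = of_int p ^ (g + 1) * of_int (c * r + d * p)"
    unfolding D_p using p by simp
  have "(\<i> * \<kappa>) * (D ^ g * of_real (S_odd g y) - of_real (S_odd g x)) = (\<i> * \<kappa>) *
     ((- 1) ^ (h + 1) * 2 ^ (g + 2) * period_R g (E_odd (int g + 2)) a b c d (of_rat x)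
        + (- 1) ^ h * 2 ^ (g + 2) * cusp_value g r p * (of_int c / (of_int p ^ (g + 1) * of_int (c * r + d * p))))"
    unfolding diff[symmetric] main wk pD by (simp add: algebra_simps)
  hence "D ^ g * of_real (S_odd g y) - of_real (S_odd g x) =
     (- 1) ^ (h + 1) * 2 ^ (g + 2) * period_R g (E_odd (int g + 2)) a b c d (of_rat x)
        + (- 1) ^ h * 2 ^ (g + 2) * cusp_value g r p * (of_int c / (of_int p ^ (g + 1) * of_int (c * r + d * p)))"
    using \<kappa> mult_left_cancel by blast
  moreover have "g div 2 = h" using h by simp
  ultimately show ?thesis unfolding D_def y_def by simp
qed

section \<open>The reciprocity law for the generator \<open>x \<mapsto> x / (2 x + 1)\<close>\<close>

lemma bernpoly_0_values: "bernpoly 2 0 = 1 / 6" "bernpoly 4 0 = - 1 / 30"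
proof -
  define Q where "Q = (fps_X * fps_exp 0) / (fps_exp 1 - 1 :: real fps)"
  have e: "Q * (fps_exp 1 - 1) = fps_X"
    unfolding Q_def by (subst dvd_div_mult_self[OF fps_exp_minus_1_dvd(2)]) simp
  note E = arg_cong[OF e, of "\<lambda>F. fps_nth F n" for n, unfolded fps_mult_nth]
  have "fps_nth Q 0 = 1" using E[of 1] by simp
  moreover from this have "fps_nth Q 1 = - 1 / 2" using E[of 2] by (simp add: numeral_eq_Suc)
  moreover from this calculation have "fps_nth Q 2 = 1 / 12" using E[of 3] by (simp add: numeral_eq_Suc)
  moreover from this calculation have "fps_nth Q 3 = 0" using E[of 4] by (simp add: numeral_eq_Suc)
  moreover from this calculation have "fps_nth Q 4 = - 1 / 720" using E[of 5] by (simp add: numeral_eq_Suc)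
  ultimately show "bernpoly 2 0 = 1 / 6" "bernpoly 4 0 = - 1 / 30"
    unfolding bernpoly_def Q_def[symmetric] by (simp_all add: fact_numeral)
qed

text \<open>The period polynomial is the same for all \<open>x\<close> and has degree at most \<open>g\<close>, so finitely many instances of
  the law determine it.\<close>

lemma S_odd_reciprocity_generator:
  assumes g: "even g"
    and \<kappa>: "(- 1) ^ (g div 2) * 2 ^ (g + 3) * ((2 ^ (g + 2) - 1) / (4 * (of_nat g + 2)) * bernpoly (g + 2) 0) = \<kappa>"
  obtains c :: "nat \<Rightarrow> complex" where
    "\<And>x r p. quotient_of x = (r, p) \<Longrightarrow> 2 * x + 1 \<noteq> 0 \<Longrightarrow>
       of_rat (2 * x + 1) ^ g * of_real (S_odd g (x / (2 * x + 1))) - of_real (S_odd g x) =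
       (\<Sum>k\<le>g. c k * of_rat x ^ k) + of_real (\<kappa> * (of_bool (odd p) * (- 1) powi (r + 1) / (of_int p ^ (g + 1) * of_int (2 * r + p))))"
proof -
  have \<gamma>: "Gamma2 1 0 2 1" by (simp add: Gamma2_def)
  obtain R where R: "degree R \<le> g"
    "\<And>X. period_R g (E_odd (int g + 2)) 1 0 2 1 X = - (fact g / (of_real pi * \<i>) ^ Suc g) * (\<i> * poly (cpoly R) X)"
    using period_R_eq[OF g \<gamma>] by metis
  define C where "C = (- 1) ^ (g div 2 + 1) * 2 ^ (g + 2) * (- (fact g / (of_real pi * \<i>) ^ Suc g) * \<i>)"
  have deg: "degree (cpoly R) \<le> g" using R(1) by (simp add: degree_map_poly)
  have poly: "(- 1) ^ (g div 2 + 1) * 2 ^ (g + 2) * period_R g (E_odd (int g + 2)) 1 0 2 1 X =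
      (\<Sum>k\<le>g. C * coeff (cpoly R) k * X ^ k)" for X
  proof -
    have "poly (cpoly R) X = (\<Sum>k\<le>g. coeff (cpoly R) k * X ^ k)"
      using poly_as_sum_of_monoms'[OF deg] by (metis (no_types, lifting) poly_monom poly_sum sum.cong)
    thus ?thesis unfolding R(2) by (simp add: C_def sum_distrib_left mult_ac del: power_Suc)
  qed
  show ?thesis
  proof (rule that[of "\<lambda>k. C * coeff (cpoly R) k"])
    fix x r p assume q: "quotient_of x = (r, p)" and nz: "2 * x + 1 \<noteq> 0"
    have "of_rat (2 * x + 1) ^ g * of_real (S_odd g (x / (2 * x + 1))) - of_real (S_odd g x) =
       (\<Sum>k\<le>g. C * coeff (cpoly R) k * of_rat x ^ k) +
       (- 1) ^ (g div 2) * 2 ^ (g + 2) * cusp_value g r p * (2 / (of_int p ^ (g + 1) * of_int (2 * r + p)))"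
      using S_odd_reciprocity[OF g \<gamma> q] nz unfolding poly by simp
    also have "(- 1) ^ (g div 2) * 2 ^ (g + 2) * cusp_value g r p * (2 / (of_int p ^ (g + 1) * of_int (2 * r + p))) =
       of_real (\<kappa> * (of_bool (odd p) * (- 1) powi (r + 1) / (of_int p ^ (g + 1) * of_int (2 * r + p))))"
      unfolding cusp_value_bernoulli[OF g] \<kappa>[symmetric] by (simp add: eval_nat_numeral)
    finally show "of_rat (2 * x + 1) ^ g * of_real (S_odd g (x / (2 * x + 1))) - of_real (S_odd g x) =
       (\<Sum>k\<le>g. C * coeff (cpoly R) k * of_rat x ^ k) + of_real (\<kappa> * (of_bool (odd p) * (- 1) powi (r + 1) / (of_int p ^ (g + 1) * of_int (2 * r + p))))" .
  qed
qed

lemma S_odd_integer: "S_odd g (of_int n) = 0"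
proof -
  have "quotient_of (of_int n) = (n, 1)" by simp
  moreover have "{m::int. 1 \<le> m \<and> m \<le> 1 - 1 \<and> odd m} = {}" by auto
  ultimately show ?thesis unfolding S_odd_def by (simp only: Let_def snd_conv sum.empty mult_zero_right)
qed

lemma S_odd_2_third: "S_odd 2 (1 / 3) = 16 / 27"
proof -
  have q: "quotient_of (1 / 3) = (1, 3)" by (rule quotient_of_eq) auto
  have set: "{n::int. 1 \<le> n \<and> n \<le> 3 - 1 \<and> odd n} = {1}" by auto presburger
  have "deriv cot x = - inverse ((sin x)\<^sup>2)" if "sin x \<noteq> 0" for x :: real
    using DERIV_cot[OF that] by (rule DERIV_imp_deriv)
  moreover have "\<forall>\<^sub>F x in nhds (pi / 6). sin (x::real) \<noteq> 0"
  proof (rule eventually_nhds_in_open[of "{x. sin x \<noteq> 0}", simplified])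
    show "open {x::real. sin x \<noteq> 0}" by (intro open_Collect_neq continuous_intros)
  qed (simp add: sin_30)
  ultimately have "deriv (deriv cot) (pi / 6 :: real) = deriv (\<lambda>x. - inverse ((sin x)\<^sup>2)) (pi / 6)"
    by (intro deriv_cong_ev) (auto elim!: eventually_mono)
  also have "((\<lambda>x::real. - inverse ((sin x)\<^sup>2)) has_field_derivative 8 * sqrt 3) (at (pi / 6))"
    by (rule derivative_eq_intros refl)+ (auto simp: sin_30 cos_30 power2_eq_square field_simps)
  hence "deriv (\<lambda>x. - inverse ((sin x)\<^sup>2)) (pi / 6 :: real) = 8 * sqrt 3" by (rule DERIV_imp_deriv)
  finally have d: "(deriv ^^ 2) cot (pi / 6 :: real) = 8 * sqrt 3" by (simp add: numeral_2_eq_2)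
  have "S_odd 2 (1 / 3) = 1 / 27 * ((deriv ^^ 2) cot (pi / 6) / sin (pi * of_rat (1 / 3)))"
    unfolding S_odd_def q Let_def snd_conv set by (simp add: power3_eq_cube)
  also have "of_rat (1 / 3) = (1 / 3 :: real)" by (simp add: of_rat_divide)
  finally show ?thesis unfolding d by (simp add: sin_60)
qed

lemma S_odd_0_reciprocity:
  assumes q: "quotient_of x = (r, p)" and nz: "2 * x + 1 \<noteq> 0"
  shows "S_odd 0 (x / (2 * x + 1)) - S_odd 0 x =
        1 / 2 + of_bool (odd p) * (- 1) powi (r + 1) / (2 * of_int p * of_int (2 * r + p))"
proof -
  obtain c where c: "\<And>x r p. quotient_of x = (r, p) \<Longrightarrow> 2 * x + 1 \<noteq> 0 \<Longrightarrow>
       of_real (S_odd 0 (x / (2 * x + 1))) - of_real (S_odd 0 x) =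
       c 0 + complex_of_real (1 / 2 * (of_bool (odd p) * (- 1) powi (r + 1) / (of_int p * of_int (2 * r + p))))"
  proof -
    have "(- 1) ^ (0 div 2) * 2 ^ (0 + 3) * ((2 ^ (0 + 2) - 1) / (4 * (of_nat 0 + 2)) * bernpoly (0 + 2) 0) = 1 / 2"
      unfolding add_0 bernpoly_0_values by simp
    from S_odd_reciprocity_generator[OF _ this] obtain c where c: "\<And>x r p. quotient_of x = (r, p) \<Longrightarrow> 2 * x + 1 \<noteq> 0 \<Longrightarrow>
       of_rat (2 * x + 1) ^ 0 * of_real (S_odd 0 (x / (2 * x + 1))) - of_real (S_odd 0 x) =
       (\<Sum>k\<le>0. c k * of_rat x ^ k) + complex_of_real (1 / 2 * (of_bool (odd p) * (- 1) powi (r + 1) / (of_int p ^ (0 + 1) * of_int (2 * r + p))))"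
      by auto
    have 1: "(\<Sum>k\<le>0. c k * z ^ k) = c 0" for z by simp
    from c[unfolded 1 power_0 mult_1_left add_0 power_one_right] show ?thesis by (rule that)
  qed
  have "c 0 = of_real (1 / 2)" using c[of 0 0 1] S_odd_integer[of 0 0] by simp
  hence "complex_of_real (S_odd 0 (x / (2 * x + 1)) - S_odd 0 x) =
     of_real (1 / 2 + 1 / 2 * (of_bool (odd p) * (- 1) powi (r + 1) / (of_int p * of_int (2 * r + p))))"
    using c[OF q nz] unfolding of_real_add of_real_diff by simp
  thus ?thesis unfolding of_real_eq_iff by (simp add: mult_ac)
qed

text \<open>Three instances, at \<open>0\<close>, \<open>-1\<close> and \<open>1\<close>, determine the quadratic polynomial.\<close>

lemma S_odd_2_reciprocity:
  assumes q: "quotient_of x = (r, p)" and nz: "2 * x + 1 \<noteq> 0"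
  shows "of_rat ((2 * x + 1) ^ 2) * S_odd 2 (x / (2 * x + 1)) - S_odd 2 x =
        of_rat (2 * x ^ 2 + 2 * x + 1) + of_bool (odd p) * (- 1) powi (r + 1) / (of_int p ^ 3 * of_int (2 * r + p))"
proof -
  obtain c :: "nat \<Rightarrow> complex" where c: "\<And>x r p. quotient_of x = (r, p) \<Longrightarrow> 2 * x + 1 \<noteq> 0 \<Longrightarrow>
       (of_rat (2 * x + 1))\<^sup>2 * of_real (S_odd 2 (x / (2 * x + 1))) - of_real (S_odd 2 x) =
       (c 0 + c 1 * of_rat x + c 2 * (of_rat x)\<^sup>2) +
       complex_of_real (of_bool (odd p) * (- 1) powi (r + 1) / (of_int p ^ 3 * of_int (2 * r + p)))"
  proof -
    have "(- 1) ^ (2 div 2) * 2 ^ (2 + 3) * ((2 ^ (2 + 2) - 1) / (4 * (of_nat 2 + 2)) * bernpoly (2 + 2) 0) = 1"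
      by (simp add: bernpoly_0_values)
    from S_odd_reciprocity_generator[OF _ this] obtain c where c: "\<And>x r p. quotient_of x = (r, p) \<Longrightarrow> 2 * x + 1 \<noteq> 0 \<Longrightarrow>
       of_rat (2 * x + 1) ^ 2 * of_real (S_odd 2 (x / (2 * x + 1))) - of_real (S_odd 2 x) =
       (\<Sum>k\<le>2. c k * of_rat x ^ k) + complex_of_real (1 * (of_bool (odd p) * (- 1) powi (r + 1) / (of_int p ^ (2 + 1) * of_int (2 * r + p))))"
      by auto
    have 1: "(\<Sum>k\<le>2. c k * z ^ k) = c 0 + c 1 * z + c 2 * z\<^sup>2" for z by (simp add: numeral_2_eq_2)
    have 2: "(of_int p :: real) ^ (2 + 1) = of_int p ^ 3" for p by simp
    from c[unfolded mult_1_left 1 2] show ?thesis by (rule that)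
  qed
  have c0: "c 0 = 1" using c[of 0 0 1] S_odd_integer[of 2 0] by simp
  have c1: "c 2 - c 1 = 0" using c[of "-1" "-1" 1] S_odd_integer[of 2 1] S_odd_integer[of 2 "-1"] c0 by simp
  have "3 * (c 2 + c 1) = 3 * 4" using c[of 1 1 1] S_odd_integer[of 2 1] S_odd_2_third c0
    by (simp add: of_rat_divide algebra_simps)
  hence c2: "c 2 + c 1 = 4" by (subst (asm) mult_left_cancel) auto
  have "c 1 = 2" "c 2 = 2" using c1 c2 by auto
  hence "complex_of_real (of_rat ((2 * x + 1) ^ 2) * S_odd 2 (x / (2 * x + 1)) - S_odd 2 x) =
     of_real (of_rat (2 * x ^ 2 + 2 * x + 1) + of_bool (odd p) * (- 1) powi (r + 1) / (of_int p ^ 3 * of_int (2 * r + p)))"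
    using c[OF q nz] c0 unfolding of_real_add of_real_diff of_real_mult complex_of_rat[symmetric] of_rat_power[symmetric]
    by (simp add: of_rat_add of_rat_mult of_rat_power algebra_simps)
  thus ?thesis unfolding of_real_eq_iff .
qed

section \<open>Mellin transforms\<close>

text \<open>Absolutely convergent gauge integrals, such as those of the Gamma function, as Lebesgue integrals.\<close>

lemma has_bochner_integral_lborel_restrict:
  fixes f :: "real \<Rightarrow> complex"
  assumes "S \<in> sets borel" "continuous_on S f" "f absolutely_integrable_on S" "(f has_integral I) S"
  shows "has_bochner_integral lborel (\<lambda>t. indicator S t *\<^sub>R f t) I"
proof -
  have meas: "(\<lambda>t. indicator S t *\<^sub>R f t) \<in> borel_measurable lborel"
    using assms(1,2) by (simp add: borel_measurable_continuous_on_indicator)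
  have i: "integrable lebesgue (\<lambda>t. indicator S t *\<^sub>R f t)"
    using assms(3) by (simp add: set_integrable_def)
  have "integral\<^sup>L lebesgue (\<lambda>t. indicator S t *\<^sub>R f t) = I"
    using set_lebesgue_integral_eq_integral(2)[OF assms(3)] integral_unique[OF assms(4)]
    by (simp add: set_lebesgue_integral_def)
  thus ?thesis
    using i meas by (simp add: has_bochner_integral_iff integrable_completion integral_completion)
qed

lemma mellin_exp:
  fixes s :: complex and b :: real
  assumes s: "Re s > 0" and b: "b > 0"
  shows "has_bochner_integral lborel (\<lambda>t. indicator {0<..} t *\<^sub>R (of_real t powr (s - 1) * of_real (exp (- (b * t)))))
     (Gamma s / of_real b powr s)"
proof -
  define G where "G = (\<lambda>t. indicator {0<..} t *\<^sub>R (of_real t powr (s - 1) * complex_of_real (exp (- t))))"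
  have "has_bochner_integral lborel G (Gamma s)"
    unfolding G_def
  proof (rule has_bochner_integral_lborel_restrict)
    have eq: "of_real t powr (s - 1) * complex_of_real (exp (- t)) = of_real t powr (s - 1) / of_real (exp t)" for t
      by (simp add: exp_minus field_simps)
    show "(\<lambda>t. of_real t powr (s - 1) * complex_of_real (exp (- t))) absolutely_integrable_on {0<..}"
      unfolding eq by (rule absolutely_integrable_Gamma_integral'[OF s])
    show "((\<lambda>t. of_real t powr (s - 1) * complex_of_real (exp (- t))) has_integral Gamma s) {0<..}"
      unfolding eq by (rule Gamma_integral_complex'[OF s])
  qed (auto intro!: continuous_intros)
  hence G: "integrable lborel G" "integral\<^sup>L lborel G = Gamma s"
    by (auto simp: has_bochner_integral_iff)
  have b0: "complex_of_real b \<noteq> 0" using b by simp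
  have scale: "of_real b powr (1 - s) * G (0 + b * t) = indicator {0<..} t *\<^sub>R (of_real t powr (s - 1) * of_real (exp (- (b * t))))" for t
  proof (cases "t > 0")
    case True
    have "complex_of_real (b * t) powr (s - 1) = of_real b powr (s - 1) * of_real t powr (s - 1)"
      using True b by (simp add: powr_times_real)
    moreover have "complex_of_real b powr (1 - s) * of_real b powr (s - 1) = 1"
      using b0 by (simp flip: powr_add)
    ultimately show ?thesis using True b by (simp add: G_def zero_less_mult_iff)
  next
    case False
    thus ?thesis using b by (simp add: G_def zero_less_mult_iff)
  qed
  have "integrable lborel (\<lambda>t. G (0 + b * t))" using lborel_integrable_real_affine[OF G(1), of b 0] b by simp
  hence "integrable lborel (\<lambda>t. of_real b powr (1 - s) * G (0 + b * t))" by simp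
  moreover have "(\<integral>t. of_real b powr (1 - s) * G (0 + b * t) \<partial>lborel) = Gamma s / of_real b powr s"
  proof -
    have "Gamma s = of_real b * (\<integral>t. G (0 + b * t) \<partial>lborel)"
      using lborel_integral_real_affine[of b G 0] b unfolding G(2) by (simp add: scaleR_conv_of_real)
    hence "(\<integral>t. G (0 + b * t) \<partial>lborel) = Gamma s / of_real b" using b0 by (simp add: field_simps)
    moreover have "complex_of_real b powr (1 - s) = of_real b / of_real b powr s"
      using b0 by (simp add: powr_diff)
    ultimately show ?thesis using b0 by simp
  qed
  ultimately show ?thesis unfolding has_bochner_integral_iff scale by blast
qed

lemma mellin_exp_real:
  fixes \<sigma> b :: real
  assumes "\<sigma> > 0" "b > 0"
  shows "has_bochner_integral lborel (\<lambda>t. indicator {0<..} t * (t powr (\<sigma> - 1) * exp (- (b * t)))) (Gamma \<sigma> / b powr \<sigma>)"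
proof -
  have "has_bochner_integral lborel (\<lambda>t. Re (indicator {0<..} t *\<^sub>R (of_real t powr (of_real \<sigma> - 1) * of_real (exp (- (b * t))))))
     (Re (Gamma (of_real \<sigma>) / of_real b powr of_real \<sigma>))"
    by (rule has_bochner_integral_bounded_linear[OF bounded_linear_Re mellin_exp]) (use assms in auto)
  moreover have "Re (indicator {0<..} t *\<^sub>R (of_real t powr (of_real \<sigma> - 1) * of_real (exp (- (b * t))))) =
     indicator {0<..} t * (t powr (\<sigma> - 1) * exp (- (b * t)))" for t
  proof (cases "t > 0")
    case True
    hence "complex_of_real t powr (of_real \<sigma> - 1) = of_real (t powr (\<sigma> - 1))"
      using powr_of_real[of t "\<sigma> - 1"] by simp
    thus ?thesis using True by (simp flip: of_real_mult)
  qed simp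
  moreover have "Gamma (of_real \<sigma>) / complex_of_real b powr of_real \<sigma> = of_real (Gamma \<sigma> / b powr \<sigma>)"
    using assms by (simp add: Gamma_complex_of_real powr_of_real)
  ultimately show ?thesis by (simp only: Re_complex_of_real)
qed

text \<open>Absolute convergence of the Dirichlet series is what justifies integrating term by term.\<close>

theorem mellin_qser:
  assumes c: "poly_bounded c" "c 0 = 0" and s: "Re s > 0"
    and sum: "summable (\<lambda>n. norm (c (Suc n)) / of_nat (Suc n) powr Re s)"
  shows "has_bochner_integral lborel (\<lambda>t. indicator {0<..} t *\<^sub>R (of_real t powr (s - 1) * qser c (\<i> * of_real t)))
     (Gamma s / of_real pi powr s * (\<Sum>n. c (Suc n) / of_nat (Suc n) powr s))"
proof -
  define f where "f = (\<lambda>n t. indicator {0<..} t *\<^sub>R (of_real t powr (s - 1) * of_real (exp (- (pi * of_nat (Suc n) * t)))))"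
  have b: "pi * of_nat (Suc n) > 0" for n by simp
  have f: "has_bochner_integral lborel (f n) (Gamma s / of_real (pi * of_nat (Suc n)) powr s)" for n
    unfolding f_def by (rule mellin_exp[OF s b])
  have nf: "(\<integral>t. norm (f n t) \<partial>lborel) = Gamma (Re s) / (pi * of_nat (Suc n)) powr Re s" for n
  proof -
    have "norm (f n t) = indicator {0<..} t * (t powr (Re s - 1) * exp (- (pi * of_nat (Suc n) * t)))" for t
      by (cases "t > 0") (simp_all add: f_def norm_mult norm_powr_real_powr)
    thus ?thesis using mellin_exp_real[OF s b] by (simp add: has_bochner_integral_iff)
  qed
  have sums: "(\<lambda>n. c (Suc n) * f n t) sums (indicator {0<..} t *\<^sub>R (of_real t powr (s - 1) * qser c (\<i> * of_real t)))"
    and abs: "summable (\<lambda>n. norm (c (Suc n) * f n t))" for t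
  proof -
    show "(\<lambda>n. c (Suc n) * f n t) sums (indicator {0<..} t *\<^sub>R (of_real t powr (s - 1) * qser c (\<i> * of_real t)))"
    proof (cases "t > 0")
      case True
      have "(\<lambda>n. c n * exp (of_real pi * \<i> * of_nat n * (\<i> * of_real t))) sums qser c (\<i> * of_real t)"
        by (rule qser_sums[OF c(1)]) (use True in simp)
      hence "(\<lambda>n. c (Suc n) * exp (of_real pi * \<i> * of_nat (Suc n) * (\<i> * of_real t))) sums qser c (\<i> * of_real t)"
        by (subst sums_Suc_iff) (simp add: c(2))
      moreover have "exp (of_real pi * \<i> * of_nat m * (\<i> * of_real t)) = of_real (exp (- (pi * of_nat m * t)))" for m
      proof -
        have "of_real pi * \<i> * of_nat m * (\<i> * of_real t) = of_real (- (pi * of_nat m * t))"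
          by (simp add: complex_eq_iff)
        thus ?thesis by (simp only: exp_of_real)
      qed
      ultimately have "(\<lambda>n. c (Suc n) * of_real (exp (- (pi * of_nat (Suc n) * t)))) sums qser c (\<i> * of_real t)"
        by (simp only:)
      from sums_mult[OF this, of "of_real t powr (s - 1)"] True show ?thesis by (simp add: f_def mult_ac)
    qed (simp add: f_def)
    show "summable (\<lambda>n. norm (c (Suc n) * f n t))"
    proof (cases "t > 0")
      case True
      have "summable (\<lambda>n. norm (c n * exp (of_real pi * \<i> * of_nat n * (\<i> * of_real t))))"
        by (rule qser_abs_summable[OF c(1)]) (use True in simp)
      hence "summable (\<lambda>n. norm (c (Suc n) * exp (of_real pi * \<i> * of_nat (Suc n) * (\<i> * of_real t))))"
        by (subst summable_Suc_iff)
      from summable_mult[OF this, of "norm (complex_of_real t powr (s - 1))"] True show ?thesis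
        by (simp add: f_def norm_mult mult_ac norm_exp_eq_Re)
    qed (simp add: f_def)
  qed
  have scale: "(pi * of_nat (Suc n)) powr Re s = pi powr Re s * of_nat (Suc n) powr Re s"
    "complex_of_real (pi * of_nat (Suc n)) powr s = of_real pi powr s * of_nat (Suc n) powr s" for n
    by (simp_all add: powr_mult powr_times_real)
  have int: "integrable lborel (\<lambda>t. c (Suc n) * f n t)" for n
    using f[of n] by (simp add: has_bochner_integral_iff)
  have ae: "AE t in lborel. summable (\<lambda>n. norm (c (Suc n) * f n t))" using abs by simp
  have sum': "summable (\<lambda>n. \<integral>t. norm (c (Suc n) * f n t) \<partial>lborel)"
  proof -
    have "(\<integral>t. norm (c (Suc n) * f n t) \<partial>lborel) = Gamma (Re s) / pi powr Re s * (norm (c (Suc n)) / of_nat (Suc n) powr Re s)" for n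
      unfolding norm_mult using nf[of n] unfolding scale by simp
    thus ?thesis by (simp only: summable_mult[OF sum])
  qed
  have S: "(\<Sum>n. c (Suc n) * f n t) = indicator {0<..} t *\<^sub>R (of_real t powr (s - 1) * qser c (\<i> * of_real t))" for t
    using sums by (rule sums_unique[symmetric])
  have "(\<lambda>n. \<integral>t. c (Suc n) * f n t \<partial>lborel) = (\<lambda>n. Gamma s / of_real pi powr s * (c (Suc n) / of_nat (Suc n) powr s))"
    using f unfolding scale by (auto simp: has_bochner_integral_iff)
  moreover have "summable (\<lambda>n. c (Suc n) / of_nat (Suc n) powr s)"
    by (rule summable_norm_cancel) (use sum in \<open>simp add: norm_divide norm_powr_real_powr del: of_nat_Suc\<close>)
  ultimately have "(\<integral>t. (\<Sum>n. c (Suc n) * f n t) \<partial>lborel) = Gamma s / of_real pi powr s * (\<Sum>n. c (Suc n) / of_nat (Suc n) powr s)"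
    using integral_suminf[OF int ae sum'] by (simp only: suminf_mult)
  thus ?thesis using integrable_suminf[OF int ae sum'] unfolding S has_bochner_integral_iff by blast
qed

lemma mellin_unit_interval:
  assumes w: "Re w > 0"
  shows "has_bochner_integral lborel (\<lambda>t. indicator {0<..1} t *\<^sub>R (of_real t powr (w - 1))) (1 / w)"
proof (rule has_bochner_integral_lborel_restrict)
  have w0: "w \<noteq> 0" using w by auto
  have "((\<lambda>t. of_real t powr (w - 1)) has_integral (of_real 1 powr w / w - of_real 0 powr w / w)) {0..1::real}"
  proof (rule fundamental_theorem_of_calculus_interior)
    have "((\<lambda>t. complex_of_real t powr w) \<longlongrightarrow> of_real x powr w) (at x within {0..1})" if "x \<in> {0..1}" for x
      by (intro tendsto_powr_complex' tendsto_intros) (use that w in \<open>auto simp: complex_nonpos_Reals_iff\<close>)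
    thus "continuous_on {0..1} (\<lambda>t. complex_of_real t powr w / w)"
      unfolding continuous_on_def using w0 by (intro ballI tendsto_divide tendsto_const)
    fix x :: real assume x: "x \<in> {0<..<1}"
    have "((\<lambda>z. z powr w / w) has_field_derivative of_real x powr (w - 1)) (at (of_real x))"
      using DERIV_cdivide[OF has_field_derivative_powr[of "of_real x" w], of w] x w0 by (simp add: complex_nonpos_Reals_iff)
    from has_vector_derivative_real_field[OF this]
    show "((\<lambda>t. complex_of_real t powr w / w) has_vector_derivative of_real x powr (w - 1)) (at x)" .
  qed simp
  hence *: "((\<lambda>t. complex_of_real t powr (w - 1)) has_integral 1 / w) {0..1}" by simp
  show has: "((\<lambda>t. complex_of_real t powr (w - 1)) has_integral 1 / w) {0<..1}"
  proof -
    have "((\<lambda>t. complex_of_real t powr (w - 1)) has_integral 1 / w) {0..1} \<longleftrightarrow> ((\<lambda>t. complex_of_real t powr (w - 1)) has_integral 1 / w) {0<..1}"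
      by (rule has_integral_spike_set_eq) (rule negligible_subset[of "{0}"], auto)+
    thus ?thesis using * by blast
  qed
  show "(\<lambda>t. complex_of_real t powr (w - 1)) absolutely_integrable_on {0<..1}"
  proof (rule absolutely_integrable_integrable_bound)
    show "(\<lambda>t. t powr (Re w - 1)) integrable_on {0<..1::real}" by (rule integrable_on_powr_from_0') (use w in auto)
    show "(\<lambda>t. complex_of_real t powr (w - 1)) integrable_on {0<..1}" using has by blast
  qed (simp add: norm_powr_real_powr)
qed (auto intro!: continuous_intros simp: complex_nonpos_Reals_iff)

lemma norm_powr_difference_quotient:
  assumes "t > 0" "u \<noteq> 0" "norm u \<le> 1"
  shows "norm ((complex_of_real t powr u - 1) / u) \<le> t powr 2 + t powr (- 2)"
proof -
  define L where "L = ln t"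
  have t: "complex_of_real t powr u = exp (u * of_real L)"
    using assms by (simp add: powr_def L_def Ln_of_real)
  have uL: "norm (u * of_real L) \<le> \<bar>L\<bar>" using assms(3) by (simp add: norm_mult mult_left_le_one_le)
  have "norm (exp (u * of_real L) - 1) \<le> exp \<bar>Re (u * of_real L)\<bar> * norm (u * of_real L)"
    using Taylor_exp[of "u * of_real L" 0] by simp
  also have "\<dots> \<le> exp \<bar>L\<bar> * norm (u * of_real L)"
    by (intro mult_right_mono) (use uL abs_Re_le_cmod[of "u * of_real L"] in auto)
  also have "\<dots> = norm u * (exp \<bar>L\<bar> * \<bar>L\<bar>)" by (simp add: norm_mult)
  finally have "norm ((exp (u * of_real L) - 1) / u) \<le> exp \<bar>L\<bar> * \<bar>L\<bar>"
    using assms(2) by (simp add: norm_divide divide_le_eq mult_ac)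
  also have "\<dots> \<le> exp \<bar>L\<bar> * exp \<bar>L\<bar>"
    by (intro mult_left_mono) (use exp_ge_add_one_self[of "\<bar>L\<bar>"] in linarith, simp)
  also have "\<dots> = exp (2 * \<bar>L\<bar>)" by (simp flip: exp_add)
  also have "\<dots> \<le> exp (2 * L) + exp (- 2 * L)" by (cases "L \<ge> 0") auto
  also have "\<dots> = t powr 2 + t powr (- 2)" using assms(1) by (simp add: powr_def L_def)
  finally show ?thesis unfolding t .
qed

text \<open>A function that decays faster than every power at both ends of the half-line has an entire Mellin
  transform. The bound on the difference quotients of \<open>t\<^sup>u\<close> at \<open>u = 0\<close> dominates those of the integral.\<close>

theorem mellin_entire:
  fixes h :: "real \<Rightarrow> complex"
  assumes meas: "h \<in> borel_measurable borel" and supp: "\<And>t. t \<le> 0 \<Longrightarrow> h t = 0"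
    and int: "\<And>\<sigma>. integrable lborel (\<lambda>t. t powr \<sigma> * norm (h t))"
  shows "integrable lborel (\<lambda>t. of_real t powr w * h t)"
    and "(\<lambda>s. \<integral>t. of_real t powr (s - 1) * h t \<partial>lborel) holomorphic_on UNIV"
proof -
  have pm: "(\<lambda>t. complex_of_real t powr w) \<in> borel_measurable borel" for w
    unfolding powr_def by measurable
  have nrm: "norm (of_real t powr w * h t) = t powr Re w * norm (h t)" for t w
    by (cases "t \<le> 0") (simp_all add: supp norm_mult norm_powr_real_powr)
  have I: "integrable lborel (\<lambda>t. of_real t powr w * h t)" for w
    by (rule Bochner_Integration.integrable_bound[OF int[of "Re w"]]) (use pm meas nrm in auto)
  show "integrable lborel (\<lambda>t. of_real t powr w * h t)" by (rule I)
  define D where "D = (\<lambda>s. \<integral>t. of_real t powr (s - 1) * of_real (ln t) * h t \<partial>lborel)"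
  have "((\<lambda>s. \<integral>t. of_real t powr (s - 1) * h t \<partial>lborel) has_field_derivative D s) (at s)" for s
    unfolding DERIV_def tendsto_at_iff_sequentially o_def
  proof (intro allI impI)
    fix X :: "nat \<Rightarrow> complex" assume X: "\<forall>i. X i \<in> UNIV - {0}" "X \<longlonglongrightarrow> 0"
    have "\<forall>\<^sub>F i in sequentially. norm (X i) < 1"
      using order_tendstoD(2)[OF tendsto_norm[OF X(2)], of 1] by simp
    then obtain N where N: "\<And>i. i \<ge> N \<Longrightarrow> norm (X i) \<le> 1" unfolding eventually_sequentially by (meson less_imp_le)
    define Y where "Y i = X (i + N)" for i
    have Y: "Y i \<noteq> 0" "norm (Y i) \<le> 1" "Y \<longlonglongrightarrow> 0" for i
      using X N LIMSEQ_ignore_initial_segment[OF X(2), of N] unfolding Y_def by auto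
    define q where "q = (\<lambda>i t. of_real t powr (s - 1) * ((of_real t powr Y i - 1) / Y i) * h t)"
    have q: "((\<integral>t. of_real t powr (s + Y i - 1) * h t \<partial>lborel) - (\<integral>t. of_real t powr (s - 1) * h t \<partial>lborel)) / Y i =
       (\<integral>t. q i t \<partial>lborel)" for i
    proof -
      have "(of_real t powr (s + Y i - 1) * h t - of_real t powr (s - 1) * h t) / Y i = q i t" for t
      proof (cases "t \<le> 0")
        case False
        have "complex_of_real t powr (s + Y i - 1) = of_real t powr (s - 1) * of_real t powr Y i"
          using False by (simp flip: powr_add add: algebra_simps)
        thus ?thesis by (simp add: q_def algebra_simps diff_divide_distrib)
      qed (simp add: supp q_def)
      thus ?thesis by (simp add: Bochner_Integration.integral_diff[OF I I, symmetric] flip: integral_divide_zero)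
    qed
    have "(\<lambda>i. \<integral>t. q i t \<partial>lborel) \<longlonglongrightarrow> D s"
      unfolding D_def
    proof (rule integral_dominated_convergence)
      let ?w = "\<lambda>t. t powr (Re s + 1) * norm (h t) + t powr (Re s - 3) * norm (h t)"
      show "integrable lborel ?w" by (intro Bochner_Integration.integrable_add int)
      show "(\<lambda>t. of_real t powr (s - 1) * of_real (ln t) * h t) \<in> borel_measurable lborel"
        using pm[of "s - 1"] meas by measurable
      show "q i \<in> borel_measurable lborel" for i
        unfolding q_def using pm meas by measurable
      show "AE t in lborel. norm (q i t) \<le> ?w t" for i
      proof (rule AE_I2)
        fix t show "norm (q i t) \<le> ?w t"
        proof (cases "t > 0")
          case True
          have "norm (q i t) = t powr (Re s - 1) * norm ((of_real t powr Y i - 1) / Y i) * norm (h t)"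
            unfolding q_def norm_mult using True by (simp add: norm_powr_real_powr)
          also have "\<dots> \<le> t powr (Re s - 1) * (t powr 2 + t powr (- 2)) * norm (h t)"
            by (intro mult_right_mono mult_left_mono norm_powr_difference_quotient True Y) auto
          also have "\<dots> = ?w t" by (simp add: distrib_left distrib_right add.commute flip: powr_add)
          finally show ?thesis .
        qed (simp add: q_def supp)
      qed
      show "AE t in lborel. (\<lambda>i. q i t) \<longlonglongrightarrow> of_real t powr (s - 1) * of_real (ln t) * h t"
      proof (rule AE_I2)
        fix t show "(\<lambda>i. q i t) \<longlonglongrightarrow> of_real t powr (s - 1) * of_real (ln t) * h t"
        proof (cases "t > 0")
          case True
          have "((\<lambda>u. of_real t powr u) has_field_derivative Ln (of_real t) * of_real t powr 0) (at (0::complex))"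
            using True by (intro has_field_derivative_powr_right) auto
          hence "((\<lambda>u. (of_real t powr u - 1) / u) \<longlongrightarrow> of_real (ln t)) (at (0::complex))"
            using True by (simp add: has_field_derivative_iff Ln_of_real)
          hence "(\<lambda>i. (of_real t powr Y i - 1) / Y i) \<longlonglongrightarrow> of_real (ln t)"
            using Y unfolding tendsto_at_iff_sequentially o_def by auto
          thus ?thesis unfolding q_def by (intro tendsto_intros)
        qed (simp add: q_def supp)
      qed
    qed
    hence "(\<lambda>i. ((\<integral>t. of_real t powr (s + X (i + N) - 1) * h t \<partial>lborel) - (\<integral>t. of_real t powr (s - 1) * h t \<partial>lborel)) / X (i + N)) \<longlonglongrightarrow> D s"
      unfolding q[symmetric] Y_def .
    thus "(\<lambda>i. ((\<integral>t. of_real t powr (s + X i - 1) * h t \<partial>lborel) - (\<integral>t. of_real t powr (s - 1) * h t \<partial>lborel)) / X i) \<longlonglongrightarrow> D s"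
      by (rule LIMSEQ_offset)
  qed
  thus "(\<lambda>s. \<integral>t. of_real t powr (s - 1) * h t \<partial>lborel) holomorphic_on UNIV"
    unfolding holomorphic_on_open[OF open_UNIV] by blast
qed

section \<open>The completed \<open>L\<close>-function\<close>

lemma qser_add: "qser c (z + w) = qser (\<lambda>n. c n * exp (of_real pi * \<i> * of_nat n * z)) w"
  by (simp add: qser_def algebra_simps exp_add mult_ac)

lemma poly_bounded_mult_exp:
  assumes "poly_bounded c" "Im z \<ge> 0"
  shows "poly_bounded (\<lambda>n. c n * exp (of_real pi * \<i> * of_nat n * z))"
proof -
  obtain C N where C: "\<And>n. norm (c n) \<le> C * (of_nat n + 1) ^ N" using poly_boundedE[OF assms(1)] by metis
  have "norm (c n * exp (of_real pi * \<i> * of_nat n * z)) \<le> C * (of_nat n + 1) ^ N" for n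
  proof -
    have "norm (exp (of_real pi * \<i> * of_nat n * z)) \<le> 1" using assms(2) by (simp add: norm_exp_eq_Re)
    hence "norm (c n * exp (of_real pi * \<i> * of_nat n * z)) \<le> norm (c n) * 1"
      unfolding norm_mult by (intro mult_left_mono) auto
    thus ?thesis using C[of n] by simp
  qed
  thus ?thesis unfolding poly_bounded_def by blast
qed

text \<open>From \<open>\<sigma>\<^bsub>k-1\<^esub>(n) = n\<^bsup>k-1\<^esup> \<Sum>\<^bsub>d | n\<^esub> d\<^bsup>1-k\<^esup>\<close> and \<open>1/d \<le> n\<^sup>\<delta> d\<^bsup>-1-\<delta>\<^esup>\<close> for \<open>d \<le> n\<close> one gets \<open>\<sigma>\<^bsub>k-1\<^esub>(n) = O(n\<^bsup>k-1+\<delta>\<^esup>)\<close>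
  for every \<open>\<delta> > 0\<close>, which is what absolute convergence in the whole half-plane requires.\<close>

lemma norm_odd_coeff_neg_le:
  assumes \<delta>: "\<delta> > 0"
  obtains C where "\<And>n. n > 0 \<Longrightarrow> norm (odd_coeff (- int g) n) \<le> C * of_nat n powr \<delta>"
proof -
  define C where "C = (\<Sum>d. of_nat d powr (- 1 - \<delta>) :: real)"
  have sum: "summable (\<lambda>d. of_nat d powr (- 1 - \<delta>) :: real)" using \<delta> by (simp add: summable_real_powr_iff)
  have "norm (odd_coeff (- int g) n) \<le> C * of_nat n powr \<delta>" if n: "n > 0" for n
  proof -
    have fin: "finite {d. d dvd n}" using n by simp
    have le: "norm (complex_of_nat d powi (- int g - 1)) \<le> of_nat n powr \<delta> * of_nat d powr (- 1 - \<delta>)" if "d dvd n" for d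
    proof -
      have d: "real d \<ge> 1" "d \<le> n" using that n by (auto simp: Suc_le_eq dvd_pos_nat dvd_imp_le)
      have "norm (complex_of_nat d powi (- int g - 1)) = real d powi (- int g - 1)"
        by (simp add: norm_power_int)
      also have "\<dots> = real d powr (- real g - 1)" using d(1) powr_real_of_int'[of "real d" "- int g - 1"] by simp
      also have "\<dots> \<le> real d powr (\<delta> + (- 1 - \<delta>))" using d(1) by (intro powr_mono) auto
      also have "\<dots> = real d powr \<delta> * real d powr (- 1 - \<delta>)" by (rule powr_add)
      also have "\<dots> \<le> real n powr \<delta> * real d powr (- 1 - \<delta>)"
        using d \<delta> by (intro mult_right_mono powr_mono2) auto
      finally show ?thesis .
    qed
    have "norm (odd_coeff (- int g) n) \<le> (\<Sum>d | d dvd n. norm (complex_of_nat d powi (- int g - 1)))"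
      by (cases "odd n") (auto simp: odd_coeff_def divisor_sigma_def intro!: norm_sum sum_nonneg)
    also have "\<dots> \<le> (\<Sum>d | d dvd n. of_nat n powr \<delta> * of_nat d powr (- 1 - \<delta>))" by (intro sum_mono le) simp
    also have "\<dots> = of_nat n powr \<delta> * (\<Sum>d | d dvd n. of_nat d powr (- 1 - \<delta>))" by (simp add: sum_distrib_left)
    also have "\<dots> \<le> of_nat n powr \<delta> * C"
      unfolding C_def by (intro mult_left_mono sum_le_suminf[OF sum fin]) auto
    finally show ?thesis by (simp add: mult.commute)
  qed
  thus ?thesis by (rule that)
qed

lemma summable_odd_coeff_pos:
  assumes \<sigma>: "\<sigma> > of_nat (g + 2)"
  shows "summable (\<lambda>n. norm (odd_coeff (int g + 2) (Suc n)) / of_nat (Suc n) powr \<sigma>)"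
proof -
  define \<delta> where "\<delta> = (\<sigma> - of_nat (g + 2)) / 2"
  have \<delta>: "\<delta> > 0" using \<sigma> by (simp add: \<delta>_def)
  obtain C where C: "\<And>n. n > 0 \<Longrightarrow> norm (odd_coeff (- int g) n) \<le> C * of_nat n powr \<delta>"
    using norm_odd_coeff_neg_le[OF \<delta>] by metis
  have bound: "norm (odd_coeff (int g + 2) (Suc n)) / of_nat (Suc n) powr \<sigma> \<le> C * of_nat (Suc n) powr (- 1 - \<delta>)" for n
  proof -
    define N where "N = real (Suc n)"
    have N: "N > 0" by (simp add: N_def)
    have "norm (odd_coeff (int g + 2) (Suc n)) = N ^ Suc g * norm (odd_coeff (- int g) (Suc n))"
      unfolding odd_coeff_pos by (simp add: norm_mult norm_power N_def del: of_nat_Suc power_Suc)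
    also have "\<dots> \<le> N ^ Suc g * (C * N powr \<delta>)" unfolding N_def by (intro mult_left_mono C) auto
    also have "N ^ Suc g = N powr of_nat (Suc g)" using N by (simp add: powr_realpow del: of_nat_Suc power_Suc)
    finally have "norm (odd_coeff (int g + 2) (Suc n)) / N powr \<sigma> \<le> N powr of_nat (Suc g) * (C * N powr \<delta>) / N powr \<sigma>"
      by (rule divide_right_mono) simp
    also have "\<dots> = C * N powr (of_nat (Suc g) + \<delta> - \<sigma>)" by (simp add: powr_add powr_diff)
    also have "of_nat (Suc g) + \<delta> - \<sigma> = - 1 - \<delta>" by (simp add: \<delta>_def field_simps)
    finally show ?thesis by (simp add: N_def)
  qed
  have "summable (\<lambda>n. of_nat n powr (- 1 - \<delta>) :: real)" using \<delta> by (simp add: summable_real_powr_iff)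
  hence "summable (\<lambda>n. C * of_nat (Suc n) powr (- 1 - \<delta>) :: real)"
    by (intro summable_mult) (subst summable_Suc_iff)
  thus ?thesis by (rule summable_comparison_test'[where N = 0]) (use bound in simp)
qed

lemma exp_neg_divide_le:
  fixes c t :: real
  assumes "c > 0" "t > 0"
  shows "exp (- (c / t)) \<le> fact N * t ^ N / c ^ N"
proof -
  have "(c / t) ^ N / fact N \<le> exp (c / t)"
  proof -
    have e: "(\<lambda>n. (c / t) ^ n /\<^sub>R fact n) sums exp (c / t)" by (rule exp_converges)
    have "(\<Sum>n\<in>{N}. (c / t) ^ n /\<^sub>R fact n) \<le> (\<Sum>n. (c / t) ^ n /\<^sub>R fact n)"
      using assms e by (intro sum_le_suminf) (auto simp: sums_iff)
    thus ?thesis unfolding sums_unique[OF e, symmetric] by (simp add: field_simps)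
  qed
  hence "inverse (exp (c / t)) \<le> inverse ((c / t) ^ N / fact N)" using assms by (intro le_imp_inverse_le) auto
  thus ?thesis by (simp add: exp_minus power_divide field_simps)
qed

text \<open>On \<open>(0, 1]\<close> the factor \<open>exp (- c / t)\<close> outweighs any power of \<open>1 / t\<close>.\<close>

lemma rapid_decay_integrable:
  fixes h :: "real \<Rightarrow> complex"
  assumes meas: "h \<in> borel_measurable borel" and supp: "\<And>t. t \<le> 0 \<Longrightarrow> h t = 0" and c: "c > 0"
    and M: "M \<ge> 0" and small: "\<And>t. 0 < t \<Longrightarrow> t \<le> 1 \<Longrightarrow> norm (h t) \<le> M / t ^ k * exp (- (c / t))"
    and M': "M' \<ge> 0" and large: "\<And>t. t > 1 \<Longrightarrow> norm (h t) \<le> M' * exp (- pi * t)"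
  shows "integrable lborel (\<lambda>t. t powr \<sigma> * norm (h t))"
proof -
  define N where "N = nat \<lceil>real k - \<sigma>\<rceil>"
  have N: "\<sigma> - real k + real N \<ge> 0" unfolding N_def by linarith
  define K where "K = M * (fact N / c ^ N)"
  have K: "K \<ge> 0" using M c by (simp add: K_def)
  define w where "w = (\<lambda>t. K * indicator {0..1} t + M' * (indicator {0<..} t * (t powr ((max \<sigma> 0 + 1) - 1) * exp (- (pi * t)))))"
  have "integrable lborel w"
    unfolding w_def using mellin_exp_real[of "max \<sigma> 0 + 1" pi]
    by (intro Bochner_Integration.integrable_add integrable_mult_right) (auto simp: has_bochner_integral_iff)
  thus ?thesis
  proof (rule Bochner_Integration.integrable_bound)
    show "(\<lambda>t. t powr \<sigma> * norm (h t)) \<in> borel_measurable lborel" using meas by measurable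
    show "AE t in lborel. norm (t powr \<sigma> * norm (h t)) \<le> norm (w t)"
    proof (rule AE_I2)
      fix t :: real
      have w0: "w t \<ge> 0" using K M' by (simp add: w_def)
      consider "t \<le> 0" | "0 < t" "t \<le> 1" | "t > 1" by linarith
      hence "t powr \<sigma> * norm (h t) \<le> w t"
      proof cases
        case 1 thus ?thesis using supp w0 by simp
      next
        case 2
        have "t powr \<sigma> * norm (h t) \<le> t powr \<sigma> * (M / t ^ k * (fact N * t ^ N / c ^ N))"
          by (intro mult_left_mono order.trans[OF small[OF 2]] exp_neg_divide_le c) (use 2 M in auto)
        also have "\<dots> = K * (t powr \<sigma> / t ^ k * t ^ N)" by (simp add: K_def mult_ac)
        also have "t powr \<sigma> / t ^ k * t ^ N = t powr (\<sigma> - real k + real N)"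
          using 2 by (simp add: powr_add powr_diff powr_realpow)
        also have "K * \<dots> \<le> K * 1" using 2 N K by (intro mult_left_mono powr_le1) auto
        also have "\<dots> \<le> w t" unfolding w_def using 2 M' by simp
        finally show ?thesis .
      next
        case 3
        have "t powr \<sigma> * norm (h t) \<le> t powr max \<sigma> 0 * (M' * exp (- pi * t))"
          by (intro mult_mono large powr_mono) (use 3 in auto)
        also have "\<dots> = w t" unfolding w_def using 3 by simp
        finally show ?thesis .
      qed
      thus "norm (t powr \<sigma> * norm (h t)) \<le> norm (w t)" using w0 by simp
    qed
  qed
qed

text \<open>The form on the vertical line above the cusp, with its singular part at the cusp removed.\<close>

definition mellin_kernel :: "nat \<Rightarrow> int \<Rightarrow> int \<Rightarrow> real \<Rightarrow> complex" where
  "mellin_kernel g r p t = (if t \<le> 0 then 0 else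
     E_odd (int g + 2) (of_int r / of_int p + \<i> * of_real t) -
     (if t \<le> 1 then cusp_value g r p / (of_int p * (\<i> * of_real t)) ^ (g + 2) else 0))"

definition cusp_residue :: "nat \<Rightarrow> int \<Rightarrow> int \<Rightarrow> complex" where
  "cusp_residue g r p = cusp_value g r p / (of_int p * \<i>) ^ (g + 2)"

lemma mellin_kernel_measurable: "mellin_kernel g r p \<in> borel_measurable borel"
proof -
  have "continuous_on upper_half_plane (E_odd (int g + 2))"
    unfolding E_odd_eq_qser by (intro holomorphic_on_imp_continuous_on qser_holomorphic poly_bounded_odd_coeff_pos)
  hence "continuous_on {0<..} (\<lambda>t. E_odd (int g + 2) (of_int r / of_int p + \<i> * of_real t))"
    by (rule continuous_on_compose2) (auto intro!: continuous_intros simp: upper_half_plane_def Im_divide)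
  hence "(\<lambda>t. indicator {0<..} t *\<^sub>R E_odd (int g + 2) (of_int r / of_int p + \<i> * of_real t)) \<in> borel_measurable borel"
    by (intro borel_measurable_continuous_on_indicator) auto
  moreover have "(\<lambda>t. indicator {0<..1} t *\<^sub>R (cusp_value g r p / (of_int p * (\<i> * of_real t)) ^ (g + 2))) \<in> borel_measurable borel"
    by measurable
  ultimately have "(\<lambda>t. indicator {0<..} t *\<^sub>R E_odd (int g + 2) (of_int r / of_int p + \<i> * of_real t) -
     indicator {0<..1} t *\<^sub>R (cusp_value g r p / (of_int p * (\<i> * of_real t)) ^ (g + 2))) \<in> borel_measurable borel"
    by (rule borel_measurable_diff)
  moreover have "mellin_kernel g r p = (\<lambda>t. indicator {0<..} t *\<^sub>R E_odd (int g + 2) (of_int r / of_int p + \<i> * of_real t) -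
     indicator {0<..1} t *\<^sub>R (cusp_value g r p / (of_int p * (\<i> * of_real t)) ^ (g + 2)))"
    by (rule ext) (simp add: mellin_kernel_def)
  ultimately show ?thesis by simp
qed

lemma mellin_kernel_integrable:
  assumes g: "even g" and p: "p > 0" "coprime r p"
  shows "integrable lborel (\<lambda>t. t powr \<sigma> * norm (mellin_kernel g r p t))"
proof -
  obtain M where M: "M \<ge> 0" "\<And>t. 0 < t \<Longrightarrow> t \<le> 1 \<Longrightarrow>
     norm (E_odd (int g + 2) (of_int r / of_int p + \<i> * of_real t) - cusp_value g r p / (of_int p * (\<i> * of_real t)) ^ (g + 2))
       \<le> M / t ^ (g + 2) * exp (- pi / (of_int p ^ 2 * t))"
    using E_odd_pos_near_cusp[OF g p] by metis
  obtain M' where M': "M' \<ge> 0" "\<And>\<tau>. Im \<tau> \<ge> 1 \<Longrightarrow> norm (qser (odd_coeff (int g + 2)) \<tau> - odd_coeff (int g + 2) 0) \<le> M' * exp (- pi * Im \<tau>)"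
    using qser_minus_const_bound[OF poly_bounded_odd_coeff_pos zero_less_one] by metis
  show ?thesis
  proof (rule rapid_decay_integrable[where c = "pi / of_int p ^ 2" and M = M and M' = M' and k = "g + 2"])
    show "norm (mellin_kernel g r p t) \<le> M / t ^ (g + 2) * exp (- (pi / (of_int p)\<^sup>2 / t))" if "0 < t" "t \<le> 1" for t
      using M(2)[OF that] that by (simp add: mellin_kernel_def)
    show "norm (mellin_kernel g r p t) \<le> M' * exp (- pi * t)" if "t > 1" for t
    proof -
      have "Im (of_int r / of_int p + \<i> * of_real t) = t" by (simp add: Im_divide)
      thus ?thesis using M'(2)[of "of_int r / of_int p + \<i> * of_real t"] that
        by (simp add: mellin_kernel_def E_odd_eq_qser odd_coeff_def)
    qed
    show "mellin_kernel g r p \<in> borel_measurable borel" by (rule mellin_kernel_measurable)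
  qed (use p M(1) M'(1) in \<open>auto simp: mellin_kernel_def\<close>)
qed

lemma cusp_pole_eq: "cusp_value g r p / (of_int p * (\<i> * of_real t)) ^ (g + 2) = cusp_residue g r p / of_real t ^ (g + 2)"
  unfolding cusp_residue_def by (simp add: power_mult_distrib mult_ac)

text \<open>The singular part \<open>A t\<^bsup>-(g+2)\<^esup>\<close> on \<open>(0, 1]\<close> has the Mellin transform \<open>A / (s - (g + 2))\<close>, which is added back in
  closed form.\<close>

definition mellin_continuation :: "nat \<Rightarrow> int \<Rightarrow> int \<Rightarrow> complex \<Rightarrow> complex" where
  "mellin_continuation g r p s = (\<integral>t. of_real t powr (s - 1) * mellin_kernel g r p t \<partial>lborel) + cusp_residue g r p / (s - of_nat (g + 2))"

lemma mellin_continuation_eq_series: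
  assumes g: "even g" and p: "p > 0" "coprime r p" and s: "Re s > of_nat (g + 2)"
  defines "c \<equiv> \<lambda>n. odd_coeff (int g + 2) n * exp (of_real pi * \<i> * of_nat n * (of_int r / of_int p))"
  shows "mellin_continuation g r p s = Gamma s / of_real pi powr s * (\<Sum>n. c (Suc n) / of_nat (Suc n) powr s)"
proof -
  have Im0: "Im (of_int r / of_int p) = 0" by (simp add: Im_divide)
  have s0: "Re s > 0" using s of_nat_0_le_iff[of "g + 2", where 'a = real] by linarith
  have c: "poly_bounded c" "c 0 = 0" "norm (c n) = norm (odd_coeff (int g + 2) n)" for n
    unfolding c_def using poly_bounded_mult_exp[OF poly_bounded_odd_coeff_pos, of "of_int r / of_int p"] Im0
    by (simp_all add: odd_coeff_def norm_mult norm_exp_eq_Re)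
  have "has_bochner_integral lborel (\<lambda>t. indicator {0<..} t *\<^sub>R (of_real t powr (s - 1) * qser c (\<i> * of_real t)))
     (Gamma s / of_real pi powr s * (\<Sum>n. c (Suc n) / of_nat (Suc n) powr s))"
    by (rule mellin_qser[OF c(1,2) s0]) (unfold c(3), rule summable_odd_coeff_pos[OF s])
  moreover have "has_bochner_integral lborel (\<lambda>t. cusp_residue g r p * (indicator {0<..1} t *\<^sub>R (of_real t powr ((s - of_nat (g + 2)) - 1))))
     (cusp_residue g r p * (1 / (s - of_nat (g + 2))))"
    by (rule has_bochner_integral_mult_right[OF mellin_unit_interval]) (use s in simp)
  ultimately have "has_bochner_integral lborel (\<lambda>t. indicator {0<..} t *\<^sub>R (of_real t powr (s - 1) * qser c (\<i> * of_real t)) -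
        cusp_residue g r p * (indicator {0<..1} t *\<^sub>R (of_real t powr ((s - of_nat (g + 2)) - 1))))
     (Gamma s / of_real pi powr s * (\<Sum>n. c (Suc n) / of_nat (Suc n) powr s) - cusp_residue g r p * (1 / (s - of_nat (g + 2))))"
    by (rule has_bochner_integral_diff)
  moreover have "indicator {0<..} t *\<^sub>R (of_real t powr (s - 1) * qser c (\<i> * of_real t)) -
        cusp_residue g r p * (indicator {0<..1} t *\<^sub>R (of_real t powr ((s - of_nat (g + 2)) - 1))) = of_real t powr (s - 1) * mellin_kernel g r p t" for t
  proof (cases "t > 0")
    case True
    have "of_real t powr (s - of_nat (g + 2) - 1) = of_real t powr (s - 1) / of_real t ^ (g + 2)"
    proof -
      have "of_real t powr (s - of_nat (g + 2) - 1) = of_real t powr (s - 1 - of_nat (g + 2))" by (simp add: algebra_simps)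
      also have "\<dots> = of_real t powr (s - 1) / of_real t powr of_nat (g + 2)" by (rule powr_diff)
      also have "of_real t powr of_nat (g + 2) = complex_of_real t ^ (g + 2)" using True by (intro powr_complexpow) auto
      finally show ?thesis .
    qed
    moreover have "qser c (\<i> * of_real t) = E_odd (int g + 2) (of_int r / of_int p + \<i> * of_real t)"
      unfolding E_odd_eq_qser qser_add c_def ..
    ultimately show ?thesis using True
      unfolding mellin_kernel_def cusp_pole_eq by (simp add: right_diff_distrib del: power_Suc of_nat_add power_add_numeral2)
  qed (simp add: mellin_kernel_def)
  ultimately show ?thesis unfolding mellin_continuation_def by (simp add: has_bochner_integral_iff)
qed

lemma mellin_continuation_holomorphic:
  assumes "even g" "p > 0" "coprime r p"
  shows "mellin_continuation g r p holomorphic_on (UNIV - {of_nat (g + 2)})"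
proof -
  have "(\<lambda>s. \<integral>t. of_real t powr (s - 1) * mellin_kernel g r p t \<partial>lborel) holomorphic_on UNIV"
    by (rule mellin_entire(2)[OF mellin_kernel_measurable _ mellin_kernel_integrable[OF assms]]) (simp add: mellin_kernel_def)
  hence "(\<lambda>s. (\<integral>t. of_real t powr (s - 1) * mellin_kernel g r p t \<partial>lborel) + cusp_residue g r p / (s - of_nat (g + 2)))
      holomorphic_on (UNIV - {of_nat (g + 2)})"
    by (intro holomorphic_intros) (auto elim: holomorphic_on_subset)
  thus ?thesis unfolding mellin_continuation_def[abs_def] .
qed

text \<open>Since \<open>\<complex> - {0, k}\<close> is connected, the continuation is determined by its values on the half-plane.\<close>

theorem completed_L_E_odd:
  assumes g: "even g" and q: "quotient_of x = (r, p)" and s: "s \<noteq> 0" "s \<noteq> of_nat (g + 2)"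
  shows "completed_L (g + 2) (E_odd (int g + 2)) x s = - e2pi (- s / 4) * mellin_continuation g r p s"
proof -
  have p: "p > 0" "coprime r p" and x: "x = of_int r / of_int p"
    using q quotient_of_denom_pos quotient_of_div quotient_of_coprime by blast+
  define F where "F = (\<lambda>s. - e2pi (- s / 4) * mellin_continuation g r p s)"
  define L where "L = (\<lambda>s. - (of_real (2 / (2 * pi)) powr s) * e2pi (- s / 4) * Gamma s *
          (\<Sum>n. fourier_coeff (E_odd (int g + 2)) (Suc n) / of_nat (Suc n) powr s * e2pi (of_nat (Suc n) * of_rat x / 2)))"
  define U where "U = (UNIV - {0, of_nat (g + 2)} :: complex set)"
  have coeff: "fourier_coeff (E_odd (int g + 2)) = odd_coeff (int g + 2)"
    by (rule fourier_coeff_eqI[OF poly_bounded_odd_coeff_pos]) (simp add: E_odd_eq_qser)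
  have F_L: "F s = L s" if "Re s > of_nat (g + 2)" for s
  proof -
    have "of_real (2 / (2 * pi)) powr s = 1 / of_real pi powr s"
    proof -
      have "of_real (2 / (2 * pi)) powr s * of_real pi powr s = (of_real (2 / (2 * pi)) * of_real pi) powr s"
        by (rule powr_times_real[symmetric]) auto
      thus ?thesis by (simp add: field_simps)
    qed
    moreover have "e2pi (of_nat (Suc n) * of_rat x / 2) = exp (of_real pi * \<i> * of_nat (Suc n) * (of_int r / of_int p))" for n
      unfolding e2pi_def x of_rat_divide of_rat_of_int_eq by (rule arg_cong[where f = exp]) (simp add: mult_ac del: of_nat_Suc)
    ultimately show ?thesis
      unfolding F_def L_def mellin_continuation_eq_series[OF g p that] coeff by (simp add: mult_ac)
  qed
  have F_hol: "F holomorphic_on U"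
    unfolding F_def e2pi_def U_def
    by (intro holomorphic_intros holomorphic_on_subset[OF mellin_continuation_holomorphic[OF g p]]) auto
  have "\<exists>F. F holomorphic_on (UNIV - {0, of_nat (g + 2)}) \<and> (\<forall>s. Re s > of_nat (g + 2) \<longrightarrow> F s = L s)"
    using F_hol F_L unfolding U_def by blast
  note someI_ex[OF this[unfolded L_def], folded completed_L_def]
  hence C: "completed_L (g + 2) (E_odd (int g + 2)) x holomorphic_on U"
    "\<And>s. Re s > of_nat (g + 2) \<Longrightarrow> completed_L (g + 2) (E_odd (int g + 2)) x s = L s"
    unfolding U_def L_def by blast+
  have "completed_L (g + 2) (E_odd (int g + 2)) x s = F s"
  proof (rule analytic_continuation_open[where s = "{s. Re s > of_nat (g + 2)}" and s' = U
        and f = "completed_L (g + 2) (E_odd (int g + 2)) x" and g = F and z = s])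
    show "connected U" unfolding U_def by (intro connected_open_delete_finite) (auto simp: connected_UNIV)
    show "open U" unfolding U_def by (intro open_Diff finite_imp_closed) auto
    show "{s. Re s > of_nat (g + 2)} \<noteq> {}" using complex.sel(1)[of "of_nat (g + 3)" 0] by (auto intro!: exI[of _ "of_nat (g + 3)"])
    show "{s. Re s > of_nat (g + 2)} \<subseteq> U" by (auto simp: U_def)
  qed (use C F_hol F_L s in \<open>auto simp: U_def open_halfspace_Re_gt\<close>)
  thus ?thesis by (simp add: F_def)
qed

section \<open>The value of the \<open>L\<close>-function\<close>

text \<open>\<open>E\<^bsub>-g\<^esub>\<close> is the \<open>(g+1)\<close>-fold Eichler integral of \<open>E\<^bsub>g+2\<^esub>\<close>.\<close>

lemma eichler_integral:
  assumes \<tau>: "Im \<tau> > 0"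
  shows "has_bochner_integral lborel (\<lambda>t. indicator {0<..} t *\<^sub>R (of_real t ^ g * E_odd (int g + 2) (\<tau> + \<i> * of_real t)))
     (fact g / of_real pi ^ Suc g * E_odd (- int g) \<tau>)"
proof -
  define c where "c = (\<lambda>n. odd_coeff (int g + 2) n * exp (of_real pi * \<i> * of_nat n * \<tau>))"
  have c: "poly_bounded c" "c 0 = 0"
    unfolding c_def using poly_bounded_mult_exp[OF poly_bounded_odd_coeff_pos] \<tau> by (auto simp: odd_coeff_def)
  define s where "s = complex_of_nat (Suc g)"
  have pw: "of_nat (Suc n) powr s = (of_nat (Suc n) :: complex) ^ Suc g" for n
    unfolding s_def by (rule powr_complexpow) (simp del: of_nat_Suc)
  have cs: "c (Suc n) / of_nat (Suc n) powr s = odd_coeff (- int g) (Suc n) * exp (of_real pi * \<i> * of_nat (Suc n) * \<tau>)" for n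
    unfolding c_def odd_coeff_pos pw by (simp del: of_nat_Suc power_Suc)
  have sums: "(\<lambda>n. odd_coeff (- int g) n * exp (of_real pi * \<i> * of_nat n * \<tau>)) sums E_odd (- int g) \<tau>"
    unfolding E_odd_eq_qser by (rule qser_sums[OF poly_bounded_odd_coeff_neg \<tau>])
  hence "(\<lambda>n. c (Suc n) / of_nat (Suc n) powr s) sums E_odd (- int g) \<tau>"
    unfolding cs by (subst sums_Suc_iff) (simp add: odd_coeff_def)
  hence series: "(\<Sum>n. c (Suc n) / of_nat (Suc n) powr s) = E_odd (- int g) \<tau>" by (rule sums_unique[symmetric])
  have "summable (\<lambda>n. norm (odd_coeff (- int g) n * exp (of_real pi * \<i> * of_nat n * \<tau>)))"
    by (rule qser_abs_summable[OF poly_bounded_odd_coeff_neg \<tau>])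
  hence "summable (\<lambda>n. norm (odd_coeff (- int g) (Suc n) * exp (of_real pi * \<i> * of_nat (Suc n) * \<tau>)))"
    by (subst summable_Suc_iff)
  hence abs: "summable (\<lambda>n. norm (c (Suc n)) / of_nat (Suc n) powr Re s)"
    unfolding cs[symmetric] norm_divide by (simp add: norm_powr_real_powr del: of_nat_Suc)
  have "has_bochner_integral lborel (\<lambda>t. indicator {0<..} t *\<^sub>R (of_real t powr (s - 1) * qser c (\<i> * of_real t)))
     (Gamma s / of_real pi powr s * E_odd (- int g) \<tau>)"
    unfolding series[symmetric] by (rule mellin_qser[OF c _ abs]) (simp add: s_def)
  moreover have "Gamma s = fact g" unfolding s_def by (simp add: Gamma_fact)
  moreover have "of_real pi powr s = (of_real pi ^ Suc g :: complex)" unfolding s_def by (rule powr_complexpow) simp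
  moreover have "indicator {0<..} t *\<^sub>R (of_real t powr (s - 1) * qser c (\<i> * of_real t)) =
      indicator {0<..} t *\<^sub>R (of_real t ^ g * E_odd (int g + 2) (\<tau> + \<i> * of_real t))" for t
  proof (cases "t > 0")
    case True
    have "s - 1 = of_nat g" by (simp add: s_def)
    moreover have "of_real t powr of_nat g = complex_of_real t ^ g" by (rule powr_complexpow) (use True in simp)
    moreover have "qser c (\<i> * of_real t) = E_odd (int g + 2) (\<tau> + \<i> * of_real t)"
      unfolding E_odd_eq_qser qser_add c_def ..
    ultimately show ?thesis by simp
  qed simp
  ultimately show ?thesis by (simp only:)
qed

text \<open>The integrand is the derivative of \<open>(t / (\<epsilon> + t))\<^bsup>g+1\<^esup> / ((g + 1) \<epsilon>)\<close>.\<close>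

lemma shifted_pole_integral:
  assumes \<epsilon>: "0 < \<epsilon>" "\<epsilon> < 1"
  shows "has_bochner_integral lborel (\<lambda>t. indicator {0<..1 - \<epsilon>} t *\<^sub>R (complex_of_real t ^ g / of_real (\<epsilon> + t) ^ (g + 2)))
     (of_real ((1 - \<epsilon>) ^ Suc g / (real (Suc g) * \<epsilon>)))"
proof -
  define F where "F = (\<lambda>t. (t / (\<epsilon> + t)) ^ Suc g / (real (Suc g) * \<epsilon>))"
  have "(F has_real_derivative t ^ g / (\<epsilon> + t) ^ (g + 2)) (at t)" if "0 \<le> t" for t
  proof -
    have nz: "\<epsilon> + t \<noteq> 0" using \<epsilon> that by linarith
    have "((\<lambda>t. t / (\<epsilon> + t)) has_real_derivative \<epsilon> / (\<epsilon> + t) ^ 2) (at t)"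
      by (rule derivative_eq_intros refl nz)+ (simp add: power2_eq_square)
    from DERIV_cdivide[OF DERIV_power[OF this, of "Suc g"], of "real (Suc g) * \<epsilon>"]
    have "(F has_real_derivative (real (Suc g) * (\<epsilon> / (\<epsilon> + t) ^ 2 * (t / (\<epsilon> + t)) ^ g)) / (real (Suc g) * \<epsilon>)) (at t)"
      unfolding F_def by (simp del: of_nat_Suc power_Suc)
    also have "(real (Suc g) * (\<epsilon> / (\<epsilon> + t) ^ 2 * (t / (\<epsilon> + t)) ^ g)) / (real (Suc g) * \<epsilon>) = t ^ g / (\<epsilon> + t) ^ (g + 2)"
    proof -
      have *: "n * (e / b ^ 2 * (t / b) ^ g) / (n * e) = t ^ g / b ^ (g + 2)" if "n \<noteq> 0" "e \<noteq> 0" for n e b :: real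
        using that by (simp add: power_divide power_add power2_eq_square)
      show ?thesis by (rule *) (use \<epsilon> in auto)
    qed
    finally show ?thesis .
  qed
  hence "has_bochner_integral lborel (\<lambda>t. (t ^ g / (\<epsilon> + t) ^ (g + 2)) * indicator {0..1 - \<epsilon>} t) (F (1 - \<epsilon>) - F 0)"
    using \<epsilon> by (intro has_bochner_integral_FTC_Icc_real continuous_intros) auto
  moreover have "F (1 - \<epsilon>) - F 0 = (1 - \<epsilon>) ^ Suc g / (real (Suc g) * \<epsilon>)" by (simp add: F_def)
  ultimately have "has_bochner_integral lborel (\<lambda>t. complex_of_real ((t ^ g / (\<epsilon> + t) ^ (g + 2)) * indicator {0..1 - \<epsilon>} t))
      (of_real ((1 - \<epsilon>) ^ Suc g / (real (Suc g) * \<epsilon>)))"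
    by (intro has_bochner_integral_of_real) simp
  moreover have "has_bochner_integral lborel (\<lambda>t. complex_of_real ((t ^ g / (\<epsilon> + t) ^ (g + 2)) * indicator {0..1 - \<epsilon>} t)) I \<longleftrightarrow>
     has_bochner_integral lborel (\<lambda>t. indicator {0<..1 - \<epsilon>} t *\<^sub>R (complex_of_real t ^ g / of_real (\<epsilon> + t) ^ (g + 2))) I" for I
    by (rule has_bochner_integral_discrete_difference[where X = "{0}"])
       (auto simp: indicator_def)
  ultimately show ?thesis by blast
qed

text \<open>Shifting the path of integration to \<open>x + i\<epsilon> + i\<real>\<^sub>>\<^sub>0\<close> turns the Mellin integral at \<open>s = g + 1\<close> into an Eichler
  integral; as \<open>\<epsilon>\<close> tends to \<open>0\<close>, the poles cancel and the constant term of \<open>E\<^bsub>-g\<^esub>\<close> at \<open>x\<close> remains.\<close>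

theorem mellin_continuation_value:
  assumes g: "even g" and q: "quotient_of x = (r, p)"
  shows "mellin_continuation g r p (of_nat (g + 1)) = fact g / of_real pi ^ Suc g * cusp_constant_term g x"
proof -
  have p: "p > 0" "coprime r p" and x: "x = of_int r / of_int p"
    using q quotient_of_denom_pos quotient_of_div quotient_of_coprime by blast+
  define X where "X = (of_int r / of_int p :: complex)"
  have ImX: "Im X = 0" by (simp add: X_def Im_divide)
  have xX: "of_rat x = X" by (simp add: x X_def of_rat_divide)
  define h where "h = mellin_kernel g r p"
  define A where "A = cusp_residue g r p"
  define P where "P = \<i> * complex_of_real (cusp_sign r p * odd_zeta (g + 2) / (2 * pi * of_int p ^ (g + 2)))"
  define \<kappa> where "\<kappa> = (fact g / of_real pi ^ Suc g :: complex)"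
  define \<epsilon> where "\<epsilon> = (\<lambda>n. 1 / real (n + 2))"
  have \<epsilon>: "0 < \<epsilon> n" "\<epsilon> n < 1" for n by (auto simp: \<epsilon>_def)
  have \<epsilon>_lim: "\<epsilon> \<longlonglongrightarrow> 0" unfolding \<epsilon>_def by real_asymp
  have \<epsilon>_right: "filterlim \<epsilon> (at_right 0) sequentially"
    unfolding filterlim_at using \<epsilon>_lim \<epsilon>(1) by (auto intro!: always_eventually simp: less_imp_neq[symmetric])
  define J where "J = (\<lambda>n. \<integral>u. indicator {\<epsilon> n<..} u *\<^sub>R (of_real (u - \<epsilon> n) ^ g * h u) \<partial>lborel)"

  have J: "J n = \<kappa> * E_odd (- int g) (X + \<i> * of_real (\<epsilon> n)) - A * of_real ((1 - \<epsilon> n) ^ Suc g / (real (Suc g) * \<epsilon> n))" for n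
  proof -
    let ?\<epsilon> = "\<epsilon> n"
    have "J n = (\<integral>t. indicator {?\<epsilon><..} (?\<epsilon> + 1 * t) *\<^sub>R (of_real ((?\<epsilon> + 1 * t) - ?\<epsilon>) ^ g * h (?\<epsilon> + 1 * t)) \<partial>lborel)"
      unfolding J_def by (subst lborel_integral_real_affine[of 1 _ ?\<epsilon>]) auto
    also have "\<dots> = (\<integral>t. indicator {0<..} t *\<^sub>R (of_real t ^ g * E_odd (int g + 2) ((X + \<i> * of_real ?\<epsilon>) + \<i> * of_real t)) -
        A * (indicator {0<..1 - ?\<epsilon>} t *\<^sub>R (complex_of_real t ^ g / of_real (?\<epsilon> + t) ^ (g + 2))) \<partial>lborel)"
    proof (rule Bochner_Integration.integral_cong[OF refl])
      fix t :: real
      show "indicator {?\<epsilon><..} (?\<epsilon> + 1 * t) *\<^sub>R (of_real ((?\<epsilon> + 1 * t) - ?\<epsilon>) ^ g * h (?\<epsilon> + 1 * t)) =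
         indicator {0<..} t *\<^sub>R (of_real t ^ g * E_odd (int g + 2) ((X + \<i> * of_real ?\<epsilon>) + \<i> * of_real t)) -
         A * (indicator {0<..1 - ?\<epsilon>} t *\<^sub>R (complex_of_real t ^ g / of_real (?\<epsilon> + t) ^ (g + 2)))"
      proof (cases "t > 0")
        case True
        have 1: "X + \<i> * of_real ?\<epsilon> + \<i> * of_real t = X + \<i> * of_real (?\<epsilon> + t)" by (simp add: algebra_simps)
        have "h (?\<epsilon> + t) = E_odd (int g + 2) (X + \<i> * of_real (?\<epsilon> + t)) - (if ?\<epsilon> + t \<le> 1 then A / of_real (?\<epsilon> + t) ^ (g + 2) else 0)"
          using True \<epsilon>[of n] unfolding h_def mellin_kernel_def cusp_pole_eq A_def X_def by auto
        thus ?thesis unfolding 1 using True \<epsilon>[of n]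
          by (auto simp: right_diff_distrib indicator_def simp del: power_Suc of_real_add power_add_numeral2)
      qed (use \<epsilon>[of n] in auto)
    qed
    also have "\<dots> = \<kappa> * E_odd (- int g) (X + \<i> * of_real ?\<epsilon>) - A * of_real ((1 - ?\<epsilon>) ^ Suc g / (real (Suc g) * ?\<epsilon>))"
    proof -
      have "Im (X + \<i> * of_real ?\<epsilon>) > 0" using ImX \<epsilon>[of n] by simp
      from has_bochner_integral_diff[OF eichler_integral[OF this, of g] has_bochner_integral_mult_right[OF shifted_pole_integral[OF \<epsilon>, of n g], of A]]
      show ?thesis unfolding \<kappa>_def by (rule has_bochner_integral_integral_eq)
    qed
    finally show ?thesis .
  qed

  have A_P: "A / of_nat (Suc g) = \<kappa> * P / \<i>"
  proof -
    have w0: "of_real pi ^ Suc g \<noteq> (0::complex)" by simp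
    obtain m where m: "g = 2 * m" using g by (auto elim: evenE)
    have "\<i> ^ Suc g * \<i> ^ (g + 2) = - \<i>" unfolding m by (simp add: power_mult flip: power_add power_mult_distrib)
    hence i: "\<i> ^ Suc g = - \<i> / \<i> ^ (g + 2)" by (simp add: field_simps del: power_Suc)
    have "\<kappa> * P / \<i> = - (of_real pi ^ Suc g * \<i> ^ Suc g / fact (Suc g) * (cusp_value g r p / of_int p ^ (g + 2))) * (fact g / of_real pi ^ Suc g) / \<i>"
      unfolding P_def pole_coefficient \<kappa>_def by (simp add: power_mult_distrib)
    also have "\<dots> = cusp_value g r p / (of_int p ^ (g + 2) * \<i> ^ (g + 2)) / of_nat (Suc g)"
    proof -
      have *: "- (w * (- \<i> / j) / (n * f) * (v / P)) * (f / w) / \<i> = v / (P * j) / n"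
        if "w \<noteq> 0" "f \<noteq> 0" for w j n f v P :: complex
        using that by simp
      show ?thesis unfolding i fact_Suc of_nat_mult by (rule *) (use w0 in auto)
    qed
    finally show ?thesis unfolding A_def cusp_residue_def power_mult_distrib by simp
  qed

  \<comment> \<open>the limit from the expansion of \<open>E\<^bsub>-g\<^esub>\<close> at the cusp\<close>
  have lim1: "J \<longlonglongrightarrow> \<kappa> * cusp_constant_term g x + A"
  proof -
    have eq: "J n = \<kappa> * (E_odd (- int g) (X + \<i> * of_real (\<epsilon> n)) - P / (\<i> * of_real (\<epsilon> n))) -
        A / of_nat (Suc g) * \<i> * (((1 + \<i> * (\<i> * of_real (\<epsilon> n))) ^ Suc g - 1 ^ Suc g) / (\<i> * of_real (\<epsilon> n)))" for n
    proof -
      have e0: "complex_of_real (\<epsilon> n) \<noteq> 0" using \<epsilon>[of n] by simp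
      have 1: "1 + \<i> * (\<i> * of_real (\<epsilon> n)) = complex_of_real (1 - \<epsilon> n)" by (simp add: algebra_simps)
      have 2: "A * of_real ((1 - \<epsilon> n) ^ Suc g / (real (Suc g) * \<epsilon> n)) = A / of_nat (Suc g) * (of_real (1 - \<epsilon> n) ^ Suc g / of_real (\<epsilon> n))"
        by (simp del: of_nat_Suc power_Suc)
      have 3: "\<kappa> * (P / (\<i> * of_real (\<epsilon> n))) = A / of_nat (Suc g) / of_real (\<epsilon> n)"
        unfolding A_P by (simp only: times_divide_eq_right divide_divide_eq_left)
      show ?thesis unfolding J 1 2 right_diff_distrib 3 using e0 by (simp add: field_simps del: of_nat_Suc power_Suc of_real_diff)
    qed
    obtain K where K: "\<And>\<tau>. 0 < norm \<tau> \<Longrightarrow> norm \<tau> \<le> 1 \<Longrightarrow> 1 * norm \<tau> \<le> Im \<tau> \<Longrightarrow>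
       norm (E_odd (- int g) (X + \<tau>) - (P / \<tau> + cusp_constant_term g x)) \<le> K * norm \<tau>"
      using E_odd_asymptotics[OF g q, of 1] unfolding P_def xX by auto
    have U: "(\<lambda>n. E_odd (- int g) (X + \<i> * of_real (\<epsilon> n)) - P / (\<i> * of_real (\<epsilon> n))) \<longlonglongrightarrow> cusp_constant_term g x"
    proof (rule LIM_zero_cancel, rule Lim_null_comparison)
      show "\<forall>\<^sub>F n in sequentially. norm (E_odd (- int g) (X + \<i> * of_real (\<epsilon> n)) - P / (\<i> * of_real (\<epsilon> n)) - cusp_constant_term g x) \<le> K * \<epsilon> n"
        using K[of "\<i> * of_real (\<epsilon> n)" for n] \<epsilon> by (intro always_eventually allI) (simp add: norm_mult diff_diff_eq less_imp_le)
      show "(\<lambda>n. K * \<epsilon> n) \<longlonglongrightarrow> 0" using tendsto_mult_right_zero[OF \<epsilon>_lim] .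
    qed
    have V: "(\<lambda>n. ((1 + \<i> * (\<i> * of_real (\<epsilon> n))) ^ Suc g - 1 ^ Suc g) / (\<i> * of_real (\<epsilon> n))) \<longlonglongrightarrow> of_nat (Suc g) * \<i> * 1 ^ g"
      by (rule filterlim_compose[OF tendsto_power_difference_quotient \<epsilon>_right])
    have "J \<longlonglongrightarrow> \<kappa> * cusp_constant_term g x - A / of_nat (Suc g) * \<i> * (of_nat (Suc g) * \<i> * 1 ^ g)"
      unfolding eq[abs_def] by (intro tendsto_diff tendsto_mult tendsto_const U V)
    moreover have "A / of_nat (Suc g) * \<i> * (of_nat (Suc g) * \<i> * 1 ^ g) = - A"
      by (simp add: field_simps del: of_nat_Suc)
    ultimately show ?thesis by simp
  qed

  \<comment> \<open>the limit under the integral sign\<close>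
  have lim2: "J \<longlonglongrightarrow> (\<integral>u. of_real u ^ g * h u \<partial>lborel)"
    unfolding J_def
  proof (rule integral_dominated_convergence)
    have hm: "h \<in> borel_measurable borel" unfolding h_def by (rule mellin_kernel_measurable)
    show "integrable lborel (\<lambda>u. u powr real g * norm (h u))"
      unfolding h_def by (rule mellin_kernel_integrable[OF g p])
    show "(\<lambda>u. of_real u ^ g * h u) \<in> borel_measurable lborel" using hm by measurable
    show "(\<lambda>u. indicator {\<epsilon> n<..} u *\<^sub>R (of_real (u - \<epsilon> n) ^ g * h u)) \<in> borel_measurable lborel" for n
      using hm by measurable
    show "AE u in lborel. norm (indicator {\<epsilon> n<..} u *\<^sub>R (of_real (u - \<epsilon> n) ^ g * h u)) \<le> u powr real g * norm (h u)" for n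
    proof (rule AE_I2)
      fix u :: real
      show "norm (indicator {\<epsilon> n<..} u *\<^sub>R (of_real (u - \<epsilon> n) ^ g * h u)) \<le> u powr real g * norm (h u)"
      proof (cases "u > \<epsilon> n")
        case True
        have "\<bar>u - \<epsilon> n\<bar> ^ g \<le> u ^ g" using True \<epsilon>[of n] by (intro power_mono) auto
        also have "u ^ g = u powr real g" using True \<epsilon>[of n] by (simp add: powr_realpow)
        finally have "\<bar>u - \<epsilon> n\<bar> ^ g * norm (h u) \<le> u powr real g * norm (h u)" by (rule mult_right_mono) simp
        thus ?thesis using True by (simp add: norm_mult norm_power del: of_real_diff)
      qed simp
    qed
    show "AE u in lborel. (\<lambda>n. indicator {\<epsilon> n<..} u *\<^sub>R (of_real (u - \<epsilon> n) ^ g * h u)) \<longlonglongrightarrow> of_real u ^ g * h u"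
    proof (rule AE_I2)
      fix u :: real
      show "(\<lambda>n. indicator {\<epsilon> n<..} u *\<^sub>R (of_real (u - \<epsilon> n) ^ g * h u)) \<longlonglongrightarrow> of_real u ^ g * h u"
      proof (cases "u > 0")
        case True
        have "(\<lambda>n. of_real (u - \<epsilon> n) ^ g * h u) \<longlonglongrightarrow> of_real (u - 0) ^ g * h u"
          by (intro tendsto_intros \<epsilon>_lim)
        moreover have "\<forall>\<^sub>F n in sequentially. of_real (u - \<epsilon> n) ^ g * h u = indicator {\<epsilon> n<..} u *\<^sub>R (of_real (u - \<epsilon> n) ^ g * h u)"
          using order_tendstoD(2)[OF \<epsilon>_lim True] by eventually_elim simp
        ultimately show ?thesis by (simp add: Lim_transform_eventually)
      next
        case False
        hence "h u = 0" by (simp add: h_def mellin_kernel_def)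
        thus ?thesis by simp
      qed
    qed
  qed
  have "(\<integral>u. of_real u ^ g * h u \<partial>lborel) = (\<integral>u. of_real u powr (of_nat (g + 1) - 1) * h u \<partial>lborel)"
  proof (rule Bochner_Integration.integral_cong[OF refl])
    fix u :: real
    show "of_real u ^ g * h u = of_real u powr (of_nat (g + 1) - 1) * h u"
    proof (cases "u > 0")
      case True
      hence "complex_of_real u powr of_nat g = of_real u ^ g" by (intro powr_complexpow) auto
      thus ?thesis by simp
    qed (simp add: h_def mellin_kernel_def)
  qed
  hence "(\<integral>u. of_real u powr (of_nat (g + 1) - 1) * h u \<partial>lborel) = \<kappa> * cusp_constant_term g x + A"
    using LIMSEQ_unique[OF lim1 lim2] by simp
  moreover have "of_nat (g + 1) - of_nat (g + 2) = (- 1 :: complex)" by simp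
  ultimately show ?thesis unfolding mellin_continuation_def h_def A_def \<kappa>_def by simp
qed

text \<open>The imaginary part of the constant term at the cusp is the cotangent sum, its real part the correction in
  weight 2.\<close>

theorem S_odd_eq_S_L:
  assumes g: "even g" and q: "quotient_of x = (r, p)"
  shows "complex_of_real (S_odd g x) =
        (- 1) ^ (g div 2 + 1) * 2 ^ (g + 2) * S_L g (E_odd (int g + 2)) x + 4 * \<i> / of_real pi * of_real (weight2_defect g x)"
proof -
  obtain m where m: "g = 2 * m" using g by (auto elim: evenE)
  define W where "W = complex_of_real (weight2_defect g x)"
  define S where "S = complex_of_real (S_odd g x)"
  have e: "e2pi (- of_nat (g + 1) / 4) = - \<i> * (- 1) ^ m"
  proof -
    have "e2pi (- of_nat (g + 1) / 4) = exp (of_nat (g + 1) * (- (of_real pi / 2 * \<i>)))"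
      unfolding e2pi_def by (rule arg_cong[where f = exp]) (simp add: field_simps)
    also have "\<dots> = exp (- (of_real pi / 2 * \<i>)) ^ (g + 1)" by (rule exp_of_nat_mult)
    also have "exp (- (of_real pi / 2 * \<i>)) = cis (- (pi / 2))" by (simp add: cis_conv_exp mult_ac)
    also have "\<dots> = - \<i>" by (simp add: complex_eq_iff)
    finally show ?thesis by (simp add: m power_mult)
  qed
  have "of_nat (g + 1) \<noteq> (of_nat (g + 2) :: complex)" "of_nat (g + 1) \<noteq> (0 :: complex)"
    unfolding of_nat_eq_iff of_nat_eq_0_iff by simp_all
  hence "S_L g (E_odd (int g + 2)) x = \<i> * (- 1) ^ m * (fact g / of_real pi ^ Suc g * cusp_constant_term g x)"
    unfolding S_L_def completed_L_E_odd[OF g q \<open>of_nat (g + 1) \<noteq> 0\<close> \<open>of_nat (g + 1) \<noteq> of_nat (g + 2)\<close>]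
      mellin_continuation_value[OF g q] e by simp
  also have "cusp_constant_term g x = \<i> * (of_real pi ^ Suc g / (2 ^ (g + 2) * fact g)) * S + W"
    unfolding cusp_constant_term_def S_def W_def by simp
  finally have "(- 1) ^ (g div 2 + 1) * 2 ^ (g + 2) * S_L g (E_odd (int g + 2)) x =
      (- 1) ^ (m + 1) * (- 1) ^ m * (2 ^ (g + 2) * \<i> * (fact g / of_real pi ^ Suc g) * (\<i> * (of_real pi ^ Suc g / (2 ^ (g + 2) * fact g)) * S + W))"
    by (simp add: m mult_ac)
  also have "(- 1) ^ (m + 1) * (- 1) ^ m = (- 1 :: complex)" by (simp flip: power_add power_mult_distrib)
  also have "- 1 * (2 ^ (g + 2) * \<i> * (fact g / of_real pi ^ Suc g) * (\<i> * (of_real pi ^ Suc g / (2 ^ (g + 2) * fact g)) * S + W)) =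
     S - 2 ^ (g + 2) * \<i> * (fact g / of_real pi ^ Suc g) * W"
  proof -
    have *: "- 1 * (t * \<i> * (f / w) * (\<i> * (w / (t * f)) * S + W)) = S - t * \<i> * (f / w) * W" if "t \<noteq> 0" "f \<noteq> 0" "w \<noteq> 0" for t f w
      using that by (simp add: field_simps)
    show ?thesis by (rule *) auto
  qed
  also have "2 ^ (g + 2) * \<i> * (fact g / of_real pi ^ Suc g) * W = 4 * \<i> / of_real pi * W"
  proof (cases "g = 0")
    case False
    hence "W = 0" using q by (simp add: W_def weight2_defect_def)
    thus ?thesis by simp
  qed simp
  finally show ?thesis by (simp add: S_def W_def)
qed

section \<open>The cotangent sum, its \<open>L\<close>-value and its reciprocity\<close>

text \<open>In the sector \<open>\<epsilon> \<le> Arg \<tau> \<le> \<pi> - \<epsilon>\<close> one has \<open>Im \<tau> \<ge> sin \<epsilon> \<bar>\<tau>\<bar>\<close>.\<close>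

lemma E_odd_asymptotics_sector:
  assumes g: "even g" and q: "quotient_of x = (r, p)" and \<epsilon>: "\<epsilon> > 0"
  shows "(\<lambda>\<tau>. E_odd (- int g) (of_rat x + \<tau>) -
       (\<i> * of_real (cusp_sign r p * odd_zeta (g + 2) / (2 * pi * of_int p ^ (g + 2))) / \<tau> + cusp_constant_term g x))
     \<in> O[at 0 within {\<tau>. \<epsilon> \<le> Arg \<tau> \<and> Arg \<tau> \<le> pi - \<epsilon>}](\<lambda>\<tau>. \<tau>)"
proof (cases "\<epsilon> < pi")
  case True
  have "sin \<epsilon> > 0" using \<epsilon> True by (rule sin_gt_zero)
  then obtain K where K: "\<And>\<tau>. 0 < norm \<tau> \<Longrightarrow> norm \<tau> \<le> 1 \<Longrightarrow> sin \<epsilon> * norm \<tau> \<le> Im \<tau> \<Longrightarrow>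
     norm (E_odd (- int g) (of_rat x + \<tau>) -
        (\<i> * of_real (cusp_sign r p * odd_zeta (g + 2) / (2 * pi * of_int p ^ (g + 2))) / \<tau> + cusp_constant_term g x)) \<le> K * norm \<tau>"
    using E_odd_asymptotics[OF g q] by metis
  have sector: "sin \<epsilon> * norm \<tau> \<le> Im \<tau>" if "\<epsilon> \<le> Arg \<tau>" "Arg \<tau> \<le> pi - \<epsilon>" for \<tau>
  proof -
    have "sin \<epsilon> \<le> sin (Arg \<tau>)"
    proof (cases "Arg \<tau> \<le> pi / 2")
      case True
      thus ?thesis using that \<epsilon> by (intro sin_monotone_2pi_le) auto
    next
      case False
      have "sin \<epsilon> \<le> sin (pi - Arg \<tau>)" using that \<epsilon> False by (intro sin_monotone_2pi_le) auto
      thus ?thesis by simp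
    qed
    hence "sin \<epsilon> * norm \<tau> \<le> sin (Arg \<tau>) * norm \<tau>" by (rule mult_right_mono) simp
    also have "\<dots> = Im \<tau>" by (cases "\<tau> = 0") (simp_all add: sin_Arg)
    finally show ?thesis .
  qed
  show ?thesis
  proof (rule bigoI[where c = K])
    have "\<forall>\<^sub>F \<tau> in at 0 within {\<tau>. \<epsilon> \<le> Arg \<tau> \<and> Arg \<tau> \<le> pi - \<epsilon>}. norm \<tau> < 1 \<and> \<tau> \<noteq> 0 \<and> \<epsilon> \<le> Arg \<tau> \<and> Arg \<tau> \<le> pi - \<epsilon>"
      unfolding eventually_at by (rule exI[of _ 1]) auto
    thus "\<forall>\<^sub>F \<tau> in at 0 within {\<tau>. \<epsilon> \<le> Arg \<tau> \<and> Arg \<tau> \<le> pi - \<epsilon>}. norm (E_odd (- int g) (of_rat x + \<tau>) -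
       (\<i> * of_real (cusp_sign r p * odd_zeta (g + 2) / (2 * pi * of_int p ^ (g + 2))) / \<tau> + cusp_constant_term g x)) \<le> K * norm \<tau>"
      by eventually_elim (rule K; use sector in auto)
  qed
next
  case False
  hence "\<epsilon> > pi - \<epsilon>" using pi_gt_zero by linarith
  hence e: "{\<tau>. \<epsilon> \<le> Arg \<tau> \<and> Arg \<tau> \<le> pi - \<epsilon>} = {}" by auto
  show ?thesis unfolding e by (rule bigoI[where c = 1]) simp
qed

theorem theorem6p5:
  fixes g :: nat and r p :: int and x :: rat
  assumes "even g" and "p > 0" and "coprime r p" and "x = of_int r / of_int p"
  shows
    "(complex_of_real (S_odd g x) =
        (- 1) ^ (g div 2 + 1) * 2 ^ (g + 2) * S_L g (E_odd (int g + 2)) x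
        + 4 * \<i> / of_real pi * of_real (weight2_defect g x)) \<and>
     (complex_of_real (S_odd g x) =
        \<i> / of_int p ^ (g + 1) *
        (\<Sum>m | 1 \<le> m \<and> m < 2 * p \<and> odd m. \<Sum>n | 1 \<le> n \<and> n < 2 * p \<and> odd n.
           e2pi (of_int m * of_int n * of_rat x / 2) *
           of_real (bernpoly 1 (of_int m / (2 * of_int p))) *
           of_real ((deriv ^^ g) cot (pi * of_int n / (2 * of_int p))))) \<and>
     (S_odd g x =
        (- 1) ^ (g div 2) * 2 ^ (2 * g + 1) / (of_nat g + 1) *
        (\<Sum>m | 1 \<le> m \<and> m \<le> 2 * p \<and> odd m.
           (bernpoly_per (g + 1) (of_int m * of_rat x / 2)
            - bernpoly_per (g + 1) (of_int m * of_rat x / 2 + 1 / 2)) *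
           bernpoly 1 (of_int m / (2 * of_int p)))) \<and>
     (\<forall>\<epsilon>>0. (\<lambda>\<tau>. E_odd (- int g) (of_rat x + \<tau>)
          - (- ((of_real pi * \<i>) ^ (g + 1) / fact (g + 1)
                * (cusp_const (g + 2) (E_odd (int g + 2)) x / of_int p ^ (g + 2)) * (1 / \<tau>))
             + \<i> * of_real (pi ^ (g + 1) / (2 ^ (g + 2) * fact g) * S_odd g x)
             + of_real (weight2_defect g x)))
        \<in> O[at 0 within {\<tau>. \<epsilon> \<le> Arg \<tau> \<and> Arg \<tau> \<le> pi - \<epsilon>}](\<lambda>\<tau>. \<tau>)) \<and>
     (cusp_const (g + 2) (E_odd (int g + 2)) x =
        of_real (of_bool (odd p) * (- 1) powi (r + 1) *
          ((2 ^ (g + 2) - 1) / (4 * (of_nat g + 2))) * bernpoly (g + 2) 0)) \<and>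
     (\<forall>a b c d. Gamma2 a b c d \<longrightarrow>
        (\<exists>P :: complex poly. \<forall>X. period_R g (E_odd (int g + 2)) a b c d X = poly P X)) \<and>
     (\<forall>a b c d. Gamma2 a b c d \<and> of_int c * x + of_int d \<noteq> 0 \<longrightarrow>
        of_rat (of_int c * x + of_int d) ^ g *
          of_real (S_odd g ((of_int a * x + of_int b) / (of_int c * x + of_int d)))
        - complex_of_real (S_odd g x) =
        (- 1) ^ (g div 2 + 1) * 2 ^ (g + 2) * period_R g (E_odd (int g + 2)) a b c d (of_rat x)
        + (- 1) ^ (g div 2) * 2 ^ (g + 2) * cusp_const (g + 2) (E_odd (int g + 2)) x
          * (of_int c / (of_int p ^ (g + 1) * of_int (c * r + d * p)))) \<and>
     (2 * x + 1 \<noteq> 0 \<longrightarrow>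
        S_odd 0 (x / (2 * x + 1)) - S_odd 0 x =
        1 / 2 + of_bool (odd p) * (- 1) powi (r + 1) / (2 * of_int p * of_int (2 * r + p))) \<and>
     (2 * x + 1 \<noteq> 0 \<longrightarrow>
        of_rat ((2 * x + 1) ^ 2) * S_odd 2 (x / (2 * x + 1)) - S_odd 2 x =
        of_rat (2 * x ^ 2 + 2 * x + 1)
        + of_bool (odd p) * (- 1) powi (r + 1) / (of_int p ^ 3 * of_int (2 * r + p)))"
proof -
  have q: "quotient_of x = (r, p)" by (rule quotient_of_eq) fact+
  note g = \<open>even g\<close>
  have cv: "cusp_const (g + 2) (E_odd (int g + 2)) x = cusp_value g r p" by (rule cusp_const_eq_cusp_value[OF g q])
  have lt: "{m::int. 1 \<le> m \<and> m < 2 * p \<and> odd m} = odd_residues p" by (simp add: odd_residues_def)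
  have "m < 2 * p \<longleftrightarrow> m \<le> 2 * p" if "odd m" for m :: int using that by (cases "m = 2 * p") auto
  hence le: "{m::int. 1 \<le> m \<and> m \<le> 2 * p \<and> odd m} = odd_residues p" by (auto simp: odd_residues_def)
  have L: "complex_of_real (S_odd g x) =
        (- 1) ^ (g div 2 + 1) * 2 ^ (g + 2) * S_L g (E_odd (int g + 2)) x
        + 4 * \<i> / of_real pi * of_real (weight2_defect g x)"
    by (rule S_odd_eq_S_L[OF g q])
  have asym: "(\<lambda>\<tau>. E_odd (- int g) (of_rat x + \<tau>)
          - (- ((of_real pi * \<i>) ^ (g + 1) / fact (g + 1)
                * (cusp_const (g + 2) (E_odd (int g + 2)) x / of_int p ^ (g + 2)) * (1 / \<tau>))
             + \<i> * of_real (pi ^ (g + 1) / (2 ^ (g + 2) * fact g) * S_odd g x)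
             + of_real (weight2_defect g x)))
        \<in> O[at 0 within {\<tau>. \<epsilon> \<le> Arg \<tau> \<and> Arg \<tau> \<le> pi - \<epsilon>}](\<lambda>\<tau>. \<tau>)" if "\<epsilon> > 0" for \<epsilon>
  proof -
    have *: "- C / \<tau> + (a + b) = - (C * (1 / \<tau>)) + a + b" for C \<tau> a b :: complex by simp
    show ?thesis using E_odd_asymptotics_sector[OF g q that] unfolding pole_coefficient cusp_constant_term_def cv * .
  qed
  have poly: "\<exists>P :: complex poly. \<forall>X. period_R g (E_odd (int g + 2)) a b c d X = poly P X" if \<gamma>: "Gamma2 a b c d" for a b c d
  proof -
    obtain R where "\<And>X. period_R g (E_odd (int g + 2)) a b c d X = - (fact g / (of_real pi * \<i>) ^ Suc g) * (\<i> * poly (cpoly R) X)"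
      using period_R_eq[OF g \<gamma>] by metis
    thus ?thesis by (intro exI[of _ "smult (- (fact g / (of_real pi * \<i>) ^ Suc g) * \<i>) (cpoly R)"]) (simp del: power_Suc)
  qed
  show ?thesis
    unfolding lt le
    by (intro conjI L S_odd_double_sum[OF g q] S_odd_bernoulli_sum[OF g q] asym poly allI impI cusp_value_bernoulli[OF g, of r p, folded cv]
         S_odd_reciprocity[OF g _ q, folded cv] S_odd_0_reciprocity[OF q] S_odd_2_reciprocity[OF q])
      (auto simp del: of_real_mult of_int_add)
qed

end
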